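(* Let $D$ be a torus-invariant hyperplane section of $\mathbb P^n$. Then the logarithmic tangent sheaf $\mathcal T_{\mathbb P^n}(-\log D)$ is polystable with respect to $\mathcal O_{\mathbb P^n}(1)$.
   Context: $\mathbb P^n$ is complex projective space with its standard toric structure, so the invariant hyperplanes are the coordinate hyperplanes. $\mathcal T_{\mathbb P^n}(-\log D)$ is the dual of $\Omega^1_{\mathbb P^n}(\log D)$: where $D=(z_1=0)$ in local coordinates it is generated by $z_1\partial_{z_1},\partial_{z_2},\dots,\partial_{z_n}$. Stability: for a torsion-free coherent sheaf $\mathcal E$ on a projective variety $X$ with polarization $L$, $\mu_L(\mathcal E)=\dfrac{c_1(\mathcal E)\cdot L^{\dim X-1}}{\mathrm{rk}(\mathcal E)}$; $\mathcal E$ is stable with respect to $L$ if $\mu_L(\mathcal F)<\mu_L(\mathcal E)$ for every coherent subsheaf $\mathcal F$ with $0<\mathrm{rk}\,\mathcal F<\mathrm{rk}\,\mathcal E$. $\mathcal E$ is polystable if it is a direct sum of stable subsheaves of the same slope. *)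

theory Defs
  imports Complex_Main "HOL-Algebra.Module"
begin

section \<open>Complex projective space with its Zariski topology\<close>

text \<open>A point of projective \<open>n\<close>-space is the set of its homogeneous coordinate vectors, which are
  functions \<open>nat \<Rightarrow> complex\<close> supported on \<open>{..n}\<close>. Homogeneous polynomials are taken as polynomial
  functions, which loses nothing over an infinite field.\<close>

type_synonym pt = "(nat \<Rightarrow> complex) set"
type_synonym fn = "pt \<Rightarrow> complex"

definition hclass :: "(nat \<Rightarrow> complex) \<Rightarrow> pt"
  where "hclass x = {(\<lambda>i. c * x i) | c. c \<noteq> 0}"

definition PP :: "nat \<Rightarrow> pt set"
  where "PP n = hclass ` {x. (\<forall>i>n. x i = 0) \<and> (\<exists>i\<le>n. x i \<noteq> 0)}"

definition hpoly :: "nat \<Rightarrow> nat \<Rightarrow> ((nat \<Rightarrow> complex) \<Rightarrow> complex) set"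
  where "hpoly n d = {(\<lambda>x. \<Sum>\<alpha> \<in> {\<alpha> \<in> {..n} \<rightarrow>\<^sub>E {..d}. (\<Sum>i\<le>n. \<alpha> i) = d}. c \<alpha> * (\<Prod>i\<le>n. x i ^ \<alpha> i)) | c. True}"

definition vanishing :: "nat \<Rightarrow> ((nat \<Rightarrow> complex) \<Rightarrow> complex) set \<Rightarrow> pt set"
  where "vanishing n S = {p \<in> PP n. \<forall>f\<in>S. \<forall>x\<in>p. f x = 0}"

definition opens :: "nat \<Rightarrow> pt set set"
  where "opens n = {PP n - vanishing n S | S. S \<subseteq> (\<Union>d. hpoly n d)}"

definition opens_in :: "nat \<Rightarrow> pt set \<Rightarrow> pt set set"
  where "opens_in n U = {V \<in> opens n. V \<subseteq> U}"

text \<open>The ring of regular functions on \<open>U\<close>, as a module over itself.\<close>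

definition reg :: "nat \<Rightarrow> pt set \<Rightarrow> (fn, fn) module"
  where "reg n U =
    \<lparr> carrier = {f \<in> extensional U. \<forall>p\<in>U. \<exists>V\<in>opens_in n U. p \<in> V \<and>
        (\<exists>d. \<exists>g\<in>hpoly n d. \<exists>h\<in>hpoly n d. \<forall>q\<in>V. \<forall>x\<in>q. h x \<noteq> 0 \<and> f q = g x / h x)},
      mult = (\<lambda>f g. \<lambda>p\<in>U. f p * g p),
      one = (\<lambda>p\<in>U. 1),
      zero = (\<lambda>p\<in>U. 0),
      add = (\<lambda>f g. \<lambda>p\<in>U. f p + g p),
      smult = (\<lambda>f g. \<lambda>p\<in>U. f p * g p) \<rparr>"


section \<open>Sheaves of modules over the structure sheaf\<close>

record 'a shf =
  sec :: "pt set \<Rightarrow> (fn, 'a) module"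
  rst :: "pt set \<Rightarrow> pt set \<Rightarrow> 'a \<Rightarrow> 'a"  \<comment> \<open>\<open>rst E U V\<close> is the restriction from \<open>U\<close> to \<open>V\<close>\<close>

locale sheaf_of_modules =
  fixes n :: nat and E :: "'a shf"
  assumes sec_module: "U \<in> opens n \<Longrightarrow> module (reg n U) (sec E U)"
    and rst_closed: "\<lbrakk>U \<in> opens n; V \<in> opens_in n U; s \<in> carrier (sec E U)\<rbrakk>
      \<Longrightarrow> rst E U V s \<in> carrier (sec E V)"
    and rst_add: "\<lbrakk>U \<in> opens n; V \<in> opens_in n U; s \<in> carrier (sec E U); t \<in> carrier (sec E U)\<rbrakk>
      \<Longrightarrow> rst E U V (s \<oplus>\<^bsub>sec E U\<^esub> t) = rst E U V s \<oplus>\<^bsub>sec E V\<^esub> rst E U V t"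
    and rst_smult: "\<lbrakk>U \<in> opens n; V \<in> opens_in n U; f \<in> carrier (reg n U); s \<in> carrier (sec E U)\<rbrakk>
      \<Longrightarrow> rst E U V (f \<odot>\<^bsub>sec E U\<^esub> s) = restrict f V \<odot>\<^bsub>sec E V\<^esub> rst E U V s"
    and rst_id: "\<lbrakk>U \<in> opens n; s \<in> carrier (sec E U)\<rbrakk> \<Longrightarrow> rst E U U s = s"
    and rst_trans: "\<lbrakk>U \<in> opens n; V \<in> opens_in n U; W \<in> opens_in n V; s \<in> carrier (sec E U)\<rbrakk>
      \<Longrightarrow> rst E V W (rst E U V s) = rst E U W s"
    and glue: "\<lbrakk>\<U> \<subseteq> opens n; \<And>U. U \<in> \<U> \<Longrightarrow> \<sigma> U \<in> carrier (sec E U);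
        \<And>U V. \<lbrakk>U \<in> \<U>; V \<in> \<U>\<rbrakk> \<Longrightarrow> rst E U (U \<inter> V) (\<sigma> U) = rst E V (U \<inter> V) (\<sigma> V)\<rbrakk>
      \<Longrightarrow> \<exists>!t. t \<in> carrier (sec E (\<Union>\<U>)) \<and> (\<forall>U\<in>\<U>. rst E (\<Union>\<U>) U t = \<sigma> U)"

text \<open>A family \<open>F\<close> of sets of sections of \<open>E\<close>, with the operations and restrictions of \<open>E\<close>.\<close>

definition subshf :: "'a shf \<Rightarrow> (pt set \<Rightarrow> 'a set) \<Rightarrow> 'a shf"
  where "subshf E F = E\<lparr>sec := (\<lambda>U. (sec E U)\<lparr>carrier := F U\<rparr>)\<rparr>"

definition subsheaf :: "nat \<Rightarrow> (pt set \<Rightarrow> 'a set) \<Rightarrow> 'a shf \<Rightarrow> bool"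
  where "subsheaf n F E \<longleftrightarrow>
    (\<forall>U\<in>opens n. submodule (F U) (reg n U) (sec E U)) \<and> sheaf_of_modules n (subshf E F)"

definition isomorphic :: "nat \<Rightarrow> 'a shf \<Rightarrow> 'b shf \<Rightarrow> bool"
  where "isomorphic n E F \<longleftrightarrow> (\<exists>\<phi>. \<forall>U\<in>opens n.
    bij_betw (\<phi> U) (carrier (sec E U)) (carrier (sec F U)) \<and>
    (\<forall>s\<in>carrier (sec E U). \<forall>t\<in>carrier (sec E U).
      \<phi> U (s \<oplus>\<^bsub>sec E U\<^esub> t) = \<phi> U s \<oplus>\<^bsub>sec F U\<^esub> \<phi> U t) \<and>
    (\<forall>f\<in>carrier (reg n U). \<forall>s\<in>carrier (sec E U).
      \<phi> U (f \<odot>\<^bsub>sec E U\<^esub> s) = f \<odot>\<^bsub>sec F U\<^esub> \<phi> U s) \<and>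
    (\<forall>V\<in>opens_in n U. \<forall>s\<in>carrier (sec E U). \<phi> V (rst E U V s) = rst F U V (\<phi> U s)))"

text \<open>Coherence in the sense of Serre: the sheaf is locally finitely generated, and so is the
  sheaf of relations between any finitely many sections over any open set.\<close>

definition generates :: "nat \<Rightarrow> 'a shf \<Rightarrow> pt set \<Rightarrow> nat \<Rightarrow> (nat \<Rightarrow> 'a) \<Rightarrow> bool"
  where "generates n E U m s \<longleftrightarrow>
    (\<forall>i<m. s i \<in> carrier (sec E U)) \<and>
    (\<forall>V\<in>opens_in n U. \<forall>t\<in>carrier (sec E V). \<forall>p\<in>V. \<exists>W\<in>opens_in n V. p \<in> W \<and>
      (\<exists>a. (\<forall>i<m. a i \<in> carrier (reg n W)) \<and>
        rst E V W t = (\<Oplus>\<^bsub>sec E W\<^esub>i\<in>{..<m}. a i \<odot>\<^bsub>sec E W\<^esub> rst E U W (s i))))"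

definition finite_type :: "nat \<Rightarrow> pt set \<Rightarrow> 'a shf \<Rightarrow> bool"
  where "finite_type n U E \<longleftrightarrow> (\<forall>p\<in>U. \<exists>V\<in>opens_in n U. p \<in> V \<and> (\<exists>m s. generates n E V m s))"

text \<open>The relations between \<open>s 0, \<dots>, s (m - 1)\<close>, sections of \<open>E\<close> over \<open>U\<close>; only its sections over
  open subsets of \<open>U\<close> are meaningful.\<close>

definition relations :: "nat \<Rightarrow> 'a shf \<Rightarrow> pt set \<Rightarrow> nat \<Rightarrow> (nat \<Rightarrow> 'a) \<Rightarrow> (nat \<Rightarrow> fn) shf"
  where "relations n E U m s =
    \<lparr> sec = (\<lambda>V.
        \<lparr> carrier = {a \<in> {..<m} \<rightarrow>\<^sub>E carrier (reg n V).
            (\<Oplus>\<^bsub>sec E V\<^esub>i\<in>{..<m}. a i \<odot>\<^bsub>sec E V\<^esub> rst E U V (s i)) = \<zero>\<^bsub>sec E V\<^esub>},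
          mult = undefined, one = undefined,
          zero = (\<lambda>i\<in>{..<m}. \<zero>\<^bsub>reg n V\<^esub>),
          add = (\<lambda>a b. \<lambda>i\<in>{..<m}. a i \<oplus>\<^bsub>reg n V\<^esub> b i),
          smult = (\<lambda>f a. \<lambda>i\<in>{..<m}. f \<otimes>\<^bsub>reg n V\<^esub> a i) \<rparr>),
      rst = (\<lambda>V W a. \<lambda>i\<in>{..<m}. restrict (a i) W) \<rparr>"

definition coherent :: "nat \<Rightarrow> 'a shf \<Rightarrow> bool"
  where "coherent n E \<longleftrightarrow> sheaf_of_modules n E \<and> finite_type n (PP n) E \<and>
    (\<forall>U\<in>opens n. \<forall>m s. (\<forall>i<m. s i \<in> carrier (sec E U)) \<longrightarrow> finite_type n U (relations n E U m s))"

definition torsion_free :: "nat \<Rightarrow> 'a shf \<Rightarrow> bool"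
  where "torsion_free n E \<longleftrightarrow> (\<forall>U\<in>opens n. \<forall>f\<in>carrier (reg n U). \<forall>s\<in>carrier (sec E U).
    f \<odot>\<^bsub>sec E U\<^esub> s = \<zero>\<^bsub>sec E U\<^esub> \<longrightarrow> f = \<zero>\<^bsub>reg n U\<^esub> \<or> s = \<zero>\<^bsub>sec E U\<^esub>)"

definition frame :: "nat \<Rightarrow> 'a shf \<Rightarrow> pt set \<Rightarrow> nat \<Rightarrow> (nat \<Rightarrow> 'a) \<Rightarrow> bool"
  where "frame n E U r e \<longleftrightarrow>
    (\<forall>i<r. e i \<in> carrier (sec E U)) \<and>
    (\<forall>V\<in>opens_in n U. \<forall>t\<in>carrier (sec E V). \<exists>!a. a \<in> {..<r} \<rightarrow>\<^sub>E carrier (reg n V) \<and>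
      t = (\<Oplus>\<^bsub>sec E V\<^esub>i\<in>{..<r}. a i \<odot>\<^bsub>sec E V\<^esub> rst E U V (e i)))"

text \<open>The generic rank: a coherent sheaf on an integral variety is free on some nonempty open set.\<close>

definition rank :: "nat \<Rightarrow> 'a shf \<Rightarrow> nat"
  where "rank n E = (THE r. \<exists>U\<in>opens n. U \<noteq> {} \<and> (\<exists>e. frame n E U r e))"


section \<open>Duals, determinants, degree and slope\<close>

text \<open>Sheaf of families of maps from \<open>A V\<close> to the regular functions on \<open>V\<close>, for \<open>V\<close> open in \<open>U\<close>, which
  satisfy \<open>P V\<close> and commute with the restrictions \<open>\<rho>\<close>.\<close>

definition map_sheaf :: "nat \<Rightarrow> (pt set \<Rightarrow> 'a set) \<Rightarrow> (pt set \<Rightarrow> pt set \<Rightarrow> 'a \<Rightarrow> 'a)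
    \<Rightarrow> (pt set \<Rightarrow> ('a \<Rightarrow> fn) \<Rightarrow> bool) \<Rightarrow> (pt set \<Rightarrow> 'a \<Rightarrow> fn) shf"
  where "map_sheaf n A \<rho> P =
    \<lparr> sec = (\<lambda>U.
        \<lparr> carrier = {\<phi> \<in> (\<Pi>\<^sub>E V\<in>opens_in n U. A V \<rightarrow>\<^sub>E carrier (reg n V)).
            (\<forall>V\<in>opens_in n U. P V (\<phi> V)) \<and>
            (\<forall>V\<in>opens_in n U. \<forall>W\<in>opens_in n V. \<forall>x\<in>A V. \<phi> W (\<rho> V W x) = restrict (\<phi> V x) W)},
          mult = undefined, one = undefined,
          zero = (\<lambda>V\<in>opens_in n U. \<lambda>x\<in>A V. \<zero>\<^bsub>reg n V\<^esub>),
          add = (\<lambda>\<phi> \<psi>. \<lambda>V\<in>opens_in n U. \<lambda>x\<in>A V. \<phi> V x \<oplus>\<^bsub>reg n V\<^esub> \<psi> V x),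
          smult = (\<lambda>f \<phi>. \<lambda>V\<in>opens_in n U. \<lambda>x\<in>A V. restrict f V \<otimes>\<^bsub>reg n V\<^esub> \<phi> V x) \<rparr>),
      rst = (\<lambda>U W \<phi>. restrict \<phi> (opens_in n W)) \<rparr>"

definition linear_form :: "nat \<Rightarrow> 'a shf \<Rightarrow> pt set \<Rightarrow> ('a \<Rightarrow> fn) \<Rightarrow> bool"
  where "linear_form n E V \<phi> \<longleftrightarrow>
    (\<forall>s\<in>carrier (sec E V). \<forall>t\<in>carrier (sec E V). \<phi> (s \<oplus>\<^bsub>sec E V\<^esub> t) = \<phi> s \<oplus>\<^bsub>reg n V\<^esub> \<phi> t) \<and>
    (\<forall>f\<in>carrier (reg n V). \<forall>s\<in>carrier (sec E V). \<phi> (f \<odot>\<^bsub>sec E V\<^esub> s) = f \<otimes>\<^bsub>reg n V\<^esub> \<phi> s)"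

definition dual :: "nat \<Rightarrow> 'a shf \<Rightarrow> (pt set \<Rightarrow> 'a \<Rightarrow> fn) shf"
  where "dual n E = map_sheaf n (\<lambda>V. carrier (sec E V)) (rst E) (linear_form n E)"

definition alternating_form :: "nat \<Rightarrow> nat \<Rightarrow> 'a shf \<Rightarrow> pt set \<Rightarrow> ((nat \<Rightarrow> 'a) \<Rightarrow> fn) \<Rightarrow> bool"
  where "alternating_form n r E V \<phi> \<longleftrightarrow> (\<forall>s \<in> {..<r} \<rightarrow>\<^sub>E carrier (sec E V).
    (\<forall>i<r. \<forall>x\<in>carrier (sec E V). \<forall>y\<in>carrier (sec E V).
      \<phi> (s(i := x \<oplus>\<^bsub>sec E V\<^esub> y)) = \<phi> (s(i := x)) \<oplus>\<^bsub>reg n V\<^esub> \<phi> (s(i := y))) \<and>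
    (\<forall>i<r. \<forall>f\<in>carrier (reg n V). \<forall>x\<in>carrier (sec E V).
      \<phi> (s(i := f \<odot>\<^bsub>sec E V\<^esub> x)) = f \<otimes>\<^bsub>reg n V\<^esub> \<phi> (s(i := x))) \<and>
    (\<forall>i<r. \<forall>j<r. i \<noteq> j \<and> s i = s j \<longrightarrow> \<phi> s = \<zero>\<^bsub>reg n V\<^esub>))"

text \<open>By the universal property of exterior powers the sheaf of alternating \<open>r\<close>-forms is the dual of
  the \<open>r\<close>-th exterior power of \<open>E\<close>.\<close>

definition alternating_forms :: "nat \<Rightarrow> nat \<Rightarrow> 'a shf \<Rightarrow> (pt set \<Rightarrow> (nat \<Rightarrow> 'a) \<Rightarrow> fn) shf"
  where "alternating_forms n r E =
    map_sheaf n (\<lambda>V. {..<r} \<rightarrow>\<^sub>E carrier (sec E V)) (\<lambda>V W s. \<lambda>i\<in>{..<r}. rst E V W (s i))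
      (alternating_form n r E)"

text \<open>The determinant of \<open>E\<close> is the double dual of its top exterior power.\<close>

definition det_sheaf :: "nat \<Rightarrow> 'a shf \<Rightarrow> (pt set \<Rightarrow> (pt set \<Rightarrow> (nat \<Rightarrow> 'a) \<Rightarrow> fn) \<Rightarrow> fn) shf"
  where "det_sheaf n E = dual n (alternating_forms n (rank n E) E)"

text \<open>The line bundle \<open>\<O>(d)\<close>: sections over \<open>U\<close> are the functions on the cone over \<open>U\<close> which are locally
  quotients of homogeneous polynomials whose degrees differ by \<open>d\<close>.\<close>

definition twist :: "nat \<Rightarrow> int \<Rightarrow> ((nat \<Rightarrow> complex) \<Rightarrow> complex) shf"
  where "twist n d =
    \<lparr> sec = (\<lambda>U.
        \<lparr> carrier = {s \<in> extensional (\<Union>U). \<forall>p\<in>U. \<exists>V\<in>opens_in n U. p \<in> V \<and>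
            (\<exists>a b. int a - int b = d \<and> (\<exists>g\<in>hpoly n a. \<exists>h\<in>hpoly n b.
              \<forall>x\<in>\<Union>V. h x \<noteq> 0 \<and> s x = g x / h x))},
          mult = undefined, one = undefined,
          zero = (\<lambda>x\<in>\<Union>U. 0),
          add = (\<lambda>s t. \<lambda>x\<in>\<Union>U. s x + t x),
          smult = (\<lambda>f s. \<lambda>x\<in>\<Union>U. f (hclass x) * s x) \<rparr>),
      rst = (\<lambda>U V s. restrict s (\<Union>V)) \<rparr>"

text \<open>The first Chern class of \<open>E\<close> is that of its determinant. With \<open>L = \<O>(1)\<close>, every line bundle
  is some \<open>\<O>(d)\<close>, with \<open>c\<^sub>1(\<O>(d)) = d c\<^sub>1(L)\<close> and \<open>L\<^sup>n = 1\<close>, so that \<open>c\<^sub>1(E) \<cdot> L\<^bsup>n - 1\<^esup>\<close> is the integer \<open>d\<close>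
  with \<open>det E \<cong> \<O>(d)\<close>. It is unique for \<open>n \<ge> 1\<close>.\<close>

definition degree :: "nat \<Rightarrow> 'a shf \<Rightarrow> int"
  where "degree n E = (THE d. isomorphic n (det_sheaf n E) (twist n d))"

definition slope :: "nat \<Rightarrow> 'a shf \<Rightarrow> real"
  where "slope n E = of_int (degree n E) / of_nat (rank n E)"


section \<open>Stability with respect to \<open>\<O>(1)\<close>\<close>

definition stable :: "nat \<Rightarrow> 'a shf \<Rightarrow> bool"
  where "stable n E \<longleftrightarrow> coherent n E \<and> torsion_free n E \<and> 0 < rank n E \<and>
    (\<forall>F. subsheaf n F E \<and> coherent n (subshf E F) \<and>
        0 < rank n (subshf E F) \<and> rank n (subshf E F) < rank n E
      \<longrightarrow> slope n (subshf E F) < slope n E)"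

definition direct_sum :: "nat \<Rightarrow> 'a shf \<Rightarrow> nat \<Rightarrow> (nat \<Rightarrow> pt set \<Rightarrow> 'a set) \<Rightarrow> bool"
  where "direct_sum n E k F \<longleftrightarrow> (\<forall>j<k. subsheaf n (F j) E) \<and>
    (\<forall>U\<in>opens n. \<forall>s\<in>carrier (sec E U). \<exists>!t. t \<in> (\<Pi>\<^sub>E j\<in>{..<k}. F j U) \<and>
      s = (\<Oplus>\<^bsub>sec E U\<^esub>j\<in>{..<k}. t j))"

definition polystable :: "nat \<Rightarrow> 'a shf \<Rightarrow> bool"
  where "polystable n E \<longleftrightarrow> coherent n E \<and> torsion_free n E \<and>
    (\<exists>k F. direct_sum n E k F \<and>
      (\<forall>j<k. stable n (subshf E (F j))) \<and>
      (\<forall>i<k. \<forall>j<k. slope n (subshf E (F i)) = slope n (subshf E (F j))))"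


section \<open>The logarithmic tangent sheaf\<close>

definition derivation :: "nat \<Rightarrow> pt set \<Rightarrow> (fn \<Rightarrow> fn) \<Rightarrow> bool"
  where "derivation n V \<theta> \<longleftrightarrow>
    (\<forall>f\<in>carrier (reg n V). \<forall>g\<in>carrier (reg n V).
      \<theta> (f \<oplus>\<^bsub>reg n V\<^esub> g) = \<theta> f \<oplus>\<^bsub>reg n V\<^esub> \<theta> g \<and>
      \<theta> (f \<otimes>\<^bsub>reg n V\<^esub> g) = f \<otimes>\<^bsub>reg n V\<^esub> \<theta> g \<oplus>\<^bsub>reg n V\<^esub> g \<otimes>\<^bsub>reg n V\<^esub> \<theta> f) \<and>
    (\<forall>c. \<theta> (\<lambda>p\<in>V. c) = \<zero>\<^bsub>reg n V\<^esub>)"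

definition tangent :: "nat \<Rightarrow> (pt set \<Rightarrow> fn \<Rightarrow> fn) shf"
  where "tangent n = map_sheaf n (\<lambda>V. carrier (reg n V)) (\<lambda>V W f. restrict f W) (derivation n)"

text \<open>Algebraic local coordinates \<open>z 0, \<dots>, z (n - 1)\<close> on \<open>W\<close>, with their coordinate vector fields
  \<open>\<delta> 0, \<dots>, \<delta> (n - 1)\<close>.\<close>

definition local_coordinates :: "nat \<Rightarrow> pt set \<Rightarrow> (nat \<Rightarrow> fn) \<Rightarrow> (nat \<Rightarrow> pt set \<Rightarrow> fn \<Rightarrow> fn) \<Rightarrow> bool"
  where "local_coordinates n W z \<delta> \<longleftrightarrow>
    (\<forall>i<n. z i \<in> carrier (reg n W)) \<and> frame n (tangent n) W n \<delta> \<and>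
    (\<forall>i<n. \<forall>j<n. \<delta> i W (z j) = (if i = j then \<one>\<^bsub>reg n W\<^esub> else \<zero>\<^bsub>reg n W\<^esub>))"

text \<open>For a smooth hypersurface \<open>D\<close>: the vector fields which near each point of \<open>D\<close> are combinations of
  \<open>z\<^sub>0 \<delta>\<^sub>0, \<delta>\<^sub>1, \<dots>\<close>, in local coordinates with \<open>D = (z\<^sub>0 = 0)\<close>. Since \<open>z\<^sub>0\<close> is part of a coordinate
  system, its zero divisor is reduced, and the equation of \<open>D\<close> may be required on the level of sets.\<close>

definition log_tangent :: "nat \<Rightarrow> pt set \<Rightarrow> (pt set \<Rightarrow> fn \<Rightarrow> fn) shf"
  where "log_tangent n D = subshf (tangent n) (\<lambda>U. {\<theta> \<in> carrier (sec (tangent n) U).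
    \<forall>p \<in> U \<inter> D. \<exists>W\<in>opens_in n U. p \<in> W \<and>
      (\<exists>z \<delta>. local_coordinates n W z \<delta> \<and> D \<inter> W = {q \<in> W. z 0 q = 0} \<and>
        (\<exists>a. (\<forall>i<n. a i \<in> carrier (reg n W)) \<and>
          rst (tangent n) U W \<theta> = (\<Oplus>\<^bsub>sec (tangent n) W\<^esub>i\<in>{..<n}.
            (if i = 0 then a 0 \<otimes>\<^bsub>reg n W\<^esub> z 0 else a i) \<odot>\<^bsub>sec (tangent n) W\<^esub> \<delta> i)))})"


section \<open>Torus-invariant hyperplanes\<close>

definition hyperplane :: "nat \<Rightarrow> pt set \<Rightarrow> bool"
  where "hyperplane n D \<longleftrightarrow>
    (\<exists>a. (\<exists>j\<le>n. a j \<noteq> 0) \<and> D = {p \<in> PP n. \<forall>x\<in>p. (\<Sum>j\<le>n. a j * x j) = 0})"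

definition torus_invariant :: "nat \<Rightarrow> pt set \<Rightarrow> bool"
  where "torus_invariant n D \<longleftrightarrow>
    (\<forall>t. (\<forall>j\<le>n. t j \<noteq> 0) \<longrightarrow> (\<forall>p\<in>D. (\<lambda>x j. t j * x j) ` p \<in> D))"

end

(* Let D be the hyperplane x_k = 0. By Euler's relation every section of the logarithmic tangent sheaf
   over an open set U has a unique expression as the sum over j <> k of s_j d/dx_j, where the s_j are
   sections of O(1) over U; hence the sheaf is the direct sum of the n line bundles O(1) d/dx_j. A sheaf
   of rank one is stable for want of subsheaves of intermediate rank, and the summands are isomorphic
   to each other, so that they have the same slope; their degree need not be computed.

   The expression exists because a derivation is determined by its values on the affine
   coordinates x_j / x_l, and because x_k / x_l divides the first coordinate of every local
   coordinate system adapted to D with a quotient that does not vanish on D. Coherence rests on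
   Hilbert's basis theorem for the affine coordinate rings. *)

theory Submission
  imports Defs "HOL-Computational_Algebra.Polynomial" "HOL-Library.Function_Algebras"
begin

section \<open>Hilbert's basis theorem for modules over a finitely generated algebra\<close>

text \<open>A vector field is a compatible system of derivations and a point is a class of vectors,
  so neither offers coordinates to compute with. Calculus takes place on the cone
  \<open>\<Union>U\<close>, where partial derivatives are complex derivatives along coordinate lines
  and a coefficient of degree 1 makes up for the degree lost by differentiation. The Euler field
  acts as zero on functions of degree 0; leaving out the direction \<open>k\<close> makes
  coefficients unique, and this uniqueness lets them glue over every open set and not only over a
  chart.

  Coherence concerns relations between arbitrary sections over arbitrary open sets, so generators of
  the sheaf are not enough. Multiplied by one function without zeros, a local relation has
  components in an affine coordinate ring, and the identity principle extends it from a small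
  neighbourhood to the whole part of the open set in a chart. It then lies in a submodule of a free
  module over that ring. Only values at points enter, so the argument covers every subsheaf of the
  tangent sheaf at once.\<close>

definition sub_ring :: "'a::comm_ring_1 set \<Rightarrow> bool"
  where "sub_ring R \<longleftrightarrow> 1 \<in> R \<and> - 1 \<in> R \<and> (\<forall>x\<in>R. \<forall>y\<in>R. x + y \<in> R \<and> x * y \<in> R)"

text \<open>A module is a subset of the same ambient ring as its scalars. A free module over a ring
  of functions on \<open>pt\<close> fits this scheme as a set of functions on
  \<open>nat \<times> pt\<close>, on which scalars act by pointwise multiplication.\<close>

definition sub_mod :: "'a::comm_ring_1 set \<Rightarrow> 'a set \<Rightarrow> bool"
  where "sub_mod R N \<longleftrightarrow> 0 \<in> N \<and> (\<forall>x\<in>N. \<forall>y\<in>N. x + y \<in> N) \<and> (\<forall>r\<in>R. \<forall>x\<in>N. r * x \<in> N)"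

text \<open>Adding one scaled generator at a time makes closure properties plain inductions. A
  generator may occur repeatedly; \<open>lspan_sum\<close> collects its terms.\<close>

inductive_set lspan :: "'a::comm_ring_1 set \<Rightarrow> 'a set \<Rightarrow> 'a set" for R S
  where
    lspan_zero: "0 \<in> lspan R S"
  | lspan_step: "\<lbrakk>x \<in> lspan R S; r \<in> R; s \<in> S\<rbrakk> \<Longrightarrow> x + r * s \<in> lspan R S"

definition noetherian :: "'a::comm_ring_1 set \<Rightarrow> 'a set \<Rightarrow> bool"
  where "noetherian R M \<longleftrightarrow>
    (\<forall>N\<subseteq>M. sub_mod R N \<longrightarrow> (\<exists>S\<subseteq>N. finite S \<and> N \<subseteq> lspan R S))"

lemma sub_mod_diff:
  assumes "sub_ring R" "sub_mod R N" "x \<in> N" "y \<in> N"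
  shows "x - y \<in> N"
proof -
  have "-1 * y \<in> N" using assms unfolding sub_ring_def sub_mod_def by blast
  then have "x + -1 * y \<in> N" using assms unfolding sub_mod_def by blast
  then show ?thesis by simp
qed

lemma lspan_add:
  assumes "x \<in> lspan R S" "y \<in> lspan R S"
  shows "x + y \<in> lspan R S"
  using assms(2) by induction (use assms(1) in \<open>auto simp: add.assoc[symmetric] intro: lspan_step\<close>)

lemma lspan_mono: "x \<in> lspan R S \<Longrightarrow> R \<subseteq> R' \<Longrightarrow> S \<subseteq> S' \<Longrightarrow> x \<in> lspan R' S'"
  by (induction rule: lspan.induct) (auto intro: lspan.intros)

text \<open>The inductive span keeps repeated generators apart; merging their coefficients over a
  finite generating set gives the sum with one coefficient per generator that
  \<open>generates\<close> asks for.\<close>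

lemma lspan_sum:
  assumes "x \<in> lspan R S" "finite S" "sub_ring R"
  shows "\<exists>c. (\<forall>s. c s \<in> R) \<and> x = (\<Sum>s\<in>S. c s * s)"
  using assms(1)
proof induction
  case lspan_zero
  \<comment> \<open>\<open>sub_ring\<close> lists \<open>1\<close> and \<open>- 1\<close> but not
    \<open>0\<close>, so the zero coefficients come from this sum.\<close>
  have "1 + - 1 \<in> R" using assms(3) unfolding sub_ring_def by blast
  then show ?case by (intro exI[of _ "\<lambda>_. 0"]) simp
next
  case (lspan_step x r s)
  then obtain c where c: "\<forall>s. c s \<in> R" "x = (\<Sum>s\<in>S. c s * s)" by blast
  have "(\<Sum>t\<in>S. (c(s := c s + r)) t * t) = (\<Sum>t\<in>S. c t * t + (if t = s then r * s else 0))"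
    by (intro sum.cong) (auto simp: algebra_simps)
  also have "\<dots> = x + r * s"
    using lspan_step(3) assms(2) by (simp add: sum.distrib c(2))
  finally show ?case
    using c lspan_step assms(3) unfolding sub_ring_def by (intro exI[of _ "c(s := c s + r)"]) simp
qed

text \<open>\<open>poly_below X M d\<close> consists of the polynomial expressions in \<open>X\<close> of formal degree less than \<open>d\<close>
  with coefficients in \<open>M\<close>. As \<open>X\<close> need not be transcendental, an element may have several
  leading coefficients.\<close>

primrec poly_below :: "'a::comm_ring_1 \<Rightarrow> 'a set \<Rightarrow> nat \<Rightarrow> 'a set"
  where
    "poly_below X M 0 = {0}"
  | "poly_below X M (Suc d) = {a * X ^ d + b | a b. a \<in> M \<and> b \<in> poly_below X M d}"

definition adjoin :: "'a::comm_ring_1 \<Rightarrow> 'a set \<Rightarrow> 'a set"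
  where "adjoin X M = (\<Union>d. poly_below X M d)"

lemma poly_below_sub_mod:
  assumes "sub_mod R M"
  shows "sub_mod R (poly_below X M d)"
proof (induction d)
  case 0
  then show ?case by (simp add: sub_mod_def)
next
  case (Suc d)
  have "x + y \<in> poly_below X M (Suc d)"
    if x: "x \<in> poly_below X M (Suc d)" and y: "y \<in> poly_below X M (Suc d)" for x y
  proof -
    obtain a b where ab: "x = a * X ^ d + b" "a \<in> M" "b \<in> poly_below X M d" using x by auto
    obtain a' b' where ab': "y = a' * X ^ d + b'" "a' \<in> M" "b' \<in> poly_below X M d" using y by auto
    have "x + y = (a + a') * X ^ d + (b + b')" using ab ab' by (simp add: algebra_simps)
    moreover have "a + a' \<in> M" "b + b' \<in> poly_below X M d"
      using ab ab' assms Suc unfolding sub_mod_def by auto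
    ultimately show ?thesis by auto
  qed
  moreover have "r * x \<in> poly_below X M (Suc d)"
    if r: "r \<in> R" and x: "x \<in> poly_below X M (Suc d)" for r x
  proof -
    obtain a b where ab: "x = a * X ^ d + b" "a \<in> M" "b \<in> poly_below X M d" using x by auto
    have "r * x = (r * a) * X ^ d + r * b" using ab by (simp add: algebra_simps)
    moreover have "r * a \<in> M" "r * b \<in> poly_below X M d"
      using ab r assms Suc unfolding sub_mod_def by auto
    ultimately show ?thesis by auto
  qed
  moreover have "0 \<in> poly_below X M (Suc d)"
  proof -
    have "0 * X ^ d + 0 \<in> poly_below X M (Suc d)"
      using assms Suc unfolding sub_mod_def poly_below.simps by blast
    then show ?thesis by simp
  qed
  ultimately show ?case unfolding sub_mod_def by blast
qed

lemma poly_below_Suc: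
  assumes "0 \<in> M" "x \<in> poly_below X M d"
  shows "x \<in> poly_below X M (Suc d)"
proof -
  have "0 * X ^ d + x \<in> poly_below X M (Suc d)" using assms unfolding poly_below.simps by blast
  then show ?thesis by simp
qed

lemma poly_below_mono:
  assumes "0 \<in> M" "x \<in> poly_below X M d" "d \<le> e"
  shows "x \<in> poly_below X M e"
  using assms(3) by (induction e rule: dec_induct) (use assms poly_below_Suc in blast)+

lemma poly_below_mult_var:
  assumes "0 \<in> M" "x \<in> poly_below X M d"
  shows "X * x \<in> poly_below X M (Suc d)"
  using assms(2)
proof (induction d arbitrary: x)
  case 0
  then show ?case using poly_below_Suc[OF assms(1), of 0 X 0] by simp
next
  case (Suc d)
  then obtain a b where ab: "x = a * X ^ d + b" "a \<in> M" "b \<in> poly_below X M d" by auto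
  have "X * x = a * X ^ (Suc d) + X * b" using ab by (simp add: algebra_simps)
  then show ?case using ab Suc.IH poly_below.simps(2)[of X M "Suc d"] by blast
qed

lemma poly_below_mult_power:
  assumes "0 \<in> M" "x \<in> poly_below X M d"
  shows "X ^ k * x \<in> poly_below X M (d + k)"
  by (induction k) (use assms poly_below_mult_var[OF assms(1)] in \<open>auto simp: mult.assoc\<close>)

lemma subset_adjoin:
  assumes "0 \<in> M"
  shows "M \<subseteq> adjoin X M"
proof
  fix x assume "x \<in> M"
  then have "x * X ^ 0 + 0 \<in> poly_below X M (Suc 0)" unfolding poly_below.simps by blast
  then have "x \<in> poly_below X M (Suc 0)" by simp
  then show "x \<in> adjoin X M" unfolding adjoin_def by blast
qed

text \<open>Closure is shown for the old scalars and the single new element \<open>X\<close>;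
  \<open>alg_closure_sub_mod\<close> extends it to the algebra that they generate.\<close>

lemma adjoin_sub_mod:
  assumes "sub_mod R M"
  shows "sub_mod (insert X R) (adjoin X M)"
proof -
  have z: "0 \<in> M" using assms by (simp add: sub_mod_def)
  have "x + y \<in> adjoin X M" if x: "x \<in> adjoin X M" and y: "y \<in> adjoin X M" for x y
  proof -
    obtain d where "x \<in> poly_below X M d" using x by (auto simp: adjoin_def)
    moreover obtain e where "y \<in> poly_below X M e" using y by (auto simp: adjoin_def)
    ultimately have "x \<in> poly_below X M (max d e)" "y \<in> poly_below X M (max d e)"
      by (auto intro: poly_below_mono[OF z])
    then have "x + y \<in> poly_below X M (max d e)"
      using poly_below_sub_mod[OF assms] unfolding sub_mod_def by blast
    then show ?thesis by (auto simp: adjoin_def)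
  qed
  moreover have "r * x \<in> adjoin X M" if r: "r \<in> insert X R" and x: "x \<in> adjoin X M" for r x
  proof -
    obtain d where d: "x \<in> poly_below X M d" using x by (auto simp: adjoin_def)
    then have "r * x \<in> poly_below X M d \<or> r * x \<in> poly_below X M (Suc d)"
      using r poly_below_sub_mod[OF assms] poly_below_mult_var[OF z d] unfolding sub_mod_def by blast
    then show ?thesis unfolding adjoin_def by blast
  qed
  moreover have "0 \<in> adjoin X M" using subset_adjoin[OF z] z by blast
  ultimately show ?thesis unfolding sub_mod_def by blast
qed

text \<open>A lift of formal degree \<open>d\<close> times \<open>X ^ (e - d)\<close> has formal
  degree \<open>e\<close> and the same leading coefficient, so a combination of leading coefficients
  is lifted by the same combination of lifts. Membership in \<open>N\<close> travels along the
  induction because the result will be subtracted from an element of \<open>N\<close>.\<close>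

lemma lift_leading_coefficient:
  assumes R': "sub_mod R' N" "R \<subseteq> R'" "X \<in> R'" "sub_ring R'"
    and M: "sub_mod R M" and G: "G \<subseteq> N" and d: "d \<le> e"
    and lift: "\<And>s. s \<in> S \<Longrightarrow> \<exists>b\<in>poly_below X M d. s * X ^ d + b \<in> G"
    and a: "a \<in> lspan R S"
  shows "\<exists>b\<in>poly_below X M e. a * X ^ e + b \<in> lspan R' G \<inter> N"
  using a
proof induction
  case lspan_zero
  have "0 \<in> poly_below X M e" "0 \<in> N"
    using poly_below_sub_mod[OF M] R'(1) unfolding sub_mod_def by auto
  then show ?case using lspan.lspan_zero[of R' G] by (intro bexI[of _ 0]) auto
next
  case (lspan_step a r s)
  then obtain b where b: "b \<in> poly_below X M e" "a * X ^ e + b \<in> lspan R' G" "a * X ^ e + b \<in> N"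
    by blast
  obtain c where c: "c \<in> poly_below X M d" "s * X ^ d + c \<in> G" using lift lspan_step by blast
  have P: "X ^ k \<in> R'" for k
    by (induction k) (use R' in \<open>auto simp: sub_ring_def\<close>)
  have rX: "r * X ^ (e - d) \<in> R'" using P lspan_step(2) R' unfolding sub_ring_def by blast
  have "X ^ (e - d) * c \<in> poly_below X M (d + (e - d))"
    by (rule poly_below_mult_power) (use c M in \<open>auto simp: sub_mod_def\<close>)
  then have "r * (X ^ (e - d) * c) \<in> poly_below X M e"
    using poly_below_sub_mod[OF M] lspan_step(2) d unfolding sub_mod_def by auto
  then have c': "b + r * (X ^ (e - d) * c) \<in> poly_below X M e"
    using poly_below_sub_mod[OF M] b(1) unfolding sub_mod_def by blast
  have "X ^ e = X ^ (e - d) * X ^ d" using d by (simp flip: power_add)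
  then have eq: "(a + r * s) * X ^ e + (b + r * (X ^ (e - d) * c))
      = (a * X ^ e + b) + (r * X ^ (e - d)) * (s * X ^ d + c)"
    by (simp add: algebra_simps)
  have "(r * X ^ (e - d)) * (s * X ^ d + c) \<in> N"
    using rX c(2) G R'(1) unfolding sub_mod_def by blast
  then have "(a * X ^ e + b) + (r * X ^ (e - d)) * (s * X ^ d + c) \<in> N"
    using b(3) R'(1) unfolding sub_mod_def by blast
  moreover have "(a * X ^ e + b) + (r * X ^ (e - d)) * (s * X ^ d + c) \<in> lspan R' G"
    using b(2) rX c(2) by (rule lspan.lspan_step)
  ultimately have "(a + r * s) * X ^ e + (b + r * (X ^ (e - d) * c)) \<in> lspan R' G \<inter> N"
    unfolding eq by blast
  then show ?case using c' by blast
qed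

text \<open>Hilbert's argument with leading coefficients: the modules \<open>L d\<close> increase
  with \<open>d\<close>, the finitely many generators of their union all lie in some
  \<open>L m\<close>, and lifts of generators in the degrees up to \<open>m\<close> generate
  \<open>N\<close> by descent on the formal degree.\<close>

lemma noetherian_adjoin:
  assumes noeth: "noetherian R M" and R: "sub_ring R" and M: "sub_mod R M"
    and R': "sub_ring R'" "R \<subseteq> R'" "X \<in> R'"
  shows "noetherian R' (adjoin X M)"
  unfolding noetherian_def
proof (intro allI impI)
  fix N assume N: "N \<subseteq> adjoin X M" "sub_mod R' N"
  have z: "0 \<in> M" using M by (simp add: sub_mod_def)
  \<comment> \<open>All leading coefficients that occur in formal degree \<open>d\<close>, over
    every way of writing an element of \<open>N\<close>. Collecting all of them keeps
    \<open>L d\<close> a module although an element can have several.\<close>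
  define L where "L d = {a \<in> M. \<exists>b\<in>poly_below X M d. a * X ^ d + b \<in> N}" for d
  have L_mod: "sub_mod R (L d)" for d
  proof -
    have "0 \<in> L d"
      using z poly_below_sub_mod[OF M, of X d] N(2) unfolding L_def sub_mod_def
      by (auto intro!: bexI[of _ 0])
    moreover have "x + y \<in> L d" if xy: "x \<in> L d" "y \<in> L d" for x y
    proof -
      obtain b c where *: "b \<in> poly_below X M d" "x * X ^ d + b \<in> N"
        "c \<in> poly_below X M d" "y * X ^ d + c \<in> N" using xy unfolding L_def by blast
      have "(x * X ^ d + b) + (y * X ^ d + c) \<in> N" using * N(2) unfolding sub_mod_def by blast
      then have "(x + y) * X ^ d + (b + c) \<in> N" by (simp add: algebra_simps)
      then show ?thesis using * xy poly_below_sub_mod[OF M, of X d] M unfolding L_def sub_mod_def by blast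
    qed
    moreover have "r * x \<in> L d" if rx: "r \<in> R" "x \<in> L d" for r x
    proof -
      obtain b where *: "b \<in> poly_below X M d" "x * X ^ d + b \<in> N" using rx unfolding L_def by blast
      have "r * (x * X ^ d + b) \<in> N" using * N(2) R'(2) rx unfolding sub_mod_def by blast
      then have "(r * x) * X ^ d + r * b \<in> N" by (simp add: algebra_simps)
      then show ?thesis using * rx poly_below_sub_mod[OF M, of X d] M unfolding L_def sub_mod_def by blast
    qed
    ultimately show ?thesis unfolding sub_mod_def by blast
  qed
  have L_Suc: "L d \<subseteq> L (Suc d)" for d
  proof
    fix a assume "a \<in> L d"
    then obtain b where *: "a \<in> M" "b \<in> poly_below X M d" "a * X ^ d + b \<in> N" unfolding L_def by blast
    have "X * (a * X ^ d + b) \<in> N" using * N(2) R'(3) unfolding sub_mod_def by blast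
    then have "a * X ^ Suc d + X * b \<in> N" by (simp add: algebra_simps)
    then show "a \<in> L (Suc d)" using * poly_below_mult_var[OF z] unfolding L_def by blast
  qed
  have L_mono: "L d \<subseteq> L e" if "d \<le> e" for d e
    using lift_Suc_mono_le[of L, OF L_Suc that] .
  have "sub_mod R (\<Union>d. L d)"
  proof -
    have "x + y \<in> (\<Union>d. L d)" if xy: "x \<in> L d" "y \<in> L e" for x y d e
    proof -
      have "x \<in> L (max d e)" "y \<in> L (max d e)"
        using xy L_mono[of d "max d e"] L_mono[of e "max d e"] by (meson max.cobounded1 max.cobounded2 subsetD)+
      then show ?thesis using L_mod[of "max d e"] unfolding sub_mod_def by blast
    qed
    moreover have "0 \<in> (\<Union>d. L d)" using L_mod[of 0] unfolding sub_mod_def by blast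
    moreover have "r * x \<in> (\<Union>d. L d)" if "r \<in> R" "x \<in> L d" for r x d
      using L_mod[of d] that unfolding sub_mod_def by blast
    ultimately show ?thesis unfolding sub_mod_def by auto
  qed
  moreover have "(\<Union>d. L d) \<subseteq> M" unfolding L_def by blast
  ultimately obtain S where S: "S \<subseteq> (\<Union>d. L d)" "finite S" "(\<Union>d. L d) \<subseteq> lspan R S"
    using noeth unfolding noetherian_def by meson
  have "\<exists>m. S \<subseteq> L m"
    using S(2,1)
  proof (induction S rule: finite_induct)
    case (insert x F)
    then obtain m where "F \<subseteq> L m" by blast
    moreover obtain d where "x \<in> L d" using insert by blast
    ultimately have "insert x F \<subseteq> L (max d m)"
      using L_mono[of d "max d m"] L_mono[of m "max d m"] by (simp add: subset_iff)
    then show ?case by blast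
  qed auto
  then obtain m where m: "S \<subseteq> L m" by blast
  have "\<exists>T. T \<subseteq> L d \<and> finite T \<and> L d \<subseteq> lspan R T" for d
    using noeth L_mod[of d] unfolding noetherian_def L_def by (metis (no_types, lifting) mem_Collect_eq subsetI)
  then obtain T where T: "\<And>d. T d \<subseteq> L d" "\<And>d. finite (T d)" "\<And>d. L d \<subseteq> lspan R (T d)" by metis
  \<comment> \<open>From \<open>m\<close> on, the generators \<open>S\<close> of the whole union
    serve every degree; below \<open>m\<close> each degree keeps its own finite set. Hence the index
    \<open>min d m\<close> in \<open>span_T'\<close>.\<close>
  define T' where "T' d = (if d = m then S else T d)" for d
  have T': "T' d \<subseteq> L d" "finite (T' d)" for d using T m S unfolding T'_def by auto
  have span_T': "a \<in> lspan R (T' (min d m))" if "a \<in> L d" for a d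
    using that S(3) T(3)[of d] unfolding T'_def min_def by auto
  have "\<exists>b\<in>poly_below X M d. s * X ^ d + b \<in> N" if "s \<in> T' d" for s d
    using T'(1)[of d] that unfolding L_def by blast
  then obtain B where B: "\<And>s d. s \<in> T' d \<Longrightarrow> B s d \<in> poly_below X M d \<and> s * X ^ d + B s d \<in> N"
    by metis
  define G where "G = (\<Union>d\<in>{..m}. (\<lambda>s. s * X ^ d + B s d) ` T' d)"
  have G: "G \<subseteq> N" "finite G" using B T'(2) unfolding G_def by auto
  \<comment> \<open>Induction on the formal degree: a combination of the lifts in \<open>G\<close>
    with the same leading coefficient is subtracted, and the rest lies in \<open>N\<close> one
    degree lower.\<close>
  have "N \<inter> poly_below X M d \<subseteq> lspan R' G" for d
  proof (induction d)
    case 0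
    then show ?case by (auto intro: lspan_zero)
  next
    case (Suc d)
    show ?case
    proof
      fix f assume f: "f \<in> N \<inter> poly_below X M (Suc d)"
      then obtain a b where ab: "f = a * X ^ d + b" "a \<in> M" "b \<in> poly_below X M d" by auto
      then have "a \<in> L d" using f unfolding L_def by blast
      then have a: "a \<in> lspan R (T' (min d m))" by (rule span_T')
      have lift: "\<exists>b\<in>poly_below X M (min d m). s * X ^ min d m + b \<in> G" if "s \<in> T' (min d m)" for s
        using B[OF that] that unfolding G_def by (intro bexI[of _ "B s (min d m)"]) auto
      obtain c where c: "c \<in> poly_below X M d" "a * X ^ d + c \<in> lspan R' G \<inter> N"
        using lift_leading_coefficient[OF N(2) R'(2,3,1) M G(1) _ lift a, of d] by auto
      have "f - (a * X ^ d + c) \<in> N" using sub_mod_diff[OF R'(1) N(2)] f c by blast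
      moreover have "f - (a * X ^ d + c) = b - c" using ab by simp
      moreover have "b - c \<in> poly_below X M d"
        using sub_mod_diff[OF R poly_below_sub_mod[OF M]] ab c by blast
      ultimately have "f - (a * X ^ d + c) \<in> lspan R' G" using Suc by (metis IntI subsetD)
      then have "(f - (a * X ^ d + c)) + (a * X ^ d + c) \<in> lspan R' G"
        using c(2) by (blast intro: lspan_add)
      then show "f \<in> lspan R' G" by simp
    qed
  qed
  then have "N \<subseteq> lspan R' G" using N(1) unfolding adjoin_def by blast
  then show "\<exists>S\<subseteq>N. finite S \<and> N \<subseteq> lspan R' S" using G by blast
qed

section \<open>Finitely generated algebras over a field and their Noetherian modules\<close>

inductive_set alg_closure :: "'a::comm_ring_1 set \<Rightarrow> 'a set \<Rightarrow> 'a set" for C G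
  where
    alg_const: "c \<in> C \<Longrightarrow> c \<in> alg_closure C G"
  | alg_gen: "g \<in> G \<Longrightarrow> g \<in> alg_closure C G"
  | alg_add: "\<lbrakk>x \<in> alg_closure C G; y \<in> alg_closure C G\<rbrakk> \<Longrightarrow> x + y \<in> alg_closure C G"
  | alg_mult: "\<lbrakk>x \<in> alg_closure C G; y \<in> alg_closure C G\<rbrakk> \<Longrightarrow> x * y \<in> alg_closure C G"

lemma alg_closure_sub_ring: "sub_ring C \<Longrightarrow> sub_ring (alg_closure C G)"
  unfolding sub_ring_def by (auto intro: alg_closure.intros)

lemma alg_closure_empty:
  assumes "sub_ring C"
  shows "alg_closure C {} = C"
proof
  show "alg_closure C {} \<subseteq> C"
  proof
    fix x assume "x \<in> alg_closure C {}"
    then show "x \<in> C" by induction (use assms in \<open>auto simp: sub_ring_def\<close>)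
  qed
qed (auto intro: alg_const)

lemma alg_closure_mono: "x \<in> alg_closure C G \<Longrightarrow> G \<subseteq> G' \<Longrightarrow> x \<in> alg_closure C G'"
  by (induction rule: alg_closure.induct) (auto intro: alg_closure.intros)

text \<open>The scalars that preserve \<open>M\<close> are closed under sums and products, so
  constants and generators are enough to test.\<close>

lemma alg_closure_sub_mod:
  assumes "sub_mod (C \<union> G) M"
  shows "sub_mod (alg_closure C G) M"
proof -
  have "r * x \<in> M" if "r \<in> alg_closure C G" "x \<in> M" for r x
    using that
    by (induction arbitrary: x) (use assms in \<open>auto simp: sub_mod_def distrib_right mult.assoc\<close>)
  then show ?thesis using assms unfolding sub_mod_def by blast
qed

text \<open>One generator is adjoined at a time. \<open>M'\<close> stays existential because the
  application wants three facts of it: it contains \<open>M\<close>, it is a module over the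
  algebra, and it is Noetherian.\<close>

lemma noetherian_alg_closure:
  assumes C: "sub_ring C" and M: "sub_mod C M" "noetherian C M"
  shows "\<exists>M'. M \<subseteq> M' \<and> sub_mod (alg_closure C (X ` {..<m::nat})) M' \<and> noetherian (alg_closure C (X ` {..<m})) M'"
proof (induction m)
  case 0
  then show ?case using M alg_closure_empty[OF C] by auto
next
  case (Suc m)
  let ?R = "alg_closure C (X ` {..<m})" and ?R' = "alg_closure C (X ` {..<Suc m})"
  obtain M' where M': "M \<subseteq> M'" "sub_mod ?R M'" "noetherian ?R M'" using Suc by blast
  have sub: "?R \<subseteq> ?R'" by (auto intro: alg_closure_mono)
  have X: "X m \<in> ?R'" by (auto intro: alg_gen)
  have noeth: "noetherian ?R' (adjoin (X m) M')"
    using noetherian_adjoin[OF M'(3) alg_closure_sub_ring[OF C] M'(2) alg_closure_sub_ring[OF C] sub X] .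
  have "sub_mod (insert (X m) ?R) (adjoin (X m) M')" by (rule adjoin_sub_mod[OF M'(2)])
  moreover have "C \<union> X ` {..<Suc m} \<subseteq> insert (X m) ?R"
    by (auto simp: lessThan_Suc intro: alg_const alg_gen)
  ultimately have "sub_mod (C \<union> X ` {..<Suc m}) (adjoin (X m) M')"
    unfolding sub_mod_def by blast
  then have "sub_mod ?R' (adjoin (X m) M')" by (rule alg_closure_sub_mod)
  note noeth this
  moreover have "M \<subseteq> adjoin (X m) M'"
    using M'(1) subset_adjoin[of M' "X m"] M'(2) unfolding sub_mod_def by blast
  ultimately show ?case by (intro exI[of _ "adjoin (X m) M'"] conjI)
qed

text \<open>By \<open>inv\<close> the scalars form a field, so this is linear algebra, one vector at
  a time. The coordinate along \<open>e m\<close> need not be unique, since \<open>e m\<close> may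
  already lie in \<open>M\<close>.\<close>

lemma noetherian_finite_dimensional:
  assumes C: "sub_ring C" and inv: "\<And>c. c \<in> C \<Longrightarrow> c \<noteq> 0 \<Longrightarrow> \<exists>d\<in>C. d * c = 1"
  shows "\<exists>M. sub_mod C M \<and> noetherian C M \<and> (\<forall>i<m::nat. e i \<in> M)"
proof (induction m)
  case 0
  have "sub_mod C {0}" by (simp add: sub_mod_def)
  moreover have "noetherian C {0}"
    unfolding noetherian_def by (auto intro!: exI[of _ "{}"] simp: lspan_zero)
  ultimately show ?case by blast
next
  case (Suc m)
  then obtain M where M: "sub_mod C M" "noetherian C M" "\<forall>i<m. e i \<in> M" by blast
  define M' where "M' = {u + c * e m | u c. u \<in> M \<and> c \<in> C}"
  have z: "0 \<in> C" using C unfolding sub_ring_def by (metis add.right_inverse)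
  have "sub_mod C M'"
  proof -
    have "0 + 0 * e m \<in> M'" unfolding M'_def using z M(1) sub_mod_def by blast
    moreover have "x + y \<in> M'" if xy: "x \<in> M'" "y \<in> M'" for x y
    proof -
      obtain u c v d where *: "x = u + c * e m" "y = v + d * e m" "u \<in> M" "v \<in> M" "c \<in> C" "d \<in> C"
        using xy unfolding M'_def by blast
      have "x + y = (u + v) + (c + d) * e m" using * by (simp add: algebra_simps)
      moreover have "u + v \<in> M" "c + d \<in> C" using * C M(1) unfolding sub_ring_def sub_mod_def by auto
      ultimately show ?thesis unfolding M'_def by blast
    qed
    moreover have "r * x \<in> M'" if rx: "r \<in> C" "x \<in> M'" for r x
    proof -
      obtain u c where *: "x = u + c * e m" "u \<in> M" "c \<in> C" using rx unfolding M'_def by blast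
      have "r * x = r * u + (r * c) * e m" using * by (simp add: algebra_simps)
      moreover have "r * u \<in> M" "r * c \<in> C" using * rx C M(1) unfolding sub_ring_def sub_mod_def by auto
      ultimately show ?thesis unfolding M'_def by blast
    qed
    ultimately show ?thesis unfolding sub_mod_def by auto
  qed
  moreover have "noetherian C M'"
    unfolding noetherian_def
  proof (intro allI impI)
    fix N assume N: "N \<subseteq> M'" "sub_mod C N"
    show "\<exists>S\<subseteq>N. finite S \<and> N \<subseteq> lspan C S"
    proof (cases "N \<subseteq> M")
      case True
      then show ?thesis using M(2) N(2) unfolding noetherian_def by blast
    next
      case False
      then obtain v u c where v: "v \<in> N" "v \<notin> M" "v = u + c * e m" "u \<in> M" "c \<in> C"
        using N(1) unfolding M'_def by blast
      \<comment> \<open>Otherwise \<open>v = u\<close> would lie in \<open>M\<close>. As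
        \<open>c\<close> is invertible, a multiple of \<open>v\<close> removes the
        \<open>e m\<close> part of any element of \<open>N\<close>.\<close>
      then have "c \<noteq> 0" by auto
      then obtain d where d: "d \<in> C" "d * c = 1" using inv v by blast
      have "sub_mod C (N \<inter> M)" using N(2) M(1) unfolding sub_mod_def by blast
      then obtain S where S: "S \<subseteq> N \<inter> M" "finite S" "N \<inter> M \<subseteq> lspan C S"
        using M(2) unfolding noetherian_def by (meson inf_le2)
      have "w \<in> lspan C (insert v S)" if w: "w \<in> N" for w
      proof -
        obtain u' c' where *: "w = u' + c' * e m" "u' \<in> M" "c' \<in> C" using N(1) w unfolding M'_def by blast
        have cd: "c' * d \<in> C" using * d C unfolding sub_ring_def by blast
        then have "(c' * d) * v \<in> N" using v N(2) unfolding sub_mod_def by blast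
        then have 1: "w - (c' * d) * v \<in> N" using sub_mod_diff[OF C N(2)] w by blast
        have "w - (c' * d) * v = u' - (c' * d) * u + (c' - c' * (d * c)) * e m"
          using * v by (simp add: algebra_simps)
        also have "\<dots> = u' - (c' * d) * u" using d by simp
        also have "\<dots> \<in> M"
          using * cd v M(1) sub_mod_diff[OF C M(1)] unfolding sub_mod_def by blast
        finally have "w - (c' * d) * v \<in> lspan C (insert v S)"
          using 1 S(3) lspan_mono[of _ C S C "insert v S"] by blast
        from lspan_step[OF this cd, of v] show ?thesis by simp
      qed
      then show ?thesis using S v by (intro exI[of _ "insert v S"]) auto
    qed
  qed
  moreover have "e i \<in> M'" if "i < Suc m" for i
  proof (cases "i = m")
    case True
    have "0 + 1 * e m \<in> M'" unfolding M'_def using M(1) C sub_mod_def sub_ring_def by blast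
    then show ?thesis using True by simp
  next
    case False
    then have "e i + 0 * e m \<in> M'" unfolding M'_def using M(3) z that less_antisym by blast
    then show ?thesis by simp
  qed
  ultimately show ?case by blast
qed


section \<open>Homogeneous polynomial functions\<close>

lemma hpoly_monomial:
  assumes "(\<Sum>i\<le>n. \<alpha> i) = d"
  shows "(\<lambda>x. c * (\<Prod>i\<le>n. x i ^ \<alpha> i)) \<in> hpoly n d"
proof -
  let ?A = "{\<alpha> \<in> {..n} \<rightarrow>\<^sub>E {..d}. (\<Sum>i\<le>n. \<alpha> i) = d}"
  let ?\<beta> = "restrict \<alpha> {..n}"
  have fin: "finite ?A" by (rule finite_subset[OF _ finite_PiE[of "{..n}" "\<lambda>_. {..d}"]]) auto
  have "\<alpha> i \<le> d" if "i \<le> n" for i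
    using member_le_sum[of i "{..n}" \<alpha>] that assms by auto
  then have "?\<beta> \<in> ?A" using assms by auto
  then have "(\<Sum>\<gamma>\<in>?A. (if \<gamma> = ?\<beta> then c else 0) * (\<Prod>i\<le>n. x i ^ \<gamma> i)) = c * (\<Prod>i\<le>n. x i ^ \<alpha> i)" for x :: "nat \<Rightarrow> complex"
    using fin by (simp add: if_distrib[of "\<lambda>u. u * _"] cong: if_cong)
  then show ?thesis unfolding hpoly_def by (auto simp: fun_eq_iff intro!: exI[of _ "\<lambda>\<gamma>. if \<gamma> = ?\<beta> then c else 0"])
qed

lemma hpoly_add:
  assumes "f \<in> hpoly n d" "g \<in> hpoly n d"
  shows "(\<lambda>x. f x + g x) \<in> hpoly n d"
proof -
  let ?A = "{\<alpha> \<in> {..n} \<rightarrow>\<^sub>E {..d}. (\<Sum>i\<le>n. \<alpha> i) = d}"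
  obtain a b where "f = (\<lambda>x. \<Sum>\<alpha>\<in>?A. a \<alpha> * (\<Prod>i\<le>n. x i ^ \<alpha> i))" "g = (\<lambda>x. \<Sum>\<alpha>\<in>?A. b \<alpha> * (\<Prod>i\<le>n. x i ^ \<alpha> i))"
    using assms unfolding hpoly_def by blast
  then have "(\<lambda>x. f x + g x) = (\<lambda>x. \<Sum>\<alpha>\<in>?A. (a \<alpha> + b \<alpha>) * (\<Prod>i\<le>n. x i ^ \<alpha> i))"
    by (simp add: sum.distrib distrib_right)
  then show ?thesis unfolding hpoly_def by (auto intro: exI[of _ "\<lambda>\<alpha>. a \<alpha> + b \<alpha>"])
qed

lemma hpoly_zero: "(\<lambda>x. 0) \<in> hpoly n d"
  using hpoly_monomial[where n = n and \<alpha> = "\<lambda>i. if i = 0 then d else 0" and d = d and c = 0] by simp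

lemma hpoly_monomial_induct [consumes 1]:
  assumes "f \<in> hpoly n d"
    and mono: "\<And>c \<alpha>. (\<Sum>i\<le>n. \<alpha> i) = d \<Longrightarrow> P (\<lambda>x. c * (\<Prod>i\<le>n. x i ^ \<alpha> i))"
    and add: "\<And>f g. \<lbrakk>f \<in> hpoly n d; g \<in> hpoly n d; P f; P g\<rbrakk> \<Longrightarrow> P (\<lambda>x. f x + g x)"
  shows "P f"
proof -
  let ?A = "{\<alpha> \<in> {..n} \<rightarrow>\<^sub>E {..d}. (\<Sum>i\<le>n. \<alpha> i) = d}"
  obtain a where f: "f = (\<lambda>x. \<Sum>\<alpha>\<in>?A. a \<alpha> * (\<Prod>i\<le>n. x i ^ \<alpha> i))"
    using assms unfolding hpoly_def by blast
  have "finite ?A" by (rule finite_subset[OF _ finite_PiE[of "{..n}" "\<lambda>_. {..d}"]]) auto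
  moreover have "P (\<lambda>x. \<Sum>\<alpha>\<in>B. a \<alpha> * (\<Prod>i\<le>n. x i ^ \<alpha> i)) \<and> (\<lambda>x. \<Sum>\<alpha>\<in>B. a \<alpha> * (\<Prod>i\<le>n. x i ^ \<alpha> i)) \<in> hpoly n d"
    if "finite B" "B \<subseteq> ?A" for B
    using that
  proof (induction B rule: finite_induct)
    case empty
    then show ?case using mono[of "\<lambda>i. if i = 0 then d else 0" 0] hpoly_zero[of n d] by simp
  next
    case (insert \<alpha> B)
    then have "(\<Sum>i\<le>n. \<alpha> i) = d" by auto
    then show ?case using insert mono[of \<alpha> "a \<alpha>"] hpoly_monomial[where n = n and \<alpha> = \<alpha> and d = d and c = "a \<alpha>"]
      by (auto intro!: add hpoly_add)
  qed
  ultimately show ?thesis using f by blast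
qed

lemma hpoly_mult:
  assumes "f \<in> hpoly n d" "g \<in> hpoly n e"
  shows "(\<lambda>x. f x * g x) \<in> hpoly n (d + e)"
  using assms(1)
proof (induction rule: hpoly_monomial_induct)
  case (1 c \<alpha>)
  show ?case using assms(2)
  proof (induction rule: hpoly_monomial_induct)
    case (1 c' \<beta>)
    have "(\<lambda>x. c * (\<Prod>i\<le>n. x i ^ \<alpha> i) * (c' * (\<Prod>i\<le>n. x i ^ \<beta> i)))
      = (\<lambda>x. (c * c') * (\<Prod>i\<le>n. x i ^ (\<alpha> i + \<beta> i)))"
      by (simp add: power_add prod.distrib mult_ac)
    also have "\<dots> \<in> hpoly n (d + e)"
      by (rule hpoly_monomial) (use 1 \<open>sum \<alpha> {..n} = d\<close> in \<open>simp add: sum.distrib\<close>)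
    finally show ?case .
  next
    case (2 f g)
    then show ?case by (simp add: distrib_left hpoly_add)
  qed
next
  case (2 f g)
  then show ?case by (simp add: distrib_right hpoly_add)
qed

lemma hpoly_const: "(\<lambda>x. c) \<in> hpoly n 0"
  using hpoly_monomial[where n = n and \<alpha> = "\<lambda>_. 0" and d = 0 and c = c] by simp

lemma hpoly_var: "i \<le> n \<Longrightarrow> (\<lambda>x. x i) \<in> hpoly n 1"
  using hpoly_monomial[where n = n and \<alpha> = "\<lambda>j. if j = i then 1 else 0" and d = 1 and c = 1]
  by (simp add: if_distrib[of "\<lambda>u. _ ^ u"] cong: if_cong)

lemma hpoly_scale: "f \<in> hpoly n d \<Longrightarrow> (\<lambda>x. c * f x) \<in> hpoly n d"
  using hpoly_mult[OF hpoly_const[of c n], of f d] by simp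

lemma hpoly_diff: "f \<in> hpoly n d \<Longrightarrow> g \<in> hpoly n d \<Longrightarrow> (\<lambda>x. f x - g x) \<in> hpoly n d"
  using hpoly_add[OF _ hpoly_scale[of g n d "-1"], of f] by simp

text \<open>A monomial of positive degree contains a variable that can be split off. The degree is
  an argument of the predicate because it changes with each variable.\<close>

lemma hpoly_induct [consumes 1, case_names const var add]:
  assumes "f \<in> hpoly n d"
    and const: "\<And>c. P 0 (\<lambda>x. c)"
    and var: "\<And>i d g. \<lbrakk>i \<le> n; g \<in> hpoly n d; P d g\<rbrakk> \<Longrightarrow> P (Suc d) (\<lambda>x. x i * g x)"
    and add: "\<And>d f g. \<lbrakk>f \<in> hpoly n d; g \<in> hpoly n d; P d f; P d g\<rbrakk> \<Longrightarrow> P d (\<lambda>x. f x + g x)"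
  shows "P d f"
  using assms(1)
proof (induction rule: hpoly_monomial_induct)
  case (1 c \<alpha>)
  then show ?case
  proof (induction d arbitrary: \<alpha>)
    case 0
    then show ?case using const[of c] by simp
  next
    case (Suc d)
    then obtain i where i: "i \<le> n" "\<alpha> i \<noteq> 0"
      by (metis (no_types, lifting) atMost_iff nat.simps(3) sum.neutral)
    let ?\<beta> = "\<alpha>(i := \<alpha> i - 1)"
    have "sum \<alpha> {..n} = \<alpha> i + sum \<alpha> ({..n} - {i})" "sum ?\<beta> {..n} = ?\<beta> i + sum ?\<beta> ({..n} - {i})"
      using i by (simp_all only: sum.remove[of "{..n}" i] finite_atMost atMost_iff)
    moreover have "sum ?\<beta> ({..n} - {i}) = sum \<alpha> ({..n} - {i})" by (intro sum.cong) auto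
    ultimately have \<beta>: "sum ?\<beta> {..n} = d" using Suc.prems i by simp
    have "(\<Prod>j\<le>n. x j ^ \<alpha> j) = x i * (\<Prod>j\<le>n. x j ^ ?\<beta> j)" for x :: "nat \<Rightarrow> complex"
    proof -
      have "(\<Prod>j\<le>n. x j ^ \<alpha> j) = x i ^ \<alpha> i * (\<Prod>j\<in>{..n} - {i}. x j ^ \<alpha> j)"
        "(\<Prod>j\<le>n. x j ^ ?\<beta> j) = x i ^ ?\<beta> i * (\<Prod>j\<in>{..n} - {i}. x j ^ ?\<beta> j)"
        using i by (simp_all only: prod.remove[of "{..n}" i] finite_atMost atMost_iff)
      moreover have "(\<Prod>j\<in>{..n} - {i}. x j ^ ?\<beta> j) = (\<Prod>j\<in>{..n} - {i}. x j ^ \<alpha> j)"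
        by (intro prod.cong) auto
      moreover have "x i ^ \<alpha> i = x i * x i ^ ?\<beta> i" using i by (simp flip: power_Suc)
      ultimately show ?thesis by simp
    qed
    then have "(\<lambda>x. c * (\<Prod>j\<le>n. x j ^ \<alpha> j)) = (\<lambda>x :: nat \<Rightarrow> complex. x i * (c * (\<Prod>j\<le>n. x j ^ ?\<beta> j)))"
      by (auto simp: fun_eq_iff)
    then show ?case using var[OF i(1) hpoly_monomial[OF \<beta>] Suc.IH[OF \<beta>]] by simp
  qed
next
  case (2 f g)
  then show ?case by (intro add)
qed

lemma hpoly_homogeneous: "f \<in> hpoly n d \<Longrightarrow> f (\<lambda>i. c * x i) = c ^ d * f x"
  by (induction rule: hpoly_induct) (auto simp: algebra_simps)

text \<open>On a line, nonvanishing of a form becomes nonvanishing of a polynomial in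
  \<open>t\<close>, which has finitely many roots; irreducibility of projective space comes from
  this.\<close>

lemma hpoly_line:
  "f \<in> hpoly n d \<Longrightarrow> \<exists>p. \<forall>t. f (\<lambda>i. x i + t * (y i - x i)) = poly p t"
proof (induction rule: hpoly_induct)
  case (const c)
  show ?case by (intro exI[of _ "[:c:]"]) simp
next
  case (var i d g)
  then obtain p where "\<forall>t. g (\<lambda>i. x i + t * (y i - x i)) = poly p t" by blast
  then show ?case by (intro exI[of _ "[:x i, y i - x i:] * p"]) (simp add: algebra_simps)
next
  case (add d f g)
  then obtain p q where "\<forall>t. f (\<lambda>i. x i + t * (y i - x i)) = poly p t"
    "\<forall>t. g (\<lambda>i. x i + t * (y i - x i)) = poly q t" by blast
  then show ?case by (intro exI[of _ "p + q"]) simp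
qed

text \<open>The derivative has degree \<open>d - 1\<close>, which is no natural number for
  constants. Speaking only of its product with a form of degree \<open>Suc e\<close> treats all
  degrees alike, and it is the form in which coefficients of degree 1 meet derivatives.\<close>

lemma hpoly_derivative:
  "f \<in> hpoly n d \<Longrightarrow> \<exists>f'. (\<forall>x. ((\<lambda>t. f (x(j := t))) has_field_derivative f' x) (at (x j))) \<and>
    (\<forall>e. \<forall>a\<in>hpoly n (Suc e). (\<lambda>x. a x * f' x) \<in> hpoly n (e + d))"
proof (induction rule: hpoly_induct)
  case (const c)
  show ?case by (intro exI[of _ "\<lambda>_. 0"]) (auto simp: hpoly_zero)
next
  case (var i d g)
  then obtain g' where g': "\<And>x. ((\<lambda>t. g (x(j := t))) has_field_derivative g' x) (at (x j))"
    "\<And>e a. a \<in> hpoly n (Suc e) \<Longrightarrow> (\<lambda>x. a x * g' x) \<in> hpoly n (e + d)" by blast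
  define f' where "f' x = (if i = j then 1 else 0) * g x + x i * g' x" for x
  have "((\<lambda>t. (x(j := t)) i * g (x(j := t))) has_field_derivative f' x) (at (x j))" for x
  proof -
    have "((\<lambda>t. (x(j := t)) i) has_field_derivative (if i = j then 1 else 0)) (at (x j))" by simp
    from DERIV_mult[OF this g'(1)[of x]] show ?thesis by (simp add: f'_def algebra_simps)
  qed
  moreover have "(\<lambda>x. a x * f' x) \<in> hpoly n (e + Suc d)" if a: "a \<in> hpoly n (Suc e)" for e a
  proof -
    have "(\<lambda>x. (if i = j then 1 else 0) * (a x * g x)) \<in> hpoly n (Suc e + d)"
      by (intro hpoly_scale hpoly_mult a var)
    moreover have "(\<lambda>x. x i * (a x * g' x)) \<in> hpoly n (1 + (e + d))"
      using var by (intro hpoly_mult[OF hpoly_var] g' a)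
    ultimately have "(\<lambda>x. (if i = j then 1 else 0) * (a x * g x) + x i * (a x * g' x)) \<in> hpoly n (e + Suc d)"
      using hpoly_add by fastforce
    then show ?thesis unfolding f'_def by (simp add: algebra_simps)
  qed
  ultimately show ?case by blast
next
  case (add d f g)
  then obtain f' where f': "\<And>x. ((\<lambda>t. f (x(j := t))) has_field_derivative f' x) (at (x j))"
    "\<And>e a. a \<in> hpoly n (Suc e) \<Longrightarrow> (\<lambda>x. a x * f' x) \<in> hpoly n (e + d)" by blast
  obtain g' where g': "\<And>x. ((\<lambda>t. g (x(j := t))) has_field_derivative g' x) (at (x j))"
    "\<And>e a. a \<in> hpoly n (Suc e) \<Longrightarrow> (\<lambda>x. a x * g' x) \<in> hpoly n (e + d)" using add by blast
  show ?case
    by (intro exI[of _ "\<lambda>x. f' x + g' x"])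
      (auto simp: distrib_left simp del: fun_upd_apply intro!: DERIV_add f' g' hpoly_add)
qed

text \<open>Splitting off \<open>x k\<close> lowers the degree and the factor \<open>x l\<close>
  restores it. So the quotient is again a form of degree \<open>d\<close>, constants included, and
  over a denominator of degree \<open>d\<close> the factor split off is the function
  \<open>x k / x l\<close> of degree 0.\<close>

lemma hpoly_restrict_hyperplane:
  assumes "l \<le> n"
  shows "f \<in> hpoly n d \<Longrightarrow> \<exists>q\<in>hpoly n d. \<forall>x. x l * (f x - f (x(k := 0))) = x k * q x"
proof (induction rule: hpoly_induct)
  case (const c)
  show ?case by (intro bexI[of _ "\<lambda>_. 0"]) (auto simp: hpoly_zero)
next
  case (var i d g)
  show ?case
  proof (cases "i = k")
    case True
    have "(\<lambda>x. x l * g x) \<in> hpoly n (1 + d)" by (intro hpoly_mult hpoly_var assms var)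
    then show ?thesis using True by (intro bexI[of _ "\<lambda>x. x l * g x"]) auto
  next
    case False
    obtain q where q: "q \<in> hpoly n d" "\<And>x. x l * (g x - g (x(k := 0))) = x k * q x" using var by blast
    have "(\<lambda>x. x i * q x) \<in> hpoly n (1 + d)" by (intro hpoly_mult hpoly_var var q)
    moreover have "x l * (x i * g x - x i * g (x(k := 0))) = x k * (x i * q x)" for x
    proof -
      have "x l * (x i * g x - x i * g (x(k := 0))) = x i * (x l * (g x - g (x(k := 0))))"
        by (simp add: algebra_simps)
      then show ?thesis using q(2)[of x] by simp
    qed
    ultimately show ?thesis using False by (intro bexI[of _ "\<lambda>x. x i * q x"]) (simp_all add: fun_upd_def)
  qed
next
  case (add d f g)
  then obtain q where q: "q \<in> hpoly n d" "\<And>x. x l * (f x - f (x(k := 0))) = x k * q x" by blast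
  obtain r where r: "r \<in> hpoly n d" "\<And>x. x l * (g x - g (x(k := 0))) = x k * r x" using add by blast
  have "x l * (f x + g x - (f (x(k := 0)) + g (x(k := 0)))) = x k * (q x + r x)" for x
    using q(2)[of x] r(2)[of x] by (simp add: algebra_simps)
  then show ?case using q r by (intro bexI[of _ "\<lambda>x. q x + r x"]) (simp_all add: hpoly_add fun_upd_def)
qed


section \<open>Open sets and their cones\<close>

definition vecs :: "nat \<Rightarrow> (nat \<Rightarrow> complex) set"
  where "vecs n = {x. (\<forall>i>n. x i = 0) \<and> (\<exists>i\<le>n. x i \<noteq> 0)}"

lemma PP_vecs: "PP n = hclass ` vecs n"
  by (simp add: PP_def vecs_def)

lemma mem_hclass: "x \<in> hclass x"
  unfolding hclass_def by (auto intro: exI[of _ 1])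

lemma hclass_scale:
  assumes "c \<noteq> 0"
  shows "hclass (\<lambda>i. c * x i) = hclass x"
proof
  show "hclass (\<lambda>i. c * x i) \<subseteq> hclass x"
    using assms unfolding hclass_def by (auto intro: exI[of _ "_ * c"] simp: mult.assoc)
  show "hclass x \<subseteq> hclass (\<lambda>i. c * x i)"
  proof
    fix y assume "y \<in> hclass x"
    then obtain a where "a \<noteq> 0" "y = (\<lambda>i. a * x i)" unfolding hclass_def by blast
    then have "y = (\<lambda>i. (a / c) * (c * x i))" "a / c \<noteq> 0" using assms by auto
    then show "y \<in> hclass (\<lambda>i. c * x i)" unfolding hclass_def by blast
  qed
qed

lemma hclass_eq:
  assumes "y \<in> hclass x"
  shows "hclass y = hclass x"
proof -
  obtain c where "c \<noteq> 0" "y = (\<lambda>i. c * x i)" using assms by (auto simp: hclass_def)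
  then show ?thesis using hclass_scale by simp
qed

lemma mem_PP:
  assumes "p \<in> PP n" "x \<in> p"
  shows "x \<in> vecs n" "hclass x = p"
proof -
  obtain y where y: "y \<in> vecs n" "p = hclass y" using assms by (auto simp: PP_vecs)
  then obtain c where "c \<noteq> 0" "x = (\<lambda>i. c * y i)" using assms unfolding hclass_def by blast
  then show "x \<in> vecs n" using y by (auto simp: vecs_def)
  show "hclass x = p" using hclass_eq assms y by blast
qed

lemma PP_obtain:
  assumes "p \<in> PP n"
  obtains x where "x \<in> vecs n" "p = hclass x"
  using assms by (auto simp: PP_vecs)

lemma opens_subset: "U \<in> opens n \<Longrightarrow> U \<subseteq> PP n"
  by (auto simp: opens_def)

text \<open>Points are classes of vectors, so the cone over \<open>U\<close> without its vertex is
  the union \<open>\<Union>U\<close>; this is the passage between sets of points and sets of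
  vectors.\<close>

lemma mem_cone: "U \<in> opens n \<Longrightarrow> x \<in> \<Union>U \<longleftrightarrow> x \<in> vecs n \<and> hclass x \<in> U"
  using mem_PP[of _ n x] opens_subset[of U n] mem_hclass[of x] by blast

lemma cone_scale:
  assumes "U \<in> opens n" "x \<in> \<Union>U" "c \<noteq> 0"
  shows "(\<lambda>i. c * x i) \<in> \<Union>U"
proof -
  have "x \<in> vecs n" "hclass (\<lambda>i. c * x i) \<in> U"
    using assms mem_cone[OF assms(1)] hclass_scale by auto
  then show ?thesis unfolding mem_cone[OF assms(1)] using assms(3) by (auto simp: vecs_def)
qed

definition basic_open :: "nat \<Rightarrow> ((nat \<Rightarrow> complex) \<Rightarrow> complex) \<Rightarrow> pt set"
  where "basic_open n h = hclass ` {x \<in> vecs n. h x \<noteq> 0}"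

lemma mem_basic_open:
  assumes "h \<in> hpoly n d" "x \<in> vecs n"
  shows "hclass x \<in> basic_open n h \<longleftrightarrow> h x \<noteq> 0"
proof
  assume "hclass x \<in> basic_open n h"
  then obtain y where "h y \<noteq> 0" "hclass x = hclass y" by (auto simp: basic_open_def)
  then have "x \<in> hclass y" using mem_hclass[of x] by simp
  then obtain c where "c \<noteq> 0" "x = (\<lambda>i. c * y i)" by (auto simp: hclass_def)
  then show "h x \<noteq> 0" using hpoly_homogeneous[OF assms(1), of c y] \<open>h y \<noteq> 0\<close> by simp
qed (use assms in \<open>auto simp: basic_open_def\<close>)

text \<open>Principal open sets form a basis. Openness becomes a condition at each point with a
  single form \<open>h\<close>, which suits unions, intersections and the choice of
  neighbourhoods.\<close>

lemma opens_iff: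
  "U \<in> opens n \<longleftrightarrow> U \<subseteq> PP n \<and>
    (\<forall>x\<in>vecs n. hclass x \<in> U \<longrightarrow> (\<exists>d. \<exists>h\<in>hpoly n d. h x \<noteq> 0 \<and> basic_open n h \<subseteq> U))" (is "?L \<longleftrightarrow> ?R")
proof
  assume ?L
  then obtain S where S: "U = PP n - vanishing n S" "S \<subseteq> (\<Union>d. hpoly n d)" by (auto simp: opens_def)
  have "\<exists>d. \<exists>h\<in>hpoly n d. h x \<noteq> 0 \<and> basic_open n h \<subseteq> U" if x: "x \<in> vecs n" "hclass x \<in> U" for x
  proof -
    obtain f y where f: "f \<in> S" "y \<in> hclass x" "f y \<noteq> 0" using x S by (auto simp: vanishing_def)
    obtain d where d: "f \<in> hpoly n d" using f S by blast
    have "hclass x \<in> PP n" using x PP_vecs by blast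
    note y = mem_PP[OF this f(2)]
    then have "f x \<noteq> 0" using mem_basic_open[OF d] x f by metis
    moreover have "basic_open n f \<subseteq> U"
    proof
      fix p assume "p \<in> basic_open n f"
      then obtain z where "z \<in> vecs n" "p = hclass z" "f z \<noteq> 0" by (auto simp: basic_open_def)
      then show "p \<in> U" using f(1) mem_hclass[of z] unfolding S(1) vanishing_def PP_vecs by blast
    qed
    ultimately show ?thesis using d by blast
  qed
  then show ?R using S by blast
next
  assume R: ?R
  \<comment> \<open>The largest possible system of equations: all forms whose nonvanishing locus
    lies in \<open>U\<close>.\<close>
  let ?S = "{h. \<exists>d. h \<in> hpoly n d \<and> basic_open n h \<subseteq> U}"
  have "PP n - vanishing n ?S = U"
  proof
    show "PP n - vanishing n ?S \<subseteq> U"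
    proof
      fix p assume p: "p \<in> PP n - vanishing n ?S"
      then obtain h d x where "h \<in> hpoly n d" "basic_open n h \<subseteq> U" "x \<in> p" "h x \<noteq> 0"
        by (auto simp: vanishing_def)
      moreover have "x \<in> vecs n" "hclass x = p" using mem_PP[of p n x] p \<open>x \<in> p\<close> by blast+
      ultimately show "p \<in> U" unfolding basic_open_def by blast
    qed
    show "U \<subseteq> PP n - vanishing n ?S"
    proof
      fix p assume p: "p \<in> U"
      then have pP: "p \<in> PP n" using R by blast
      then obtain x where x: "x \<in> vecs n" "p = hclass x" by (rule PP_obtain)
      then obtain d h where "h \<in> hpoly n d" "h x \<noteq> 0" "basic_open n h \<subseteq> U" using R p by blast
      then have "h \<in> ?S" "x \<in> p" "h x \<noteq> 0" using mem_hclass x by auto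
      then show "p \<in> PP n - vanishing n ?S" using pP unfolding vanishing_def by blast
    qed
  qed
  then show ?L unfolding opens_def by blast
qed

lemma opensE:
  assumes "U \<in> opens n" "x \<in> \<Union>U"
  obtains d h where "h \<in> hpoly n d" "h x \<noteq> 0" "basic_open n h \<subseteq> U"
proof -
  have "x \<in> vecs n" "hclass x \<in> U" using assms mem_cone by blast+
  then show ?thesis using that assms(1) unfolding opens_iff by blast
qed

lemma basic_open_opens:
  assumes "h \<in> hpoly n d"
  shows "basic_open n h \<in> opens n"
proof -
  have "basic_open n h \<subseteq> PP n" by (auto simp: basic_open_def PP_vecs)
  then show ?thesis using mem_basic_open[OF assms] assms unfolding opens_iff by blast
qed

lemma opens_PP: "PP n \<in> opens n"
proof -
  have "basic_open n (\<lambda>x. 1) = PP n" by (auto simp: basic_open_def PP_vecs)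
  then show ?thesis using basic_open_opens[OF hpoly_const[of 1 n]] by simp
qed

lemma opens_Union: "\<U> \<subseteq> opens n \<Longrightarrow> \<Union>\<U> \<in> opens n"
  unfolding opens_iff subset_iff[of \<U>] by (meson Sup_least Sup_upper Union_iff order_trans)

lemma opens_Int:
  assumes "U \<in> opens n" "V \<in> opens n"
  shows "U \<inter> V \<in> opens n"
proof -
  have "\<exists>d. \<exists>h\<in>hpoly n d. h x \<noteq> 0 \<and> basic_open n h \<subseteq> U \<inter> V"
    if x: "x \<in> vecs n" "hclass x \<in> U \<inter> V" for x
  proof -
    obtain d g where g: "g \<in> hpoly n d" "g x \<noteq> 0" "basic_open n g \<subseteq> U" using assms x opens_iff by blast
    obtain e h where h: "h \<in> hpoly n e" "h x \<noteq> 0" "basic_open n h \<subseteq> V" using assms x opens_iff by blast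
    have "basic_open n (\<lambda>x. g x * h x) \<subseteq> basic_open n g \<inter> basic_open n h" by (auto simp: basic_open_def)
    then show ?thesis using hpoly_mult[OF g(1) h(1)] g h by (intro exI bexI[of _ "\<lambda>x. g x * h x"]) auto
  qed
  then show ?thesis using assms opens_subset by (subst opens_iff) blast
qed

lemma opens_in_trans: "W \<in> opens_in n V \<Longrightarrow> V \<in> opens_in n U \<Longrightarrow> W \<in> opens_in n U"
  by (auto simp: opens_in_def)

lemma opens_in_refl: "U \<in> opens n \<Longrightarrow> U \<in> opens_in n U"
  by (auto simp: opens_in_def)

text \<open>On the line from \<open>x\<close> to \<open>y\<close>, the polynomials of
  \<open>h\<close> and of one nonzero coordinate of \<open>x\<close> are nonzero at parameter 0 and
  that of \<open>g\<close> at parameter 1, so their product has finitely many roots. The coordinate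
  factor keeps the point away from the origin. The vector \<open>y\<close> may be zero, as can
  happen in \<open>lquot_divide_hyperplane\<close>.\<close>

lemma hpoly_line_nonzero:
  assumes "g \<in> hpoly n d" "h \<in> hpoly n e" "x \<in> vecs n" "\<And>i. i > n \<Longrightarrow> y i = 0" "h x \<noteq> 0" "g y \<noteq> 0"
  obtains t where "g (\<lambda>i. x i + t * (y i - x i)) \<noteq> 0" "h (\<lambda>i. x i + t * (y i - x i)) \<noteq> 0"
    "(\<lambda>i. x i + t * (y i - x i)) \<in> vecs n"
proof -
  obtain p where p: "\<And>t. g (\<lambda>i. x i + t * (y i - x i)) = poly p t" using hpoly_line[OF assms(1)] by blast
  obtain q where q: "\<And>t. h (\<lambda>i. x i + t * (y i - x i)) = poly q t" using hpoly_line[OF assms(2)] by blast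
  obtain l where l: "l \<le> n" "x l \<noteq> 0" using assms(3) by (auto simp: vecs_def)
  let ?r = "[:x l, y l - x l:]"
  have "p \<noteq> 0" using p[of 1] assms(6) by auto
  moreover have "q \<noteq> 0" using q[of 0] assms(5) by auto
  moreover have "?r \<noteq> 0" using l by simp
  ultimately have "p * q * ?r \<noteq> 0" by (metis mult_eq_0_iff)
  then have "finite {t. poly (p * q * ?r) t = 0}" by (rule poly_roots_finite)
  then obtain t where "poly (p * q * ?r) t \<noteq> 0"
    using infinite_UNIV_char_0[where 'a=complex] by (metis (mono_tags, lifting) UNIV_I finite_subset mem_Collect_eq subsetI)
  then have "poly p t * poly q t * poly ?r t \<noteq> 0" by (simp only: poly_mult not_False_eq_True)
  then have "poly p t \<noteq> 0" "poly q t \<noteq> 0" "x l + t * (y l - x l) \<noteq> 0" by auto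
  moreover have "x i + t * (y i - x i) = 0" if "i > n" for i
    using assms(3,4) that by (simp add: vecs_def)
  ultimately show ?thesis using that p q l by (auto simp: vecs_def)
qed

text \<open>A general point of the line joining \<open>x\<close> and \<open>y\<close> lies in both
  sets. This irreducibility carries the identity principle, torsion-freeness and the uniqueness of
  the rank.\<close>

lemma opens_irreducible:
  assumes "U \<in> opens n" "V \<in> opens n" "x \<in> \<Union>U" "y \<in> \<Union>V"
  obtains z where "z \<in> \<Union>U" "z \<in> \<Union>V"
proof -
  obtain d g where g: "g \<in> hpoly n d" "g x \<noteq> 0" "basic_open n g \<subseteq> U" using opensE[OF assms(1,3)] .
  obtain e h where h: "h \<in> hpoly n e" "h y \<noteq> 0" "basic_open n h \<subseteq> V" using opensE[OF assms(2,4)] .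
  have xy: "x \<in> vecs n" "y \<in> vecs n" using assms mem_cone by blast+
  have "y i = 0" if "i > n" for i using xy(2) that by (simp add: vecs_def)
  from hpoly_line_nonzero[OF h(1) g(1) xy(1) this g(2) h(2)] obtain z where
    "h z \<noteq> 0" "g z \<noteq> 0" "z \<in> vecs n" by metis
  then have "z \<in> \<Union>U" "z \<in> \<Union>V" using mem_cone[OF assms(1)] mem_cone[OF assms(2)] mem_basic_open g h by blast+
  then show ?thesis using that by blast
qed

lemma opens_Int_nonempty:
  assumes "U \<in> opens n" "V \<in> opens n" "U \<noteq> {}" "V \<noteq> {}"
  shows "U \<inter> V \<noteq> {}"
proof -
  obtain p q where "p \<in> U" "q \<in> V" using assms by blast
  then obtain x y where "x \<in> \<Union>U" "y \<in> \<Union>V" using assms opens_subset by (metis PP_obtain UnionI mem_hclass subsetD)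
  then obtain z where "z \<in> \<Union>U" "z \<in> \<Union>V" using opens_irreducible[OF assms(1,2)] by metis
  then show ?thesis using mem_cone assms by blast
qed

text \<open>Derivatives are limits in the classical topology, while functions are known on Zariski
  open sets only. Forms are continuous along coordinate lines, so a small change of one coordinate
  stays in the cone.\<close>

lemma eventually_cone:
  assumes "V \<in> opens n" "x \<in> \<Union>V" "j \<le> n"
  shows "\<forall>\<^sub>F t in nhds (x j). x(j := t) \<in> \<Union>V"
proof -
  obtain d h where h: "h \<in> hpoly n d" "h x \<noteq> 0" "basic_open n h \<subseteq> V" using opensE[OF assms(1,2)] .
  have xv: "x \<in> vecs n" using assms mem_cone by blast
  obtain l where l: "l \<le> n" "x l \<noteq> 0" using xv by (auto simp: vecs_def)
  have *: "\<forall>\<^sub>F t in nhds (x j). f (x(j := t)) \<noteq> 0" if f: "f \<in> hpoly n e" "f x \<noteq> 0" for f e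
  proof -
    obtain f' where "((\<lambda>t. f (x(j := t))) has_field_derivative f') (at (x j))"
      using hpoly_derivative[OF f(1), of j] by metis
    then have "isCont (\<lambda>t. f (x(j := t))) (x j)" by (rule DERIV_isCont)
    then have "((\<lambda>t. f (x(j := t))) \<longlongrightarrow> f x) (nhds (x j))" by (simp add: continuous_at filterlim_at_within_not_equal tendsto_nhds_iff)
    then show ?thesis using f(2) by (rule tendsto_imp_eventually_ne)
  qed
  \<comment> \<open>The coordinate \<open>l\<close> is watched together with \<open>h\<close>, since
    the moved vector must also stay nonzero.\<close>
  show ?thesis using *[OF h(1,2)] *[OF hpoly_var[OF l(1)] l(2)]
  proof eventually_elim
    case (elim t)
    have "(x(j := t)) i = 0" if "i > n" for i using that xv assms(3) by (simp add: vecs_def)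
    then have "x(j := t) \<in> vecs n" using elim(2) l(1) unfolding vecs_def by blast
    then show ?case using elim h mem_basic_open[OF h(1)] mem_cone[OF assms(1)] by blast
  qed
qed


section \<open>Quotients of homogeneous polynomials\<close>

definition quot_on :: "nat \<Rightarrow> int \<Rightarrow> pt set \<Rightarrow> ((nat \<Rightarrow> complex) \<Rightarrow> complex) \<Rightarrow> bool"
  where "quot_on n d V s \<longleftrightarrow> (\<exists>a b. int a - int b = d \<and>
    (\<exists>g\<in>hpoly n a. \<exists>h\<in>hpoly n b. \<forall>x\<in>\<Union>V. h x \<noteq> 0 \<and> s x = g x / h x))"

text \<open>These are the sections of O(d) over \<open>U\<close>, without a convention on values
  outside the cone. Degree 0 describes regular functions and degree 1 the coefficients of vector
  fields, so that one calculus serves both.\<close>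

definition lquot :: "nat \<Rightarrow> int \<Rightarrow> pt set \<Rightarrow> ((nat \<Rightarrow> complex) \<Rightarrow> complex) \<Rightarrow> bool"
  where "lquot n d U s \<longleftrightarrow> (\<forall>p\<in>U. \<exists>V\<in>opens_in n U. p \<in> V \<and> quot_on n d V s)"

lemma quot_onE:
  assumes "quot_on n d V s"
  obtains a b g h where "int a - int b = d" "g \<in> hpoly n a" "h \<in> hpoly n b"
    "\<forall>x\<in>\<Union>V. h x \<noteq> 0 \<and> s x = g x / h x"
  using assms unfolding quot_on_def by (elim exE conjE bexE) blast

lemma lquotE:
  assumes "lquot n d U s" "p \<in> U"
  obtains V a b g h where "V \<in> opens_in n U" "p \<in> V" "int a - int b = d" "g \<in> hpoly n a" "h \<in> hpoly n b"
    "\<forall>x\<in>\<Union>V. h x \<noteq> 0 \<and> s x = g x / h x"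
proof -
  obtain V where V: "V \<in> opens_in n U" "p \<in> V" "quot_on n d V s"
    using assms unfolding lquot_def by blast
  from V(3) show ?thesis by (rule quot_onE) (rule that[OF V(1,2)])
qed

lemma quot_on_mono:
  assumes "quot_on n d V s" "W \<subseteq> V"
  shows "quot_on n d W s"
  using assms(1)
proof (rule quot_onE)
  fix a b g h
  assume *: "int a - int b = d" "g \<in> hpoly n a" "h \<in> hpoly n b" "\<forall>x\<in>\<Union>V. h x \<noteq> 0 \<and> s x = g x / h x"
  then have "\<forall>x\<in>\<Union>W. h x \<noteq> 0 \<and> s x = g x / h x" using assms(2) by blast
  then show ?thesis unfolding quot_on_def using *(1-3) by blast
qed

lemma quot_on_cong: "quot_on n d V s \<Longrightarrow> (\<And>x. x \<in> \<Union>V \<Longrightarrow> s x = t x) \<Longrightarrow> quot_on n d V t"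
  unfolding quot_on_def by (metis (no_types, lifting))

lemma lquot_global:
  assumes "U \<in> opens n" "int a - int b = d" "g \<in> hpoly n a" "h \<in> hpoly n b"
    "\<And>x. x \<in> \<Union>U \<Longrightarrow> h x \<noteq> 0 \<and> s x = g x / h x"
  shows "lquot n d U s"
proof -
  have "quot_on n d U s" unfolding quot_on_def using assms(2-5) by blast
  then show ?thesis using opens_in_refl[OF assms(1)] unfolding lquot_def by blast
qed

lemma lquot_local:
  assumes "\<And>p. p \<in> U \<Longrightarrow> \<exists>V\<in>opens_in n U. p \<in> V \<and> lquot n d V s"
  shows "lquot n d U s"
  using assms opens_in_trans unfolding lquot_def by meson

lemma lquot_restrict:
  assumes "lquot n d U s" "V \<in> opens_in n U"
  shows "lquot n d V s"
  unfolding lquot_def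
proof
  fix p assume p: "p \<in> V"
  then have "p \<in> U" using assms by (auto simp: opens_in_def)
  then obtain W where W: "W \<in> opens_in n U" "p \<in> W" "quot_on n d W s"
    using assms(1) unfolding lquot_def by blast
  have "V \<inter> W \<in> opens_in n V" using W(1) assms(2) opens_Int by (auto simp: opens_in_def)
  then show "\<exists>V\<in>opens_in n V. p \<in> V \<and> quot_on n d V s"
    using p W quot_on_mono[OF W(3), of "V \<inter> W"] by blast
qed

lemma lquot_cong:
  assumes "lquot n d U s" "\<And>x. x \<in> \<Union>U \<Longrightarrow> s x = t x"
  shows "lquot n d U t"
  unfolding lquot_def
proof
  fix p assume "p \<in> U"
  then obtain W where W: "W \<in> opens_in n U" "p \<in> W" "quot_on n d W s"
    using assms(1) unfolding lquot_def by blast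
  have "quot_on n d W t" by (rule quot_on_cong[OF W(3)]) (use assms(2) W(1) in \<open>auto simp: opens_in_def\<close>)
  then show "\<exists>V\<in>opens_in n U. p \<in> V \<and> quot_on n d V t" using W by blast
qed

text \<open>The representations of \<open>s\<close> and \<open>t\<close> as quotients live on
  different neighbourhoods; on the intersection both hold, and there the combination has to be
  represented.\<close>

lemma lquot_combine:
  assumes "lquot n d U s" "lquot n e U t"
    and step: "\<And>V a b g h a' b' g' h'. \<lbrakk>V \<in> opens n; V \<subseteq> U; int a - int b = d; g \<in> hpoly n a; h \<in> hpoly n b;
      int a' - int b' = e; g' \<in> hpoly n a'; h' \<in> hpoly n b';
      \<And>x. x \<in> \<Union>V \<Longrightarrow> h x \<noteq> 0 \<and> s x = g x / h x; \<And>x. x \<in> \<Union>V \<Longrightarrow> h' x \<noteq> 0 \<and> t x = g' x / h' x\<rbrakk>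
      \<Longrightarrow> lquot n k V u"
  shows "lquot n k U u"
proof (rule lquot_local)
  fix p assume p: "p \<in> U"
  with assms(1) obtain V a b g h where V: "V \<in> opens_in n U" "p \<in> V" "int a - int b = d" "g \<in> hpoly n a"
    "h \<in> hpoly n b" "\<forall>x\<in>\<Union>V. h x \<noteq> 0 \<and> s x = g x / h x" by (rule lquotE)
  from assms(2) p obtain W a' b' g' h' where W: "W \<in> opens_in n U" "p \<in> W" "int a' - int b' = e" "g' \<in> hpoly n a'"
    "h' \<in> hpoly n b'" "\<forall>x\<in>\<Union>W. h' x \<noteq> 0 \<and> t x = g' x / h' x" by (rule lquotE)
  have VW: "V \<inter> W \<in> opens n" "V \<inter> W \<subseteq> U" using V(1) W(1) opens_Int by (auto simp: opens_in_def)
  have "lquot n k (V \<inter> W) u"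
    by (rule step[OF VW V(3-5) W(3-5)]) (use V(6) W(6) in blast)+
  then show "\<exists>V\<in>opens_in n U. p \<in> V \<and> lquot n k V u"
    using VW V(2) W(2) by (intro bexI[of _ "V \<inter> W"]) (auto simp: opens_in_def)
qed

lemma lquot_mult:
  assumes "lquot n d U s" "lquot n e U t"
  shows "lquot n (d + e) U (\<lambda>x. s x * t x)"
proof (rule lquot_combine[OF assms])
  fix V a b g h a' b' g' h'
  assume *: "V \<in> opens n" "int a - int b = d" "g \<in> hpoly n a" "h \<in> hpoly n b"
      "int a' - int b' = e" "g' \<in> hpoly n a'" "h' \<in> hpoly n b'"
      "\<And>x. x \<in> \<Union>V \<Longrightarrow> h x \<noteq> 0 \<and> s x = g x / h x" "\<And>x. x \<in> \<Union>V \<Longrightarrow> h' x \<noteq> 0 \<and> t x = g' x / h' x"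
  show "lquot n (d + e) V (\<lambda>x. s x * t x)"
    by (rule lquot_global[OF *(1) _ hpoly_mult[OF *(3,6)] hpoly_mult[OF *(4,7)]]) (use * in auto)
qed

lemma lquot_add:
  assumes "lquot n d U s" "lquot n d U t"
  shows "lquot n d U (\<lambda>x. s x + t x)"
proof (rule lquot_combine[OF assms])
  fix V a b g h a' b' g' h'
  assume *: "V \<in> opens n" "int a - int b = d" "g \<in> hpoly n a" "h \<in> hpoly n b"
      "int a' - int b' = d" "g' \<in> hpoly n a'" "h' \<in> hpoly n b'"
      "\<And>x. x \<in> \<Union>V \<Longrightarrow> h x \<noteq> 0 \<and> s x = g x / h x" "\<And>x. x \<in> \<Union>V \<Longrightarrow> h' x \<noteq> 0 \<and> t x = g' x / h' x"
  have "a + b' = a' + b" using *(2,5) by linarith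
  then have "(\<lambda>x. g x * h' x + g' x * h x) \<in> hpoly n (a + b')"
    using hpoly_mult[OF *(3,7)] hpoly_mult[OF *(6,4)] by (simp add: hpoly_add)
  from lquot_global[OF *(1) _ this hpoly_mult[OF *(4,7)]]
  show "lquot n d V (\<lambda>x. s x + t x)" using * by (simp add: field_simps)
qed

lemma lquot_const: "U \<in> opens n \<Longrightarrow> lquot n 0 U (\<lambda>x. c)"
  by (rule lquot_global[of U n 0 0 0 "\<lambda>x. c" "\<lambda>x. 1"]) (auto simp: hpoly_const)

lemma lquot_var: "U \<in> opens n \<Longrightarrow> i \<le> n \<Longrightarrow> lquot n 1 U (\<lambda>x. x i)"
  by (rule lquot_global[of U n 1 0 1 "\<lambda>x. x i" "\<lambda>x. 1"])
    (use hpoly_const[of 1 n] hpoly_var[of i n] in auto)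

lemma lquot_minus: "lquot n d U s \<Longrightarrow> U \<in> opens n \<Longrightarrow> lquot n d U (\<lambda>x. - s x)"
  using lquot_mult[OF lquot_const[of U n "-1"], of d s] by simp

lemma lquot_diff: "lquot n d U s \<Longrightarrow> lquot n d U t \<Longrightarrow> U \<in> opens n \<Longrightarrow> lquot n d U (\<lambda>x. s x - t x)"
  using lquot_add[OF _ lquot_minus] by fastforce

lemma lquot_inverse:
  assumes "lquot n d U s" "\<And>x. x \<in> \<Union>U \<Longrightarrow> s x \<noteq> 0"
  shows "lquot n (- d) U (\<lambda>x. 1 / s x)"
proof (rule lquot_local)
  fix p assume "p \<in> U"
  with assms(1) obtain V a b g h where V: "V \<in> opens_in n U" "p \<in> V" "int a - int b = d" "g \<in> hpoly n a"
    "h \<in> hpoly n b" "\<forall>x\<in>\<Union>V. h x \<noteq> 0 \<and> s x = g x / h x" by (rule lquotE)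
  have "g x \<noteq> 0 \<and> 1 / s x = h x / g x" if x: "x \<in> \<Union>V" for x
  proof -
    have "x \<in> \<Union>U" using x V(1) by (auto simp: opens_in_def)
    then have "s x \<noteq> 0" by (rule assms(2))
    then show ?thesis using V(6)[rule_format, OF x] by auto
  qed
  then have "lquot n (- d) V (\<lambda>x. 1 / s x)"
    by (intro lquot_global[OF _ _ V(5,4)]) (use V in \<open>auto simp: opens_in_def\<close>)
  then show "\<exists>V\<in>opens_in n U. p \<in> V \<and> lquot n (- d) V (\<lambda>x. 1 / s x)" using V by blast
qed

lemma lquot_divide:
  assumes "lquot n d U s" "lquot n e U t" "\<And>x. x \<in> \<Union>U \<Longrightarrow> t x \<noteq> 0"
  shows "lquot n (d - e) U (\<lambda>x. s x / t x)"
  using lquot_mult[OF assms(1) lquot_inverse[OF assms(2,3)]] by simp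

text \<open>For \<open>d = 0\<close> this is the invariance under scaling that lets a function on
  the cone descend to points.\<close>

lemma lquot_homogeneous:
  assumes "lquot n d U s" "U \<in> opens n" "x \<in> \<Union>U" "c \<noteq> 0"
  shows "s (\<lambda>i. c * x i) = c powi d * s x"
proof -
  have "hclass x \<in> U" using assms(2,3) mem_cone by blast
  with assms(1) obtain V a b g h where V: "V \<in> opens_in n U" "hclass x \<in> V" "int a - int b = d" "g \<in> hpoly n a"
    "h \<in> hpoly n b" "\<forall>x\<in>\<Union>V. h x \<noteq> 0 \<and> s x = g x / h x" by (rule lquotE)
  have "x \<in> \<Union>V" using V(2) mem_hclass by blast
  then have "(\<lambda>i. c * x i) \<in> \<Union>V" using cone_scale[of V n x c] V(1) assms(4) by (auto simp: opens_in_def)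
  then have "s (\<lambda>i. c * x i) = (c ^ a * g x) / (c ^ b * h x)"
    using V(6)[rule_format, of "\<lambda>i. c * x i"] hpoly_homogeneous[OF V(4), of c x] hpoly_homogeneous[OF V(5), of c x]
    by (simp del: Union_iff)
  also have "\<dots> = c powi d * s x"
  proof -
    have "c powi d = c ^ a / c ^ b" using assms(4) unfolding V(3)[symmetric] by (simp add: power_int_diff)
    moreover have "s x = g x / h x" using V(6) \<open>x \<in> \<Union>V\<close> by blast
    ultimately show ?thesis by simp
  qed
  finally show ?thesis .
qed

text \<open>The identity principle: if \<open>s x\<close> were nonzero, the numerator of a local
  representation would be nonzero on a nonempty open set, which meets \<open>W\<close> by
  irreducibility.\<close>

lemma lquot_identity:
  assumes "lquot n d U s" "U \<in> opens n" "W \<in> opens_in n U" "W \<noteq> {}"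
    and zero: "\<And>x. x \<in> \<Union>W \<Longrightarrow> s x = 0" and x: "x \<in> \<Union>U"
  shows "s x = 0"
proof (rule ccontr)
  assume nz: "s x \<noteq> 0"
  have xU: "hclass x \<in> U" using assms(2) x mem_cone by blast
  with assms(1) obtain V a b g h where V: "V \<in> opens_in n U" "hclass x \<in> V" "int a - int b = d" "g \<in> hpoly n a"
    "h \<in> hpoly n b" "\<forall>x\<in>\<Union>V. h x \<noteq> 0 \<and> s x = g x / h x" by (rule lquotE)
  have xV: "x \<in> \<Union>V" using V(2) mem_hclass by blast
  have op: "V \<in> opens n" "W \<in> opens n" using V(1) assms(3) by (auto simp: opens_in_def)
  have "g x \<noteq> 0" using V(6)[rule_format, OF xV] nz by auto
  moreover have "x \<in> vecs n" using x assms(2) mem_cone by blast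
  ultimately have "hclass x \<in> basic_open n g" using mem_basic_open[OF V(4)] by blast
  then have "V \<inter> basic_open n g \<noteq> {}" using V(2) by blast
  then have "(V \<inter> basic_open n g) \<inter> W \<noteq> {}"
    using opens_Int_nonempty[OF opens_Int[OF op(1) basic_open_opens[OF V(4)]] op(2)] assms(4) by blast
  then obtain p where p: "p \<in> V" "p \<in> basic_open n g" "p \<in> W" by blast
  then obtain y where y: "y \<in> vecs n" "p = hclass y" "g y \<noteq> 0" by (auto simp: basic_open_def)
  then have "y \<in> \<Union>V" "y \<in> \<Union>W" using p mem_hclass by auto
  then show False using V(6) zero y by fastforce
qed


section \<open>Partial derivatives on the cone\<close>

text \<open>A complex derivative along a coordinate line instead of a formal one: it does not depend
  on how the function is written as a quotient near the point.\<close>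

definition pd :: "nat \<Rightarrow> ((nat \<Rightarrow> complex) \<Rightarrow> complex) \<Rightarrow> (nat \<Rightarrow> complex) \<Rightarrow> complex"
  where "pd j f x = (THE D. ((\<lambda>t. f (x(j := t))) has_field_derivative D) (at (x j)))"

lemma pd_eq: "((\<lambda>t. f (x(j := t))) has_field_derivative D) (at (x j)) \<Longrightarrow> pd j f x = D"
  unfolding pd_def by (blast intro: DERIV_unique)

lemma has_pd_cong:
  assumes "V \<in> opens n" "x \<in> \<Union>V" "j \<le> n" "\<And>y. y \<in> \<Union>V \<Longrightarrow> f y = g y"
    "((\<lambda>t. g (x(j := t))) has_field_derivative D) (at (x j))"
  shows "((\<lambda>t. f (x(j := t))) has_field_derivative D) (at (x j))"
proof -
  have "\<forall>\<^sub>F t in nhds (x j). g (x(j := t)) = f (x(j := t))"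
    using eventually_cone[OF assms(1-3)] by eventually_elim (simp add: assms(4))
  from DERIV_cong_ev[OF refl this refl] assms(5) show ?thesis by blast
qed

lemma lquot_has_pd:
  assumes "lquot n d U f" "x \<in> \<Union>U" "U \<in> opens n" "j \<le> n"
  shows "((\<lambda>t. f (x(j := t))) has_field_derivative pd j f x) (at (x j))"
proof -
  have "hclass x \<in> U" using assms(2,3) mem_cone by blast
  with assms(1) obtain V a b g h where V: "V \<in> opens_in n U" "hclass x \<in> V" "int a - int b = d" "g \<in> hpoly n a"
    "h \<in> hpoly n b" "\<forall>x\<in>\<Union>V. h x \<noteq> 0 \<and> f x = g x / h x" by (rule lquotE)
  have op: "V \<in> opens n" using V(1) by (auto simp: opens_in_def)
  have x: "x \<in> \<Union>V" using V(2) mem_hclass by blast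
  obtain g' where g': "((\<lambda>t. g (x(j := t))) has_field_derivative g') (at (x j))"
    using hpoly_derivative[OF V(4), of j] by metis
  obtain h' where h': "((\<lambda>t. h (x(j := t))) has_field_derivative h') (at (x j))"
    using hpoly_derivative[OF V(5), of j] by metis
  have "((\<lambda>t. g (x(j := t)) / h (x(j := t))) has_field_derivative
      (g' * h (x(j := x j)) - g (x(j := x j)) * h') / (h (x(j := x j)) * h (x(j := x j)))) (at (x j))"
    by (rule DERIV_divide[OF g' h']) (use V(6)[rule_format, OF x] in simp)
  then have "((\<lambda>t. f (x(j := t))) has_field_derivative
      (g' * h (x(j := x j)) - g (x(j := x j)) * h') / (h (x(j := x j)) * h (x(j := x j)))) (at (x j))"
    by (intro has_pd_cong[OF op x assms(4), of f "\<lambda>x. g x / h x"]) (use V(6) in auto)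
  then show ?thesis using pd_eq by metis
qed

lemma pd_cong:
  assumes "lquot n d U g" "x \<in> \<Union>U" "U \<in> opens n" "j \<le> n" "\<And>y. y \<in> \<Union>U \<Longrightarrow> f y = g y"
  shows "pd j f x = pd j g x"
  using has_pd_cong[OF assms(3,2,4), of f g] assms(5) lquot_has_pd[OF assms(1-4)] by (intro pd_eq) auto

lemma pd_add:
  assumes "lquot n d U f" "lquot n e U g" "x \<in> \<Union>U" "U \<in> opens n" "j \<le> n"
  shows "pd j (\<lambda>x. f x + g x) x = pd j f x + pd j g x"
  by (intro pd_eq DERIV_add lquot_has_pd[OF assms(1)] lquot_has_pd[OF assms(2)] assms)

lemma pd_mult:
  assumes "lquot n d U f" "lquot n e U g" "x \<in> \<Union>U" "U \<in> opens n" "j \<le> n"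
  shows "pd j (\<lambda>x. f x * g x) x = f x * pd j g x + g x * pd j f x"
proof -
  have "((\<lambda>t. f (x(j := t)) * g (x(j := t))) has_field_derivative
      pd j f x * g (x(j := x j)) + pd j g x * f (x(j := x j))) (at (x j))"
    by (intro DERIV_mult lquot_has_pd[OF assms(1)] lquot_has_pd[OF assms(2)] assms)
  from pd_eq[OF this] show ?thesis by simp
qed

lemma pd_const: "pd j (\<lambda>x. c) x = 0"
  by (intro pd_eq) simp

lemma pd_affine_coordinate:
  assumes "x l \<noteq> 0"
  shows "pd j (\<lambda>x. x i / x l) x = (if i = j then 1 / x l else 0) - (if l = j then x i / (x l)\<^sup>2 else 0)"
proof -
  have *: "((\<lambda>t. (x(j := t)) i) has_field_derivative (if i = j then 1 else 0)) (at (x j))" for i by simp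
  have "((\<lambda>t. (x(j := t)) i / (x(j := t)) l) has_field_derivative
      ((if i = j then 1 else 0) * (x(j := x j)) l - (x(j := x j)) i * (if l = j then 1 else 0)) /
      ((x(j := x j)) l * (x(j := x j)) l)) (at (x j))"
    by (rule DERIV_divide[OF * *]) (use assms in simp)
  from pd_eq[OF this] show ?thesis using assms by (simp add: power2_eq_square)
qed

text \<open>The derivative lowers the degree by one and the coefficient raises it again. The
  numerator of \<open>s\<close> has positive degree \<open>Suc b\<close>, and the quotient rule
  places it next to each derivative, just as \<open>hpoly_derivative\<close> wants.\<close>

lemma lquot_mult_pd:
  assumes "lquot n 1 U s" "lquot n 0 U f" "j \<le> n"
  shows "lquot n 0 U (\<lambda>x. s x * pd j f x)"
proof (rule lquot_combine[OF assms(1,2)])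
  fix V a b g h a' b' g' h'
  assume *: "V \<in> opens n" "int a - int b = 1" "g \<in> hpoly n a" "h \<in> hpoly n b"
      "int a' - int b' = 0" "g' \<in> hpoly n a'" "h' \<in> hpoly n b'"
      "\<And>x. x \<in> \<Union>V \<Longrightarrow> h x \<noteq> 0 \<and> s x = g x / h x" "\<And>x. x \<in> \<Union>V \<Longrightarrow> h' x \<noteq> 0 \<and> f x = g' x / h' x"
  have a: "a = Suc b" "a' = b'" using * by auto
  obtain dg where dg: "\<And>x. ((\<lambda>t. g' (x(j := t))) has_field_derivative dg x) (at (x j))"
    "\<And>e a. a \<in> hpoly n (Suc e) \<Longrightarrow> (\<lambda>x. a x * dg x) \<in> hpoly n (e + a')"
    using hpoly_derivative[OF *(6), of j] by blast
  obtain dh where dh: "\<And>x. ((\<lambda>t. h' (x(j := t))) has_field_derivative dh x) (at (x j))"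
    "\<And>e a. a \<in> hpoly n (Suc e) \<Longrightarrow> (\<lambda>x. a x * dh x) \<in> hpoly n (e + b')"
    using hpoly_derivative[OF *(7), of j] by blast
  have pdf: "pd j f x = (dg x * h' x - g' x * dh x) / (h' x * h' x)" if x: "x \<in> \<Union>V" for x
  proof -
    have "((\<lambda>t. g' (x(j := t)) / h' (x(j := t))) has_field_derivative
        (dg x * h' (x(j := x j)) - g' (x(j := x j)) * dh x) / (h' (x(j := x j)) * h' (x(j := x j)))) (at (x j))"
      by (rule DERIV_divide[OF dg(1) dh(1)]) (use *(9)[OF x] in simp)
    then have "((\<lambda>t. f (x(j := t))) has_field_derivative
        (dg x * h' (x(j := x j)) - g' (x(j := x j)) * dh x) / (h' (x(j := x j)) * h' (x(j := x j)))) (at (x j))"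
      by (intro has_pd_cong[OF *(1) x assms(3), of f "\<lambda>x. g' x / h' x"]) (use *(9) in auto)
    from pd_eq[OF this] show ?thesis by simp
  qed
  have "(\<lambda>x. g x * dg x * h' x - g x * dh x * g' x) \<in> hpoly n (b + b' + b')"
  proof (rule hpoly_diff)
    have g: "g \<in> hpoly n (Suc b)" using *(3) a by simp
    show "(\<lambda>x. g x * dg x * h' x) \<in> hpoly n (b + b' + b')"
      using hpoly_mult[OF dg(2)[OF g] *(7)] a by simp
    show "(\<lambda>x. g x * dh x * g' x) \<in> hpoly n (b + b' + b')"
      using hpoly_mult[OF dh(2)[OF g] *(6)] a by simp
  qed
  moreover have "(\<lambda>x. h x * h' x * h' x) \<in> hpoly n (b + b' + b')"
    by (intro hpoly_mult *(4) *(7))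
  moreover have "s x * pd j f x = (g x * dg x * h' x - g x * dh x * g' x) / (h x * h' x * h' x)" if "x \<in> \<Union>V" for x
  proof -
    have "s x * pd j f x = (g x * (dg x * h' x - g' x * dh x)) / (h x * (h' x * h' x))"
      using pdf[OF that] *(8)[OF that] by simp
    then show ?thesis by (simp add: right_diff_distrib mult_ac)
  qed
  moreover have "h x * h' x * h' x \<noteq> 0" if "x \<in> \<Union>V" for x
    using *(8)[OF that] *(9)[OF that] by simp
  ultimately show "lquot n 0 V (\<lambda>x. s x * pd j f x)"
    by (intro lquot_global[OF *(1), where g = "\<lambda>x. g x * dg x * h' x - g x * dh x * g' x" and h = "\<lambda>x. h x * h' x * h' x"
          and a = "b + b' + b'" and b = "b + b' + b'"]) auto
qed

text \<open>The numerator of \<open>s\<close> vanishes on an open part of the hyperplane, hence on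
  all of it, and \<open>hpoly_restrict_hyperplane\<close> splits off \<open>x k / x l\<close>. It is
  applied to the first coordinate of an adapted system and to the derivative of
  \<open>x k / x l\<close> along a logarithmic field.\<close>

lemma lquot_divide_hyperplane:
  assumes "lquot n 0 U s" "U \<in> opens n" "y \<in> \<Union>U" "y k = 0" "k \<le> n" "l \<le> n" "y l \<noteq> 0"
    and zero: "\<And>x. x \<in> \<Union>U \<Longrightarrow> x k = 0 \<Longrightarrow> s x = 0"
  shows "\<exists>W b. W \<in> opens_in n U \<and> y \<in> \<Union>W \<and> lquot n 0 W b \<and> (\<forall>x\<in>\<Union>W. x l \<noteq> 0 \<and> s x = b x * (x k / x l))"
proof -
  have "hclass y \<in> U" using assms mem_cone by blast
  with assms(1) obtain V a a' g h where V: "V \<in> opens_in n U" "hclass y \<in> V" "int a - int a' = 0" "g \<in> hpoly n a"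
    "h \<in> hpoly n a'" "\<forall>x\<in>\<Union>V. h x \<noteq> 0 \<and> s x = g x / h x" by (rule lquotE)
  have aa: "a' = a" using V(3) by simp
  have op: "V \<in> opens n" using V(1) by (auto simp: opens_in_def)
  have yV: "y \<in> \<Union>V" "y \<in> vecs n" using V(2) mem_hclass assms mem_cone by blast+
  obtain e u where u: "u \<in> hpoly n e" "u y \<noteq> 0" "basic_open n u \<subseteq> V" using opensE[OF op yV(1)] .
  \<comment> \<open>The line from \<open>y\<close> to \<open>x(k := 0)\<close> stays in the
    hyperplane. If \<open>g\<close> were nonzero at its end, some point of it would have
    \<open>g\<close> nonzero and still lie in \<open>V\<close>, where \<open>s\<close> vanishes on
    the hyperplane.\<close>
  have g0: "g (x(k := 0)) = 0" if x: "x \<in> vecs n" for x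
  proof (rule ccontr)
    assume nz: "g (x(k := 0)) \<noteq> 0"
    have "(x(k := 0)) i = 0" if "i > n" for i using x that by (simp add: vecs_def)
    then obtain t where
      t: "g (\<lambda>i. y i + t * ((x(k := 0)) i - y i)) \<noteq> 0" "u (\<lambda>i. y i + t * ((x(k := 0)) i - y i)) \<noteq> 0"
        "(\<lambda>i. y i + t * ((x(k := 0)) i - y i)) \<in> vecs n"
      using hpoly_line_nonzero[OF V(4) u(1) yV(2) _ u(2) nz] by blast
    let ?z = "\<lambda>i. y i + t * ((x(k := 0)) i - y i)"
    have "?z \<in> \<Union>V" using mem_cone[OF op] t(2,3) u mem_basic_open[OF u(1) t(3)] by blast
    moreover from this have "?z \<in> \<Union>U" using V(1) by (auto simp: opens_in_def)
    then have "s ?z = 0" by (rule zero) (simp add: assms)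
    ultimately show False using V(6) t(1) by fastforce
  qed
  obtain q where q: "q \<in> hpoly n a" "\<And>x. x l * (g x - g (x(k := 0))) = x k * q x"
    using hpoly_restrict_hyperplane[OF assms(6) V(4)] by blast
  define W where "W = V \<inter> basic_open n (\<lambda>x. x l)"
  have opW: "W \<in> opens n" unfolding W_def by (intro opens_Int op basic_open_opens[OF hpoly_var[OF assms(6)]])
  have nz: "x l \<noteq> 0 \<and> x \<in> vecs n \<and> x \<in> \<Union>V" if "x \<in> \<Union>W" for x
  proof -
    have "x \<in> vecs n" "hclass x \<in> W" using that mem_cone[OF opW] by auto
    then show ?thesis using mem_basic_open[OF hpoly_var[OF assms(6)], of x] mem_cone[OF op, of x] unfolding W_def by blast
  qed
  have "lquot n 0 W (\<lambda>x. q x / h x)"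
  proof (rule lquot_global[OF opW _ q(1)])
    show "h \<in> hpoly n a" using V(5) aa by simp
    show "h x \<noteq> 0 \<and> q x / h x = q x / h x" if "x \<in> \<Union>W" for x using V(6) nz[OF that] by blast
  qed simp
  moreover have "s x = q x / h x * (x k / x l)" if "x \<in> \<Union>W" for x
  proof -
    have "x l * g x = x k * q x" using q(2)[of x] g0 nz[OF that] by simp
    then have "q x / h x * (x k / x l) = (x l * g x) / (x l * h x)" by (simp add: mult.commute)
    moreover have "s x = g x / h x" using V(6) nz[OF that] by blast
    ultimately show ?thesis using nz[OF that] by simp
  qed
  moreover have "y \<in> \<Union>W"
    using mem_cone[OF opW] V(2) yV(2) mem_basic_open[OF hpoly_var[OF assms(6)] yV(2)] assms(7)
    unfolding W_def by blast
  moreover have "W \<in> opens_in n U" using opW V(1) by (auto simp: opens_in_def W_def)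
  ultimately show ?thesis using nz by blast
qed


section \<open>The ring of regular functions\<close>

lemma reg_simps:
  "(\<otimes>\<^bsub>reg n U\<^esub>) = (\<lambda>f g. \<lambda>p\<in>U. f p * g p)"
  "\<one>\<^bsub>reg n U\<^esub> = (\<lambda>p\<in>U. 1)"
  "\<zero>\<^bsub>reg n U\<^esub> = (\<lambda>p\<in>U. 0)"
  "(\<oplus>\<^bsub>reg n U\<^esub>) = (\<lambda>f g. \<lambda>p\<in>U. f p + g p)"
  by (simp_all add: reg_def)

text \<open>Moves regularity from points to the cone: from here on a regular function is handled as
  a function of degree 0 of homogeneous coordinates.\<close>

lemma reg_iff: "f \<in> carrier (reg n U) \<longleftrightarrow> f \<in> extensional U \<and> lquot n 0 U (\<lambda>x. f (hclass x))"
proof -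
  have "(\<exists>d. \<exists>g\<in>hpoly n d. \<exists>h\<in>hpoly n d. \<forall>q\<in>V. \<forall>x\<in>q. h x \<noteq> 0 \<and> f q = g x / h x) \<longleftrightarrow>
      quot_on n 0 V (\<lambda>x. f (hclass x))" if V: "V \<in> opens_in n U" for V
  proof -
    have "(\<forall>q\<in>V. \<forall>x\<in>q. h x \<noteq> 0 \<and> f q = g x / h x) \<longleftrightarrow> (\<forall>x\<in>\<Union>V. h x \<noteq> 0 \<and> f (hclass x) = g x / h x)" for g h
    proof -
      have "hclass x = q" if "q \<in> V" "x \<in> q" for q x
        using V that mem_PP opens_subset unfolding opens_in_def by blast
      then show ?thesis by fastforce
    qed
    then show ?thesis unfolding quot_on_def by auto
  qed
  then show ?thesis unfolding reg_def lquot_def by (simp cong: bex_cong)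
qed

lemma reg_lquot: "f \<in> carrier (reg n U) \<Longrightarrow> lquot n 0 U (\<lambda>x. f (hclass x))"
  by (simp add: reg_iff)

lemma reg_extensional: "f \<in> carrier (reg n U) \<Longrightarrow> f \<in> extensional U"
  by (simp add: reg_iff)

lemma hclass_mem: "U \<in> opens n \<Longrightarrow> x \<in> \<Union>U \<Longrightarrow> hclass x \<in> U"
  using mem_cone by blast

lemma cone_obtain:
  assumes "U \<in> opens n" "p \<in> U"
  obtains x where "x \<in> \<Union>U" "p = hclass x" "x \<in> vecs n"
  using assms PP_obtain opens_subset mem_hclass by (metis UnionI subsetD)

lemma reg_restrictI:
  assumes "U \<in> opens n" "lquot n 0 U (\<lambda>x. f (hclass x))"
  shows "restrict f U \<in> carrier (reg n U)"
  unfolding reg_iff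
  using lquot_cong[OF assms(2), of "\<lambda>x. restrict f U (hclass x)"] hclass_mem[OF assms(1)] by simp

text \<open>The function on \<open>U\<close> induced by \<open>s\<close>, meaningful only if \<open>s\<close> is invariant under scaling.\<close>

definition desc :: "pt set \<Rightarrow> ((nat \<Rightarrow> complex) \<Rightarrow> complex) \<Rightarrow> fn"
  where "desc U s = (\<lambda>p\<in>U. s (SOME x. x \<in> p))"

lemma desc_apply:
  assumes "lquot n 0 U s" "U \<in> opens n" "x \<in> \<Union>U"
  shows "desc U s (hclass x) = s x"
proof -
  have "(SOME y. y \<in> hclass x) \<in> hclass x" by (rule someI[of "\<lambda>y. y \<in> hclass x" x], rule mem_hclass)
  then obtain c where c: "c \<noteq> 0" "(SOME y. y \<in> hclass x) = (\<lambda>i. c * x i)"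
    unfolding hclass_def[of x] mem_Collect_eq by metis
  have "desc U s (hclass x) = s (SOME y. y \<in> hclass x)"
    using hclass_mem[OF assms(2,3)] unfolding desc_def by (rule restrict_apply')
  also have "\<dots> = s x" unfolding c(2) using lquot_homogeneous[OF assms c(1)] by simp
  finally show ?thesis .
qed

lemma desc_reg:
  assumes "lquot n 0 U s" "U \<in> opens n"
  shows "desc U s \<in> carrier (reg n U)"
  unfolding reg_iff using lquot_cong[OF assms(1)] desc_apply[OF assms] by (simp add: desc_def)

lemma reg_const: "U \<in> opens n \<Longrightarrow> (\<lambda>p\<in>U. c) \<in> carrier (reg n U)"
  by (rule reg_restrictI) (auto intro: lquot_const)

lemma reg_add: "U \<in> opens n \<Longrightarrow> f \<in> carrier (reg n U) \<Longrightarrow> g \<in> carrier (reg n U) \<Longrightarrow> (\<lambda>p\<in>U. f p + g p) \<in> carrier (reg n U)"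
  by (rule reg_restrictI) (auto intro: lquot_add reg_lquot)

lemma reg_mult: "U \<in> opens n \<Longrightarrow> f \<in> carrier (reg n U) \<Longrightarrow> g \<in> carrier (reg n U) \<Longrightarrow> (\<lambda>p\<in>U. f p * g p) \<in> carrier (reg n U)"
  by (rule reg_restrictI) (use lquot_mult[of n 0 U _ 0] reg_lquot in auto)

lemma reg_sum:
  assumes "U \<in> opens n" "\<And>i. i \<in> A \<Longrightarrow> f i \<in> carrier (reg n U)"
  shows "(\<lambda>p\<in>U. \<Sum>i\<in>A. f i p) \<in> carrier (reg n U)"
  using assms(2)
proof (induction A rule: infinite_finite_induct)
  case (insert i A)
  then have "(\<lambda>p\<in>U. f i p + (\<lambda>p\<in>U. \<Sum>i\<in>A. f i p) p) \<in> carrier (reg n U)" using reg_add[OF assms(1)] by blast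
  also have "(\<lambda>p\<in>U. f i p + (\<lambda>p\<in>U. \<Sum>i\<in>A. f i p) p) = (\<lambda>p\<in>U. \<Sum>i\<in>insert i A. f i p)"
    using insert by (intro restrict_ext) simp
  finally show ?case .
qed (simp_all add: reg_const assms)

lemma reg_restrict: "f \<in> carrier (reg n U) \<Longrightarrow> V \<in> opens_in n U \<Longrightarrow> restrict f V \<in> carrier (reg n V)"
  by (rule reg_restrictI) (auto simp: opens_in_def intro: lquot_restrict reg_lquot)

lemma reg_eqI:
  "f \<in> carrier (reg n U) \<Longrightarrow> g \<in> carrier (reg n U) \<Longrightarrow> (\<And>p. p \<in> U \<Longrightarrow> f p = g p) \<Longrightarrow> f = g"
  by (rule extensionalityI[of f U g]) (auto simp: reg_extensional)

lemma reg_identity: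
  assumes "f \<in> carrier (reg n U)" "U \<in> opens n" "W \<in> opens_in n U" "W \<noteq> {}"
    and "\<And>p. p \<in> W \<Longrightarrow> f p = 0" and p: "p \<in> U"
  shows "f p = 0"
proof -
  obtain x where x: "x \<in> \<Union>U" "p = hclass x" using cone_obtain[OF assms(2) p] .
  have W: "W \<in> opens n" using assms(3) by (simp add: opens_in_def)
  show ?thesis
    using lquot_identity[OF reg_lquot[OF assms(1)] assms(2-4) _ x(1)] hclass_mem[OF W] assms(5) x(2) by simp
qed

lemma reg_cring:
  assumes "U \<in> opens n"
  shows "cring (reg n U)"
proof (rule cringI)
  show "abelian_group (reg n U)"
  proof (rule abelian_groupI)
    fix f assume f: "f \<in> carrier (reg n U)"
    have "(\<lambda>p\<in>U. (\<lambda>p\<in>U. -1) p * f p) \<in> carrier (reg n U)"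
      by (intro reg_mult assms reg_const f)
    then show "\<exists>g\<in>carrier (reg n U). g \<oplus>\<^bsub>reg n U\<^esub> f = \<zero>\<^bsub>reg n U\<^esub>"
      by (rule bexI[rotated]) (auto simp: reg_simps intro!: restrict_ext)
    show "\<zero>\<^bsub>reg n U\<^esub> \<oplus>\<^bsub>reg n U\<^esub> f = f"
      using reg_extensional[OF f] by (auto simp: reg_simps extensional_def fun_eq_iff)
  qed (auto simp: reg_simps assms reg_add reg_const algebra_simps cong: restrict_cong)
  show "Group.comm_monoid (reg n U)"
  proof (rule comm_monoidI)
    fix f assume f: "f \<in> carrier (reg n U)"
    show "\<one>\<^bsub>reg n U\<^esub> \<otimes>\<^bsub>reg n U\<^esub> f = f"
      using reg_extensional[OF f] by (auto simp: reg_simps extensional_def fun_eq_iff)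
  qed (auto simp: reg_simps assms reg_mult reg_const algebra_simps cong: restrict_cong)
qed (auto simp: reg_simps algebra_simps cong: restrict_cong)


section \<open>Vector fields\<close>

abbreviation vf :: "nat \<Rightarrow> pt set \<Rightarrow> (pt set \<Rightarrow> fn \<Rightarrow> fn) set"
  where "vf n U \<equiv> carrier (sec (tangent n) U)"

lemma rst_tangent: "rst (tangent n) U W = (\<lambda>\<theta>. restrict \<theta> (opens_in n W))"
  by (simp add: tangent_def map_sheaf_def)

lemma tangent_zero: "\<zero>\<^bsub>sec (tangent n) U\<^esub> = (\<lambda>V\<in>opens_in n U. \<lambda>f\<in>carrier (reg n V). \<lambda>p\<in>V. 0)"
  by (simp add: tangent_def map_sheaf_def reg_simps)

lemma tangent_add: "(\<oplus>\<^bsub>sec (tangent n) U\<^esub>) =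
    (\<lambda>\<theta> \<eta>. \<lambda>V\<in>opens_in n U. \<lambda>f\<in>carrier (reg n V). \<lambda>p\<in>V. \<theta> V f p + \<eta> V f p)"
  by (simp add: tangent_def map_sheaf_def reg_simps)

lemma tangent_smult: "(\<odot>\<^bsub>sec (tangent n) U\<^esub>) =
    (\<lambda>a \<theta>. \<lambda>V\<in>opens_in n U. \<lambda>f\<in>carrier (reg n V). \<lambda>p\<in>V. a p * \<theta> V f p)"
  by (simp add: tangent_def map_sheaf_def reg_simps cong: restrict_cong)

lemma vf_iff: "\<theta> \<in> vf n U \<longleftrightarrow> \<theta> \<in> (\<Pi>\<^sub>E V\<in>opens_in n U. carrier (reg n V) \<rightarrow>\<^sub>E carrier (reg n V)) \<and>
    (\<forall>V\<in>opens_in n U. derivation n V (\<theta> V)) \<and>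
    (\<forall>V\<in>opens_in n U. \<forall>W\<in>opens_in n V. \<forall>f\<in>carrier (reg n V). \<theta> W (restrict f W) = restrict (\<theta> V f) W)"
  by (simp add: tangent_def map_sheaf_def)

lemma derivation_iff: "derivation n V \<theta> \<longleftrightarrow>
    (\<forall>f\<in>carrier (reg n V). \<forall>g\<in>carrier (reg n V).
      \<theta> (\<lambda>p\<in>V. f p + g p) = (\<lambda>p\<in>V. \<theta> f p + \<theta> g p) \<and>
      \<theta> (\<lambda>p\<in>V. f p * g p) = (\<lambda>p\<in>V. f p * \<theta> g p + g p * \<theta> f p)) \<and>
    (\<forall>c. \<theta> (\<lambda>p\<in>V. c) = (\<lambda>p\<in>V. 0))"
  by (simp add: derivation_def reg_simps cong: restrict_cong)

lemma vf_closed: "\<theta> \<in> vf n U \<Longrightarrow> V \<in> opens_in n U \<Longrightarrow> f \<in> carrier (reg n V) \<Longrightarrow> \<theta> V f \<in> carrier (reg n V)"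
proof -
  assume *: "\<theta> \<in> vf n U" "V \<in> opens_in n U" "f \<in> carrier (reg n V)"
  then have "\<theta> V \<in> carrier (reg n V) \<rightarrow>\<^sub>E carrier (reg n V)" unfolding vf_iff by (blast dest: PiE_mem)
  then show ?thesis using *(3) by (rule PiE_mem)
qed

lemma vf_deriv: "\<theta> \<in> vf n U \<Longrightarrow> V \<in> opens_in n U \<Longrightarrow> derivation n V (\<theta> V)"
  unfolding vf_iff by blast

lemma vf_add_apply: "\<theta> \<in> vf n U \<Longrightarrow> V \<in> opens_in n U \<Longrightarrow> f \<in> carrier (reg n V) \<Longrightarrow> g \<in> carrier (reg n V) \<Longrightarrow>
    p \<in> V \<Longrightarrow> \<theta> V (\<lambda>p\<in>V. f p + g p) p = \<theta> V f p + \<theta> V g p"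
  using vf_deriv[of \<theta> n U V] unfolding derivation_iff by simp

lemma vf_mult_apply: "\<theta> \<in> vf n U \<Longrightarrow> V \<in> opens_in n U \<Longrightarrow> f \<in> carrier (reg n V) \<Longrightarrow> g \<in> carrier (reg n V) \<Longrightarrow>
    p \<in> V \<Longrightarrow> \<theta> V (\<lambda>p\<in>V. f p * g p) p = f p * \<theta> V g p + g p * \<theta> V f p"
  using vf_deriv[of \<theta> n U V] unfolding derivation_iff by simp

lemma vf_const_apply: "\<theta> \<in> vf n U \<Longrightarrow> V \<in> opens_in n U \<Longrightarrow> p \<in> V \<Longrightarrow> \<theta> V (\<lambda>p\<in>V. c) p = 0"
  using vf_deriv[of \<theta> n U V] unfolding derivation_iff by simp

lemma vf_restrict_apply: "\<theta> \<in> vf n U \<Longrightarrow> V \<in> opens_in n U \<Longrightarrow> W \<in> opens_in n V \<Longrightarrow> f \<in> carrier (reg n V) \<Longrightarrow>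
    p \<in> W \<Longrightarrow> \<theta> W (restrict f W) p = \<theta> V f p"
  unfolding vf_iff by simp

lemma vf_eqI:
  assumes "\<theta> \<in> vf n U" "\<eta> \<in> vf n U"
    and eq: "\<And>V f p. V \<in> opens_in n U \<Longrightarrow> f \<in> carrier (reg n V) \<Longrightarrow> p \<in> V \<Longrightarrow> \<theta> V f p = \<eta> V f p"
  shows "\<theta> = \<eta>"
proof (rule PiE_ext[of \<theta> "opens_in n U" "\<lambda>V. carrier (reg n V) \<rightarrow>\<^sub>E carrier (reg n V)"])
  fix V assume V: "V \<in> opens_in n U"
  show "\<theta> V = \<eta> V"
  proof (rule PiE_ext[of "\<theta> V" "carrier (reg n V)" "\<lambda>_. carrier (reg n V)"])
    show "\<theta> V \<in> carrier (reg n V) \<rightarrow>\<^sub>E carrier (reg n V)" "\<eta> V \<in> carrier (reg n V) \<rightarrow>\<^sub>E carrier (reg n V)"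
      using assms V unfolding vf_iff by blast+
    show "\<theta> V f = \<eta> V f" if "f \<in> carrier (reg n V)" for f
      using vf_closed[OF assms(1) V that] vf_closed[OF assms(2) V that] eq[OF V that] by (rule reg_eqI)
  qed
qed (use assms in \<open>auto simp: vf_iff\<close>)

text \<open>The conditions on a vector field become identities of values at points; the three nested
  restrictions in the conclusion take care of extensionality.\<close>

lemma vfI:
  assumes closed: "\<And>V f. V \<in> opens_in n U \<Longrightarrow> f \<in> carrier (reg n V) \<Longrightarrow> (\<lambda>p\<in>V. t V f p) \<in> carrier (reg n V)"
    and add: "\<And>V f g p. V \<in> opens_in n U \<Longrightarrow> f \<in> carrier (reg n V) \<Longrightarrow> g \<in> carrier (reg n V) \<Longrightarrow> p \<in> V \<Longrightarrow>
      t V (\<lambda>p\<in>V. f p + g p) p = t V f p + t V g p"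
    and mult: "\<And>V f g p. V \<in> opens_in n U \<Longrightarrow> f \<in> carrier (reg n V) \<Longrightarrow> g \<in> carrier (reg n V) \<Longrightarrow> p \<in> V \<Longrightarrow>
      t V (\<lambda>p\<in>V. f p * g p) p = f p * t V g p + g p * t V f p"
    and const: "\<And>V p c. V \<in> opens_in n U \<Longrightarrow> p \<in> V \<Longrightarrow> t V (\<lambda>p\<in>V. c) p = 0"
    and restr: "\<And>V W f p. V \<in> opens_in n U \<Longrightarrow> W \<in> opens_in n V \<Longrightarrow> f \<in> carrier (reg n V) \<Longrightarrow> p \<in> W \<Longrightarrow>
      t W (restrict f W) p = t V f p"
  shows "(\<lambda>V\<in>opens_in n U. \<lambda>f\<in>carrier (reg n V). \<lambda>p\<in>V. t V f p) \<in> vf n U" (is "?t \<in> _")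
  unfolding vf_iff
proof (intro conjI ballI)
  show "?t \<in> (\<Pi>\<^sub>E V\<in>opens_in n U. carrier (reg n V) \<rightarrow>\<^sub>E carrier (reg n V))"
    using closed by (auto simp: PiE_iff)
  show "derivation n V (?t V)" if V: "V \<in> opens_in n U" for V
  proof -
    have op: "V \<in> opens n" using V by (simp add: opens_in_def)
    show ?thesis unfolding derivation_iff
      using V add mult const reg_add[OF op] reg_mult[OF op] reg_const[OF op] by (auto intro!: restrict_ext)
  qed
  show "?t W (restrict f W) = restrict (?t V f) W"
    if V: "V \<in> opens_in n U" and W: "W \<in> opens_in n V" and f: "f \<in> carrier (reg n V)" for V W f
  proof -
    have "W \<in> opens_in n U" "W \<subseteq> V" using V W opens_in_trans by (auto simp: opens_in_def)
    then show ?thesis using V W f restr reg_restrict[OF f W] by (auto intro!: restrict_ext simp: fun_eq_iff)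
  qed
qed

lemma vf_add_closed: "\<theta> \<in> vf n U \<Longrightarrow> \<eta> \<in> vf n U \<Longrightarrow> \<theta> \<oplus>\<^bsub>sec (tangent n) U\<^esub> \<eta> \<in> vf n U"
  unfolding tangent_add
  by (rule vfI) (auto simp: vf_add_apply vf_mult_apply vf_const_apply vf_restrict_apply opens_in_def algebra_simps
      intro!: reg_add intro: vf_closed)

lemma vf_zero_closed: "\<zero>\<^bsub>sec (tangent n) U\<^esub> \<in> vf n U"
  unfolding tangent_zero by (rule vfI) (auto simp: opens_in_def intro!: reg_const)

lemma vf_smult_closed:
  assumes "a \<in> carrier (reg n U)" "\<theta> \<in> vf n U"
  shows "a \<odot>\<^bsub>sec (tangent n) U\<^esub> \<theta> \<in> vf n U"
  unfolding tangent_smult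
proof (rule vfI)
  fix V f assume V: "V \<in> opens_in n U" and f: "f \<in> carrier (reg n V)"
  have "V \<in> opens n" using V by (simp add: opens_in_def)
  from reg_mult[OF this reg_restrict[OF assms(1) V] vf_closed[OF assms(2) V f]]
  show "(\<lambda>p\<in>V. a p * \<theta> V f p) \<in> carrier (reg n V)" by (simp cong: restrict_cong)
qed (use assms in \<open>auto simp: vf_add_apply vf_mult_apply vf_const_apply vf_restrict_apply algebra_simps\<close>)

lemma vf_rst_closed:
  assumes "\<theta> \<in> vf n U" "V \<in> opens_in n U"
  shows "restrict \<theta> (opens_in n V) \<in> vf n V"
proof -
  have "opens_in n V \<subseteq> opens_in n U" using assms(2) opens_in_trans by blast
  then show ?thesis using assms(1) unfolding vf_iff by (auto simp: PiE_iff subset_iff intro: opens_in_trans)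
qed


section \<open>Sheaves of vector fields\<close>

text \<open>Conditions that make a family of sets of vector fields a subsheaf of modules of the
  tangent sheaf; the last one is locality. The sheaf property, torsion-freeness and finiteness of
  relations are proved once for all such families and then used for the logarithmic fields and for
  the line summands.\<close>

definition vf_family :: "nat \<Rightarrow> (pt set \<Rightarrow> (pt set \<Rightarrow> fn \<Rightarrow> fn) set) \<Rightarrow> bool"
  where "vf_family n F \<longleftrightarrow> (\<forall>U\<in>opens n.
    F U \<subseteq> vf n U \<and> \<zero>\<^bsub>sec (tangent n) U\<^esub> \<in> F U \<and>
    (\<forall>\<theta>\<in>F U. \<forall>\<eta>\<in>F U. \<theta> \<oplus>\<^bsub>sec (tangent n) U\<^esub> \<eta> \<in> F U) \<and>
    (\<forall>a\<in>carrier (reg n U). \<forall>\<theta>\<in>F U. a \<odot>\<^bsub>sec (tangent n) U\<^esub> \<theta> \<in> F U) \<and>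
    (\<forall>V\<in>opens_in n U. \<forall>\<theta>\<in>F U. restrict \<theta> (opens_in n V) \<in> F V) \<and>
    (\<forall>\<theta>\<in>vf n U. (\<forall>p\<in>U. \<exists>V\<in>opens_in n U. p \<in> V \<and> restrict \<theta> (opens_in n V) \<in> F V) \<longrightarrow> \<theta> \<in> F U))"

lemma sec_subshf: "sec (subshf E G) U = (sec E U)\<lparr>carrier := G U\<rparr>"
  by (simp add: subshf_def)

lemma rst_subshf: "rst (subshf E G) = rst E"
  by (simp add: subshf_def)

context
  fixes n F
  assumes F: "vf_family n F"
begin

lemmas family_unfold = bspec[OF F[unfolded vf_family_def]]

lemma family_vf: "U \<in> opens n \<Longrightarrow> \<theta> \<in> F U \<Longrightarrow> \<theta> \<in> vf n U"
  by (rule subsetD[OF conjunct1[OF family_unfold]])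

lemma family_zero: "U \<in> opens n \<Longrightarrow> \<zero>\<^bsub>sec (tangent n) U\<^esub> \<in> F U"
  by (rule conjunct1[OF conjunct2[OF family_unfold]])

lemma family_add: "U \<in> opens n \<Longrightarrow> \<theta> \<in> F U \<Longrightarrow> \<eta> \<in> F U \<Longrightarrow> \<theta> \<oplus>\<^bsub>sec (tangent n) U\<^esub> \<eta> \<in> F U"
  by (rule bspec[OF bspec[OF conjunct1[OF conjunct2[OF conjunct2[OF family_unfold]]]]])

lemma family_smult: "U \<in> opens n \<Longrightarrow> a \<in> carrier (reg n U) \<Longrightarrow> \<theta> \<in> F U \<Longrightarrow> a \<odot>\<^bsub>sec (tangent n) U\<^esub> \<theta> \<in> F U"
  by (rule bspec[OF bspec[OF conjunct1[OF conjunct2[OF conjunct2[OF conjunct2[OF family_unfold]]]]]])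

lemma family_rst: "U \<in> opens n \<Longrightarrow> V \<in> opens_in n U \<Longrightarrow> \<theta> \<in> F U \<Longrightarrow> restrict \<theta> (opens_in n V) \<in> F V"
  by (rule bspec[OF bspec[OF conjunct1[OF conjunct2[OF conjunct2[OF conjunct2[OF conjunct2[OF family_unfold]]]]]]])

lemma family_local:
  assumes "U \<in> opens n" "\<theta> \<in> vf n U"
    and "\<And>p. p \<in> U \<Longrightarrow> \<exists>V\<in>opens_in n U. p \<in> V \<and> restrict \<theta> (opens_in n V) \<in> F V"
  shows "\<theta> \<in> F U"
proof -
  note * = bspec[OF conjunct2[OF conjunct2[OF conjunct2[OF conjunct2[OF conjunct2[OF family_unfold[OF assms(1)]]]]]] assms(2)]
  show ?thesis by (rule mp[OF *]) (use assms(3) in blast)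
qed

lemma family_eqI:
  assumes "U \<in> opens n" "\<theta> \<in> F U" "\<eta> \<in> F U"
    "\<And>V f p. V \<in> opens_in n U \<Longrightarrow> f \<in> carrier (reg n V) \<Longrightarrow> p \<in> V \<Longrightarrow> \<theta> V f p = \<eta> V f p"
  shows "\<theta> = \<eta>"
  by (rule vf_eqI[OF family_vf[OF assms(1,2)] family_vf[OF assms(1,3)] assms(4)])

lemma family_module:
  assumes U: "U \<in> opens n"
  shows "module (reg n U) (sec (subshf (tangent n) F) U)" (is "module _ ?M")
proof -
  have simps: "carrier ?M = F U" "(\<oplus>\<^bsub>?M\<^esub>) = (\<oplus>\<^bsub>sec (tangent n) U\<^esub>)"
    "\<zero>\<^bsub>?M\<^esub> = \<zero>\<^bsub>sec (tangent n) U\<^esub>" "(\<odot>\<^bsub>?M\<^esub>) = (\<odot>\<^bsub>sec (tangent n) U\<^esub>)"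
    by (simp_all add: sec_subshf)
  note cl = family_zero[OF U] family_add[OF U] family_smult[OF U]
  have sub: "p \<in> V \<Longrightarrow> V \<in> opens_in n U \<Longrightarrow> p \<in> U" for p V by (auto simp: opens_in_def)
  show ?thesis
  proof (rule moduleI; (unfold simps)?)
    show "cring (reg n U)" by (rule reg_cring[OF U])
    show "abelian_group ?M"
    proof (rule abelian_groupI; (unfold simps)?)
      fix x y z assume x: "x \<in> F U" and y: "y \<in> F U" and z: "z \<in> F U"
      show "x \<oplus>\<^bsub>sec (tangent n) U\<^esub> y \<oplus>\<^bsub>sec (tangent n) U\<^esub> z = x \<oplus>\<^bsub>sec (tangent n) U\<^esub> (y \<oplus>\<^bsub>sec (tangent n) U\<^esub> z)"
        by (rule family_eqI[OF U]) (simp_all add: cl x y z, simp add: tangent_add)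
    next
      fix x y assume x: "x \<in> F U" and y: "y \<in> F U"
      show "x \<oplus>\<^bsub>sec (tangent n) U\<^esub> y \<in> F U" by (intro cl x y)
      show "x \<oplus>\<^bsub>sec (tangent n) U\<^esub> y = y \<oplus>\<^bsub>sec (tangent n) U\<^esub> x"
        by (rule family_eqI[OF U]) (simp_all add: cl x y, simp add: tangent_add)
    next
      fix x assume x: "x \<in> F U"
      show "\<zero>\<^bsub>sec (tangent n) U\<^esub> \<oplus>\<^bsub>sec (tangent n) U\<^esub> x = x"
        by (rule family_eqI[OF U]) (simp_all add: cl x, simp add: tangent_add tangent_zero)
      have m1: "(\<lambda>p\<in>U. -1) \<odot>\<^bsub>sec (tangent n) U\<^esub> x \<in> F U" by (intro cl x reg_const U)
      have "(\<lambda>p\<in>U. -1) \<odot>\<^bsub>sec (tangent n) U\<^esub> x \<oplus>\<^bsub>sec (tangent n) U\<^esub> x = \<zero>\<^bsub>sec (tangent n) U\<^esub>"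
        by (rule family_eqI[OF U]) (simp_all add: cl x m1, simp add: tangent_add tangent_smult tangent_zero sub)
      then show "\<exists>y\<in>F U. y \<oplus>\<^bsub>sec (tangent n) U\<^esub> x = \<zero>\<^bsub>sec (tangent n) U\<^esub>" using m1 by blast
    qed (rule cl)
  next
    fix a x assume a: "a \<in> carrier (reg n U)" and x: "x \<in> F U"
    show "a \<odot>\<^bsub>sec (tangent n) U\<^esub> x \<in> F U" by (intro cl a x)
  next
    fix x assume x: "x \<in> F U"
    have "\<one>\<^bsub>reg n U\<^esub> \<in> carrier (reg n U)" using reg_const[OF U] by (simp add: reg_simps)
    then show "\<one>\<^bsub>reg n U\<^esub> \<odot>\<^bsub>sec (tangent n) U\<^esub> x = x"
      by (intro family_eqI[OF U]) (simp_all add: cl x, simp add: tangent_smult reg_simps sub)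
  next
    fix a b x assume a: "a \<in> carrier (reg n U)" and b: "b \<in> carrier (reg n U)" and x: "x \<in> F U"
    have ab: "a \<oplus>\<^bsub>reg n U\<^esub> b \<in> carrier (reg n U)" "a \<otimes>\<^bsub>reg n U\<^esub> b \<in> carrier (reg n U)"
      using reg_add[OF U a b] reg_mult[OF U a b] by (simp_all add: reg_simps)
    show "(a \<oplus>\<^bsub>reg n U\<^esub> b) \<odot>\<^bsub>sec (tangent n) U\<^esub> x =
        a \<odot>\<^bsub>sec (tangent n) U\<^esub> x \<oplus>\<^bsub>sec (tangent n) U\<^esub> b \<odot>\<^bsub>sec (tangent n) U\<^esub> x"
      by (intro family_eqI[OF U])
        (simp_all add: cl x a b ab, simp add: tangent_smult tangent_add reg_simps sub algebra_simps)
    show "(a \<otimes>\<^bsub>reg n U\<^esub> b) \<odot>\<^bsub>sec (tangent n) U\<^esub> x =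
        a \<odot>\<^bsub>sec (tangent n) U\<^esub> (b \<odot>\<^bsub>sec (tangent n) U\<^esub> x)"
      by (intro family_eqI[OF U])
        (simp_all add: cl x a b ab, simp add: tangent_smult tangent_add reg_simps sub algebra_simps)
  next
    fix a x y assume a: "a \<in> carrier (reg n U)" and x: "x \<in> F U" and y: "y \<in> F U"
    show "a \<odot>\<^bsub>sec (tangent n) U\<^esub> (x \<oplus>\<^bsub>sec (tangent n) U\<^esub> y) =
        a \<odot>\<^bsub>sec (tangent n) U\<^esub> x \<oplus>\<^bsub>sec (tangent n) U\<^esub> a \<odot>\<^bsub>sec (tangent n) U\<^esub> y"
      by (intro family_eqI[OF U]) (simp_all add: cl x y a, simp add: tangent_smult tangent_add algebra_simps)
  qed
qed

text \<open>A function on \<open>V\<close> cannot be differentiated on all of \<open>V\<close> at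
  once, since no member of the cover need contain \<open>V\<close>. The value at \<open>p\<close> is
  computed on \<open>V \<inter> U\<close> for some member \<open>U\<close> containing
  \<open>p\<close>, and agreement on overlaps makes the choice of \<open>U\<close>
  immaterial.\<close>

lemma vf_glue:
  assumes \<U>: "\<U> \<subseteq> opens n"
    and \<sigma>: "\<And>U. U \<in> \<U> \<Longrightarrow> \<sigma> U \<in> vf n U"
    and compat: "\<And>U V. U \<in> \<U> \<Longrightarrow> V \<in> \<U> \<Longrightarrow>
      restrict (\<sigma> U) (opens_in n (U \<inter> V)) = restrict (\<sigma> V) (opens_in n (U \<inter> V))"
  shows "\<exists>t\<in>vf n (\<Union>\<U>). \<forall>U\<in>\<U>. restrict t (opens_in n U) = \<sigma> U"
proof -
  have agree: "\<sigma> U W f p = \<sigma> U' W f p" if "U \<in> \<U>" "U' \<in> \<U>" "W \<in> opens_in n U" "W \<in> opens_in n U'" for U U' W f p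
  proof -
    have "W \<in> opens_in n (U \<inter> U')" using that by (auto simp: opens_in_def)
    then have "\<sigma> U W = \<sigma> U' W" using compat[OF that(1,2)] by (metis restrict_apply')
    then show ?thesis by simp
  qed
  define u where "u p = (SOME U. U \<in> \<U> \<and> p \<in> U)" for p
  define t where "t V f p = \<sigma> (u p) (V \<inter> u p) (restrict f (V \<inter> u p)) p" for V f p
  have u: "u p \<in> \<U>" "p \<in> u p" if "U \<in> \<U>" "p \<in> U" for U p
    using someI[of "\<lambda>U. U \<in> \<U> \<and> p \<in> U" U] that unfolding u_def by blast+
  have inter: "V \<inter> U \<in> opens_in n U" "V \<inter> U \<in> opens_in n V" if "V \<in> opens n" "U \<in> opens n" for V U
    using opens_Int[OF that] by (auto simp: opens_in_def)
  \<comment> \<open>The chosen member and \<open>U\<close> are compared on the intersection of both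
    with \<open>V\<close>, where they act on the same restricted function.\<close>
  have t: "t V f p = \<sigma> U (V \<inter> U) (restrict f (V \<inter> U)) p"
    if V: "V \<in> opens n" and f: "f \<in> carrier (reg n V)" and U: "U \<in> \<U>" and p: "p \<in> V" "p \<in> U" for V f p U
  proof -
    let ?U = "u p" and ?W = "V \<inter> U \<inter> u p"
    note up = u[OF U p(2)]
    have op: "U \<in> opens n" "?U \<in> opens n" using \<U> U up by auto
    have W: "?W \<in> opens n" by (intro opens_Int V op)
    have W1: "?W \<in> opens_in n (V \<inter> U)" "?W \<in> opens_in n (V \<inter> ?U)" "?W \<in> opens_in n U" "?W \<in> opens_in n ?U"
      using W by (auto simp: opens_in_def)
    have r: "restrict (restrict f (V \<inter> U)) ?W = restrict f ?W" "restrict (restrict f (V \<inter> ?U)) ?W = restrict f ?W"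
      by (auto simp: fun_eq_iff)
    have "\<sigma> ?U ?W (restrict f ?W) p = \<sigma> ?U (V \<inter> ?U) (restrict f (V \<inter> ?U)) p"
      using vf_restrict_apply[OF \<sigma>[OF up(1)] inter(1)[OF V op(2)] W1(2) reg_restrict[OF f inter(2)[OF V op(2)]]]
        p up unfolding r by simp
    moreover have "\<sigma> U ?W (restrict f ?W) p = \<sigma> U (V \<inter> U) (restrict f (V \<inter> U)) p"
      using vf_restrict_apply[OF \<sigma>[OF U] inter(1)[OF V op(1)] W1(1) reg_restrict[OF f inter(2)[OF V op(1)]]]
        p up unfolding r by simp
    ultimately show ?thesis unfolding t_def using agree[OF up(1) U W1(4,3)] by simp
  qed
  let ?t = "\<lambda>V\<in>opens_in n (\<Union>\<U>). \<lambda>f\<in>carrier (reg n V). \<lambda>p\<in>V. t V f p"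
  have cover: "\<exists>U\<in>\<U>. p \<in> U" if "V \<in> opens_in n (\<Union>\<U>)" "p \<in> V" for V p
    using that by (auto simp: opens_in_def)
  have "?t \<in> vf n (\<Union>\<U>)"
  proof (rule vfI)
    fix V f assume V: "V \<in> opens_in n (\<Union>\<U>)" and f: "f \<in> carrier (reg n V)"
    have op: "V \<in> opens n" using V by (simp add: opens_in_def)
    show "(\<lambda>p\<in>V. t V f p) \<in> carrier (reg n V)"
    proof (rule reg_restrictI[OF op], rule lquot_local)
      fix p assume p: "p \<in> V"
      then obtain U where U: "U \<in> \<U>" "p \<in> U" using cover[OF V] by blast
      have opU: "U \<in> opens n" using \<U> U by auto
      have "lquot n 0 (V \<inter> U) (\<lambda>x. \<sigma> U (V \<inter> U) (restrict f (V \<inter> U)) (hclass x))"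
        by (intro reg_lquot vf_closed[OF \<sigma>[OF U(1)]] inter op opU reg_restrict[OF f])
      then have "lquot n 0 (V \<inter> U) (\<lambda>x. t V f (hclass x))"
      proof (rule lquot_cong)
        fix x assume "x \<in> \<Union>(V \<inter> U)"
        then have "hclass x \<in> V \<inter> U" by (rule hclass_mem[OF opens_Int[OF op opU]])
        then show "\<sigma> U (V \<inter> U) (restrict f (V \<inter> U)) (hclass x) = t V f (hclass x)" using t[OF op f U(1)] by simp
      qed
      then show "\<exists>W\<in>opens_in n V. p \<in> W \<and> lquot n 0 W (\<lambda>x. t V f (hclass x))"
        using p U inter[OF op opU] by blast
    qed
  next
    fix V f g p assume V: "V \<in> opens_in n (\<Union>\<U>)" and f: "f \<in> carrier (reg n V)" and g: "g \<in> carrier (reg n V)" and p: "p \<in> V"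
    have op: "V \<in> opens n" using V by (simp add: opens_in_def)
    obtain U where U: "U \<in> \<U>" "p \<in> U" using cover[OF V p] by blast
    have opU: "U \<in> opens n" using \<U> U by auto
    note I = inter[OF op opU]
    note fr = reg_restrict[OF f I(2)] and gr = reg_restrict[OF g I(2)]
    note tt = t[OF op _ U(1) p U(2)]
    have "restrict (\<lambda>p\<in>V. f p + g p) (V \<inter> U) = (\<lambda>p\<in>V \<inter> U. restrict f (V \<inter> U) p + restrict g (V \<inter> U) p)"
      by (auto simp: fun_eq_iff)
    then show "t V (\<lambda>p\<in>V. f p + g p) p = t V f p + t V g p"
      using vf_add_apply[OF \<sigma>[OF U(1)] I(1) fr gr, of p] p U(2) tt[OF reg_add[OF op f g]] tt[OF f] tt[OF g] by simp
    have "restrict (\<lambda>p\<in>V. f p * g p) (V \<inter> U) = (\<lambda>p\<in>V \<inter> U. restrict f (V \<inter> U) p * restrict g (V \<inter> U) p)"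
      by (auto simp: fun_eq_iff)
    then show "t V (\<lambda>p\<in>V. f p * g p) p = f p * t V g p + g p * t V f p"
      using vf_mult_apply[OF \<sigma>[OF U(1)] I(1) fr gr, of p] p U(2) tt[OF reg_mult[OF op f g]] tt[OF f] tt[OF g] by simp
  next
    fix V p and c :: complex assume V: "V \<in> opens_in n (\<Union>\<U>)" and p: "p \<in> V"
    have op: "V \<in> opens n" using V by (simp add: opens_in_def)
    obtain U where U: "U \<in> \<U>" "p \<in> U" using cover[OF V p] by blast
    have opU: "U \<in> opens n" using \<U> U by auto
    have "restrict (\<lambda>p\<in>V. c) (V \<inter> U) = (\<lambda>p\<in>V \<inter> U. c)" by (auto simp: fun_eq_iff)
    then show "t V (\<lambda>p\<in>V. c) p = 0"
      using vf_const_apply[OF \<sigma>[OF U(1)] inter(1)[OF op opU], of p c] p U(2) t[OF op reg_const[OF op] U(1) p U(2)] by simp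
  next
    fix V W f p assume V: "V \<in> opens_in n (\<Union>\<U>)" and W: "W \<in> opens_in n V" and f: "f \<in> carrier (reg n V)" and p: "p \<in> W"
    have op: "V \<in> opens n" "W \<in> opens n" and WV: "W \<subseteq> V" using V W by (auto simp: opens_in_def)
    have pV: "p \<in> V" using p WV by blast
    obtain U where U: "U \<in> \<U>" "p \<in> U" using cover[OF V pV] by blast
    have opU: "U \<in> opens n" using \<U> U by auto
    have WU: "W \<inter> U \<in> opens_in n (V \<inter> U)" using opens_Int[OF op(2) opU] WV by (auto simp: opens_in_def)
    have r: "restrict (restrict f (V \<inter> U)) (W \<inter> U) = restrict (restrict f W) (W \<inter> U)"
      using WV by (auto simp: fun_eq_iff)
    have "\<sigma> U (W \<inter> U) (restrict (restrict f W) (W \<inter> U)) p = \<sigma> U (V \<inter> U) (restrict f (V \<inter> U)) p"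
      using vf_restrict_apply[OF \<sigma>[OF U(1)] inter(1)[OF op(1) opU] WU reg_restrict[OF f inter(2)[OF op(1) opU]], of p]
        p U(2) unfolding r by simp
    then show "t W (restrict f W) p = t V f p"
      using t[OF op(2) reg_restrict[OF f W] U(1) p U(2)] t[OF op(1) f U(1) pV U(2)] by simp
  qed
  moreover have "restrict ?t (opens_in n U) = \<sigma> U" if U: "U \<in> \<U>" for U
  proof (rule vf_eqI[OF _ \<sigma>[OF U]])
    have UU: "U \<in> opens_in n (\<Union>\<U>)" using \<U> U by (auto simp: opens_in_def)
    with \<open>?t \<in> vf n (\<Union>\<U>)\<close> show "restrict ?t (opens_in n U) \<in> vf n U" by (rule vf_rst_closed)
    fix V f p assume V: "V \<in> opens_in n U" and f: "f \<in> carrier (reg n V)" and p: "p \<in> V"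
    have "V \<in> opens_in n (\<Union>\<U>)" using V UU by (rule opens_in_trans)
    moreover have "V \<inter> U = V" "V \<in> opens n" using V by (auto simp: opens_in_def)
    moreover have "restrict f V = f" using reg_extensional[OF f] by (rule extensional_restrict)
    ultimately show "restrict ?t (opens_in n U) V f p = \<sigma> U V f p"
      using t[OF _ f U p] V f p by (auto simp: opens_in_def)
  qed
  ultimately show ?thesis by blast
qed

lemma family_sheaf: "sheaf_of_modules n (subshf (tangent n) F)"
proof (rule sheaf_of_modules.intro)
  fix U assume U: "U \<in> opens n"
  show "module (reg n U) (sec (subshf (tangent n) F) U)" by (rule family_module[OF U])
next
  fix U V s assume U: "U \<in> opens n" and V: "V \<in> opens_in n U" and "s \<in> carrier (sec (subshf (tangent n) F) U)"
  then have s: "s \<in> F U" by (simp add: sec_subshf)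
  show "rst (subshf (tangent n) F) U V s \<in> carrier (sec (subshf (tangent n) F) V)"
    using family_rst[OF U V s] by (simp add: sec_subshf rst_subshf rst_tangent)
next
  fix U V s t assume "U \<in> opens n" and V: "V \<in> opens_in n U"
    and "s \<in> carrier (sec (subshf (tangent n) F) U)" and "t \<in> carrier (sec (subshf (tangent n) F) U)"
  show "rst (subshf (tangent n) F) U V (s \<oplus>\<^bsub>sec (subshf (tangent n) F) U\<^esub> t) =
      rst (subshf (tangent n) F) U V s \<oplus>\<^bsub>sec (subshf (tangent n) F) V\<^esub> rst (subshf (tangent n) F) U V t"
    using opens_in_trans[OF _ V] by (auto simp: sec_subshf rst_subshf rst_tangent tangent_add fun_eq_iff)
next
  fix U V f s assume "U \<in> opens n" and V: "V \<in> opens_in n U"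
    and "f \<in> carrier (reg n U)" and "s \<in> carrier (sec (subshf (tangent n) F) U)"
  show "rst (subshf (tangent n) F) U V (f \<odot>\<^bsub>sec (subshf (tangent n) F) U\<^esub> s) =
      restrict f V \<odot>\<^bsub>sec (subshf (tangent n) F) V\<^esub> rst (subshf (tangent n) F) U V s"
    using opens_in_trans[OF _ V]
    by (auto simp: sec_subshf rst_subshf rst_tangent tangent_smult fun_eq_iff opens_in_def)
next
  fix U V W s assume "U \<in> opens n" and "V \<in> opens_in n U" and W: "W \<in> opens_in n V"
    and "s \<in> carrier (sec (subshf (tangent n) F) U)"
  show "rst (subshf (tangent n) F) V W (rst (subshf (tangent n) F) U V s) = rst (subshf (tangent n) F) U W s"
    using opens_in_trans[OF _ W] by (auto simp: rst_subshf rst_tangent fun_eq_iff)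
next
  fix U s assume U: "U \<in> opens n" and "s \<in> carrier (sec (subshf (tangent n) F) U)"
  then have "s \<in> vf n U" using family_vf by (simp add: sec_subshf)
  then have "s \<in> extensional (opens_in n U)" by (auto simp: vf_iff PiE_def)
  then show "rst (subshf (tangent n) F) U U s = s" by (simp add: rst_subshf rst_tangent extensional_restrict)
next
  fix \<U> \<sigma> assume \<U>: "\<U> \<subseteq> opens n"
    and "\<And>U. U \<in> \<U> \<Longrightarrow> \<sigma> U \<in> carrier (sec (subshf (tangent n) F) U)"
    and "\<And>U V. U \<in> \<U> \<Longrightarrow> V \<in> \<U> \<Longrightarrow>
      rst (subshf (tangent n) F) U (U \<inter> V) (\<sigma> U) = rst (subshf (tangent n) F) V (U \<inter> V) (\<sigma> V)"
  then have \<sigma>F: "\<And>U. U \<in> \<U> \<Longrightarrow> \<sigma> U \<in> F U"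
    and compat: "\<And>U V. U \<in> \<U> \<Longrightarrow> V \<in> \<U> \<Longrightarrow> restrict (\<sigma> U) (opens_in n (U \<inter> V)) = restrict (\<sigma> V) (opens_in n (U \<inter> V))"
    by (simp_all add: sec_subshf rst_subshf rst_tangent)
  have op: "\<Union>\<U> \<in> opens n" using \<U> by (rule opens_Union)
  have "\<sigma> U \<in> vf n U" if "U \<in> \<U>" for U using family_vf[OF _ \<sigma>F[OF that]] \<U> that by blast
  from vf_glue[OF \<U> this compat] obtain t where
    t: "t \<in> vf n (\<Union>\<U>)" "\<And>U. U \<in> \<U> \<Longrightarrow> restrict t (opens_in n U) = \<sigma> U" by blast
  \<comment> \<open>Gluing yields a vector field; it is locality that puts it into the
    family.\<close>
  have "t \<in> F (\<Union>\<U>)"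
  proof (rule family_local[OF op t(1)])
    fix p assume "p \<in> \<Union>\<U>"
    then obtain U where U: "U \<in> \<U>" "p \<in> U" by blast
    then have "U \<in> opens_in n (\<Union>\<U>)" using \<U> by (auto simp: opens_in_def)
    then show "\<exists>V\<in>opens_in n (\<Union>\<U>). p \<in> V \<and> restrict t (opens_in n V) \<in> F V" using t(2) \<sigma>F U by metis
  qed
  moreover have "t' = t" if t': "t' \<in> F (\<Union>\<U>)" "\<And>U. U \<in> \<U> \<Longrightarrow> restrict t' (opens_in n U) = \<sigma> U" for t'
  proof (rule vf_eqI[OF family_vf[OF op t'(1)] t(1)])
    fix V f p assume V: "V \<in> opens_in n (\<Union>\<U>)" and f: "f \<in> carrier (reg n V)" and p: "p \<in> V"
    then obtain U where U: "U \<in> \<U>" "p \<in> U" by (auto simp: opens_in_def)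
    have "V \<inter> U \<in> opens n" using opens_Int U \<U> V by (auto simp: opens_in_def)
    then have W: "V \<inter> U \<in> opens_in n V" "V \<inter> U \<in> opens_in n U" by (auto simp: opens_in_def)
    have "t' (V \<inter> U) = t (V \<inter> U)" using t'(2)[OF U(1)] t(2)[OF U(1)] W(2) by (metis restrict_apply')
    moreover have "t' (V \<inter> U) (restrict f (V \<inter> U)) p = t' V f p"
      using vf_restrict_apply[OF family_vf[OF op t'(1)] V W(1) f] p U by blast
    moreover have "t (V \<inter> U) (restrict f (V \<inter> U)) p = t V f p"
      using vf_restrict_apply[OF t(1) V W(1) f] p U by blast
    ultimately show "t' V f p = t V f p" by simp
  qed
  ultimately have "\<exists>!t. t \<in> F (\<Union>\<U>) \<and> (\<forall>U\<in>\<U>. restrict t (opens_in n U) = \<sigma> U)"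
    using t(2) by (intro ex1I[of _ t]) blast+
  then show "\<exists>!t. t \<in> carrier (sec (subshf (tangent n) F) (\<Union>\<U>)) \<and>
      (\<forall>U\<in>\<U>. rst (subshf (tangent n) F) (\<Union>\<U>) U t = \<sigma> U)"
    by (simp add: sec_subshf rst_subshf rst_tangent)
qed

lemma family_finsum_apply:
  assumes U: "U \<in> opens n" and A: "finite A" "\<And>i. i \<in> A \<Longrightarrow> \<phi> i \<in> F U"
    and V: "V \<in> opens_in n U" "f \<in> carrier (reg n V)" "p \<in> V"
  shows "(\<Oplus>\<^bsub>sec (subshf (tangent n) F) U\<^esub>i\<in>A. \<phi> i) V f p = (\<Sum>i\<in>A. \<phi> i V f p)"
proof -
  interpret module "reg n U" "sec (subshf (tangent n) F) U" by (rule family_module[OF U])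
  have carr: "carrier (sec (subshf (tangent n) F) U) = F U" by (simp add: sec_subshf)
  show ?thesis using A
  proof (induction A rule: finite_induct)
    case empty
    show ?case using V by (simp add: M.finsum_empty) (simp add: sec_subshf tangent_zero)
  next
    case (insert i A)
    have "(\<Oplus>\<^bsub>sec (subshf (tangent n) F) U\<^esub>j\<in>insert i A. \<phi> j) =
        \<phi> i \<oplus>\<^bsub>sec (subshf (tangent n) F) U\<^esub> (\<Oplus>\<^bsub>sec (subshf (tangent n) F) U\<^esub>j\<in>A. \<phi> j)"
      using insert by (intro M.finsum_insert) (auto simp: carr)
    moreover have "(\<phi> i \<oplus>\<^bsub>sec (subshf (tangent n) F) U\<^esub> (\<Oplus>\<^bsub>sec (subshf (tangent n) F) U\<^esub>j\<in>A. \<phi> j)) V f p = \<phi> i V f p + (\<Sum>j\<in>A. \<phi> j V f p)"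
      using insert V by (simp add: sec_subshf tangent_add)
    ultimately show ?case using insert by simp
  qed
qed

lemma family_finsum_closed:
  assumes U: "U \<in> opens n" and A: "finite A" "\<And>i. i \<in> A \<Longrightarrow> \<phi> i \<in> F U"
  shows "(\<Oplus>\<^bsub>sec (subshf (tangent n) F) U\<^esub>i\<in>A. \<phi> i) \<in> F U"
proof -
  interpret module "reg n U" "sec (subshf (tangent n) F) U" by (rule family_module[OF U])
  have carr: "carrier (sec (subshf (tangent n) F) U) = F U" by (simp add: sec_subshf)
  show ?thesis using M.finsum_closed[of \<phi> A] A by (auto simp: carr)
qed

text \<open>If \<open>s\<close> is nonzero, some \<open>s V g\<close> is nonzero at a point. A point
  of \<open>V\<close> where \<open>f\<close> is nonzero would have a neighbourhood on which
  \<open>s V g\<close> vanishes, and the identity principle would give \<open>s V g = 0\<close> on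
  \<open>V\<close>. So \<open>f\<close> vanishes on \<open>V\<close>, and therefore on
  \<open>U\<close>.\<close>

lemma family_torsion_free: "torsion_free n (subshf (tangent n) F)"
  unfolding torsion_free_def
proof (intro ballI impI)
  fix U f s assume U: "U \<in> opens n" and f: "f \<in> carrier (reg n U)"
    and "s \<in> carrier (sec (subshf (tangent n) F) U)"
    and eq: "f \<odot>\<^bsub>sec (subshf (tangent n) F) U\<^esub> s = \<zero>\<^bsub>sec (subshf (tangent n) F) U\<^esub>"
  then have s: "s \<in> vf n U" using family_vf by (simp add: sec_subshf)
  have fs: "f p * s V g p = 0" if "V \<in> opens_in n U" "g \<in> carrier (reg n V)" "p \<in> V" for V g p
  proof -
    have "(f \<odot>\<^bsub>sec (tangent n) U\<^esub> s) V g p = \<zero>\<^bsub>sec (tangent n) U\<^esub> V g p" using eq by (simp add: sec_subshf)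
    then show ?thesis using that by (simp add: tangent_smult tangent_zero)
  qed
  show "f = \<zero>\<^bsub>reg n U\<^esub> \<or> s = \<zero>\<^bsub>sec (subshf (tangent n) F) U\<^esub>"
  proof (rule disjCI)
    assume "s \<noteq> \<zero>\<^bsub>sec (subshf (tangent n) F) U\<^esub>"
    then have "s \<noteq> \<zero>\<^bsub>sec (tangent n) U\<^esub>" by (simp add: sec_subshf)
    then have "\<not> (\<forall>V g p. V \<in> opens_in n U \<longrightarrow> g \<in> carrier (reg n V) \<longrightarrow> p \<in> V \<longrightarrow> s V g p = \<zero>\<^bsub>sec (tangent n) U\<^esub> V g p)"
      using vf_eqI[OF s vf_zero_closed] by blast
    then obtain V g p where V: "V \<in> opens_in n U" "g \<in> carrier (reg n V)" "p \<in> V" "s V g p \<noteq> 0"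
      by (auto simp: tangent_zero)
    have op: "V \<in> opens n" using V by (simp add: opens_in_def)
    have "f q = 0" if q: "q \<in> V" for q
    proof (rule ccontr)
      assume "f q \<noteq> 0"
      obtain x where x: "x \<in> \<Union>V" "q = hclass x" using cone_obtain[OF op q] .
      have "lquot n 0 V (\<lambda>x. f (hclass x))" by (rule lquot_restrict[OF reg_lquot[OF f] V(1)])
      from this q obtain W a b u h where W: "W \<in> opens_in n V" "q \<in> W" "int a - int b = 0" "u \<in> hpoly n a" "h \<in> hpoly n b"
        "\<forall>x\<in>\<Union>W. h x \<noteq> 0 \<and> f (hclass x) = u x / h x" by (rule lquotE)
      have opW: "W \<in> opens n" using W by (simp add: opens_in_def)
      have xW: "x \<in> \<Union>W" "x \<in> vecs n" using W(2) x mem_hclass[of x] mem_cone[OF op] by auto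
      have "u x \<noteq> 0" using W(6) xW(1) \<open>f q \<noteq> 0\<close> x by fastforce
      let ?W = "W \<inter> basic_open n u"
      have W': "?W \<in> opens_in n V" using opens_Int[OF opW basic_open_opens[OF W(4)]] W(1) by (auto simp: opens_in_def)
      have "q \<in> ?W" using mem_basic_open[OF W(4) xW(2)] \<open>u x \<noteq> 0\<close> W(2) x by simp
      have "s V g r = 0" if r: "r \<in> ?W" for r
      proof -
        obtain y where y: "y \<in> vecs n" "r = hclass y" "u y \<noteq> 0" using r by (auto simp: basic_open_def)
        then have "y \<in> \<Union>W" using r mem_hclass by blast
        then have "f r \<noteq> 0" using W(6) y by fastforce
        then show ?thesis using fs[OF V(1,2), of r] r W(1) by (auto simp: opens_in_def)
      qed
      then have "s V g p = 0"
        using \<open>q \<in> ?W\<close> by (intro reg_identity[OF vf_closed[OF s V(1,2)] op W' _ _ V(3)]) auto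
      then show False using V(4) by simp
    qed
    then have "f q = 0" if "q \<in> U" for q
      using V(3) by (intro reg_identity[OF f U V(1) _ _ that]) auto
    then show "f = \<zero>\<^bsub>reg n U\<^esub>"
      using reg_extensional[OF f] by (auto simp: reg_simps extensional_def fun_eq_iff)
  qed
qed

end


section \<open>Coherence\<close>

text \<open>The affine coordinate \<open>x\<^sub>j / x\<^sub>l\<close> of a point, with the junk value \<open>0\<close> where \<open>x\<^sub>l = 0\<close>.\<close>

definition aff :: "nat \<Rightarrow> nat \<Rightarrow> pt \<Rightarrow> complex"
  where "aff l j p = (SOME x. x \<in> p) j / (SOME x. x \<in> p) l"

lemma aff_apply: "aff l j (hclass x) = x j / x l"
proof -
  have "(SOME y. y \<in> hclass x) \<in> hclass x" by (rule someI[of "\<lambda>y. y \<in> hclass x" x], rule mem_hclass)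
  then obtain c where c: "c \<noteq> 0" "(SOME y. y \<in> hclass x) = (\<lambda>i. c * x i)"
    unfolding hclass_def[of x] mem_Collect_eq by metis
  show ?thesis unfolding aff_def c(2) using c(1) by simp
qed

definition chart :: "nat \<Rightarrow> nat \<Rightarrow> pt set"
  where "chart n l = basic_open n (\<lambda>x. x l)"

lemma chart_opens: "l \<le> n \<Longrightarrow> chart n l \<in> opens n"
  unfolding chart_def by (rule basic_open_opens[OF hpoly_var])

lemma mem_chart: "l \<le> n \<Longrightarrow> x \<in> vecs n \<Longrightarrow> hclass x \<in> chart n l \<longleftrightarrow> x l \<noteq> 0"
  unfolding chart_def by (rule mem_basic_open[OF hpoly_var])

lemma chart_nonzero:
  assumes "l \<le> n" "V \<in> opens n" "V \<subseteq> chart n l" "x \<in> \<Union>V"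
  shows "x l \<noteq> 0"
proof -
  have "x \<in> vecs n" "hclass x \<in> V" using mem_cone[OF assms(2)] assms(4) by auto
  then show ?thesis using mem_chart[OF assms(1)] assms(3) by blast
qed

text \<open>A ring of functions on all of \<open>pt\<close>, with the junk values of
  \<open>aff\<close> off the chart. Being independent of any open set, it is a subset of one fixed
  ring type, as the basis theorem requires.\<close>

definition affine_ring :: "nat \<Rightarrow> nat \<Rightarrow> (pt \<Rightarrow> complex) set"
  where "affine_ring n l = alg_closure (range (\<lambda>c p. c)) (aff l ` {..<Suc n})"

lemma lquot_aff:
  assumes "l \<le> n" "j \<le> n" "V \<in> opens n" "V \<subseteq> chart n l"
  shows "lquot n 0 V (\<lambda>x. x j / x l)"
  using lquot_divide[OF lquot_var[OF assms(3,2)] lquot_var[OF assms(3,1)]] chart_nonzero[OF assms(1,3,4)] by simp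

lemma lquot_affine_ring:
  assumes "l \<le> n" "V \<in> opens n" "V \<subseteq> chart n l" "b \<in> affine_ring n l"
  shows "lquot n 0 V (\<lambda>x. b (hclass x))"
  using assms(4) unfolding affine_ring_def
proof induction
  case (alg_const c)
  then show ?case by (auto intro: lquot_const assms)
next
  case (alg_gen g)
  then show ?case using lquot_aff[OF assms(1) _ assms(2,3)] by (auto simp: aff_apply)
next
  case (alg_add x y)
  then show ?case by (simp add: lquot_add)
next
  case (alg_mult x y)
  then show ?case using lquot_mult[of n 0 V _ 0] by simp
qed

lemma affine_ring_reg:
  assumes "l \<le> n" "V \<in> opens n" "V \<subseteq> chart n l" "b \<in> affine_ring n l"
  shows "restrict b V \<in> carrier (reg n V)"
  using lquot_affine_ring[OF assms] by (rule reg_restrictI[OF assms(2)])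

text \<open>Dehomogenisation by \<open>x l\<close>. With the convention for division by zero, the
  identity holds off the chart as well and is proved without side conditions.\<close>

lemma hpoly_affine_ring:
  assumes "g \<in> hpoly n d"
  shows "\<exists>b\<in>affine_ring n l. \<forall>x. b (hclass x) = g x / x l ^ d"
  using assms
proof (induction rule: hpoly_induct)
  case (const c)
  have "(\<lambda>p. c) \<in> affine_ring n l" unfolding affine_ring_def by (rule alg_closure.alg_const) blast
  then show ?case by (intro bexI[of _ "\<lambda>p. c"]) auto
next
  case (var i d g)
  then obtain b where b: "b \<in> affine_ring n l" "\<And>x. b (hclass x) = g x / x l ^ d" by blast
  have "aff l i * b \<in> affine_ring n l"
    unfolding affine_ring_def
    by (rule alg_mult[OF alg_gen b(1)[unfolded affine_ring_def]]) (use var(1) in auto)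
  then show ?case using b(2) by (intro bexI[of _ "aff l i * b"]) (auto simp: aff_apply)
next
  case (add d f g)
  then obtain b where b: "b \<in> affine_ring n l" "\<And>x. b (hclass x) = f x / x l ^ d" by blast
  obtain c where c: "c \<in> affine_ring n l" "\<And>x. c (hclass x) = g x / x l ^ d" using add by blast
  have "b + c \<in> affine_ring n l" using b(1) c(1) unfolding affine_ring_def by (rule alg_add)
  then show ?case using b(2) c(2) by (intro bexI[of _ "b + c"]) (auto simp: add_divide_distrib)
qed

text \<open>With one form \<open>H\<close> under all components, multiplication by a single function
  clears the denominators of a whole relation.\<close>

lemma common_denominator:
  fixes t :: "nat \<Rightarrow> fn"
  assumes W: "W \<in> opens n" "p \<in> W" and t: "\<And>i. i < m \<Longrightarrow> t i \<in> carrier (reg n W)"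
  shows "\<exists>W'\<in>opens_in n W. p \<in> W' \<and> (\<exists>e H G. H \<in> hpoly n e \<and> (\<forall>i<m. G i \<in> hpoly n e) \<and>
    (\<forall>x\<in>\<Union>W'. H x \<noteq> 0 \<and> (\<forall>i<m. t i (hclass x) = G i x / H x)))"
  using t
proof (induction m)
  case 0
  then show ?case
    using W by (intro bexI[of _ W] conjI exI[of _ 0] exI[of _ "\<lambda>x. 1"]) (auto intro: hpoly_const opens_in_refl)
next
  case (Suc m)
  then obtain W' e H G where *: "W' \<in> opens_in n W" "p \<in> W'" "H \<in> hpoly n e" "\<And>i. i < m \<Longrightarrow> G i \<in> hpoly n e"
    "\<And>x. x \<in> \<Union>W' \<Longrightarrow> H x \<noteq> 0 \<and> (\<forall>i<m. t i (hclass x) = G i x / H x)" by (metis less_SucI)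
  from reg_lquot[OF Suc.prems[OF lessI]] W(2) obtain V a b g h where V: "V \<in> opens_in n W" "p \<in> V" "int a - int b = 0"
    "g \<in> hpoly n a" "h \<in> hpoly n b" "\<forall>x\<in>\<Union>V. h x \<noteq> 0 \<and> t m (hclass x) = g x / h x" by (rule lquotE)
  have ab: "a = b" using V(3) by simp
  define G' where "G' i = (if i < m then \<lambda>x. G i x * h x else (\<lambda>x. H x * g x))" for i
  have "V \<inter> W' \<in> opens_in n W" using opens_Int V(1) *(1) by (auto simp: opens_in_def)
  moreover have "(\<lambda>x. H x * h x) \<in> hpoly n (e + b)" by (rule hpoly_mult[OF *(3) V(5)])
  moreover have "G' i \<in> hpoly n (e + b)" if "i < Suc m" for i
    using hpoly_mult[OF *(4) V(5)] hpoly_mult[OF *(3) V(4)] unfolding G'_def ab by simp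
  moreover have "H x * h x \<noteq> 0 \<and> (\<forall>i<Suc m. t i (hclass x) = G' i x / (H x * h x))" if x: "x \<in> \<Union>(V \<inter> W')" for x
  proof -
    have 1: "h x \<noteq> 0" "t m (hclass x) = g x / h x" using V(6) x by blast+
    have 2: "H x \<noteq> 0" "\<And>i. i < m \<Longrightarrow> t i (hclass x) = G i x / H x" using *(5)[of x] x by blast+
    show ?thesis using 1 2 by (auto simp: G'_def less_Suc_eq)
  qed
  ultimately show ?case using V(2) *(2) by (intro bexI[of _ "V \<inter> W'"]) blast+
qed

lemma relations_simps:
  "(\<oplus>\<^bsub>sec (relations n E U m s) V\<^esub>) = (\<lambda>a b. \<lambda>i\<in>{..<m}. \<lambda>p\<in>V. a i p + b i p)"
  "\<zero>\<^bsub>sec (relations n E U m s) V\<^esub> = (\<lambda>i\<in>{..<m}. \<lambda>p\<in>V. 0)"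
  "(\<odot>\<^bsub>sec (relations n E U m s) V\<^esub>) = (\<lambda>f a. \<lambda>i\<in>{..<m}. \<lambda>p\<in>V. f p * a i p)"
  "rst (relations n E U m s) V W = (\<lambda>a. \<lambda>i\<in>{..<m}. restrict (a i) W)"
  by (simp_all add: relations_def reg_simps)

context
  fixes n F
  assumes F: "vf_family n F"
begin

context
  fixes U m s
  assumes U: "U \<in> opens n" and s: "\<And>i. i < (m::nat) \<Longrightarrow> s i \<in> F U"
begin

text \<open>Testing a relation on functions and points turns it into linear equations between
  complex numbers, which can be multiplied, restricted and continued by the identity
  principle.\<close>

lemma relations_iff:
  assumes V: "V \<in> opens_in n U"
  shows "a \<in> carrier (sec (relations n (subshf (tangent n) F) U m s) V) \<longleftrightarrow>
    a \<in> {..<m} \<rightarrow>\<^sub>E carrier (reg n V) \<and>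
    (\<forall>W\<in>opens_in n V. \<forall>f\<in>carrier (reg n W). \<forall>p\<in>W. (\<Sum>i<m. a i p * s i W f p) = 0)"
proof -
  let ?E = "subshf (tangent n) F"
  let ?\<phi> = "\<lambda>i. a i \<odot>\<^bsub>sec ?E V\<^esub> rst ?E U V (s i)"
  have op: "V \<in> opens n" using V by (simp add: opens_in_def)
  have "(\<Oplus>\<^bsub>sec ?E V\<^esub>i\<in>{..<m}. ?\<phi> i) = \<zero>\<^bsub>sec ?E V\<^esub> \<longleftrightarrow>
      (\<forall>W\<in>opens_in n V. \<forall>f\<in>carrier (reg n W). \<forall>p\<in>W. (\<Sum>i<m. a i p * s i W f p) = 0)"
    if a: "a \<in> {..<m} \<rightarrow>\<^sub>E carrier (reg n V)"
  proof -
    have \<phi>: "?\<phi> i \<in> F V" if "i \<in> {..<m}" for i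
    proof -
      have "a i \<in> carrier (reg n V)" using a that by blast
      moreover have "restrict (s i) (opens_in n V) \<in> F V" by (rule family_rst[OF F U V s]) (use that in simp)
      ultimately show ?thesis using family_smult[OF F op] by (simp add: sec_subshf rst_subshf rst_tangent)
    qed
    have eval: "(\<Oplus>\<^bsub>sec ?E V\<^esub>i\<in>{..<m}. ?\<phi> i) W f p = (\<Sum>i<m. a i p * s i W f p)"
      if "W \<in> opens_in n V" "f \<in> carrier (reg n W)" "p \<in> W" for W f p
    proof -
      have "(\<Oplus>\<^bsub>sec ?E V\<^esub>i\<in>{..<m}. ?\<phi> i) W f p = (\<Sum>i<m. ?\<phi> i W f p)"
        by (rule family_finsum_apply[OF F op finite_lessThan \<phi> that])
      also have "\<dots> = (\<Sum>i<m. a i p * s i W f p)"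
        using that by (intro sum.cong refl) (simp add: sec_subshf rst_subshf rst_tangent tangent_smult)
      finally show ?thesis .
    qed
    have z: "\<zero>\<^bsub>sec ?E V\<^esub> W f p = 0" if "W \<in> opens_in n V" "f \<in> carrier (reg n W)" "p \<in> W" for W f p
      using that by (simp add: sec_subshf tangent_zero)
    show ?thesis
    proof
      assume eq: "(\<Oplus>\<^bsub>sec ?E V\<^esub>i\<in>{..<m}. ?\<phi> i) = \<zero>\<^bsub>sec ?E V\<^esub>"
      show "\<forall>W\<in>opens_in n V. \<forall>f\<in>carrier (reg n W). \<forall>p\<in>W. (\<Sum>i<m. a i p * s i W f p) = 0"
      proof (intro ballI)
        fix W f p assume w: "W \<in> opens_in n V" "f \<in> carrier (reg n W)" "p \<in> W"
        show "(\<Sum>i<m. a i p * s i W f p) = 0"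
          unfolding eval[OF w, symmetric] eq by (rule z[OF w])
      qed
    next
      assume *: "\<forall>W\<in>opens_in n V. \<forall>f\<in>carrier (reg n W). \<forall>p\<in>W. (\<Sum>i<m. a i p * s i W f p) = 0"
      show "(\<Oplus>\<^bsub>sec ?E V\<^esub>i\<in>{..<m}. ?\<phi> i) = \<zero>\<^bsub>sec ?E V\<^esub>"
      proof (rule family_eqI[OF F op])
        show "(\<Oplus>\<^bsub>sec ?E V\<^esub>i\<in>{..<m}. ?\<phi> i) \<in> F V" by (rule family_finsum_closed[OF F op _ \<phi>]) simp_all
        show "\<zero>\<^bsub>sec ?E V\<^esub> \<in> F V" using family_zero[OF F op] by (simp add: sec_subshf)
      next
        fix W f p assume w: "W \<in> opens_in n V" "f \<in> carrier (reg n W)" "p \<in> W"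
        show "(\<Oplus>\<^bsub>sec ?E V\<^esub>i\<in>{..<m}. ?\<phi> i) W f p = \<zero>\<^bsub>sec ?E V\<^esub> W f p"
          unfolding eval[OF w] z[OF w] using * w by blast
      qed
    qed
  qed
  note inner = this
  have "a \<in> carrier (sec (relations n ?E U m s) V) \<longleftrightarrow>
      a \<in> {..<m} \<rightarrow>\<^sub>E carrier (reg n V) \<and> (\<Oplus>\<^bsub>sec ?E V\<^esub>i\<in>{..<m}. ?\<phi> i) = \<zero>\<^bsub>sec ?E V\<^esub>"
    by (simp add: relations_def)
  then show ?thesis using conj_cong[OF refl inner] by (rule trans)
qed

text \<open>A finite sum in the relation sheaf is evaluated by induction, once the relations are
  seen to form an abelian monoid under pointwise addition.\<close>

lemma relations_finsum_apply:
  assumes V: "V \<in> opens_in n U" and A: "finite A"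
    and \<phi>: "\<And>k. k \<in> A \<Longrightarrow> \<phi> k \<in> carrier (sec (relations n (subshf (tangent n) F) U m s) V)"
  shows "(\<Oplus>\<^bsub>sec (relations n (subshf (tangent n) F) U m s) V\<^esub>k\<in>A. \<phi> k) =
    (\<lambda>i\<in>{..<m}. \<lambda>p\<in>V. \<Sum>k\<in>A. \<phi> k i p)"
proof -
  let ?M = "sec (relations n (subshf (tangent n) F) U m s) V"
  have op: "V \<in> opens n" using V by (simp add: opens_in_def)
  have sub: "p \<in> W \<Longrightarrow> W \<in> opens_in n V \<Longrightarrow> p \<in> V" for p W by (auto simp: opens_in_def)
  note iff = relations_iff[OF V]
  interpret abelian_monoid ?M
  proof (rule abelian_monoidI)
    fix a b assume "a \<in> carrier ?M" "b \<in> carrier ?M"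
    then have a: "a \<in> {..<m} \<rightarrow>\<^sub>E carrier (reg n V)" "b \<in> {..<m} \<rightarrow>\<^sub>E carrier (reg n V)"
      and rel: "\<And>W f p. W \<in> opens_in n V \<Longrightarrow> f \<in> carrier (reg n W) \<Longrightarrow> p \<in> W \<Longrightarrow> (\<Sum>i<m. a i p * s i W f p) = 0"
        "\<And>W f p. W \<in> opens_in n V \<Longrightarrow> f \<in> carrier (reg n W) \<Longrightarrow> p \<in> W \<Longrightarrow> (\<Sum>i<m. b i p * s i W f p) = 0"
      unfolding iff by simp_all
    show "a \<oplus>\<^bsub>?M\<^esub> b \<in> carrier ?M"
      unfolding iff relations_simps
    proof (intro conjI ballI)
      show "(\<lambda>i\<in>{..<m}. \<lambda>p\<in>V. a i p + b i p) \<in> {..<m} \<rightarrow>\<^sub>E carrier (reg n V)"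
        unfolding restrict_PiE_iff using PiE_mem[OF a(1)] PiE_mem[OF a(2)] reg_add[OF op] by simp
      fix W f p assume w: "W \<in> opens_in n V" "f \<in> carrier (reg n W)" "p \<in> W"
      have "(\<Sum>i<m. (\<lambda>i\<in>{..<m}. \<lambda>p\<in>V. a i p + b i p) i p * s i W f p) =
          (\<Sum>i<m. a i p * s i W f p) + (\<Sum>i<m. b i p * s i W f p)"
        unfolding sum.distrib[symmetric] using sub[OF w(3,1)] by (intro sum.cong) (simp_all add: distrib_right)
      then show "(\<Sum>i<m. (\<lambda>i\<in>{..<m}. \<lambda>p\<in>V. a i p + b i p) i p * s i W f p) = 0" using rel[OF w] by simp
    qed
  next
    show "\<zero>\<^bsub>?M\<^esub> \<in> carrier ?M" unfolding iff relations_simps restrict_PiE_iff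
    proof (intro conjI ballI)
      fix W f p assume w: "W \<in> opens_in n V" "f \<in> carrier (reg n W)" "p \<in> W"
      show "(\<Sum>i<m. (\<lambda>i\<in>{..<m}. \<lambda>p\<in>V. 0) i p * s i W f p) = 0"
        using sub[OF w(3,1)] by (intro sum.neutral) simp
    qed (rule reg_const[OF op])
  next
    fix a assume "a \<in> carrier ?M"
    then have a: "a \<in> {..<m} \<rightarrow>\<^sub>E carrier (reg n V)" unfolding iff by (rule conjunct1)
    show "\<zero>\<^bsub>?M\<^esub> \<oplus>\<^bsub>?M\<^esub> a = a"
    proof
      fix i
      show "(\<zero>\<^bsub>?M\<^esub> \<oplus>\<^bsub>?M\<^esub> a) i = a i"
      proof (cases "i < m")
        case True
        then have "a i \<in> extensional V" using PiE_mem[OF a] reg_extensional by blast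
        then show ?thesis using True by (auto simp: relations_simps fun_eq_iff extensional_def)
      next
        case False
        then show ?thesis using PiE_arb[OF a] by (simp add: relations_simps)
      qed
    qed
  qed (simp_all add: relations_simps ac_simps cong: restrict_cong)
  show ?thesis using A \<phi>
  proof (induction A rule: finite_induct)
    case empty
    show ?case unfolding finsum_empty relations_simps by (simp only: sum.empty)
  next
    case (insert k A)
    have "(\<Oplus>\<^bsub>?M\<^esub>j\<in>insert k A. \<phi> j) = \<phi> k \<oplus>\<^bsub>?M\<^esub> (\<Oplus>\<^bsub>?M\<^esub>j\<in>A. \<phi> j)"
      using insert by (intro finsum_insert) auto
    also have "\<dots> = (\<lambda>i\<in>{..<m}. \<lambda>p\<in>V. \<Sum>j\<in>insert k A. \<phi> j i p)"
      using insert by (auto simp: relations_simps fun_eq_iff)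
    finally show ?case .
  qed
qed

text \<open>Elements of the free module of rank \<open>m\<close> over the affine coordinate ring are encoded as functions
  on \<open>nat \<times> pt\<close>, scalars as functions that do not depend on the first argument.\<close>

lemma relations_finite_type: "finite_type n U (relations n (subshf (tangent n) F) U m s)"
  unfolding finite_type_def
proof
  let ?Rel = "relations n (subshf (tangent n) F) U m s"
  fix p assume p: "p \<in> U"
  obtain x where x: "x \<in> \<Union>U" "p = hclass x" "x \<in> vecs n" using cone_obtain[OF U p] .
  obtain l where l: "l \<le> n" "x l \<noteq> 0" using x(3) unfolding vecs_def by blast
  define V where "V = U \<inter> chart n l"
  have opV: "V \<in> opens n" unfolding V_def by (rule opens_Int[OF U chart_opens[OF l(1)]])
  have V: "V \<in> opens_in n U" "V \<subseteq> chart n l" using opV unfolding V_def opens_in_def by simp_all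
  have pV: "p \<in> V" using mem_chart[OF l(1) x(3)] l(2) p x(2) unfolding V_def by simp
  have sV: "s i \<in> vf n U" if "i < m" for i using family_vf[OF F U s[OF that]] .

  define C where "C = range (\<lambda>(c::complex) (_::nat \<times> pt). c)"
  define lift where "lift r = (\<lambda>(i::nat, q::pt). r q :: complex)" for r
  define R where "R = alg_closure C ((\<lambda>j. lift (aff l j)) ` {..<Suc n})"
  have C_ring: "sub_ring C"
  proof -
    have "1 = (\<lambda>_::nat \<times> pt. 1 :: complex)" "- 1 = (\<lambda>_::nat \<times> pt. - 1 :: complex)"
      by (simp_all add: fun_eq_iff)
    moreover have "(\<lambda>_. a) + (\<lambda>_. b) = (\<lambda>_::nat \<times> pt. a + b :: complex)" "(\<lambda>_. a) * (\<lambda>_. b) = (\<lambda>_::nat \<times> pt. a * b :: complex)"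
      for a b by (simp_all add: fun_eq_iff)
    ultimately show ?thesis unfolding sub_ring_def C_def by auto
  qed
  have C_inv: "\<exists>d\<in>C. d * c = 1" if "c \<in> C" "c \<noteq> 0" for c
  proof -
    obtain a where a: "c = (\<lambda>_. a)" using \<open>c \<in> C\<close> unfolding C_def by blast
    then have "a \<noteq> 0" using \<open>c \<noteq> 0\<close> by (auto simp: fun_eq_iff)
    then have "(\<lambda>_. 1 / a) * c = 1" unfolding a by (simp add: fun_eq_iff)
    then show ?thesis unfolding C_def by blast
  qed
  have lift_add: "lift (r + r') = lift r + lift r'" and lift_mult: "lift (r * r') = lift r * lift r'" for r r'
    by (simp_all add: lift_def fun_eq_iff)
  have liftR: "lift r \<in> R" if "r \<in> affine_ring n l" for r
    using that unfolding affine_ring_def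
  proof induction
    case (alg_const c)
    then obtain a where "c = (\<lambda>p. a)" by blast
    then have "lift c = (\<lambda>_. a)" by (simp add: lift_def fun_eq_iff)
    then show ?case unfolding R_def C_def by (intro alg_closure.alg_const) blast
  next
    case (alg_gen g)
    then show ?case unfolding R_def by (intro alg_closure.alg_gen) blast
  next
    case (alg_add r r')
    then show ?case unfolding lift_add R_def by (intro alg_closure.alg_add)
  next
    case (alg_mult r r')
    then show ?case unfolding lift_mult R_def by (intro alg_closure.alg_mult)
  qed
  have Rlift: "\<exists>r\<in>affine_ring n l. b = lift r" if "b \<in> R" for b
    using that unfolding R_def
  proof induction
    case (alg_const c)
    then obtain a where "c = (\<lambda>_. a)" unfolding C_def by blast
    then have "c = lift (\<lambda>p. a)" by (simp add: lift_def fun_eq_iff)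
    moreover have "(\<lambda>p. a) \<in> affine_ring n l" unfolding affine_ring_def by (intro alg_closure.alg_const) blast
    ultimately show ?case by blast
  next
    case (alg_gen g)
    then show ?case unfolding affine_ring_def by (blast intro: alg_closure.alg_gen)
  next
    case (alg_add b b')
    then obtain r r' where "r \<in> affine_ring n l" "b = lift r" "r' \<in> affine_ring n l" "b' = lift r'" by blast
    moreover from this have "r + r' \<in> affine_ring n l" unfolding affine_ring_def by (intro alg_closure.alg_add)
    ultimately show ?case using lift_add[of r r'] by (intro bexI[of _ "r + r'"]) (simp_all only:)
  next
    case (alg_mult b b')
    then obtain r r' where "r \<in> affine_ring n l" "b = lift r" "r' \<in> affine_ring n l" "b' = lift r'" by blast
    moreover from this have "r * r' \<in> affine_ring n l" unfolding affine_ring_def by (intro alg_closure.alg_mult)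
    ultimately show ?case using lift_mult[of r r'] by (intro bexI[of _ "r * r'"]) (simp_all only:)
  qed

  \<comment> \<open>The standard basis of the free module. \<open>M0\<close> is a Noetherian space
    over the constants that contains it, and \<open>M\<close> a Noetherian module over
    \<open>R\<close> that contains \<open>M0\<close>.\<close>
  define e where "e i = (\<lambda>(j::nat, q::pt). if j = i then 1 else 0 :: complex)" for i
  obtain M0 where M0: "sub_mod C M0" "noetherian C M0" "\<forall>i<m. e i \<in> M0"
    using noetherian_finite_dimensional[OF C_ring C_inv, of m e] by blast
  obtain M where M: "M0 \<subseteq> M" "sub_mod R M" "noetherian R M"
    using noetherian_alg_closure[OF C_ring M0(1,2), of "\<lambda>j. lift (aff l j)" "Suc n"] unfolding R_def by blast

  \<comment> \<open>\<open>N\<close> consists of the relations over all of \<open>V\<close> whose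
    components come from the affine ring. As a submodule inside \<open>M\<close> it is finitely
    generated, and its generators will generate the relation sheaf on \<open>V\<close>.\<close>
  define rel where "rel B \<longleftrightarrow> (\<forall>W\<in>opens_in n V. \<forall>f\<in>carrier (reg n W). \<forall>q\<in>W. (\<Sum>i<m. B (i, q) * s i W f q) = 0)"
    for B :: "nat \<times> pt \<Rightarrow> complex"
  define comp where "comp B \<longleftrightarrow> (\<forall>i<m. \<exists>b\<in>affine_ring n l. \<forall>q. B (i, q) = b q) \<and> (\<forall>i\<ge>m. \<forall>q. B (i, q) = 0)"
    for B :: "nat \<times> pt \<Rightarrow> complex"
  define N where "N = {B. comp B \<and> rel B}"
  have comp_M: "B \<in> M" if comp: "comp B" for B
  proof -
    obtain b where b: "\<And>i. i < m \<Longrightarrow> b i \<in> affine_ring n l" "\<And>i q. i < m \<Longrightarrow> B (i, q) = b i q"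
      using comp unfolding comp_def by metis
    have "(\<Sum>i<k. lift (b i) * e i) \<in> M" if "k \<le> m" for k
      using that
    proof (induction k)
      case (Suc k)
      then have "lift (b k) \<in> R" "e k \<in> M" using M(1) M0(3) liftR[OF b(1)] by auto
      then have "lift (b k) * e k \<in> M" using M(2) unfolding sub_mod_def by blast
      moreover have "(\<Sum>i<k. lift (b i) * e i) \<in> M" by (rule Suc.IH) (use Suc.prems in simp)
      ultimately show ?case using M(2) unfolding sub_mod_def sum.lessThan_Suc by blast
    qed (use M(2) in \<open>simp add: sub_mod_def\<close>)
    moreover have "B = (\<Sum>i<m. lift (b i) * e i)"
    proof
      fix z :: "nat \<times> pt"
      obtain j q where z: "z = (j, q)" by (cases z)
      have sum: "(\<Sum>i\<in>A. lift (b i) * e i) z = (\<Sum>i\<in>A. (if j = i then b i q else 0))" if "finite A" for A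
        using that by (induction A) (auto simp: lift_def e_def z)
      show "B z = (\<Sum>i<m. lift (b i) * e i) z"
        unfolding sum[OF finite_lessThan] using b(2) comp unfolding comp_def z by simp
    qed
    ultimately show ?thesis by simp
  qed
  have N_mod: "sub_mod R N"
    unfolding sub_mod_def
  proof (intro conjI ballI)
    have "(\<lambda>p. 0) \<in> affine_ring n l" unfolding affine_ring_def by (intro alg_closure.alg_const) blast
    then show "0 \<in> N" unfolding N_def comp_def rel_def by (auto intro!: bexI[of _ "\<lambda>p. 0"])
  next
    fix A B assume A: "A \<in> N" and B: "B \<in> N"
    have "\<exists>b\<in>affine_ring n l. \<forall>q. (A + B) (i, q) = b q" if i: "i < m" for i
    proof -
      obtain a b where "a \<in> affine_ring n l" "\<forall>q. A (i, q) = a q" "b \<in> affine_ring n l" "\<forall>q. B (i, q) = b q"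
        using A B i unfolding N_def comp_def by blast
      then show ?thesis unfolding affine_ring_def by (intro bexI[of _ "a + b"] alg_closure.alg_add) auto
    qed
    then have "comp (A + B)" using A B unfolding N_def comp_def by simp
    moreover have "rel (A + B)" using A B unfolding N_def rel_def by (simp add: distrib_right sum.distrib)
    ultimately show "A + B \<in> N" unfolding N_def by blast
  next
    fix r B assume "r \<in> R" and B: "B \<in> N"
    then obtain r' where r: "r' \<in> affine_ring n l" "r = lift r'" using Rlift by blast
    have "\<exists>b\<in>affine_ring n l. \<forall>q. (r * B) (i, q) = b q" if i: "i < m" for i
    proof -
      obtain b where "b \<in> affine_ring n l" "\<forall>q. B (i, q) = b q"
        using B i unfolding N_def comp_def by blast
      then show ?thesis using r unfolding affine_ring_def
        by (intro bexI[of _ "r' * b"] alg_closure.alg_mult) (auto simp: lift_def)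
    qed
    then have "comp (r * B)" using B unfolding N_def comp_def by simp
    moreover have "rel (r * B)" using B unfolding N_def rel_def r(2)
      by (simp add: lift_def mult.assoc flip: sum_distrib_left)
    ultimately show "r * B \<in> N" unfolding N_def by blast
  qed
  have "N \<subseteq> M" using comp_M unfolding N_def by blast
  then obtain S where S: "S \<subseteq> N" "finite S" "N \<subseteq> lspan R S" using M(3) N_mod unfolding noetherian_def by meson
  obtain h where h: "bij_betw h {..<card S} S"
    using ex_bij_betw_nat_finite[OF S(2)] by (auto simp: atLeast0LessThan)
  have hN: "h k \<in> N" if "k < card S" for k using bij_betwE[OF h] S(1) that by blast
  define \<sigma> where "\<sigma> k = (\<lambda>i\<in>{..<m}. \<lambda>q\<in>V. h k (i, q))" for k

  have reg_comp: "(\<lambda>q\<in>W. B (i, q)) \<in> carrier (reg n W)" if B: "comp B" "i < m" "W \<in> opens_in n V" for B i W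
  proof -
    obtain b where "b \<in> affine_ring n l" "\<forall>q. B (i, q) = b q" using B unfolding comp_def by blast
    then show ?thesis using affine_ring_reg[OF l(1), of W b] B(3) V(2) by (auto simp: opens_in_def)
  qed
  have \<sigma>: "\<sigma> k \<in> carrier (sec ?Rel V)" if "k < card S" for k
    unfolding relations_iff[OF V(1)] \<sigma>_def restrict_PiE_iff
  proof (intro conjI ballI)
    have cr: "comp (h k)" "rel (h k)" using hN[OF that] unfolding N_def by auto
    fix i assume "i \<in> {..<m}"
    then show "(\<lambda>q\<in>V. h k (i, q)) \<in> carrier (reg n V)" using reg_comp[OF cr(1) _ opens_in_refl[OF opV]] by simp
  next
    have cr: "rel (h k)" using hN[OF that] unfolding N_def by auto
    fix W f q assume w: "W \<in> opens_in n V" "f \<in> carrier (reg n W)" "q \<in> W"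
    have "q \<in> V" using w by (auto simp: opens_in_def)
    then have "(\<Sum>i<m. (\<lambda>i\<in>{..<m}. \<lambda>q\<in>V. h k (i, q)) i q * s i W f q) = (\<Sum>i<m. h k (i, q) * s i W f q)"
      by (intro sum.cong) simp_all
    then show "(\<Sum>i<m. (\<lambda>i\<in>{..<m}. \<lambda>q\<in>V. h k (i, q)) i q * s i W f q) = 0" using cr w unfolding rel_def by simp
  qed
  have "generates n ?Rel V (card S) \<sigma>"
    unfolding generates_def
  proof (intro conjI ballI allI impI)
    fix W t q assume W: "W \<in> opens_in n V" and t: "t \<in> carrier (sec ?Rel W)" and q: "q \<in> W"
    have opW: "W \<in> opens n" and WV: "W \<subseteq> V" using W by (simp_all add: opens_in_def)
    have WU: "W \<in> opens_in n U" using opens_in_trans[OF W V(1)] .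
    have tt: "t \<in> {..<m} \<rightarrow>\<^sub>E carrier (reg n W)"
      and trel: "\<And>W' f q. W' \<in> opens_in n W \<Longrightarrow> f \<in> carrier (reg n W') \<Longrightarrow> q \<in> W' \<Longrightarrow> (\<Sum>i<m. t i q * s i W' f q) = 0"
      using t unfolding relations_iff[OF WU] by simp_all
    have treg: "t i \<in> carrier (reg n W)" if "i < m" for i using PiE_mem[OF tt] that by simp
    from common_denominator[where m = m and t = t, OF opW q treg] obtain W' d H G where
      W': "W' \<in> opens_in n W" "q \<in> W'" "H \<in> hpoly n d" "\<And>i. i < m \<Longrightarrow> G i \<in> hpoly n d"
        "\<And>x. x \<in> \<Union>W' \<Longrightarrow> H x \<noteq> 0 \<and> (\<forall>i<m. t i (hclass x) = G i x / H x)" by blast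
    have opW': "W' \<in> opens n" and W'V: "W' \<in> opens_in n V" using W'(1) opens_in_trans[OF W'(1) W] by (auto simp: opens_in_def)
    obtain H' where H': "H' \<in> affine_ring n l" "\<And>x. H' (hclass x) = H x / x l ^ d"
      using hpoly_affine_ring[OF W'(3), of l] by blast
    have "\<forall>i. \<exists>b. i < m \<longrightarrow> b \<in> affine_ring n l \<and> (\<forall>x. b (hclass x) = G i x / x l ^ d)"
      using hpoly_affine_ring[OF W'(4), of _ l] by blast
    then obtain G' where G': "\<And>i. i < m \<Longrightarrow> G' i \<in> affine_ring n l" "\<And>i x. i < m \<Longrightarrow> G' i (hclass x) = G i x / x l ^ d"
      by metis
    \<comment> \<open>Clearing denominators: on \<open>W'\<close>, \<open>B\<close> is the local
      relation \<open>t\<close> times \<open>H'\<close>, that is \<open>H / x l ^ d\<close>, which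
      has no zeros there.\<close>
    define B where "B = (\<lambda>(i, q). if i < m then G' i q else 0)"
    have H'nz: "H' r \<noteq> 0" and B: "\<And>i. i < m \<Longrightarrow> B (i, r) = H' r * t i r" if r: "r \<in> W'" for r
    proof -
      obtain y where y: "y \<in> \<Union>W'" "r = hclass y" using cone_obtain[OF opW' r] .
      have yl: "y l \<noteq> 0" using chart_nonzero[OF l(1) opW' _ y(1)] W'V V(2) by (auto simp: opens_in_def)
      show "H' r \<noteq> 0" using W'(5)[OF y(1)] yl unfolding y(2) H'(2) by simp
      fix i assume i: "i < m"
      then have "t i (hclass y) = G i y / H y" "H y \<noteq> 0" using W'(5)[OF y(1)] by blast+
      then show "B (i, r) = H' r * t i r" using i G'(2)[OF i] unfolding B_def y(2) H'(2) by simp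
    qed
    have compB: "comp B" unfolding comp_def B_def using G'(1) by auto
    \<comment> \<open>A priori the relation holds on \<open>W'\<close> only. The sum that should
      vanish on \<open>W2\<close> is a regular function that vanishes on the nonempty set
      \<open>W2 \<inter> W'\<close>, hence everywhere.\<close>
    have "rel B"
      unfolding rel_def
    proof (intro ballI)
      fix W2 f r assume w: "W2 \<in> opens_in n V" "f \<in> carrier (reg n W2)" "r \<in> W2"
      have opW2: "W2 \<in> opens n" using w by (simp add: opens_in_def)
      have W2U: "W2 \<in> opens_in n U" using opens_in_trans[OF w(1) V(1)] .
      let ?W = "W2 \<inter> W'"
      have opI: "?W \<in> opens n" by (rule opens_Int[OF opW2 opW'])
      have I: "?W \<in> opens_in n W2" "?W \<in> opens_in n W'" "?W \<in> opens_in n W"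
        using opI W'(1) by (auto simp: opens_in_def)
      have "W2 \<inter> W' \<noteq> {}" by (rule opens_Int_nonempty[OF opW2 opW']) (use w W'(2) in auto)
      define u where "u = (\<lambda>r\<in>W2. \<Sum>i<m. (\<lambda>r\<in>W2. (\<lambda>q\<in>W2. B (i, q)) r * s i W2 f r) r)"
      have "u \<in> carrier (reg n W2)"
        unfolding u_def
      proof (rule reg_sum[OF opW2])
        fix i assume "i \<in> {..<m}"
        then have i: "i < m" by simp
        show "(\<lambda>r\<in>W2. (\<lambda>q\<in>W2. B (i, q)) r * s i W2 f r) \<in> carrier (reg n W2)"
          by (rule reg_mult[OF opW2 reg_comp[OF compB i w(1)] vf_closed[OF sV[OF i] W2U w(2)]])
      qed
      moreover have "u r' = 0" if r': "r' \<in> ?W" for r'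
      proof -
        have "u r' = (\<Sum>i<m. H' r' * (t i r' * s i ?W (restrict f ?W) r'))"
          unfolding u_def using r' B[of r'] vf_restrict_apply[OF sV W2U I(1) w(2) r']
          by (simp add: mult.assoc)
        also have "\<dots> = H' r' * (\<Sum>i<m. t i r' * s i ?W (restrict f ?W) r')" by (rule sum_distrib_left[symmetric])
        also have "\<dots> = 0" using trel[OF I(3) reg_restrict[OF w(2) I(1)] r'] by simp
        finally show ?thesis .
      qed
      ultimately have "u r = 0" using reg_identity[OF _ opW2 I(1) \<open>?W \<noteq> {}\<close> _ w(3)] by blast
      then show "(\<Sum>i<m. B (i, r) * s i W2 f r) = 0" using w(3) unfolding u_def by simp
    qed
    then have "B \<in> lspan R S" using compB S(3) unfolding N_def by blast
    from lspan_sum[OF this S(2)] obtain c where c: "\<And>z. c z \<in> R" "B = (\<Sum>z\<in>S. c z * z)"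
      using alg_closure_sub_ring[OF C_ring] unfolding R_def by blast
    obtain c' where c': "\<And>z. c' z \<in> affine_ring n l" "\<And>z. c z = lift (c' z)" using Rlift[OF c(1)] by metis
    have Beq: "B (i, r) = (\<Sum>k<card S. c' (h k) r * h k (i, r))" for i r
    proof -
      have sum: "(\<Sum>z\<in>A. c z * z) (i, r) = (\<Sum>z\<in>A. c' z r * z (i, r))" if "finite A" for A
        using that by (induction A) (auto simp: c'(2) lift_def)
      show ?thesis unfolding c(2) sum[OF S(2)] by (rule sum.reindex_bij_betw[OF h, symmetric])
    qed
    \<comment> \<open>The coefficients of \<open>B\<close> with respect to the generators, divided
      by the cleared denominator \<open>H'\<close> to return to \<open>t\<close>.\<close>
    define a where "a k = (\<lambda>r\<in>W'. c' (h k) r / H' r)" for k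
    have a: "a k \<in> carrier (reg n W')" for k
    proof -
      have sub: "W' \<subseteq> chart n l" using W'V V(2) by (auto simp: opens_in_def)
      note q = lquot_affine_ring[OF l(1) opW' sub]
      have "lquot n (0 - 0) W' (\<lambda>x. c' (h k) (hclass x) / H' (hclass x))"
        by (rule lquot_divide[OF q[OF c'(1)] q[OF H'(1)]]) (rule H'nz[OF hclass_mem[OF opW']])
      then show ?thesis unfolding a_def by (intro reg_restrictI[OF opW']) simp
    qed
    have W'U: "W' \<in> opens_in n U" by (rule opens_in_trans[OF W'V V(1)])
    have closed: "a k \<odot>\<^bsub>sec ?Rel W'\<^esub> rst ?Rel V W' (\<sigma> k) \<in> carrier (sec ?Rel W')" if k: "k < card S" for k
      unfolding relations_iff[OF W'U] relations_simps restrict_PiE_iff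
    proof (intro conjI ballI)
      fix i assume i: "i \<in> {..<m}"
      have "restrict (\<sigma> k i) W' \<in> carrier (reg n W')"
        using \<sigma>[OF k] i unfolding relations_iff[OF V(1)] by (blast intro: reg_restrict[OF _ W'V] PiE_mem)
      from reg_mult[OF opW' a[of k] this] show "(\<lambda>r\<in>W'. a k r * (\<lambda>i\<in>{..<m}. restrict (\<sigma> k i) W') i r) \<in> carrier (reg n W')"
        using i by simp
    next
      fix W2 f r assume w: "W2 \<in> opens_in n W'" "f \<in> carrier (reg n W2)" "r \<in> W2"
      have r: "r \<in> W'" "r \<in> V" using w W'V by (auto simp: opens_in_def)
      have "(\<Sum>i<m. (\<lambda>i\<in>{..<m}. \<lambda>r\<in>W'. a k r * (\<lambda>i\<in>{..<m}. restrict (\<sigma> k i) W') i r) i r * s i W2 f r) =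
          a k r * (\<Sum>i<m. \<sigma> k i r * s i W2 f r)"
        unfolding sum_distrib_left using r by (intro sum.cong) simp_all
      also have "(\<Sum>i<m. \<sigma> k i r * s i W2 f r) = 0"
        using \<sigma>[OF k] w opens_in_trans[OF w(1) W'V] unfolding relations_iff[OF V(1)] by blast
      finally show "(\<Sum>i<m. (\<lambda>i\<in>{..<m}. \<lambda>r\<in>W'. a k r * (\<lambda>i\<in>{..<m}. restrict (\<sigma> k i) W') i r) i r * s i W2 f r) = 0"
        unfolding mult_zero_right .
    qed
    have "rst ?Rel W W' t = (\<Oplus>\<^bsub>sec ?Rel W'\<^esub>k\<in>{..<card S}. a k \<odot>\<^bsub>sec ?Rel W'\<^esub> rst ?Rel V W' (\<sigma> k))"
    proof -
      have "(\<Oplus>\<^bsub>sec ?Rel W'\<^esub>k\<in>{..<card S}. a k \<odot>\<^bsub>sec ?Rel W'\<^esub> rst ?Rel V W' (\<sigma> k)) =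
          (\<lambda>i\<in>{..<m}. \<lambda>r\<in>W'. \<Sum>k<card S. (a k \<odot>\<^bsub>sec ?Rel W'\<^esub> rst ?Rel V W' (\<sigma> k)) i r)"
        by (rule relations_finsum_apply[OF W'U finite_lessThan closed]) simp
      also have "\<dots> = (\<lambda>i\<in>{..<m}. \<lambda>r\<in>W'. t i r)"
      proof (intro restrict_ext)
        fix i r assume i: "i \<in> {..<m}" and r: "r \<in> W'"
        have rV: "r \<in> V" using r W'V by (auto simp: opens_in_def)
        have "(\<Sum>k<card S. (a k \<odot>\<^bsub>sec ?Rel W'\<^esub> rst ?Rel V W' (\<sigma> k)) i r) = (\<Sum>k<card S. c' (h k) r * h k (i, r)) / H' r"
          unfolding sum_divide_distrib using i r rV by (intro sum.cong) (simp_all add: relations_simps \<sigma>_def a_def)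
        also have "\<dots> = t i r" using B[OF r] i H'nz[OF r] unfolding Beq[symmetric] by simp
        finally show "(\<Sum>k<card S. (a k \<odot>\<^bsub>sec ?Rel W'\<^esub> rst ?Rel V W' (\<sigma> k)) i r) = t i r" .
      qed
      finally show ?thesis by (simp add: relations_simps restrict_def)
    qed
    then show "\<exists>W''\<in>opens_in n W. q \<in> W'' \<and> (\<exists>a. (\<forall>i<card S. a i \<in> carrier (reg n W'')) \<and>
        rst ?Rel W W'' t = (\<Oplus>\<^bsub>sec ?Rel W''\<^esub>i\<in>{..<card S}. a i \<odot>\<^bsub>sec ?Rel W''\<^esub> rst ?Rel V W'' (\<sigma> i)))"
      using W'(1,2) a by blast
  qed (rule \<sigma>)
  then show "\<exists>V\<in>opens_in n U. p \<in> V \<and> (\<exists>m s. generates n ?Rel V m s)" using V(1) pV by blast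
qed

end

text \<open>The relations are of finite type for every family, so a particular sheaf has to
  contribute only its own finite type.\<close>

lemma family_coherent:
  assumes "finite_type n (PP n) (subshf (tangent n) F)"
  shows "coherent n (subshf (tangent n) F)"
  unfolding coherent_def using family_sheaf[OF F] assms relations_finite_type by (simp add: sec_subshf)

end


section \<open>Frames and rank one\<close>

lemma tangent_family: "vf_family n (vf n)"
  unfolding vf_family_def by (auto intro: vf_zero_closed vf_add_closed vf_smult_closed vf_rst_closed)

lemma subshf_vf: "subshf (tangent n) (vf n) = tangent n"
  by (simp add: subshf_def)

context
  fixes n F
  assumes F: "vf_family n F"
begin

lemma family_combination:
  assumes U: "U \<in> opens n" and V: "V \<in> opens_in n U" and e: "\<And>i. i < (r::nat) \<Longrightarrow> e i \<in> F U"
    and a: "\<And>i. i < r \<Longrightarrow> a i \<in> carrier (reg n V)"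
  shows "(\<Oplus>\<^bsub>sec (subshf (tangent n) F) V\<^esub>i\<in>{..<r}. a i \<odot>\<^bsub>sec (subshf (tangent n) F) V\<^esub> rst (subshf (tangent n) F) U V (e i)) \<in> F V"
    and "\<lbrakk>W \<in> opens_in n V; f \<in> carrier (reg n W); p \<in> W\<rbrakk> \<Longrightarrow>
      (\<Oplus>\<^bsub>sec (subshf (tangent n) F) V\<^esub>i\<in>{..<r}. a i \<odot>\<^bsub>sec (subshf (tangent n) F) V\<^esub> rst (subshf (tangent n) F) U V (e i)) W f p
      = (\<Sum>i<r. a i p * e i W f p)"
proof -
  have op: "V \<in> opens n" using V by (simp add: opens_in_def)
  have *: "a i \<odot>\<^bsub>sec (subshf (tangent n) F) V\<^esub> rst (subshf (tangent n) F) U V (e i) \<in> F V" if "i \<in> {..<r}" for i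
  proof -
    have "i < r" using that by simp
    moreover have "(\<odot>\<^bsub>sec (subshf (tangent n) F) V\<^esub>) = (\<odot>\<^bsub>sec (tangent n) V\<^esub>)" by (simp add: sec_subshf)
    ultimately show ?thesis unfolding rst_subshf rst_tangent
      using family_smult[OF F op a family_rst[OF F U V e]] by metis
  qed
  show "(\<Oplus>\<^bsub>sec (subshf (tangent n) F) V\<^esub>i\<in>{..<r}. a i \<odot>\<^bsub>sec (subshf (tangent n) F) V\<^esub> rst (subshf (tangent n) F) U V (e i)) \<in> F V"
    by (rule family_finsum_closed[OF F op finite_lessThan *])
  assume w: "W \<in> opens_in n V" "f \<in> carrier (reg n W)" "p \<in> W"
  have "(\<Oplus>\<^bsub>sec (subshf (tangent n) F) V\<^esub>i\<in>{..<r}. a i \<odot>\<^bsub>sec (subshf (tangent n) F) V\<^esub> rst (subshf (tangent n) F) U V (e i)) W f p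
      = (\<Sum>i<r. (a i \<odot>\<^bsub>sec (subshf (tangent n) F) V\<^esub> rst (subshf (tangent n) F) U V (e i)) W f p)"
    by (rule family_finsum_apply[OF F op finite_lessThan * w])
  also have "\<dots> = (\<Sum>i<r. a i p * e i W f p)"
    using w by (intro sum.cong refl) (simp add: sec_subshf rst_subshf rst_tangent tangent_smult)
  finally show "(\<Oplus>\<^bsub>sec (subshf (tangent n) F) V\<^esub>i\<in>{..<r}. a i \<odot>\<^bsub>sec (subshf (tangent n) F) V\<^esub> rst (subshf (tangent n) F) U V (e i)) W f p
      = (\<Sum>i<r. a i p * e i W f p)" .
qed

lemma family_eq_combination:
  assumes U: "U \<in> opens n" and V: "V \<in> opens_in n U" and e: "\<And>i. i < (r::nat) \<Longrightarrow> e i \<in> F U"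
    and a: "\<And>i. i < r \<Longrightarrow> a i \<in> carrier (reg n V)" and t: "t \<in> F V"
  shows "t = (\<Oplus>\<^bsub>sec (subshf (tangent n) F) V\<^esub>i\<in>{..<r}. a i \<odot>\<^bsub>sec (subshf (tangent n) F) V\<^esub> rst (subshf (tangent n) F) U V (e i))
    \<longleftrightarrow> (\<forall>W\<in>opens_in n V. \<forall>f\<in>carrier (reg n W). \<forall>p\<in>W. t W f p = (\<Sum>i<r. a i p * e i W f p))" (is "t = ?S \<longleftrightarrow> _")
proof
  have op: "V \<in> opens n" using V by (simp add: opens_in_def)
  {
    assume eq: "t = ?S"
    show "\<forall>W\<in>opens_in n V. \<forall>f\<in>carrier (reg n W). \<forall>p\<in>W. t W f p = (\<Sum>i<r. a i p * e i W f p)"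
      unfolding eq by (intro ballI family_combination(2)[where a = a and e = e and r = r, OF U V e a])
  next
    assume *: "\<forall>W\<in>opens_in n V. \<forall>f\<in>carrier (reg n W). \<forall>p\<in>W. t W f p = (\<Sum>i<r. a i p * e i W f p)"
    show "t = ?S"
    proof (rule family_eqI[OF F op t family_combination(1)[where a = a and e = e and r = r, OF U V e a]])
      fix W f p assume w: "W \<in> opens_in n V" "f \<in> carrier (reg n W)" "p \<in> W"
      show "t W f p = ?S W f p"
        by (rule trans[OF *[rule_format, OF w] sym[OF family_combination(2)[where a = a and e = e and r = r, OF U V e a w]]])
    qed
  }
qed

text \<open>The frame condition in terms of values at points instead of module sums; frames are
  exhibited and compared in this form.\<close>

lemma family_frame_iff:
  assumes U: "U \<in> opens n" and e: "\<And>i. i < (r::nat) \<Longrightarrow> e i \<in> F U"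
  shows "frame n (subshf (tangent n) F) U r e \<longleftrightarrow>
    (\<forall>V\<in>opens_in n U. \<forall>t\<in>F V. \<exists>!a. a \<in> {..<r} \<rightarrow>\<^sub>E carrier (reg n V) \<and>
      (\<forall>W\<in>opens_in n V. \<forall>f\<in>carrier (reg n W). \<forall>p\<in>W. t W f p = (\<Sum>i<r. a i p * e i W f p)))"
proof -
  have "(a \<in> {..<r} \<rightarrow>\<^sub>E carrier (reg n V) \<and>
      t = (\<Oplus>\<^bsub>sec (subshf (tangent n) F) V\<^esub>i\<in>{..<r}. a i \<odot>\<^bsub>sec (subshf (tangent n) F) V\<^esub> rst (subshf (tangent n) F) U V (e i))) \<longleftrightarrow>
    (a \<in> {..<r} \<rightarrow>\<^sub>E carrier (reg n V) \<and>
      (\<forall>W\<in>opens_in n V. \<forall>f\<in>carrier (reg n W). \<forall>p\<in>W. t W f p = (\<Sum>i<r. a i p * e i W f p)))"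
    if V: "V \<in> opens_in n U" and t: "t \<in> F V" for V t a
  proof (rule conj_cong[OF refl])
    assume "a \<in> {..<r} \<rightarrow>\<^sub>E carrier (reg n V)"
    then have "a i \<in> carrier (reg n V)" if "i < r" for i using PiE_mem that by fastforce
    then show "t = (\<Oplus>\<^bsub>sec (subshf (tangent n) F) V\<^esub>i\<in>{..<r}. a i \<odot>\<^bsub>sec (subshf (tangent n) F) V\<^esub> rst (subshf (tangent n) F) U V (e i))
      \<longleftrightarrow> (\<forall>W\<in>opens_in n V. \<forall>f\<in>carrier (reg n W). \<forall>p\<in>W. t W f p = (\<Sum>i<r. a i p * e i W f p))"
      by (intro family_eq_combination[OF U V e _ t])
  qed
  moreover have "\<forall>i<r. e i \<in> carrier (sec (subshf (tangent n) F) U)" using e by (simp add: sec_subshf)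
  moreover have "carrier (sec (subshf (tangent n) F) V) = F V" for V by (simp add: sec_subshf)
  ultimately show ?thesis unfolding frame_def by (simp cong: ball_cong)
qed

lemma frame_carrier: "frame n (subshf (tangent n) F) U r e \<Longrightarrow> i < r \<Longrightarrow> e i \<in> F U"
  unfolding frame_def by (simp add: sec_subshf)

lemma frame_ex1:
  assumes U: "U \<in> opens n" and fr: "frame n (subshf (tangent n) F) U r e" and V: "V \<in> opens_in n U" and t: "t \<in> F V"
  shows "\<exists>!a. a \<in> {..<r} \<rightarrow>\<^sub>E carrier (reg n V) \<and>
      (\<forall>W\<in>opens_in n V. \<forall>f\<in>carrier (reg n W). \<forall>p\<in>W. t W f p = (\<Sum>i<r. a i p * e i W f p))"
proof -
  have "frame n (subshf (tangent n) F) U r e \<longleftrightarrow>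
    (\<forall>V\<in>opens_in n U. \<forall>t\<in>F V. \<exists>!a. a \<in> {..<r} \<rightarrow>\<^sub>E carrier (reg n V) \<and>
      (\<forall>W\<in>opens_in n V. \<forall>f\<in>carrier (reg n W). \<forall>p\<in>W. t W f p = (\<Sum>i<r. a i p * e i W f p)))"
    by (rule family_frame_iff[OF U]) (rule frame_carrier[OF fr])
  from bspec[OF bspec[OF iffD1[OF this fr] V] t] show ?thesis .
qed

lemma frame_unique:
  assumes U: "U \<in> opens n" and fr: "frame n (subshf (tangent n) F) U r e" and V: "V \<in> opens_in n U" and t: "t \<in> F V"
    and a: "a \<in> {..<r} \<rightarrow>\<^sub>E carrier (reg n V)" "b \<in> {..<r} \<rightarrow>\<^sub>E carrier (reg n V)"
    and ta: "\<And>W f p. W \<in> opens_in n V \<Longrightarrow> f \<in> carrier (reg n W) \<Longrightarrow> p \<in> W \<Longrightarrow> t W f p = (\<Sum>i<r. a i p * e i W f p)"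
    and tb: "\<And>W f p. W \<in> opens_in n V \<Longrightarrow> f \<in> carrier (reg n W) \<Longrightarrow> p \<in> W \<Longrightarrow> t W f p = (\<Sum>i<r. b i p * e i W f p)"
  shows "a = b"
proof -
  note E = frame_ex1[OF U fr V t]
  have "a \<in> {..<r} \<rightarrow>\<^sub>E carrier (reg n V) \<and>
      (\<forall>W\<in>opens_in n V. \<forall>f\<in>carrier (reg n W). \<forall>p\<in>W. t W f p = (\<Sum>i<r. a i p * e i W f p))"
    by (intro conjI ballI a(1) ta)
  note Pa = this
  have "b \<in> {..<r} \<rightarrow>\<^sub>E carrier (reg n V) \<and>
      (\<forall>W\<in>opens_in n V. \<forall>f\<in>carrier (reg n W). \<forall>p\<in>W. t W f p = (\<Sum>i<r. b i p * e i W f p))"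
    by (intro conjI ballI a(2) tb)
  note Pb = this
  show ?thesis by (rule trans[OF sym[OF the1_equality[OF E, OF Pa]] the1_equality[OF E, OF Pb]])
qed

text \<open>Another frame is compared with \<open>u\<close> on the intersection of the open sets,
  nonempty by irreducibility. There uniqueness of coefficients excludes every length other than 1,
  so the definite description in \<open>rank\<close> has the value 1.\<close>

lemma rank_one:
  assumes U: "U \<in> opens n" "U \<noteq> {}" and fr: "frame n (subshf (tangent n) F) U 1 u"
  shows "rank n (subshf (tangent n) F) = 1"
  unfolding rank_def
proof (rule the_equality)
  show "\<exists>U\<in>opens n. U \<noteq> {} \<and> (\<exists>e. frame n (subshf (tangent n) F) U 1 e)" using assms by blast
  fix r assume "\<exists>U\<in>opens n. U \<noteq> {} \<and> (\<exists>e. frame n (subshf (tangent n) F) U r e)"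
  then obtain U' e where U': "U' \<in> opens n" "U' \<noteq> {}" and fr': "frame n (subshf (tangent n) F) U' r e" by blast
  let ?W = "U \<inter> U'"
  have op: "?W \<in> opens n" by (rule opens_Int[OF U(1) U'(1)])
  obtain p where p: "p \<in> ?W" using opens_Int_nonempty[OF U(1) U'(1) U(2) U'(2)] by blast
  have W: "?W \<in> opens_in n U" "?W \<in> opens_in n U'" using op by (simp_all add: opens_in_def)
  have coeff: "\<exists>a\<in>carrier (reg n ?W). \<forall>X\<in>opens_in n ?W. \<forall>f\<in>carrier (reg n X). \<forall>q\<in>X. t X f q = a q * u 0 X f q"
    if t: "t \<in> F ?W" for t
  proof -
    obtain a where a: "a \<in> {..<1} \<rightarrow>\<^sub>E carrier (reg n ?W)"
      "\<forall>X\<in>opens_in n ?W. \<forall>f\<in>carrier (reg n X). \<forall>q\<in>X. t X f q = (\<Sum>i<1. a i q * u i X f q)"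
      using ex1_implies_ex[OF frame_ex1[OF U(1) fr W(1) t]] by blast
    then show ?thesis by (intro bexI[of _ "a 0"]) auto
  qed
  have one: "(\<lambda>q\<in>?W. 1) \<in> carrier (reg n ?W)" and zero: "(\<lambda>q\<in>?W. 0) \<in> carrier (reg n ?W)" by (rule reg_const[OF op])+
  have sub: "q \<in> ?W" if "X \<in> opens_in n ?W" "q \<in> X" for X q using that by (auto simp: opens_in_def)
  have z: "\<zero>\<^bsub>sec (tangent n) ?W\<^esub> \<in> F ?W" by (rule family_zero[OF F op])
  have zv: "\<zero>\<^bsub>sec (tangent n) ?W\<^esub> X f q = 0" if "X \<in> opens_in n ?W" "f \<in> carrier (reg n X)" "q \<in> X" for X f q
    using that by (simp add: tangent_zero)
  show "r = 1"
  proof (rule ccontr)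
    assume "r \<noteq> 1"
    then consider "r = 0" | "2 \<le> r" by linarith
    then show False
    proof cases
      case 1
      \<comment> \<open>Without frame vectors \<open>u 0\<close> is zero, and then the zero section
        has both 1 and 0 as coefficient.\<close>
      have u0: "u 0 X f q = 0" if w: "X \<in> opens_in n ?W" "f \<in> carrier (reg n X)" "q \<in> X" for X f q
      proof -
        have "restrict (u 0) (opens_in n ?W) \<in> F ?W" using family_rst[OF F U(1) W(1) frame_carrier[OF fr]] by simp
        from ex1_implies_ex[OF frame_ex1[OF U'(1) fr' W(2) this]] have "restrict (u 0) (opens_in n ?W) X f q = 0"
          using w unfolding 1 by auto
        then show ?thesis using w by simp
      qed
      have "(\<lambda>i\<in>{..<1::nat}. \<lambda>q\<in>?W. 1 :: complex) = (\<lambda>i\<in>{..<1}. \<lambda>q\<in>?W. 0)"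
        by (rule frame_unique[OF U(1) fr W(1) z]) (auto simp: one zero zv u0 restrict_PiE_iff)
      from fun_cong[OF fun_cong[OF this, of 0], of p] show False using p by simp
    next
      case 2
      have e: "restrict (e i) (opens_in n ?W) \<in> F ?W" if "i < 2" for i
        using family_rst[OF F U'(1) W(2) frame_carrier[OF fr']] that 2 by simp
      from coeff[OF e[of 0]] obtain f0 where f0: "f0 \<in> carrier (reg n ?W)"
        "\<And>X f q. X \<in> opens_in n ?W \<Longrightarrow> f \<in> carrier (reg n X) \<Longrightarrow> q \<in> X \<Longrightarrow> e 0 X f q = f0 q * u 0 X f q" by auto
      from coeff[OF e[of 1]] obtain f1 where f1: "f1 \<in> carrier (reg n ?W)"
        "\<And>X f q. X \<in> opens_in n ?W \<Longrightarrow> f \<in> carrier (reg n X) \<Longrightarrow> q \<in> X \<Longrightarrow> e 1 X f q = f1 q * u 0 X f q" by auto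
      \<comment> \<open>With \<open>e 0 = f0 u 0\<close> and \<open>e 1 = f1 u 0\<close>, the
        section \<open>f1 e 0 = f0 e 1\<close> has two expansions in \<open>e\<close>. Comparing the
        entries at 1 gives \<open>f0 = 0\<close>, so \<open>e 0\<close> vanishes and the zero
        section has two expansions as well.\<close>
      have f1e: "f1 \<odot>\<^bsub>sec (tangent n) ?W\<^esub> restrict (e 0) (opens_in n ?W) \<in> F ?W"
        by (intro family_smult[OF F op] f1 e) simp
      have sum1: "(\<Sum>i<r. (\<lambda>i\<in>{..<r}. if i = k then g else (\<lambda>q\<in>?W. 0)) i q * e i X f q) = g q * e k X f q"
        if "k < r" "q \<in> ?W" for k g q X f
      proof -
        have "(\<Sum>i<r. (\<lambda>i\<in>{..<r}. if i = k then g else (\<lambda>q\<in>?W. 0)) i q * e i X f q)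
            = (\<Sum>i<r. if i = k then g q * e k X f q else 0)" using that by (intro sum.cong) auto
        then show ?thesis using that by simp
      qed
      have "(\<lambda>i\<in>{..<r}. if i = 0 then f1 else (\<lambda>q\<in>?W. 0)) = (\<lambda>i\<in>{..<r}. if i = 1 then f0 else (\<lambda>q\<in>?W. 0))"
      proof (rule frame_unique[OF U'(1) fr' W(2) f1e])
        fix X f q assume w: "X \<in> opens_in n ?W" "f \<in> carrier (reg n X)" "q \<in> X"
        have v: "(f1 \<odot>\<^bsub>sec (tangent n) ?W\<^esub> restrict (e 0) (opens_in n ?W)) X f q = f1 q * e 0 X f q"
          using w by (simp add: tangent_smult)
        show "(f1 \<odot>\<^bsub>sec (tangent n) ?W\<^esub> restrict (e 0) (opens_in n ?W)) X f q =
            (\<Sum>i<r. (\<lambda>i\<in>{..<r}. if i = 0 then f1 else (\<lambda>q\<in>?W. 0)) i q * e i X f q)"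
          unfolding v using 2 sum1[of 0 q] sub[OF w(1,3)] by simp
        show "(f1 \<odot>\<^bsub>sec (tangent n) ?W\<^esub> restrict (e 0) (opens_in n ?W)) X f q =
            (\<Sum>i<r. (\<lambda>i\<in>{..<r}. if i = 1 then f0 else (\<lambda>q\<in>?W. 0)) i q * e i X f q)"
          unfolding v f0(2)[OF w] using 2 sum1[of 1 q f0 X f] sub[OF w(1,3)] f1(2)[OF w] by simp
      qed (use f0(1) f1(1) zero in \<open>auto simp: restrict_PiE_iff\<close>)
      from fun_cong[OF this, of 1] have f0z: "f0 = (\<lambda>q\<in>?W. 0)" using 2 by simp
      have "(\<lambda>i\<in>{..<r}. if i = 0 then (\<lambda>q\<in>?W. 1) else (\<lambda>q\<in>?W. 0)) = (\<lambda>i\<in>{..<r}. if i = 0 then (\<lambda>q\<in>?W. 0) else (\<lambda>q\<in>?W. 0 :: complex))"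
      proof (rule frame_unique[OF U'(1) fr' W(2) z])
        fix X f q assume w: "X \<in> opens_in n ?W" "f \<in> carrier (reg n X)" "q \<in> X"
        have "e 0 X f q = 0" unfolding f0(2)[OF w] f0z using sub[OF w(1,3)] by simp
        then show "\<zero>\<^bsub>sec (tangent n) ?W\<^esub> X f q =
            (\<Sum>i<r. (\<lambda>i\<in>{..<r}. if i = 0 then (\<lambda>q\<in>?W. 1) else (\<lambda>q\<in>?W. 0)) i q * e i X f q)"
          unfolding zv[OF w] using 2 sum1[of 0 q "\<lambda>q\<in>?W. 1" X f] sub[OF w(1,3)] by simp
        show "\<zero>\<^bsub>sec (tangent n) ?W\<^esub> X f q =
            (\<Sum>i<r. (\<lambda>i\<in>{..<r}. if i = 0 then (\<lambda>q\<in>?W. 0) else (\<lambda>q\<in>?W. 0)) i q * e i X f q)"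
          unfolding zv[OF w] using sub[OF w(1,3)] by (intro sum.neutral[symmetric]) simp
      qed (use one zero in \<open>auto simp: restrict_PiE_iff\<close>)
      from fun_cong[OF fun_cong[OF this, of 0], of p] show False using p 2 by simp
    qed
  qed
qed

end


section \<open>Isomorphic sheaves have the same degree\<close>

text \<open>The inverse is given explicitly because dualising reverses arrows, so that transport
  needs the map in the opposite direction. The conditions are one-sided and are assumed in both
  orders where an isomorphism is meant.\<close>

definition iso_pair :: "nat \<Rightarrow> 'a shf \<Rightarrow> 'b shf \<Rightarrow> (pt set \<Rightarrow> 'a \<Rightarrow> 'b) \<Rightarrow> (pt set \<Rightarrow> 'b \<Rightarrow> 'a) \<Rightarrow> bool"
  where "iso_pair n E F \<alpha> \<beta> \<longleftrightarrow> (\<forall>U\<in>opens n.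
    (\<forall>s\<in>carrier (sec E U). \<alpha> U s \<in> carrier (sec F U) \<and> \<beta> U (\<alpha> U s) = s) \<and>
    (\<forall>s\<in>carrier (sec E U). \<forall>t\<in>carrier (sec E U). \<alpha> U (s \<oplus>\<^bsub>sec E U\<^esub> t) = \<alpha> U s \<oplus>\<^bsub>sec F U\<^esub> \<alpha> U t) \<and>
    (\<forall>f\<in>carrier (reg n U). \<forall>s\<in>carrier (sec E U). \<alpha> U (f \<odot>\<^bsub>sec E U\<^esub> s) = f \<odot>\<^bsub>sec F U\<^esub> \<alpha> U s) \<and>
    (\<forall>V\<in>opens_in n U. \<forall>s\<in>carrier (sec E U). \<alpha> V (rst E U V s) = rst F U V (\<alpha> U s)))"

context
  fixes n E F \<alpha> \<beta> U
  assumes iso: "iso_pair n E F \<alpha> \<beta>" and U: "U \<in> opens n"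
begin

lemmas iso_unfold = bspec[OF iso[unfolded iso_pair_def] U]

lemma iso_closed: "s \<in> carrier (sec E U) \<Longrightarrow> \<alpha> U s \<in> carrier (sec F U)"
  using conjunct1[OF iso_unfold] by blast

lemma iso_inv: "s \<in> carrier (sec E U) \<Longrightarrow> \<beta> U (\<alpha> U s) = s"
  using conjunct1[OF iso_unfold] by blast

lemma iso_add: "s \<in> carrier (sec E U) \<Longrightarrow> t \<in> carrier (sec E U) \<Longrightarrow> \<alpha> U (s \<oplus>\<^bsub>sec E U\<^esub> t) = \<alpha> U s \<oplus>\<^bsub>sec F U\<^esub> \<alpha> U t"
  using conjunct1[OF conjunct2[OF iso_unfold]] by blast

lemma iso_smult: "f \<in> carrier (reg n U) \<Longrightarrow> s \<in> carrier (sec E U) \<Longrightarrow> \<alpha> U (f \<odot>\<^bsub>sec E U\<^esub> s) = f \<odot>\<^bsub>sec F U\<^esub> \<alpha> U s"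
  using conjunct1[OF conjunct2[OF conjunct2[OF iso_unfold]]] by blast

lemma iso_rst: "V \<in> opens_in n U \<Longrightarrow> s \<in> carrier (sec E U) \<Longrightarrow> \<alpha> V (rst E U V s) = rst F U V (\<alpha> U s)"
  using conjunct2[OF conjunct2[OF conjunct2[OF iso_unfold]]] by blast

end

text \<open>Used with \<open>G\<close> a line bundle \<open>twist n d\<close>: sheaves that are
  isomorphic to each other are isomorphic to the same twists.\<close>

lemma isomorphic_comp:
  assumes \<alpha>: "iso_pair n E F \<alpha> \<beta>" and \<beta>: "iso_pair n F E \<beta> \<alpha>" and G: "isomorphic n F G"
  shows "isomorphic n E G"
proof -
  obtain \<phi> where \<phi>: "\<forall>U\<in>opens n.
    bij_betw (\<phi> U) (carrier (sec F U)) (carrier (sec G U)) \<and>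
    (\<forall>s\<in>carrier (sec F U). \<forall>t\<in>carrier (sec F U).
      \<phi> U (s \<oplus>\<^bsub>sec F U\<^esub> t) = \<phi> U s \<oplus>\<^bsub>sec G U\<^esub> \<phi> U t) \<and>
    (\<forall>f\<in>carrier (reg n U). \<forall>s\<in>carrier (sec F U).
      \<phi> U (f \<odot>\<^bsub>sec F U\<^esub> s) = f \<odot>\<^bsub>sec G U\<^esub> \<phi> U s) \<and>
    (\<forall>V\<in>opens_in n U. \<forall>s\<in>carrier (sec F U). \<phi> V (rst F U V s) = rst G U V (\<phi> U s))"
    using G unfolding isomorphic_def by (rule exE)
  show ?thesis
    unfolding isomorphic_def
  proof (intro exI[of _ "\<lambda>U s. \<phi> U (\<alpha> U s)"] ballI conjI)
    fix U assume U: "U \<in> opens n"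
    note p = bspec[OF \<phi> U]
    have "bij_betw (\<alpha> U) (carrier (sec E U)) (carrier (sec F U))"
      by (rule bij_betw_byWitness[of _ "\<beta> U"])
        (use iso_inv[OF \<alpha> U] iso_inv[OF \<beta> U] iso_closed[OF \<alpha> U] iso_closed[OF \<beta> U] in auto)
    from bij_betw_trans[OF this conjunct1[OF p]]
    show "bij_betw (\<lambda>s. \<phi> U (\<alpha> U s)) (carrier (sec E U)) (carrier (sec G U))" by (simp add: comp_def)
    fix s assume s: "s \<in> carrier (sec E U)"
    note sF = iso_closed[OF \<alpha> U s]
    show "\<phi> U (\<alpha> U (s \<oplus>\<^bsub>sec E U\<^esub> t)) = \<phi> U (\<alpha> U s) \<oplus>\<^bsub>sec G U\<^esub> \<phi> U (\<alpha> U t)" if t: "t \<in> carrier (sec E U)" for t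
      unfolding iso_add[OF \<alpha> U s t] using conjunct1[OF conjunct2[OF p]] sF iso_closed[OF \<alpha> U t] by blast
    show "\<phi> U (\<alpha> U (f \<odot>\<^bsub>sec E U\<^esub> s)) = f \<odot>\<^bsub>sec G U\<^esub> \<phi> U (\<alpha> U s)" if f: "f \<in> carrier (reg n U)" for f
      unfolding iso_smult[OF \<alpha> U f s] using conjunct1[OF conjunct2[OF conjunct2[OF p]]] sF f by blast
    show "\<phi> V (\<alpha> V (rst E U V s)) = rst G U V (\<phi> U (\<alpha> U s))" if V: "V \<in> opens_in n U" for V
      unfolding iso_rst[OF \<alpha> U V s] using conjunct2[OF conjunct2[OF conjunct2[OF p]]] sF V by blast
  qed
qed

section \<open>Transport of linear and alternating forms along isomorphisms\<close>

definition map_transport :: "nat \<Rightarrow> (pt set \<Rightarrow> 'b set) \<Rightarrow> (pt set \<Rightarrow> 'b \<Rightarrow> 'a) \<Rightarrow> pt set \<Rightarrow> (pt set \<Rightarrow> 'a \<Rightarrow> fn) \<Rightarrow> (pt set \<Rightarrow> 'b \<Rightarrow> fn)"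
  where "map_transport n B \<beta> U \<phi> = (\<lambda>V\<in>opens_in n U. \<lambda>y\<in>B V. \<phi> V (\<beta> V y))"

lemma map_sheaf_iff: "\<phi> \<in> carrier (sec (map_sheaf n A \<rho> P) U) \<longleftrightarrow>
    \<phi> \<in> (\<Pi>\<^sub>E V\<in>opens_in n U. A V \<rightarrow>\<^sub>E carrier (reg n V)) \<and>
    (\<forall>V\<in>opens_in n U. P V (\<phi> V)) \<and>
    (\<forall>V\<in>opens_in n U. \<forall>W\<in>opens_in n V. \<forall>x\<in>A V. \<phi> W (\<rho> V W x) = restrict (\<phi> V x) W)"
  by (simp add: map_sheaf_def)

lemma map_sheaf_simps:
  "(\<oplus>\<^bsub>sec (map_sheaf n A \<rho> P) U\<^esub>) = (\<lambda>\<phi> \<psi>. \<lambda>V\<in>opens_in n U. \<lambda>x\<in>A V. \<phi> V x \<oplus>\<^bsub>reg n V\<^esub> \<psi> V x)"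
  "(\<odot>\<^bsub>sec (map_sheaf n A \<rho> P) U\<^esub>) = (\<lambda>f \<phi>. \<lambda>V\<in>opens_in n U. \<lambda>x\<in>A V. restrict f V \<otimes>\<^bsub>reg n V\<^esub> \<phi> V x)"
  "rst (map_sheaf n A \<rho> P) U W = (\<lambda>\<phi>. restrict \<phi> (opens_in n W))"
  by (simp_all add: map_sheaf_def)

lemma map_sheaf_rst_closed:
  assumes "\<phi> \<in> carrier (sec (map_sheaf n A \<rho> P) U)" "W \<in> opens_in n U"
  shows "rst (map_sheaf n A \<rho> P) U W \<phi> \<in> carrier (sec (map_sheaf n A \<rho> P) W)"
proof -
  have "opens_in n W \<subseteq> opens_in n U" using assms(2) opens_in_trans by blast
  then show ?thesis using assms(1) unfolding map_sheaf_iff map_sheaf_simps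
    by (auto simp: PiE_iff subset_iff intro: opens_in_trans)
qed

text \<open>Precomposition with the inverse map. At the level of \<open>map_sheaf\<close> this
  covers duals and alternating forms together; they differ in the domains of the maps and in the
  predicate that has to be preserved.\<close>

lemma map_transport_iso_pair:
  assumes \<alpha>: "\<And>V x. V \<in> opens n \<Longrightarrow> x \<in> A V \<Longrightarrow> \<alpha> V x \<in> B V \<and> \<beta> V (\<alpha> V x) = x"
    and \<beta>: "\<And>V y. V \<in> opens n \<Longrightarrow> y \<in> B V \<Longrightarrow> \<beta> V y \<in> A V"
    and \<rho>: "\<And>V W y. V \<in> opens n \<Longrightarrow> W \<in> opens_in n V \<Longrightarrow> y \<in> B V \<Longrightarrow> \<rho>B V W y \<in> B W \<and> \<beta> W (\<rho>B V W y) = \<rho>A V W (\<beta> V y)"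
    and P: "\<And>V \<chi>. V \<in> opens n \<Longrightarrow> \<chi> \<in> A V \<rightarrow>\<^sub>E carrier (reg n V) \<Longrightarrow> PA V \<chi> \<Longrightarrow> PB V (\<lambda>y\<in>B V. \<chi> (\<beta> V y))"
  shows "iso_pair n (map_sheaf n A \<rho>A PA) (map_sheaf n B \<rho>B PB) (map_transport n B \<beta>) (map_transport n A \<alpha>)"
  unfolding iso_pair_def
proof (intro ballI conjI)
  fix U \<phi> assume U: "U \<in> opens n" and \<phi>: "\<phi> \<in> carrier (sec (map_sheaf n A \<rho>A PA) U)"
  have op: "V \<in> opens n" if "V \<in> opens_in n U" for V using that by (simp add: opens_in_def)
  have \<phi>PiE: "\<phi> \<in> (\<Pi>\<^sub>E V\<in>opens_in n U. A V \<rightarrow>\<^sub>E carrier (reg n V))" using \<phi> unfolding map_sheaf_iff by blast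
  have \<phi>V: "\<phi> V \<in> A V \<rightarrow>\<^sub>E carrier (reg n V)" "PA V (\<phi> V)" if "V \<in> opens_in n U" for V
    using \<phi> that unfolding map_sheaf_iff by blast+
  have \<phi>\<rho>: "\<phi> W (\<rho>A V W x) = restrict (\<phi> V x) W" if "V \<in> opens_in n U" "W \<in> opens_in n V" "x \<in> A V" for V W x
    using \<phi> that unfolding map_sheaf_iff by blast
  show "map_transport n B \<beta> U \<phi> \<in> carrier (sec (map_sheaf n B \<rho>B PB) U)"
    unfolding map_sheaf_iff
  proof (intro conjI ballI)
    show "map_transport n B \<beta> U \<phi> \<in> (\<Pi>\<^sub>E V\<in>opens_in n U. B V \<rightarrow>\<^sub>E carrier (reg n V))"
      unfolding map_transport_def restrict_PiE_iff using PiE_mem[OF \<phi>V(1)] \<beta>[OF op] by blast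
    fix V assume V: "V \<in> opens_in n U"
    show "PB V (map_transport n B \<beta> U \<phi> V)"
      using P[OF op[OF V] \<phi>V[OF V]] V by (simp add: map_transport_def)
    fix W y assume W: "W \<in> opens_in n V" and y: "y \<in> B V"
    have "W \<in> opens_in n U" by (rule opens_in_trans[OF W V])
    then show "map_transport n B \<beta> U \<phi> W (\<rho>B V W y) = restrict (map_transport n B \<beta> U \<phi> V y) W"
      using \<rho>[OF op[OF V] W y] \<phi>\<rho>[OF V W \<beta>[OF op[OF V] y]] V y by (simp add: map_transport_def)
  qed
  show "map_transport n A \<alpha> U (map_transport n B \<beta> U \<phi>) = \<phi>"
  proof
    fix V
    show "map_transport n A \<alpha> U (map_transport n B \<beta> U \<phi>) V = \<phi> V"
    proof (cases "V \<in> opens_in n U")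
      case True
      have "map_transport n A \<alpha> U (map_transport n B \<beta> U \<phi>) V x = \<phi> V x" for x
        using True \<alpha>[OF op[OF True], of x] PiE_arb[OF \<phi>V(1)[OF True], of x]
        by (cases "x \<in> A V") (simp_all add: map_transport_def)
      then show ?thesis by blast
    next
      case False
      then show ?thesis using PiE_arb[OF \<phi>PiE False] by (simp add: map_transport_def)
    qed
  qed
  show "map_transport n B \<beta> W (rst (map_sheaf n A \<rho>A PA) U W \<phi>) = rst (map_sheaf n B \<rho>B PB) U W (map_transport n B \<beta> U \<phi>)"
    if W: "W \<in> opens_in n U" for W
    using opens_in_trans[OF _ W] by (auto simp: map_transport_def map_sheaf_simps fun_eq_iff)
  show "map_transport n B \<beta> U (f \<odot>\<^bsub>sec (map_sheaf n A \<rho>A PA) U\<^esub> \<phi>) = f \<odot>\<^bsub>sec (map_sheaf n B \<rho>B PB) U\<^esub> map_transport n B \<beta> U \<phi>"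
    for f
    unfolding map_transport_def map_sheaf_simps using \<beta>[OF op] by (intro restrict_ext) simp
  show "map_transport n B \<beta> U (\<phi> \<oplus>\<^bsub>sec (map_sheaf n A \<rho>A PA) U\<^esub> \<psi>) =
      map_transport n B \<beta> U \<phi> \<oplus>\<^bsub>sec (map_sheaf n B \<rho>B PB) U\<^esub> map_transport n B \<beta> U \<psi>" for \<psi>
    unfolding map_transport_def map_sheaf_simps using \<beta>[OF op] by (intro restrict_ext) simp
qed

text \<open>The carriers need not be closed under the operations here: where they are not, both sides of the
  identities for the transported form take the same junk value.\<close>

lemma dual_iso_pair:
  assumes \<alpha>: "iso_pair n E F \<alpha> \<beta>" and \<beta>: "iso_pair n F E \<beta> \<alpha>"
    and rst: "\<And>V W y. V \<in> opens n \<Longrightarrow> W \<in> opens_in n V \<Longrightarrow> y \<in> carrier (sec F V) \<Longrightarrow> rst F V W y \<in> carrier (sec F W)"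
  shows "iso_pair n (dual n E) (dual n F) (map_transport n (\<lambda>V. carrier (sec F V)) \<beta>) (map_transport n (\<lambda>V. carrier (sec E V)) \<alpha>)"
  unfolding dual_def
proof (rule map_transport_iso_pair)
  fix V x assume V: "V \<in> opens n"
  show "\<alpha> V x \<in> carrier (sec F V) \<and> \<beta> V (\<alpha> V x) = x" if "x \<in> carrier (sec E V)"
    using iso_closed[OF \<alpha> V that] iso_inv[OF \<alpha> V that] by blast
next
  fix V y assume V: "V \<in> opens n" and y: "y \<in> carrier (sec F V)"
  show "\<beta> V y \<in> carrier (sec E V)" by (rule iso_closed[OF \<beta> V y])
  fix W assume W: "W \<in> opens_in n V"
  show "rst F V W y \<in> carrier (sec F W) \<and> \<beta> W (rst F V W y) = rst E V W (\<beta> V y)"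
    using rst[OF V W y] iso_rst[OF \<beta> V W y] by blast
next
  fix V \<chi> assume V: "V \<in> opens n" and \<chi>: "\<chi> \<in> carrier (sec E V) \<rightarrow>\<^sub>E carrier (reg n V)" and lin: "linear_form n E V \<chi>"
  let ?\<chi> = "\<lambda>y\<in>carrier (sec F V). \<chi> (\<beta> V y)"
  have mem: "z \<in> carrier (sec F V) \<longleftrightarrow> w \<in> carrier (sec E V)"
    if "z \<in> carrier (sec F V) \<Longrightarrow> \<beta> V z = w" "w \<in> carrier (sec E V) \<Longrightarrow> \<alpha> V w = z" for z w
    using that iso_closed[OF \<alpha> V] iso_closed[OF \<beta> V] by metis
  have eval: "?\<chi> z = \<chi> w" if "\<beta> V z = w" "\<alpha> V w = z" for z w
    using mem[of z w] that PiE_arb[OF \<chi>, of w] by (cases "z \<in> carrier (sec F V)") auto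
  show "linear_form n F V ?\<chi>"
    unfolding linear_form_def
  proof (intro conjI ballI)
    fix y z assume y: "y \<in> carrier (sec F V)" and z: "z \<in> carrier (sec F V)"
    note c = iso_closed[OF \<beta> V y] iso_closed[OF \<beta> V z]
    have "?\<chi> (y \<oplus>\<^bsub>sec F V\<^esub> z) = \<chi> (\<beta> V y \<oplus>\<^bsub>sec E V\<^esub> \<beta> V z)"
      by (rule eval) (simp_all add: iso_add[OF \<beta> V y z] iso_add[OF \<alpha> V c] iso_inv[OF \<beta> V y] iso_inv[OF \<beta> V z])
    then show "?\<chi> (y \<oplus>\<^bsub>sec F V\<^esub> z) = ?\<chi> y \<oplus>\<^bsub>reg n V\<^esub> ?\<chi> z"
      using lin c y z unfolding linear_form_def by simp
  next
    fix f y assume f: "f \<in> carrier (reg n V)" and y: "y \<in> carrier (sec F V)"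
    note c = iso_closed[OF \<beta> V y]
    have "?\<chi> (f \<odot>\<^bsub>sec F V\<^esub> y) = \<chi> (f \<odot>\<^bsub>sec E V\<^esub> \<beta> V y)"
      by (rule eval) (simp_all add: iso_smult[OF \<beta> V f y] iso_smult[OF \<alpha> V f c] iso_inv[OF \<beta> V y])
    then show "?\<chi> (f \<odot>\<^bsub>sec F V\<^esub> y) = f \<otimes>\<^bsub>reg n V\<^esub> ?\<chi> y"
      using lin c y f unfolding linear_form_def by simp
  qed
qed

text \<open>A tuple updated by a sum or a multiple has to stay in the domain of the transported
  form, since only there is the form given by its formula; \<open>add\<close> and
  \<open>smult\<close> guarantee this.\<close>

lemma alternating_iso_pair:
  assumes \<alpha>: "iso_pair n E F \<alpha> \<beta>" and \<beta>: "iso_pair n F E \<beta> \<alpha>"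
    and rst: "\<And>V W y. V \<in> opens n \<Longrightarrow> W \<in> opens_in n V \<Longrightarrow> y \<in> carrier (sec F V) \<Longrightarrow> rst F V W y \<in> carrier (sec F W)"
    and add: "\<And>V x y. V \<in> opens n \<Longrightarrow> x \<in> carrier (sec F V) \<Longrightarrow> y \<in> carrier (sec F V) \<Longrightarrow> x \<oplus>\<^bsub>sec F V\<^esub> y \<in> carrier (sec F V)"
    and smult: "\<And>V f y. V \<in> opens n \<Longrightarrow> f \<in> carrier (reg n V) \<Longrightarrow> y \<in> carrier (sec F V) \<Longrightarrow> f \<odot>\<^bsub>sec F V\<^esub> y \<in> carrier (sec F V)"
  shows "iso_pair n (alternating_forms n r E) (alternating_forms n r F)
    (map_transport n (\<lambda>V. {..<r} \<rightarrow>\<^sub>E carrier (sec F V)) (\<lambda>V s. \<lambda>i\<in>{..<r}. \<beta> V (s i)))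
    (map_transport n (\<lambda>V. {..<r} \<rightarrow>\<^sub>E carrier (sec E V)) (\<lambda>V s. \<lambda>i\<in>{..<r}. \<alpha> V (s i)))"
  unfolding alternating_forms_def
proof (rule map_transport_iso_pair)
  fix V x assume V: "V \<in> opens n" and x: "x \<in> {..<r} \<rightarrow>\<^sub>E carrier (sec E V)"
  have "(\<lambda>i\<in>{..<r}. \<beta> V ((\<lambda>i\<in>{..<r}. \<alpha> V (x i)) i)) i = x i" for i
    using iso_inv[OF \<alpha> V PiE_mem[OF x]] PiE_arb[OF x] by simp
  then show "(\<lambda>i\<in>{..<r}. \<alpha> V (x i)) \<in> {..<r} \<rightarrow>\<^sub>E carrier (sec F V) \<and>
      (\<lambda>i\<in>{..<r}. \<beta> V ((\<lambda>i\<in>{..<r}. \<alpha> V (x i)) i)) = x"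
    unfolding restrict_PiE_iff using iso_closed[OF \<alpha> V PiE_mem[OF x]] by blast
next
  fix V y assume V: "V \<in> opens n" and y: "y \<in> {..<r} \<rightarrow>\<^sub>E carrier (sec F V)"
  show "(\<lambda>i\<in>{..<r}. \<beta> V (y i)) \<in> {..<r} \<rightarrow>\<^sub>E carrier (sec E V)"
    unfolding restrict_PiE_iff using iso_closed[OF \<beta> V PiE_mem[OF y]] by blast
  fix W assume W: "W \<in> opens_in n V"
  show "(\<lambda>i\<in>{..<r}. rst F V W (y i)) \<in> {..<r} \<rightarrow>\<^sub>E carrier (sec F W) \<and>
      (\<lambda>i\<in>{..<r}. \<beta> W ((\<lambda>i\<in>{..<r}. rst F V W (y i)) i)) = (\<lambda>i\<in>{..<r}. rst E V W ((\<lambda>i\<in>{..<r}. \<beta> V (y i)) i))"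
    unfolding restrict_PiE_iff using rst[OF V W PiE_mem[OF y]] iso_rst[OF \<beta> V W PiE_mem[OF y]]
    by (auto intro!: restrict_ext)
next
  fix V \<chi> assume V: "V \<in> opens n" and \<chi>: "\<chi> \<in> ({..<r} \<rightarrow>\<^sub>E carrier (sec E V)) \<rightarrow>\<^sub>E carrier (reg n V)"
    and alt: "alternating_form n r E V \<chi>"
  let ?b = "\<lambda>s. \<lambda>i\<in>{..<r}. \<beta> V (s i)"
  let ?\<chi> = "\<lambda>s\<in>{..<r} \<rightarrow>\<^sub>E carrier (sec F V). \<chi> (?b s)"
  have eval: "?\<chi> (s(i := x)) = \<chi> ((?b s)(i := \<beta> V x))"
    if "s \<in> {..<r} \<rightarrow>\<^sub>E carrier (sec F V)" "i < r" "x \<in> carrier (sec F V)" for s i x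
  proof -
    have "s(i := x) \<in> {..<r} \<rightarrow>\<^sub>E carrier (sec F V)" using that by (auto simp: PiE_iff extensional_def)
    moreover have "?b (s(i := x)) = (?b s)(i := \<beta> V x)" using that by (auto simp: fun_eq_iff)
    ultimately show ?thesis by (simp only: restrict_apply')
  qed
  show "alternating_form n r F V ?\<chi>"
    unfolding alternating_form_def
  proof (intro ballI conjI allI impI)
    fix s assume s: "s \<in> {..<r} \<rightarrow>\<^sub>E carrier (sec F V)"
    have bs: "?b s \<in> {..<r} \<rightarrow>\<^sub>E carrier (sec E V)"
      unfolding restrict_PiE_iff using iso_closed[OF \<beta> V PiE_mem[OF s]] by blast
    note A = bspec[OF alt[unfolded alternating_form_def] bs]
    fix i assume i: "i < r"
    {
      fix x y assume x: "x \<in> carrier (sec F V)" and y: "y \<in> carrier (sec F V)"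
      have "\<chi> ((?b s)(i := \<beta> V x \<oplus>\<^bsub>sec E V\<^esub> \<beta> V y)) = \<chi> ((?b s)(i := \<beta> V x)) \<oplus>\<^bsub>reg n V\<^esub> \<chi> ((?b s)(i := \<beta> V y))"
        using conjunct1[OF A] i iso_closed[OF \<beta> V x] iso_closed[OF \<beta> V y] by blast
      then show "?\<chi> (s(i := x \<oplus>\<^bsub>sec F V\<^esub> y)) = ?\<chi> (s(i := x)) \<oplus>\<^bsub>reg n V\<^esub> ?\<chi> (s(i := y))"
        unfolding eval[OF s i x] eval[OF s i y] eval[OF s i add[OF V x y]] iso_add[OF \<beta> V x y] .
    next
      fix f x assume f: "f \<in> carrier (reg n V)" and x: "x \<in> carrier (sec F V)"
      have "\<chi> ((?b s)(i := f \<odot>\<^bsub>sec E V\<^esub> \<beta> V x)) = f \<otimes>\<^bsub>reg n V\<^esub> \<chi> ((?b s)(i := \<beta> V x))"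
        using conjunct1[OF conjunct2[OF A]] i iso_closed[OF \<beta> V x] f by blast
      then show "?\<chi> (s(i := f \<odot>\<^bsub>sec F V\<^esub> x)) = f \<otimes>\<^bsub>reg n V\<^esub> ?\<chi> (s(i := x))"
        unfolding eval[OF s i x] eval[OF s i smult[OF V f x]] iso_smult[OF \<beta> V f x] .
    next
      fix j assume j: "j < r" and eq: "i \<noteq> j \<and> s i = s j"
      have "i \<noteq> j \<and> ?b s i = ?b s j" using eq i j by simp
      then have "\<chi> (?b s) = \<zero>\<^bsub>reg n V\<^esub>" using conjunct2[OF conjunct2[OF A]] i j by blast
      then show "?\<chi> s = \<zero>\<^bsub>reg n V\<^esub>" using s by simp
    }
  qed
qed

text \<open>The isomorphism passes to alternating forms and, dualised once more, to determinants.
  Both degrees are then definite descriptions with the same predicate in \<open>d\<close>, so they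
  agree.\<close>

lemma iso_pair_degree:
  assumes "iso_pair n E F \<alpha> \<beta>" "iso_pair n F E \<beta> \<alpha>" "sheaf_of_modules n E" "sheaf_of_modules n F" "rank n E = rank n F"
  shows "Defs.degree n E = Defs.degree n F"
proof -
  interpret E: sheaf_of_modules n E by fact
  interpret F: sheaf_of_modules n F by fact
  let ?r = "rank n F"
  have cl: "x \<oplus>\<^bsub>sec E V\<^esub> y \<in> carrier (sec E V)" "f \<odot>\<^bsub>sec E V\<^esub> y \<in> carrier (sec E V)"
    if "V \<in> opens n" "x \<in> carrier (sec E V)" "y \<in> carrier (sec E V)" "f \<in> carrier (reg n V)" for V x y f
  proof -
    interpret module "reg n V" "sec E V" by (rule E.sec_module[OF that(1)])
    show "x \<oplus>\<^bsub>sec E V\<^esub> y \<in> carrier (sec E V)" "f \<odot>\<^bsub>sec E V\<^esub> y \<in> carrier (sec E V)" using that by simp_all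
  qed
  have cl': "x \<oplus>\<^bsub>sec F V\<^esub> y \<in> carrier (sec F V)" "f \<odot>\<^bsub>sec F V\<^esub> y \<in> carrier (sec F V)"
    if "V \<in> opens n" "x \<in> carrier (sec F V)" "y \<in> carrier (sec F V)" "f \<in> carrier (reg n V)" for V x y f
  proof -
    interpret module "reg n V" "sec F V" by (rule F.sec_module[OF that(1)])
    show "x \<oplus>\<^bsub>sec F V\<^esub> y \<in> carrier (sec F V)" "f \<odot>\<^bsub>sec F V\<^esub> y \<in> carrier (sec F V)" using that by simp_all
  qed
  note one = reg_const[of _ n 1]
  have alt: "iso_pair n (alternating_forms n ?r E) (alternating_forms n ?r F)
      (map_transport n (\<lambda>V. {..<?r} \<rightarrow>\<^sub>E carrier (sec F V)) (\<lambda>V s. \<lambda>i\<in>{..<?r}. \<beta> V (s i)))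
      (map_transport n (\<lambda>V. {..<?r} \<rightarrow>\<^sub>E carrier (sec E V)) (\<lambda>V s. \<lambda>i\<in>{..<?r}. \<alpha> V (s i)))"
    by (rule alternating_iso_pair[OF assms(1,2) F.rst_closed cl'(1) cl'(2)]) (auto intro: one)
  have alt': "iso_pair n (alternating_forms n ?r F) (alternating_forms n ?r E)
      (map_transport n (\<lambda>V. {..<?r} \<rightarrow>\<^sub>E carrier (sec E V)) (\<lambda>V s. \<lambda>i\<in>{..<?r}. \<alpha> V (s i)))
      (map_transport n (\<lambda>V. {..<?r} \<rightarrow>\<^sub>E carrier (sec F V)) (\<lambda>V s. \<lambda>i\<in>{..<?r}. \<beta> V (s i)))"
    by (rule alternating_iso_pair[OF assms(2,1) E.rst_closed cl(1) cl(2)]) (auto intro: one)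
  have r: "rst (alternating_forms n r G) V W y \<in> carrier (sec (alternating_forms n r G) W)"
    if "W \<in> opens_in n V" "y \<in> carrier (sec (alternating_forms n r G) V)" for r V W y and G :: "'c shf"
    using that unfolding alternating_forms_def by (intro map_sheaf_rst_closed)
  have "isomorphic n (det_sheaf n E) (twist n d) \<longleftrightarrow> isomorphic n (det_sheaf n F) (twist n d)" for d
    unfolding det_sheaf_def assms(5)
    using isomorphic_comp[OF dual_iso_pair[OF alt alt' r] dual_iso_pair[OF alt' alt r]]
      isomorphic_comp[OF dual_iso_pair[OF alt' alt r] dual_iso_pair[OF alt alt' r]] by blast
  then show ?thesis unfolding Defs.degree_def by simp
qed


section \<open>Vector fields in homogeneous coordinates\<close>

text \<open>\<open>field_along n J s U\<close> is the vector field \<open>\<Sum>\<^sub>j s\<^sub>j \<partial>/\<partial>x\<^sub>j\<close>, \<open>j \<in> J\<close>, which acts on functions of degree \<open>0\<close>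
  on the cone over \<open>U\<close>; for the result to have degree \<open>0\<close> again, the \<open>s\<^sub>j\<close> have degree \<open>1\<close>.\<close>

definition deriv_along :: "nat set \<Rightarrow> (nat \<Rightarrow> (nat \<Rightarrow> complex) \<Rightarrow> complex) \<Rightarrow> fn \<Rightarrow> (nat \<Rightarrow> complex) \<Rightarrow> complex"
  where "deriv_along J s f x = (\<Sum>j\<in>J. s j x * pd j (\<lambda>y. f (hclass y)) x)"

definition coeffs :: "nat \<Rightarrow> nat set \<Rightarrow> pt set \<Rightarrow> (nat \<Rightarrow> (nat \<Rightarrow> complex) \<Rightarrow> complex) \<Rightarrow> bool"
  where "coeffs n J U s \<longleftrightarrow> (\<forall>j\<in>J. lquot n 1 U (s j))"

definition field_along :: "nat \<Rightarrow> nat set \<Rightarrow> (nat \<Rightarrow> (nat \<Rightarrow> complex) \<Rightarrow> complex) \<Rightarrow> pt set \<Rightarrow> pt set \<Rightarrow> fn \<Rightarrow> fn"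
  where "field_along n J s U = (\<lambda>V\<in>opens_in n U. \<lambda>f\<in>carrier (reg n V). \<lambda>p\<in>V. desc V (deriv_along J s f) p)"

lemma lquot_sum:
  assumes "U \<in> opens n" "finite A" "\<And>i. i \<in> A \<Longrightarrow> lquot n 0 U (f i)"
  shows "lquot n 0 U (\<lambda>x. \<Sum>i\<in>A. f i x)"
  using assms(2,3) by (induction A) (auto intro: lquot_const[OF assms(1)] lquot_add)

lemma coeffsI: "(\<And>j. j \<in> J \<Longrightarrow> lquot n 1 U (s j)) \<Longrightarrow> coeffs n J U s"
  unfolding coeffs_def by blast

lemma coeffsD: "coeffs n J U s \<Longrightarrow> j \<in> J \<Longrightarrow> lquot n 1 U (s j)"
  unfolding coeffs_def by blast

lemma coeffs_restrict: "coeffs n J U s \<Longrightarrow> V \<in> opens_in n U \<Longrightarrow> coeffs n J V s"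
  unfolding coeffs_def using lquot_restrict by blast

lemma coeffs_add: "coeffs n J U s \<Longrightarrow> coeffs n J U t \<Longrightarrow> coeffs n J U (\<lambda>j x. s j x + t j x)"
  unfolding coeffs_def using lquot_add by blast

lemma coeffs_smult: "coeffs n J U s \<Longrightarrow> a \<in> carrier (reg n U) \<Longrightarrow> coeffs n J U (\<lambda>j x. a (hclass x) * s j x)"
  unfolding coeffs_def using lquot_mult[OF reg_lquot] by fastforce

lemma coeffs_zero: "J \<subseteq> {..n} \<Longrightarrow> U \<in> opens n \<Longrightarrow> coeffs n J U (\<lambda>j x. 0)"
  unfolding coeffs_def using lquot_mult[OF lquot_const[of U n 0] lquot_var[of U n]] by auto

lemma lquot_deriv_along:
  assumes "U \<in> opens n" "J \<subseteq> {..n}" "coeffs n J U s" "f \<in> carrier (reg n U)"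
  shows "lquot n 0 U (deriv_along J s f)"
  unfolding deriv_along_def
  by (intro lquot_sum[OF assms(1)] lquot_mult_pd[OF coeffsD[OF assms(3)] reg_lquot[OF assms(4)]] finite_subset[OF assms(2)])
    (use assms(2) in auto)

lemma deriv_along_cong_fun:
  assumes "W \<in> opens n" "g \<in> carrier (reg n W)" "x \<in> \<Union>W" "J \<subseteq> {..n}" "\<And>p. p \<in> W \<Longrightarrow> f p = g p"
  shows "deriv_along J s f x = deriv_along J s g x"
  unfolding deriv_along_def
proof (intro sum.cong refl arg_cong2[of _ _ _ _ "(*)"])
  fix j assume "j \<in> J"
  then have "j \<le> n" using assms(4) by auto
  then show "pd j (\<lambda>y. f (hclass y)) x = pd j (\<lambda>y. g (hclass y)) x"
    by (rule pd_cong[OF reg_lquot[OF assms(2)] assms(3,1)]) (rule assms(5)[OF hclass_mem[OF assms(1)]])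
qed

lemma deriv_along_restrict:
  assumes "W \<in> opens_in n V" "f \<in> carrier (reg n V)" "x \<in> \<Union>W" "J \<subseteq> {..n}"
  shows "deriv_along J s (restrict f W) x = deriv_along J s f x"
proof -
  have W: "W \<in> opens n" using assms(1) by (simp add: opens_in_def)
  show ?thesis by (rule deriv_along_cong_fun[OF W reg_restrict[OF assms(2,1)] assms(3,4), symmetric]) simp
qed

text \<open>The second term comes from the denominator of \<open>x i / x l\<close>. For
  \<open>i\<close> outside \<open>J\<close> it is all that remains, a multiple of
  \<open>x i\<close>: this is why fields along the coordinates other than \<open>k\<close> are
  tangent to \<open>x k = 0\<close>.\<close>

lemma deriv_along_affine:
  assumes "V \<in> opens n" "V \<subseteq> chart n l" "l \<le> n" "i \<le> n" "x \<in> \<Union>V" "J \<subseteq> {..n}"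
  shows "deriv_along J s (\<lambda>p\<in>V. aff l i p) x =
    (if i \<in> J then s i x / x l else 0) - (if l \<in> J then s l x * x i / (x l)\<^sup>2 else 0)"
proof -
  have fin: "finite J" by (rule finite_subset[OF assms(6)]) simp
  have xl: "x l \<noteq> 0" by (rule chart_nonzero[OF assms(3,1,2,5)])
  have "pd j (\<lambda>y. (\<lambda>p\<in>V. aff l i p) (hclass y)) x =
      (if i = j then 1 / x l else 0) - (if l = j then x i / (x l)\<^sup>2 else 0)" if "j \<in> J" for j
  proof -
    have "j \<le> n" using that assms(6) by auto
    then have "pd j (\<lambda>y. (\<lambda>p\<in>V. aff l i p) (hclass y)) x = pd j (\<lambda>y. y i / y l) x"
      by (rule pd_cong[OF lquot_aff[OF assms(3,4,1,2)] assms(5,1)])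
        (simp add: aff_apply hclass_mem[OF assms(1)] del: Union_iff)
    then show ?thesis using pd_affine_coordinate[of x l j i, OF xl] by simp
  qed
  then have "deriv_along J s (\<lambda>p\<in>V. aff l i p) x =
      (\<Sum>j\<in>J. (if i = j then s i x / x l else 0) - (if l = j then s l x * x i / (x l)\<^sup>2 else 0))"
    unfolding deriv_along_def by (intro sum.cong refl) (simp add: right_diff_distrib)
  also have "\<dots> = (if i \<in> J then s i x / x l else 0) - (if l \<in> J then s l x * x i / (x l)\<^sup>2 else 0)"
    using fin by (simp add: sum_subtractf)
  finally show ?thesis .
qed

lemma field_along_apply:
  assumes "J \<subseteq> {..n}" "coeffs n J U s" "V \<in> opens_in n U" "f \<in> carrier (reg n V)" "x \<in> \<Union>V"
  shows "field_along n J s U V f (hclass x) = deriv_along J s f x"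
proof -
  have V: "V \<in> opens n" using assms(3) by (simp add: opens_in_def)
  have "desc V (deriv_along J s f) (hclass x) = deriv_along J s f x"
    by (rule desc_apply[OF lquot_deriv_along[OF V assms(1) coeffs_restrict[OF assms(2,3)] assms(4)] V assms(5)])
  then show ?thesis using assms(3,4) hclass_mem[OF V assms(5)] by (simp add: field_along_def)
qed

lemma field_along_vf:
  assumes J: "J \<subseteq> {..n}" and s: "coeffs n J U s"
  shows "field_along n J s U \<in> vf n U"
  unfolding field_along_def
proof (rule vfI)
  have fin: "finite J" by (rule finite_subset[OF J]) simp
  have desc: "desc V (deriv_along J s f) (hclass x) = deriv_along J s f x"
    if "V \<in> opens_in n U" "f \<in> carrier (reg n V)" "x \<in> \<Union>V" for V f x
  proof -
    have V: "V \<in> opens n" using that by (simp add: opens_in_def)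
    show ?thesis by (rule desc_apply[OF lquot_deriv_along[OF V J coeffs_restrict[OF s that(1)] that(2)] V that(3)])
  qed
  {
    fix V f assume V: "V \<in> opens_in n U" and f: "f \<in> carrier (reg n V)"
    have op: "V \<in> opens n" using V by (simp add: opens_in_def)
    have "desc V (deriv_along J s f) \<in> carrier (reg n V)"
      by (rule desc_reg[OF lquot_deriv_along[OF op J coeffs_restrict[OF s V] f] op])
    moreover from this have "(\<lambda>p\<in>V. desc V (deriv_along J s f) p) = desc V (deriv_along J s f)"
      using reg_extensional by (intro extensional_restrict)
    ultimately show "(\<lambda>p\<in>V. desc V (deriv_along J s f) p) \<in> carrier (reg n V)" by simp
  next
    fix V f g p assume V: "V \<in> opens_in n U" and f: "f \<in> carrier (reg n V)" and g: "g \<in> carrier (reg n V)" and p: "p \<in> V"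
    have op: "V \<in> opens n" using V by (simp add: opens_in_def)
    obtain x where x: "x \<in> \<Union>V" "p = hclass x" using cone_obtain[OF op p] .
    have sum: "(\<lambda>p\<in>V. f p + g p) \<in> carrier (reg n V)" and prod: "(\<lambda>p\<in>V. f p * g p) \<in> carrier (reg n V)"
      by (rule reg_add[OF op f g], rule reg_mult[OF op f g])
    note q = reg_lquot[OF f] reg_lquot[OF g]
    have jn: "j \<le> n" if "j \<in> J" for j using that J by auto
    have "pd j (\<lambda>y. (\<lambda>p\<in>V. f p + g p) (hclass y)) x = pd j (\<lambda>y. f (hclass y)) x + pd j (\<lambda>y. g (hclass y)) x" if "j \<in> J" for j
      unfolding pd_add[OF q x(1) op jn[OF that], symmetric]
      by (rule pd_cong[OF lquot_add[OF q] x(1) op jn[OF that]]) (simp add: hclass_mem[OF op] del: Union_iff)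
    then have "deriv_along J s (\<lambda>p\<in>V. f p + g p) x = deriv_along J s f x + deriv_along J s g x"
      unfolding deriv_along_def sum.distrib[symmetric] by (intro sum.cong refl) (simp add: distrib_left)
    then show "desc V (deriv_along J s (\<lambda>p\<in>V. f p + g p)) p = desc V (deriv_along J s f) p + desc V (deriv_along J s g) p"
      unfolding x(2) desc[OF V f x(1)] desc[OF V g x(1)] desc[OF V sum x(1)] .
    have "pd j (\<lambda>y. (\<lambda>p\<in>V. f p * g p) (hclass y)) x =
        f (hclass x) * pd j (\<lambda>y. g (hclass y)) x + g (hclass x) * pd j (\<lambda>y. f (hclass y)) x" if "j \<in> J" for j
      unfolding pd_mult[OF q x(1) op jn[OF that], symmetric]
      by (rule pd_cong[OF lquot_mult[OF q] x(1) op jn[OF that]]) (simp add: hclass_mem[OF op] del: Union_iff)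
    then have "deriv_along J s (\<lambda>p\<in>V. f p * g p) x = f (hclass x) * deriv_along J s g x + g (hclass x) * deriv_along J s f x"
      unfolding deriv_along_def sum_distrib_left sum.distrib[symmetric] by (intro sum.cong refl) (simp add: algebra_simps)
    then show "desc V (deriv_along J s (\<lambda>p\<in>V. f p * g p)) p = f p * desc V (deriv_along J s g) p + g p * desc V (deriv_along J s f) p"
      unfolding x(2) desc[OF V f x(1)] desc[OF V g x(1)] desc[OF V prod x(1)] .
  next
    fix V p and c :: complex assume V: "V \<in> opens_in n U" and p: "p \<in> V"
    have op: "V \<in> opens n" using V by (simp add: opens_in_def)
    obtain x where x: "x \<in> \<Union>V" "p = hclass x" using cone_obtain[OF op p] .
    have "pd j (\<lambda>y. (\<lambda>p\<in>V. c) (hclass y)) x = 0" if "j \<in> J" for j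
      unfolding pd_const[of j c x, symmetric]
      by (rule pd_cong[OF lquot_const[OF op] x(1) op]) (use J that hclass_mem[OF op] in auto)
    then have "deriv_along J s (\<lambda>p\<in>V. c) x = 0" unfolding deriv_along_def by (intro sum.neutral) simp
    then show "desc V (deriv_along J s (\<lambda>p\<in>V. c)) p = 0"
      unfolding x(2) desc[OF V reg_const[OF op] x(1)] .
  next
    fix V W f p assume V: "V \<in> opens_in n U" and W: "W \<in> opens_in n V" and f: "f \<in> carrier (reg n V)" and p: "p \<in> W"
    have op: "W \<in> opens n" and WV: "W \<subseteq> V" using W by (simp_all add: opens_in_def)
    obtain x where x: "x \<in> \<Union>W" "p = hclass x" using cone_obtain[OF op p] .
    have xV: "x \<in> \<Union>V" using x WV by blast
    show "desc W (deriv_along J s (restrict f W)) p = desc V (deriv_along J s f) p"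
      unfolding x(2) desc[OF V f xV] desc[OF opens_in_trans[OF W V] reg_restrict[OF f W] x(1)]
      by (rule deriv_along_restrict[OF W f x(1) J])
  }
qed

section \<open>Vector fields and their values on affine coordinates\<close>

lemma vf_eq_on_cone:
  assumes "\<theta> \<in> vf n U" "\<eta> \<in> vf n U"
    and "\<And>V f x. V \<in> opens_in n U \<Longrightarrow> f \<in> carrier (reg n V) \<Longrightarrow> x \<in> \<Union>V \<Longrightarrow> \<theta> V f (hclass x) = \<eta> V f (hclass x)"
  shows "\<theta> = \<eta>"
proof (rule vf_eqI[OF assms(1,2)])
  fix V f p assume V: "V \<in> opens_in n U" and f: "f \<in> carrier (reg n V)" and p: "p \<in> V"
  have "V \<in> opens n" using V by (simp add: opens_in_def)
  from cone_obtain[OF this p] obtain x where "x \<in> \<Union>V" "p = hclass x" .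
  then show "\<theta> V f p = \<eta> V f p" using assms(3)[OF V f] by simp
qed

text \<open>A derivation is determined by its values on affine coordinates, since regular functions are
  locally quotients of polynomials in them.\<close>

lemma vf_eq_affine:
  assumes \<theta>: "\<theta> \<in> vf n U" and \<eta>: "\<eta> \<in> vf n U" and U: "U \<in> opens n" "U \<subseteq> chart n l" and l: "l \<le> n"
    and eq: "\<And>j p. j \<le> n \<Longrightarrow> p \<in> U \<Longrightarrow> \<theta> U (\<lambda>p\<in>U. aff l j p) p = \<eta> U (\<lambda>p\<in>U. aff l j p) p"
  shows "\<theta> = \<eta>"
proof (rule vf_eqI[OF \<theta> \<eta>])
  fix V f p assume V: "V \<in> opens_in n U" and f: "f \<in> carrier (reg n V)" and p: "p \<in> V"
  have opV: "V \<in> opens n" and VU: "V \<subseteq> U" using V by (simp_all add: opens_in_def)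
  from reg_lquot[OF f] p obtain W a b g h where W: "W \<in> opens_in n V" "p \<in> W" "int a - int b = 0" "g \<in> hpoly n a"
    "h \<in> hpoly n b" "\<forall>x\<in>\<Union>W. h x \<noteq> 0 \<and> f (hclass x) = g x / h x" by (rule lquotE)
  have ab: "b = a" using W(3) by simp
  have op: "W \<in> opens n" and WU: "W \<in> opens_in n U" "W \<subseteq> chart n l"
    using W(1) V U opens_in_trans[OF W(1) V] by (auto simp: opens_in_def)
  have ring: "\<theta> W (restrict c W) q = \<eta> W (restrict c W) q" if "c \<in> affine_ring n l" "q \<in> W" for c q
    using that unfolding affine_ring_def
  proof (induction arbitrary: q)
    case (alg_const c)
    then obtain c0 where c: "c = (\<lambda>p. c0)" by blast
    show ?case unfolding c vf_const_apply[OF \<theta> WU(1) alg_const(2)] vf_const_apply[OF \<eta> WU(1) alg_const(2)] ..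
  next
    case (alg_gen c)
    then obtain j where j: "j \<in> {..<Suc n}" "c = aff l j" by blast
    then have jn: "j \<le> n" by simp
    have aU: "(\<lambda>p\<in>U. aff l j p) \<in> carrier (reg n U)"
      by (rule affine_ring_reg[OF l U]) (use j in \<open>auto simp: affine_ring_def intro: alg_closure.alg_gen\<close>)
    have r: "restrict (aff l j) W = restrict (\<lambda>p\<in>U. aff l j p) W" using WU(1) by (auto simp: opens_in_def fun_eq_iff)
    have "q \<in> U" using alg_gen(2) WU(1) by (auto simp: opens_in_def)
    then show ?case
      unfolding j(2) r vf_restrict_apply[OF \<theta> opens_in_refl[OF U(1)] WU(1) aU alg_gen(2)]
        vf_restrict_apply[OF \<eta> opens_in_refl[OF U(1)] WU(1) aU alg_gen(2)] by (rule eq[OF jn])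
  next
    case (alg_add c d)
    have cd: "restrict c W \<in> carrier (reg n W)" "restrict d W \<in> carrier (reg n W)"
      using affine_ring_reg[OF l op WU(2)] alg_add unfolding affine_ring_def by blast+
    have r: "restrict (c + d) W = (\<lambda>p\<in>W. restrict c W p + restrict d W p)" by (auto simp: fun_eq_iff)
    show ?case unfolding r vf_add_apply[OF \<theta> WU(1) cd alg_add(5)] vf_add_apply[OF \<eta> WU(1) cd alg_add(5)]
      unfolding alg_add(3)[OF alg_add(5)] alg_add(4)[OF alg_add(5)] ..
  next
    case (alg_mult c d)
    have cd: "restrict c W \<in> carrier (reg n W)" "restrict d W \<in> carrier (reg n W)"
      using affine_ring_reg[OF l op WU(2)] alg_mult unfolding affine_ring_def by blast+
    have r: "restrict (c * d) W = (\<lambda>p\<in>W. restrict c W p * restrict d W p)" by (auto simp: fun_eq_iff)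
    show ?case unfolding r vf_mult_apply[OF \<theta> WU(1) cd alg_mult(5)] vf_mult_apply[OF \<eta> WU(1) cd alg_mult(5)]
      unfolding alg_mult(3)[OF alg_mult(5)] alg_mult(4)[OF alg_mult(5)] ..
  qed
  obtain G where G: "G \<in> affine_ring n l" "\<And>x. G (hclass x) = g x / x l ^ a" using hpoly_affine_ring[OF W(4)] by blast
  obtain H where H: "H \<in> affine_ring n l" "\<And>x. H (hclass x) = h x / x l ^ a" using hpoly_affine_ring[OF W(5)] ab by blast
  have fH: "f q * H q = G q" and Hnz: "H q \<noteq> 0" if q: "q \<in> W" for q
  proof -
    obtain y where y: "y \<in> \<Union>W" "q = hclass y" using cone_obtain[OF op q] .
    have "y l \<noteq> 0" by (rule chart_nonzero[OF l op WU(2) y(1)])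
    moreover have "h y \<noteq> 0" "f (hclass y) = g y / h y" using W(6) y(1) by blast+
    ultimately show "f q * H q = G q" "H q \<noteq> 0" unfolding y(2) G(2) H(2) by simp_all
  qed
  have fW: "restrict f W \<in> carrier (reg n W)" by (rule reg_restrict[OF f W(1)])
  have HW: "restrict H W \<in> carrier (reg n W)" by (rule affine_ring_reg[OF l op WU(2) H(1)])
  have r: "(\<lambda>q\<in>W. restrict f W q * restrict H W q) = restrict G W" using fH by (auto simp: fun_eq_iff)
  \<comment> \<open>The Leibniz rule for \<open>f H = G\<close> determines the derivative of
    \<open>f\<close>, since \<open>H\<close> has no zeros on \<open>W\<close> and the derivatives of
    \<open>G\<close> and \<open>H\<close> are known to agree.\<close>
  have "restrict f W p * \<theta> W (restrict H W) p + restrict H W p * \<theta> W (restrict f W) p =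
      restrict f W p * \<eta> W (restrict H W) p + restrict H W p * \<eta> W (restrict f W) p"
    unfolding vf_mult_apply[OF \<theta> WU(1) fW HW W(2), symmetric] vf_mult_apply[OF \<eta> WU(1) fW HW W(2), symmetric] r
    by (rule ring[OF G(1) W(2)])
  then have "restrict H W p * \<theta> W (restrict f W) p = restrict H W p * \<eta> W (restrict f W) p"
    unfolding ring[OF H(1) W(2)] by (rule add_left_imp_eq)
  moreover have "restrict H W p \<noteq> 0" using Hnz[OF W(2)] W(2) by simp
  ultimately have "\<theta> W (restrict f W) p = \<eta> W (restrict f W) p" by (simp only: mult_cancel_left) blast
  then show "\<theta> V f p = \<eta> V f p"
    unfolding vf_restrict_apply[OF \<theta> V W(1) f W(2)] vf_restrict_apply[OF \<eta> V W(1) f W(2)] .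
qed

lemma aff_reg: "V \<in> opens n \<Longrightarrow> V \<subseteq> chart n l \<Longrightarrow> l \<le> n \<Longrightarrow> j \<le> n \<Longrightarrow> (\<lambda>p\<in>V. aff l j p) \<in> carrier (reg n V)"
  by (rule affine_ring_reg) (auto simp: affine_ring_def intro: alg_closure.alg_gen)

lemma vf_aff_self:
  assumes \<theta>: "\<theta> \<in> vf n W" and W: "W \<in> opens n" "W \<subseteq> chart n l" and l: "l \<le> n" and p: "p \<in> W"
  shows "\<theta> W (\<lambda>p\<in>W. aff l l p) p = 0"
proof -
  have "(\<lambda>p\<in>W. aff l l p) = (\<lambda>p\<in>W. 1)"
  proof (rule restrict_ext)
    fix q assume "q \<in> W"
    from cone_obtain[OF W(1) this] obtain y where y: "y \<in> \<Union>W" "q = hclass y" .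
    show "aff l l q = 1" using chart_nonzero[OF l W y(1)] unfolding y(2) aff_apply by simp
  qed
  then show ?thesis using vf_const_apply[OF \<theta> opens_in_refl[OF W(1)] p, of 1] by simp
qed

text \<open>On the chart \<open>aff l l\<close> is the constant 1, so the direction \<open>l\<close>
  can be left out. A field along the other coordinates takes \<open>aff l j\<close> to
  \<open>s j / x l\<close>, which dictates the coefficients.\<close>

lemma vf_expand:
  assumes \<theta>: "\<theta> \<in> vf n W" and W: "W \<in> opens n" "W \<subseteq> chart n l" and l: "l \<le> n"
  shows "\<And>j. j \<le> n \<Longrightarrow> lquot n 1 W (\<lambda>x. x l * \<theta> W (\<lambda>p\<in>W. aff l j p) (hclass x))"
    and "\<theta> = field_along n ({..n} - {l}) (\<lambda>j x. x l * \<theta> W (\<lambda>p\<in>W. aff l j p) (hclass x)) W"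
proof -
  have WW: "W \<in> opens_in n W" by (rule opens_in_refl[OF W(1)])
  show q: "lquot n 1 W (\<lambda>x. x l * \<theta> W (\<lambda>p\<in>W. aff l j p) (hclass x))" if "j \<le> n" for j
    using lquot_mult[OF lquot_var[OF W(1) l] reg_lquot[OF vf_closed[OF \<theta> WW aff_reg[OF W l that]]]] by simp
  have J: "{..n} - {l} \<subseteq> {..n}" by blast
  let ?s = "\<lambda>j x. x l * \<theta> W (\<lambda>p\<in>W. aff l j p) (hclass x)"
  have c: "coeffs n ({..n} - {l}) W ?s" by (rule coeffsI[OF q]) simp
  show "\<theta> = field_along n ({..n} - {l}) ?s W"
  proof (rule vf_eq_affine[OF \<theta> field_along_vf[OF J c] W l])
    fix j p assume j: "j \<le> n" and p: "p \<in> W"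
    obtain x where x: "x \<in> \<Union>W" "p = hclass x" using cone_obtain[OF W(1) p] .
    have xl: "x l \<noteq> 0" by (rule chart_nonzero[OF l W x(1)])
    have "\<theta> W (\<lambda>p\<in>W. aff l l p) (hclass x) = 0"
      using vf_aff_self[OF \<theta> W l] p x(2) by simp
    then show "\<theta> W (\<lambda>p\<in>W. aff l j p) p = field_along n ({..n} - {l}) ?s W W (\<lambda>p\<in>W. aff l j p) p"
      unfolding x(2) using field_along_apply[OF J c WW aff_reg[OF W l j] x(1)] deriv_along_affine[OF W l j x(1) J, of ?s] j xl by auto
  qed
qed


section \<open>The sheaf of fields along a set of coordinates\<close>

definition fields_along :: "nat \<Rightarrow> nat set \<Rightarrow> pt set \<Rightarrow> (pt set \<Rightarrow> fn \<Rightarrow> fn) set"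
  where "fields_along n J U = {field_along n J s U | s. coeffs n J U s}"

lemma fields_alongE:
  assumes "\<theta> \<in> fields_along n J U"
  obtains s where "coeffs n J U s" "\<theta> = field_along n J s U"
  using assms unfolding fields_along_def by blast

lemma fields_alongI: "coeffs n J U s \<Longrightarrow> field_along n J s U \<in> fields_along n J U"
  unfolding fields_along_def by blast

lemma fields_along_vf: "J \<subseteq> {..n} \<Longrightarrow> \<theta> \<in> fields_along n J U \<Longrightarrow> \<theta> \<in> vf n U"
  by (erule fields_alongE) (simp add: field_along_vf)

lemma field_along_eqI:
  assumes J: "J \<subseteq> {..n}" and s: "coeffs n J U s" and \<theta>: "\<theta> \<in> vf n U"
    and eq: "\<And>V f x. V \<in> opens_in n U \<Longrightarrow> f \<in> carrier (reg n V) \<Longrightarrow> x \<in> \<Union>V \<Longrightarrow> \<theta> V f (hclass x) = deriv_along J s f x"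
  shows "\<theta> = field_along n J s U"
  by (rule vf_eq_on_cone[OF \<theta> field_along_vf[OF J s]]) (simp_all only: eq field_along_apply[OF J s])

lemma field_along_restrict:
  assumes J: "J \<subseteq> {..n}" and s: "coeffs n J U s" and V: "V \<in> opens_in n U"
  shows "restrict (field_along n J s U) (opens_in n V) = field_along n J s V"
proof (rule field_along_eqI[OF J coeffs_restrict[OF s V] vf_rst_closed[OF field_along_vf[OF J s] V]])
  fix W f x assume W: "W \<in> opens_in n V" and f: "f \<in> carrier (reg n W)" and x: "x \<in> \<Union>W"
  show "restrict (field_along n J s U) (opens_in n V) W f (hclass x) = deriv_along J s f x"
    using W field_along_apply[OF J s opens_in_trans[OF W V] f x] by simp
qed

lemma field_along_add:
  assumes J: "J \<subseteq> {..n}" and s: "coeffs n J U s" and t: "coeffs n J U t"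
  shows "field_along n J s U \<oplus>\<^bsub>sec (tangent n) U\<^esub> field_along n J t U = field_along n J (\<lambda>j x. s j x + t j x) U"
proof (rule field_along_eqI[OF J coeffs_add[OF s t] vf_add_closed[OF field_along_vf[OF J s] field_along_vf[OF J t]]])
  fix V f x assume V: "V \<in> opens_in n U" and f: "f \<in> carrier (reg n V)" and x: "x \<in> \<Union>V"
  have "hclass x \<in> V" using hclass_mem[OF _ x] V by (auto simp: opens_in_def)
  then show "(field_along n J s U \<oplus>\<^bsub>sec (tangent n) U\<^esub> field_along n J t U) V f (hclass x) = deriv_along J (\<lambda>j x. s j x + t j x) f x"
    using V f field_along_apply[OF J s V f x] field_along_apply[OF J t V f x]
    by (simp add: tangent_add deriv_along_def distrib_right sum.distrib)
qed

lemma field_along_smult: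
  assumes J: "J \<subseteq> {..n}" and s: "coeffs n J U s" and a: "a \<in> carrier (reg n U)"
  shows "a \<odot>\<^bsub>sec (tangent n) U\<^esub> field_along n J s U = field_along n J (\<lambda>j x. a (hclass x) * s j x) U"
proof (rule field_along_eqI[OF J coeffs_smult[OF s a] vf_smult_closed[OF a field_along_vf[OF J s]]])
  fix V f x assume V: "V \<in> opens_in n U" and f: "f \<in> carrier (reg n V)" and x: "x \<in> \<Union>V"
  have "hclass x \<in> V" using hclass_mem[OF _ x] V by (auto simp: opens_in_def)
  then show "(a \<odot>\<^bsub>sec (tangent n) U\<^esub> field_along n J s U) V f (hclass x) = deriv_along J (\<lambda>j x. a (hclass x) * s j x) f x"
    using V f field_along_apply[OF J s V f x] by (simp add: tangent_smult deriv_along_def sum_distrib_left mult.assoc)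
qed

lemma field_along_zero:
  assumes J: "J \<subseteq> {..n}" and U: "U \<in> opens n"
  shows "\<zero>\<^bsub>sec (tangent n) U\<^esub> = field_along n J (\<lambda>j x. 0) U"
proof (rule field_along_eqI[OF J coeffs_zero[OF J U] vf_zero_closed])
  fix V f x assume V: "V \<in> opens_in n U" and f: "f \<in> carrier (reg n V)" and x: "x \<in> \<Union>V"
  have "hclass x \<in> V" using hclass_mem[OF _ x] V by (auto simp: opens_in_def)
  then show "\<zero>\<^bsub>sec (tangent n) U\<^esub> V f (hclass x) = deriv_along J (\<lambda>j x. 0) f x" using V f by (simp add: tangent_zero deriv_along_def)
qed

lemma field_along_cong:
  assumes J: "J \<subseteq> {..n}" and U: "U \<in> opens n" and s: "coeffs n J U s"
    and eq: "\<And>j x. j \<in> J \<Longrightarrow> x \<in> \<Union>U \<Longrightarrow> s j x = t j x"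
  shows "field_along n J s U = field_along n J t U"
proof (rule field_along_eqI[OF J _ field_along_vf[OF J s]])
  show "coeffs n J U t" by (rule coeffsI, rule lquot_cong[OF coeffsD[OF s] eq])
  fix V f x assume V: "V \<in> opens_in n U" and f: "f \<in> carrier (reg n V)" and x: "x \<in> \<Union>V"
  have "x \<in> \<Union>U" using V x by (auto simp: opens_in_def)
  then show "field_along n J s U V f (hclass x) = deriv_along J t f x"
    using field_along_apply[OF J s V f x] eq by (simp add: deriv_along_def del: Union_iff)
qed

text \<open>By Euler's relation only one coordinate direction has to be left out.\<close>

lemma field_along_inject:
  assumes J: "J \<subseteq> {..n} - {k}" and k: "k \<le> n" and U: "U \<in> opens n"
    and s: "coeffs n J U s" and t: "coeffs n J U t"
    and eq: "field_along n J s U = field_along n J t U" and j: "j \<in> J" and x: "x \<in> \<Union>U"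
  shows "s j x = t j x"
proof -
  have J': "J \<subseteq> {..n}" "k \<notin> J" "j \<le> n" using J j by auto
  \<comment> \<open>On the chart of the omitted coordinate the field takes \<open>aff k j\<close> to
    \<open>s j / x k\<close>, with no contribution from the denominator. Equality of coefficients
    there spreads to the cone over \<open>U\<close> by the identity principle.\<close>
  let ?V = "U \<inter> chart n k"
  have op: "?V \<in> opens n" by (rule opens_Int[OF U chart_opens[OF k]])
  have V: "?V \<in> opens_in n U" "?V \<subseteq> chart n k" using op by (simp_all add: opens_in_def)
  have "chart n k \<noteq> {}"
  proof -
    have "(\<lambda>i. if i = k then 1 else 0) \<in> vecs n" using k by (auto simp: vecs_def)
    from mem_chart[OF k this] show ?thesis by auto
  qed
  then have "?V \<noteq> {}" using opens_Int_nonempty[OF U chart_opens[OF k]] hclass_mem[OF U x] by blast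
  moreover have "s j y - t j y = 0" if y: "y \<in> \<Union>?V" for y
  proof -
    have yk: "y k \<noteq> 0" by (rule chart_nonzero[OF k op V(2) y])
    have f: "(\<lambda>p\<in>?V. aff k j p) \<in> carrier (reg n ?V)" by (rule aff_reg[OF op V(2) k J'(3)])
    have "deriv_along J s (\<lambda>p\<in>?V. aff k j p) y = deriv_along J t (\<lambda>p\<in>?V. aff k j p) y"
      using field_along_apply[OF J'(1) s V(1) f y] field_along_apply[OF J'(1) t V(1) f y] eq by simp
    then show ?thesis
      unfolding deriv_along_affine[OF op V(2) k J'(3) y J'(1)] using j J'(2) yk by simp
  qed
  ultimately have "s j x - t j x = 0"
    using lquot_identity[OF lquot_diff[OF coeffsD[OF s j] coeffsD[OF t j] U] U V(1) _ _ x] by blast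
  then show ?thesis by simp
qed

text \<open>Local coefficients agree on overlaps because they are unique; with all of
  \<open>{..n}\<close> as directions they would be determined only up to multiples of the Euler
  field.\<close>

lemma fields_along_glue:
  assumes J: "J \<subseteq> {..n} - {k}" and k: "k \<le> n" and U: "U \<in> opens n" and \<theta>: "\<theta> \<in> vf n U"
    and loc: "\<And>p. p \<in> U \<Longrightarrow> \<exists>V\<in>opens_in n U. p \<in> V \<and> restrict \<theta> (opens_in n V) \<in> fields_along n J V"
  shows "\<theta> \<in> fields_along n J U"
proof -
  have J': "J \<subseteq> {..n}" using J by auto
  have "\<forall>p\<in>U. \<exists>V s. V \<in> opens_in n U \<and> p \<in> V \<and> coeffs n J V s \<and>
      restrict \<theta> (opens_in n V) = field_along n J s V"
    using loc unfolding fields_along_def by fast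
  from bchoice[OF this] obtain V where "\<forall>p\<in>U. \<exists>s. V p \<in> opens_in n U \<and> p \<in> V p \<and> coeffs n J (V p) s \<and>
      restrict \<theta> (opens_in n (V p)) = field_along n J s (V p)" ..
  from bchoice[OF this] obtain s where Vs: "\<forall>p\<in>U. V p \<in> opens_in n U \<and> p \<in> V p \<and> coeffs n J (V p) (s p) \<and>
      restrict \<theta> (opens_in n (V p)) = field_along n J (s p) (V p)" ..
  have V: "V p \<in> opens_in n U" "p \<in> V p" "V p \<in> opens n" and s: "coeffs n J (V p) (s p)"
    and \<theta>V: "restrict \<theta> (opens_in n (V p)) = field_along n J (s p) (V p)" if "p \<in> U" for p
    using Vs that by (auto simp: opens_in_def)
  \<comment> \<open>The coefficient at \<open>x\<close> is taken from the neighbourhood chosen for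
    the point of \<open>x\<close> itself; \<open>agree\<close> shows that every other neighbourhood
    containing it gives the same value.\<close>
  define t where "t j x = s (hclass x) j x" for j x
  have agree: "t j x = s p j x" if p: "p \<in> U" and j: "j \<in> J" and x: "x \<in> \<Union>(V p)" for p j x
  proof -
    let ?q = "hclass x"
    have qV: "?q \<in> V p" by (rule hclass_mem[OF V(3)[OF p] x])
    then have q: "?q \<in> U" using V(1)[OF p] by (auto simp: opens_in_def)
    let ?W = "V p \<inter> V ?q"
    have op: "?W \<in> opens n" by (rule opens_Int[OF V(3)[OF p] V(3)[OF q]])
    have W: "?W \<in> opens_in n (V p)" "?W \<in> opens_in n (V ?q)" using op by (simp_all add: opens_in_def)
    have sub: "opens_in n ?W \<inter> opens_in n (V p) = opens_in n ?W" "opens_in n ?W \<inter> opens_in n (V ?q) = opens_in n ?W"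
      using opens_in_trans[OF _ W(1)] opens_in_trans[OF _ W(2)] by blast+
    have "restrict (restrict \<theta> (opens_in n (V p))) (opens_in n ?W) = restrict (restrict \<theta> (opens_in n (V ?q))) (opens_in n ?W)"
      using sub by (simp add: Int_commute)
    then have eq: "field_along n J (s p) ?W = field_along n J (s ?q) ?W"
      unfolding \<theta>V[OF p] \<theta>V[OF q] field_along_restrict[OF J' s[OF p] W(1)] field_along_restrict[OF J' s[OF q] W(2)] .
    have "x \<in> \<Union>?W" using mem_cone[OF op, of x] mem_cone[OF V(3)[OF p], of x] x qV V(2)[OF q] by blast
    from field_along_inject[OF J k op coeffs_restrict[OF s[OF p] W(1)] coeffs_restrict[OF s[OF q] W(2)] eq j this]
    show ?thesis unfolding t_def by simp
  qed
  have tq: "coeffs n J U t"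
  proof (rule coeffsI, rule lquot_local)
    fix j p assume j: "j \<in> J" and p: "p \<in> U"
    have "lquot n 1 (V p) (t j)" by (rule lquot_cong[OF coeffsD[OF s[OF p] j]]) (rule agree[OF p j, symmetric])
    then show "\<exists>V\<in>opens_in n U. p \<in> V \<and> lquot n 1 V (t j)" using V[OF p] by blast
  qed
  have "\<theta> = field_along n J t U"
  proof (rule field_along_eqI[OF J' tq \<theta>])
    fix X f x assume X: "X \<in> opens_in n U" and f: "f \<in> carrier (reg n X)" and x: "x \<in> \<Union>X"
    let ?q = "hclass x"
    have opX: "X \<in> opens n" using X by (simp add: opens_in_def)
    have qX: "?q \<in> X" by (rule hclass_mem[OF opX x])
    then have q: "?q \<in> U" using X by (auto simp: opens_in_def)
    let ?W = "X \<inter> V ?q"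
    have op: "?W \<in> opens n" by (rule opens_Int[OF opX V(3)[OF q]])
    have W: "?W \<in> opens_in n X" "?W \<in> opens_in n (V ?q)" using op by (simp_all add: opens_in_def)
    have xW: "x \<in> \<Union>?W" using mem_cone[OF op, of x] mem_cone[OF opX, of x] x qX V(2)[OF q] by blast
    have "\<theta> X f ?q = \<theta> ?W (restrict f ?W) ?q"
      using vf_restrict_apply[OF \<theta> X W(1) f] qX V(2)[OF q] by simp
    also have "\<dots> = restrict \<theta> (opens_in n (V ?q)) ?W (restrict f ?W) ?q" using W(2) by simp
    also have "\<dots> = deriv_along J (s ?q) (restrict f ?W) x"
      unfolding \<theta>V[OF q] by (rule field_along_apply[OF J' s[OF q] W(2) reg_restrict[OF f W(1)] xW])
    also have "\<dots> = deriv_along J (s ?q) f x" by (rule deriv_along_restrict[OF W(1) f xW J'])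
    also have "\<dots> = deriv_along J t f x" unfolding deriv_along_def t_def ..
    finally show "\<theta> X f ?q = deriv_along J t f x" .
  qed
  then show ?thesis using fields_alongI[OF tq] by simp
qed

lemma fields_along_family:
  assumes J: "J \<subseteq> {..n} - {k}" and k: "k \<le> n"
  shows "vf_family n (fields_along n J)"
  unfolding vf_family_def
proof (intro ballI conjI)
  have J': "J \<subseteq> {..n}" using J by auto
  fix U assume U: "U \<in> opens n"
  show "fields_along n J U \<subseteq> vf n U" using fields_along_vf[OF J'] by blast
  show "\<zero>\<^bsub>sec (tangent n) U\<^esub> \<in> fields_along n J U"
    unfolding field_along_zero[OF J' U] by (rule fields_alongI[OF coeffs_zero[OF J' U]])
  fix \<theta> assume "\<theta> \<in> fields_along n J U"
  then obtain s where s: "coeffs n J U s" "\<theta> = field_along n J s U" by (rule fields_alongE) blast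
  show "\<theta> \<oplus>\<^bsub>sec (tangent n) U\<^esub> \<eta> \<in> fields_along n J U" if "\<eta> \<in> fields_along n J U" for \<eta>
  proof -
    obtain t where t: "coeffs n J U t" "\<eta> = field_along n J t U" using \<open>\<eta> \<in> fields_along n J U\<close> by (rule fields_alongE) blast
    show ?thesis unfolding s(2) t(2) field_along_add[OF J' s(1) t(1)] by (rule fields_alongI[OF coeffs_add[OF s(1) t(1)]])
  qed
  show "restrict \<theta> (opens_in n V) \<in> fields_along n J V" if "V \<in> opens_in n U" for V
    unfolding s(2) field_along_restrict[OF J' s(1) that] by (rule fields_alongI[OF coeffs_restrict[OF s(1) that]])
next
  have J': "J \<subseteq> {..n}" using J by auto
  fix U a \<theta> assume a: "a \<in> carrier (reg n U)" and "\<theta> \<in> fields_along n J U"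
  then obtain s where s: "coeffs n J U s" "\<theta> = field_along n J s U" by (elim fields_alongE) blast
  show "a \<odot>\<^bsub>sec (tangent n) U\<^esub> \<theta> \<in> fields_along n J U"
    unfolding s(2) field_along_smult[OF J' s(1) a] by (rule fields_alongI[OF coeffs_smult[OF s(1) a]])
next
  fix U \<theta> assume "U \<in> opens n" "\<theta> \<in> vf n U"
  then show "(\<forall>p\<in>U. \<exists>V\<in>opens_in n U. p \<in> V \<and> restrict \<theta> (opens_in n V) \<in> fields_along n J V) \<longrightarrow> \<theta> \<in> fields_along n J U"
    using fields_along_glue[OF J k] by blast
qed

lemma vf_eq_fields_along:
  assumes "V \<in> opens n" "V \<subseteq> chart n l" "l \<le> n"
  shows "vf n V = fields_along n ({..n} - {l}) V"
proof
  show "fields_along n ({..n} - {l}) V \<subseteq> vf n V" using fields_along_vf[of "{..n} - {l}" n] by blast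
  show "vf n V \<subseteq> fields_along n ({..n} - {l}) V"
  proof
    fix \<theta> assume \<theta>: "\<theta> \<in> vf n V"
    have "field_along n ({..n} - {l}) (\<lambda>j x. x l * \<theta> V (\<lambda>p\<in>V. aff l j p) (hclass x)) V \<in> fields_along n ({..n} - {l}) V"
      by (rule fields_alongI[OF coeffsI[OF vf_expand(1)[OF \<theta> assms]]]) simp
    then show "\<theta> \<in> fields_along n ({..n} - {l}) V" using vf_expand(2)[OF \<theta> assms] by simp
  qed
qed

text \<open>The factor \<open>x l\<close> supplies the coefficient of degree 1. On the chart of
  \<open>l\<close>, and for \<open>j\<close> in \<open>J\<close> different from \<open>l\<close>,
  this is the coordinate vector field of \<open>x j / x l\<close>.\<close>

definition coord_field :: "nat \<Rightarrow> nat set \<Rightarrow> nat \<Rightarrow> nat \<Rightarrow> pt set \<Rightarrow> pt set \<Rightarrow> fn \<Rightarrow> fn"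
  where "coord_field n J l j U = field_along n J (\<lambda>i x. if i = j then x l else 0) U"

lemma coeffs_coord:
  assumes "U \<in> opens n" "l \<le> n"
  shows "coeffs n J U (\<lambda>i x. if i = j then x l else 0)"
proof (rule coeffsI)
  fix i
  show "lquot n 1 U (\<lambda>x. if i = j then x l else 0)"
    using lquot_var[OF assms] lquot_mult[OF lquot_const[OF assms(1), of 0] lquot_var[OF assms]] by (cases "i = j") simp_all
qed

lemma coord_field_mem: "U \<in> opens n \<Longrightarrow> l \<le> n \<Longrightarrow> coord_field n J l j U \<in> fields_along n J U"
  unfolding coord_field_def by (intro fields_alongI coeffs_coord)

lemma coord_field_apply:
  assumes "J \<subseteq> {..n}" "U \<in> opens n" "l \<le> n" "j \<in> J" "V \<in> opens_in n U" "f \<in> carrier (reg n V)" "x \<in> \<Union>V"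
  shows "coord_field n J l j U V f (hclass x) = x l * pd j (\<lambda>y. f (hclass y)) x"
proof -
  have fin: "finite J" by (rule finite_subset[OF assms(1)]) simp
  have "coord_field n J l j U V f (hclass x) = deriv_along J (\<lambda>i x. if i = j then x l else 0) f x"
    unfolding coord_field_def by (rule field_along_apply[OF assms(1) coeffs_coord[OF assms(2,3)] assms(5-7)])
  also have "\<dots> = (\<Sum>i\<in>J. if i = j then x l * pd j (\<lambda>y. f (hclass y)) x else 0)"
    unfolding deriv_along_def by (intro sum.cong) auto
  finally show ?thesis using fin assms(4) by simp
qed

text \<open>On the chart a section of O(1) is a unique regular multiple of \<open>x l\<close>, so
  the homogeneous coefficients of a field divided by \<open>x l\<close> are its coordinates. The
  bijection \<open>h\<close> passes from coordinate indices to positions in the frame.\<close>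

lemma fields_along_frame:
  assumes J: "J \<subseteq> {..n} - {k}" and k: "k \<le> n" and h: "bij_betw h {..<r} J"
    and U: "U \<in> opens n" "U \<subseteq> chart n l" and l: "l \<le> n"
  shows "frame n (subshf (tangent n) (fields_along n J)) U r (\<lambda>i. coord_field n J l (h i) U)"
proof -
  have J': "J \<subseteq> {..n}" using J by auto
  have hJ: "h i \<in> J" if "i < r" for i using bij_betwE[OF h] that by simp
  have sum: "(\<Sum>i<r. a i (hclass x) * coord_field n J l (h i) U W f (hclass x)) =
      deriv_along J (\<lambda>j x. a (inv_into {..<r} h j) (hclass x) * x l) f x"
    if "W \<in> opens_in n U" "f \<in> carrier (reg n W)" "x \<in> \<Union>W" for a :: "nat \<Rightarrow> fn" and W f x
  proof -
    have "(\<Sum>i<r. a i (hclass x) * coord_field n J l (h i) U W f (hclass x)) =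
        (\<Sum>i<r. a (inv_into {..<r} h (h i)) (hclass x) * x l * pd (h i) (\<lambda>y. f (hclass y)) x)"
      using h by (intro sum.cong refl) (simp add: coord_field_apply[OF J' U(1) l hJ that] bij_betw_inv_into_left)
    also have "\<dots> = deriv_along J (\<lambda>j x. a (inv_into {..<r} h j) (hclass x) * x l) f x"
      unfolding deriv_along_def by (rule sum.reindex_bij_betw[OF h])
    finally show ?thesis .
  qed
  show ?thesis
  proof (rule iffD2[OF family_frame_iff[OF fields_along_family[OF J k] U(1)]], rule coord_field_mem[OF U(1) l], intro ballI)
    fix V \<theta> assume V: "V \<in> opens_in n U" and \<theta>: "\<theta> \<in> fields_along n J V"
    have op: "V \<in> opens n" and VU: "V \<subseteq> U" and Vl: "V \<subseteq> chart n l" using V U by (auto simp: opens_in_def)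
    obtain s where s: "coeffs n J V s" "\<theta> = field_along n J s V" using \<theta> by (rule fields_alongE) blast
    have nz: "x l \<noteq> 0" if "x \<in> \<Union>V" for x by (rule chart_nonzero[OF l op Vl that])
    have q0: "lquot n 0 V (\<lambda>x. s j x / x l)" if "j \<in> J" for j
      using lquot_divide[OF coeffsD[OF s(1) that] lquot_var[OF op l]] nz by simp
    show "\<exists>!a. a \<in> {..<r} \<rightarrow>\<^sub>E carrier (reg n V) \<and>
      (\<forall>W\<in>opens_in n V. \<forall>f\<in>carrier (reg n W). \<forall>p\<in>W. \<theta> W f p = (\<Sum>i<r. a i p * coord_field n J l (h i) U W f p))"
    proof (rule ex1I[of _ "\<lambda>i\<in>{..<r}. desc V (\<lambda>x. s (h i) x / x l)"], intro conjI ballI)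
      show "(\<lambda>i\<in>{..<r}. desc V (\<lambda>x. s (h i) x / x l)) \<in> {..<r} \<rightarrow>\<^sub>E carrier (reg n V)"
        unfolding restrict_PiE_iff using desc_reg[OF q0[OF hJ] op] by simp
      fix W f p assume W: "W \<in> opens_in n V" and f: "f \<in> carrier (reg n W)" and p: "p \<in> W"
      have opW: "W \<in> opens n" using W by (simp add: opens_in_def)
      obtain x where x: "x \<in> \<Union>W" "p = hclass x" using cone_obtain[OF opW p] .
      have xV: "x \<in> \<Union>V" using x(1) W by (auto simp: opens_in_def)
      have "(\<Sum>i<r. (\<lambda>i\<in>{..<r}. desc V (\<lambda>x. s (h i) x / x l)) i (hclass x) * coord_field n J l (h i) U W f (hclass x)) =
          deriv_along J (\<lambda>j x. (\<lambda>i\<in>{..<r}. desc V (\<lambda>x. s (h i) x / x l)) (inv_into {..<r} h j) (hclass x) * x l) f x"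
        by (rule sum[OF opens_in_trans[OF W V] f x(1)])
      also have "\<dots> = deriv_along J s f x"
        unfolding deriv_along_def
      proof (intro sum.cong refl)
        fix j assume j: "j \<in> J"
        have "inv_into {..<r} h j \<in> {..<r}" "h (inv_into {..<r} h j) = j"
          using h j by (auto simp: bij_betw_def inv_into_into f_inv_into_f)
        then show "(\<lambda>i\<in>{..<r}. desc V (\<lambda>x. s (h i) x / x l)) (inv_into {..<r} h j) (hclass x) * x l * pd j (\<lambda>y. f (hclass y)) x =
            s j x * pd j (\<lambda>y. f (hclass y)) x"
          using desc_apply[OF q0[OF j] op xV] nz[OF xV] by simp
      qed
      also have "\<dots> = \<theta> W f (hclass x)" unfolding s(2) by (rule field_along_apply[OF J' s(1) W f x(1), symmetric])
      finally show "\<theta> W f p = (\<Sum>i<r. (\<lambda>i\<in>{..<r}. desc V (\<lambda>x. s (h i) x / x l)) i p * coord_field n J l (h i) U W f p)"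
        unfolding x(2) ..
    next
      fix a assume "a \<in> {..<r} \<rightarrow>\<^sub>E carrier (reg n V) \<and>
        (\<forall>W\<in>opens_in n V. \<forall>f\<in>carrier (reg n W). \<forall>p\<in>W. \<theta> W f p = (\<Sum>i<r. a i p * coord_field n J l (h i) U W f p))"
      then have a: "a \<in> {..<r} \<rightarrow>\<^sub>E carrier (reg n V)"
        and eq: "\<And>W f p. W \<in> opens_in n V \<Longrightarrow> f \<in> carrier (reg n W) \<Longrightarrow> p \<in> W \<Longrightarrow>
          \<theta> W f p = (\<Sum>i<r. a i p * coord_field n J l (h i) U W f p)" by blast+
      have aq: "coeffs n J V (\<lambda>j x. a (inv_into {..<r} h j) (hclass x) * x l)"
      proof (rule coeffsI)
        fix j assume "j \<in> J"
        then have "inv_into {..<r} h j \<in> {..<r}" using h by (auto simp: bij_betw_def inv_into_into)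
        from lquot_mult[OF reg_lquot[OF PiE_mem[OF a this]] lquot_var[OF op l]]
        show "lquot n 1 V (\<lambda>x. a (inv_into {..<r} h j) (hclass x) * x l)" by simp
      qed
      have "\<theta> = field_along n J (\<lambda>j x. a (inv_into {..<r} h j) (hclass x) * x l) V"
      proof (rule field_along_eqI[OF J' aq fields_along_vf[OF J' \<theta>]])
        fix W f x assume W: "W \<in> opens_in n V" and f: "f \<in> carrier (reg n W)" and x: "x \<in> \<Union>W"
        have "hclass x \<in> W" using hclass_mem[OF _ x] W by (auto simp: opens_in_def)
        then show "\<theta> W f (hclass x) = deriv_along J (\<lambda>j x. a (inv_into {..<r} h j) (hclass x) * x l) f x"
          unfolding sum[OF opens_in_trans[OF W V] f x, symmetric] by (rule eq[OF W f])
      qed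
      then have eq': "field_along n J s V = field_along n J (\<lambda>j x. a (inv_into {..<r} h j) (hclass x) * x l) V" using s(2) by simp
      show "a = (\<lambda>i\<in>{..<r}. desc V (\<lambda>x. s (h i) x / x l))"
      proof (rule PiE_ext[OF a])
        show "(\<lambda>i\<in>{..<r}. desc V (\<lambda>x. s (h i) x / x l)) \<in> {..<r} \<rightarrow>\<^sub>E carrier (reg n V)"
          unfolding restrict_PiE_iff using desc_reg[OF q0[OF hJ] op] by simp
        fix i assume i: "i \<in> {..<r}"
        then have hi: "h i \<in> J" using hJ by simp
        have "a i p = desc V (\<lambda>x. s (h i) x / x l) p" if p: "p \<in> V" for p
        proof -
          obtain x where x: "x \<in> \<Union>V" "p = hclass x" using cone_obtain[OF op p] .
          have "s (h i) x = a (inv_into {..<r} h (h i)) (hclass x) * x l"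
            by (rule field_along_inject[OF J k op s(1) aq eq' hi x(1)])
          then show ?thesis unfolding x(2) desc_apply[OF q0[OF hi] op x(1)]
            using nz[OF x(1)] bij_betw_inv_into_left[OF h i] by simp
        qed
        then show "a i = (\<lambda>i\<in>{..<r}. desc V (\<lambda>x. s (h i) x / x l)) i"
          using reg_eqI[OF PiE_mem[OF a i] desc_reg[OF q0[OF hi] op]] i by simp
      qed
    qed
  qed
qed


lemma frame_generates:
  assumes "frame n E U r e" "sheaf_of_modules n E"
  shows "generates n E U r e"
  unfolding generates_def
proof (intro conjI ballI)
  show "\<forall>i<r. e i \<in> carrier (sec E U)" using assms(1) unfolding frame_def by blast
  fix V t p assume V: "V \<in> opens_in n U" and t: "t \<in> carrier (sec E V)" and p: "p \<in> V"
  have op: "V \<in> opens n" using V by (simp add: opens_in_def)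
  obtain a where a: "a \<in> {..<r} \<rightarrow>\<^sub>E carrier (reg n V)" "t = (\<Oplus>\<^bsub>sec E V\<^esub>i\<in>{..<r}. a i \<odot>\<^bsub>sec E V\<^esub> rst E U V (e i))"
    using assms(1) V t unfolding frame_def by blast
  have "rst E V V t = t" by (rule sheaf_of_modules.rst_id[OF assms(2) op t])
  then have "rst E V V t = (\<Oplus>\<^bsub>sec E V\<^esub>i\<in>{..<r}. a i \<odot>\<^bsub>sec E V\<^esub> rst E U V (e i))" using a(2) by (rule trans)
  moreover have "\<forall>i<r. a i \<in> carrier (reg n V)" using PiE_mem[OF a(1)] by simp
  ultimately show "\<exists>W\<in>opens_in n V. p \<in> W \<and> (\<exists>a. (\<forall>i<r. a i \<in> carrier (reg n W)) \<and>
      rst E V W t = (\<Oplus>\<^bsub>sec E W\<^esub>i\<in>{..<r}. a i \<odot>\<^bsub>sec E W\<^esub> rst E U W (e i)))"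
    using opens_in_refl[OF op] p by blast
qed

lemma fields_along_finite_type:
  assumes J: "J \<subseteq> {..n} - {k}" and k: "k \<le> n"
  shows "finite_type n (PP n) (subshf (tangent n) (fields_along n J))"
  unfolding finite_type_def
proof
  fix p assume p: "p \<in> PP n"
  then obtain x where x: "x \<in> vecs n" "p = hclass x" by (rule PP_obtain)
  then obtain l where l: "l \<le> n" "x l \<noteq> 0" unfolding vecs_def by blast
  have "finite J" by (rule finite_subset[OF J]) simp
  then obtain h where h: "bij_betw h {..<card J} J" using ex_bij_betw_nat_finite by (metis atLeast0LessThan)
  note op = chart_opens[OF l(1)]
  from frame_generates[OF fields_along_frame[OF J k h op subset_refl l(1)] family_sheaf[OF fields_along_family[OF J k]]]
  have "generates n (subshf (tangent n) (fields_along n J)) (chart n l) (card J) (\<lambda>i. coord_field n J l (h i) (chart n l))" .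
  moreover have "chart n l \<in> opens_in n (PP n)" "p \<in> chart n l"
    using op opens_subset[OF op] mem_chart[OF l(1) x(1)] l(2) x(2) by (simp_all add: opens_in_def)
  ultimately show "\<exists>V\<in>opens_in n (PP n). p \<in> V \<and> (\<exists>m s. generates n (subshf (tangent n) (fields_along n J)) V m s)" by blast
qed

lemma chart_nonempty:
  assumes "k \<le> n"
  shows "chart n k \<noteq> {}"
proof -
  have "(\<lambda>i. if i = k then 1 else 0) \<in> vecs n" using assms by (auto simp: vecs_def)
  from mem_chart[OF assms this] show ?thesis by auto
qed

lemma fields_along_rank:
  assumes j: "j \<in> {..n} - {k}" and k: "k \<le> n"
  shows "rank n (subshf (tangent n) (fields_along n {j})) = 1"
proof -
  have J: "{j} \<subseteq> {..n} - {k}" using j by simp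
  have "bij_betw (\<lambda>_. j) {..<1::nat} {j}" by (auto simp: bij_betw_def inj_on_def)
  from fields_along_frame[OF J k this chart_opens[OF k] subset_refl k] show ?thesis
    by (rule rank_one[OF fields_along_family[OF J k] chart_opens[OF k] chart_nonempty[OF k]])
qed

lemma fields_along_stable:
  assumes j: "j \<in> {..n} - {k}" and k: "k \<le> n"
  shows "stable n (subshf (tangent n) (fields_along n {j}))"
proof -
  have J: "{j} \<subseteq> {..n} - {k}" using j by simp
  note F = fields_along_family[OF J k]
  show ?thesis
    unfolding stable_def fields_along_rank[OF j k]
    using family_coherent[OF F fields_along_finite_type[OF J k]] family_torsion_free[OF F] by simp
qed

text \<open>This carries the summand of direction \<open>i\<close> to that of direction
  \<open>j\<close> and keeps the coefficient. The coefficient is recovered by a choice, because a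
  field determines it on the cone over \<open>U\<close> only.\<close>

definition slide :: "nat \<Rightarrow> nat \<Rightarrow> nat \<Rightarrow> pt set \<Rightarrow> (pt set \<Rightarrow> fn \<Rightarrow> fn) \<Rightarrow> (pt set \<Rightarrow> fn \<Rightarrow> fn)"
  where "slide n i j U \<theta> = field_along n {j} (\<lambda>_. SOME s. lquot n 1 U s \<and> \<theta> = field_along n {i} (\<lambda>_. s) U) U"

lemma coeffs_single: "lquot n 1 U s \<Longrightarrow> coeffs n J U (\<lambda>_. s)"
  by (rule coeffsI)

lemma fields_along_singleE:
  assumes "\<theta> \<in> fields_along n {i} U" "i \<le> n" "U \<in> opens n"
  obtains s where "lquot n 1 U s" "\<theta> = field_along n {i} (\<lambda>_. s) U"
proof -
  obtain s where s: "coeffs n {i} U s" "\<theta> = field_along n {i} s U" using assms(1) by (rule fields_alongE)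
  have i: "{i} \<subseteq> {..n}" using assms(2) by simp
  have "\<theta> = field_along n {i} (\<lambda>_. s i) U" unfolding s(2) by (rule field_along_cong[OF i assms(3) s(1)]) simp
  then show ?thesis using that coeffsD[OF s(1)] by blast
qed

text \<open>The chosen coefficient agrees with \<open>s\<close> on the cone over \<open>U\<close> by
  uniqueness for the direction \<open>i\<close>, which is why \<open>i\<close> must differ from the
  omitted \<open>k\<close>; values off the cone do not affect the field.\<close>

lemma slide_field_along:
  assumes i: "i \<in> {..n} - {k}" and j: "j \<le> n" and k: "k \<le> n" and U: "U \<in> opens n" and s: "lquot n 1 U s"
  shows "slide n i j U (field_along n {i} (\<lambda>_. s) U) = field_along n {j} (\<lambda>_. s) U"
proof -
  have I: "{i} \<subseteq> {..n} - {k}" and J: "{j} \<subseteq> {..n}" using i j by simp_all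
  let ?P = "\<lambda>s'. lquot n 1 U s' \<and> field_along n {i} (\<lambda>_. s) U = field_along n {i} (\<lambda>_. s') U"
  define s' where "s' = (SOME s'. ?P s')"
  have "?P s'" unfolding s'_def by (rule someI[of ?P s]) (simp add: s)
  then have s': "lquot n 1 U s'" "field_along n {i} (\<lambda>_. s) U = field_along n {i} (\<lambda>_. s') U" by blast+
  have eq: "s x = s' x" if "x \<in> \<Union>U" for x
    using field_along_inject[OF I k U coeffs_single[OF s] coeffs_single[OF s'(1)] s'(2) _ that] by simp
  have "field_along n {j} (\<lambda>_. s) U = field_along n {j} (\<lambda>_. s') U"
    by (rule field_along_cong[OF J U coeffs_single[OF s]]) (rule eq)
  then show ?thesis unfolding slide_def s'_def by simp
qed

lemma slide_iso_pair:
  assumes i: "i \<in> {..n} - {k}" and j: "j \<in> {..n} - {k}" and k: "k \<le> n"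
  shows "iso_pair n (subshf (tangent n) (fields_along n {i})) (subshf (tangent n) (fields_along n {j})) (slide n i j) (slide n j i)"
  unfolding iso_pair_def
proof (intro ballI conjI)
  have ij: "i \<le> n" "j \<le> n" "{i} \<subseteq> {..n}" "{j} \<subseteq> {..n}" using i j by simp_all
  fix U \<theta> assume U: "U \<in> opens n" and "\<theta> \<in> carrier (sec (subshf (tangent n) (fields_along n {i})) U)"
  then have "\<theta> \<in> fields_along n {i} U" by (simp add: sec_subshf)
  then obtain s where s: "lquot n 1 U s" "\<theta> = field_along n {i} (\<lambda>_. s) U" using ij(1) U by (rule fields_along_singleE)
  note c = coeffs_single[OF s(1)]
  show "slide n i j U \<theta> \<in> carrier (sec (subshf (tangent n) (fields_along n {j})) U)"
    unfolding s(2) slide_field_along[OF i ij(2) k U s(1)] using fields_alongI[OF c] by (simp add: sec_subshf)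
  show "slide n j i U (slide n i j U \<theta>) = \<theta>"
    unfolding s(2) slide_field_along[OF i ij(2) k U s(1)] by (rule slide_field_along[OF j ij(1) k U s(1)])
  show "slide n i j U (\<theta> \<oplus>\<^bsub>sec (subshf (tangent n) (fields_along n {i})) U\<^esub> \<eta>) =
      slide n i j U \<theta> \<oplus>\<^bsub>sec (subshf (tangent n) (fields_along n {j})) U\<^esub> slide n i j U \<eta>"
    if "\<eta> \<in> carrier (sec (subshf (tangent n) (fields_along n {i})) U)" for \<eta>
  proof -
    have "\<eta> \<in> fields_along n {i} U" using that by (simp add: sec_subshf)
    then obtain t where t: "lquot n 1 U t" "\<eta> = field_along n {i} (\<lambda>_. t) U" using ij(1) U by (rule fields_along_singleE)
    note d = coeffs_single[OF t(1)]
    have "slide n i j U (\<theta> \<oplus>\<^bsub>sec (tangent n) U\<^esub> \<eta>) = slide n i j U \<theta> \<oplus>\<^bsub>sec (tangent n) U\<^esub> slide n i j U \<eta>"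
      unfolding s(2) t(2) field_along_add[OF ij(3) c d] slide_field_along[OF i ij(2) k U s(1)] slide_field_along[OF i ij(2) k U t(1)]
        field_along_add[OF ij(4) c d] by (rule slide_field_along[OF i ij(2) k U lquot_add[OF s(1) t(1)]])
    then show ?thesis by (simp add: sec_subshf)
  qed
  show "slide n i j U (f \<odot>\<^bsub>sec (subshf (tangent n) (fields_along n {i})) U\<^esub> \<theta>) =
      f \<odot>\<^bsub>sec (subshf (tangent n) (fields_along n {j})) U\<^esub> slide n i j U \<theta>" if f: "f \<in> carrier (reg n U)" for f
  proof -
    have q: "lquot n 1 U (\<lambda>x. f (hclass x) * s x)" using lquot_mult[OF reg_lquot[OF f] s(1)] by simp
    have "slide n i j U (f \<odot>\<^bsub>sec (tangent n) U\<^esub> \<theta>) = f \<odot>\<^bsub>sec (tangent n) U\<^esub> slide n i j U \<theta>"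
      unfolding s(2) field_along_smult[OF ij(3) c f] slide_field_along[OF i ij(2) k U s(1)] field_along_smult[OF ij(4) c f]
      by (rule slide_field_along[OF i ij(2) k U q])
    then show ?thesis by (simp add: sec_subshf)
  qed
  show "slide n i j V (rst (subshf (tangent n) (fields_along n {i})) U V \<theta>) = rst (subshf (tangent n) (fields_along n {j})) U V (slide n i j U \<theta>)"
    if V: "V \<in> opens_in n U" for V
  proof -
    have opV: "V \<in> opens n" using V by (simp add: opens_in_def)
    show ?thesis unfolding rst_subshf rst_tangent s(2) field_along_restrict[OF ij(3) c V] slide_field_along[OF i ij(2) k U s(1)]
        field_along_restrict[OF ij(4) c V] by (rule slide_field_along[OF i ij(2) k opV lquot_restrict[OF s(1) V]])
  qed
qed

lemma fields_along_slope:
  assumes i: "i \<in> {..n} - {k}" and j: "j \<in> {..n} - {k}" and k: "k \<le> n"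
  shows "slope n (subshf (tangent n) (fields_along n {i})) = slope n (subshf (tangent n) (fields_along n {j}))"
proof -
  have I: "{i} \<subseteq> {..n} - {k}" and J: "{j} \<subseteq> {..n} - {k}" using i j by simp_all
  have "Defs.degree n (subshf (tangent n) (fields_along n {i})) = Defs.degree n (subshf (tangent n) (fields_along n {j}))"
    by (rule iso_pair_degree[OF slide_iso_pair[OF i j k] slide_iso_pair[OF j i k]
        family_sheaf[OF fields_along_family[OF I k]] family_sheaf[OF fields_along_family[OF J k]]])
      (simp only: fields_along_rank[OF i k] fields_along_rank[OF j k])
  then show ?thesis unfolding slope_def by (simp only: fields_along_rank[OF i k] fields_along_rank[OF j k])
qed


section \<open>The logarithmic tangent sheaf\<close>

lemma vf_combination:
  assumes U: "U \<in> opens n" and \<delta>: "\<And>i. i < r \<Longrightarrow> \<delta> i \<in> vf n U" and c: "\<And>i. i < r \<Longrightarrow> c i \<in> carrier (reg n U)"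
  shows "(\<Oplus>\<^bsub>sec (tangent n) U\<^esub>i\<in>{..<r::nat}. c i \<odot>\<^bsub>sec (tangent n) U\<^esub> \<delta> i) \<in> vf n U"
    and "\<lbrakk>W \<in> opens_in n U; f \<in> carrier (reg n W); p \<in> W\<rbrakk> \<Longrightarrow>
      (\<Oplus>\<^bsub>sec (tangent n) U\<^esub>i\<in>{..<r}. c i \<odot>\<^bsub>sec (tangent n) U\<^esub> \<delta> i) W f p = (\<Sum>i<r. c i p * \<delta> i W f p)"
proof -
  have *: "c i \<odot>\<^bsub>sec (tangent n) U\<^esub> \<delta> i \<in> vf n U" if "i \<in> {..<r}" for i
    using vf_smult_closed[OF c \<delta>] that by simp
  show "(\<Oplus>\<^bsub>sec (tangent n) U\<^esub>i\<in>{..<r::nat}. c i \<odot>\<^bsub>sec (tangent n) U\<^esub> \<delta> i) \<in> vf n U"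
    by (rule family_finsum_closed[OF tangent_family U finite_lessThan *, unfolded subshf_vf])
  assume w: "W \<in> opens_in n U" "f \<in> carrier (reg n W)" "p \<in> W"
  have "(\<Oplus>\<^bsub>sec (tangent n) U\<^esub>i\<in>{..<r}. c i \<odot>\<^bsub>sec (tangent n) U\<^esub> \<delta> i) W f p =
      (\<Sum>i<r. (c i \<odot>\<^bsub>sec (tangent n) U\<^esub> \<delta> i) W f p)"
    by (rule family_finsum_apply[OF tangent_family U finite_lessThan * w, unfolded subshf_vf])
  also have "\<dots> = (\<Sum>i<r. c i p * \<delta> i W f p)"
    using w by (intro sum.cong refl) (simp add: tangent_smult)
  finally show "(\<Oplus>\<^bsub>sec (tangent n) U\<^esub>i\<in>{..<r}. c i \<odot>\<^bsub>sec (tangent n) U\<^esub> \<delta> i) W f p = (\<Sum>i<r. c i p * \<delta> i W f p)" .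
qed

text \<open>On the chart every vector field is a field along the coordinates other than
  \<open>l\<close>, so the frame of these fields is a frame of the whole tangent sheaf.\<close>

lemma tangent_frame:
  assumes h: "bij_betw h {..<r} ({..n} - {l})" and U: "U \<in> opens n" "U \<subseteq> chart n l" and l: "l \<le> n"
  shows "frame n (tangent n) U r (\<lambda>i. coord_field n ({..n} - {l}) l (h i) U)"
proof -
  let ?J = "{..n} - {l}"
  let ?\<delta> = "\<lambda>i. coord_field n ?J l (h i) U"
  note F = fields_along_family[OF subset_refl l]
  have eq: "vf n V = fields_along n ?J V" if V: "V \<in> opens_in n U" for V
    using vf_eq_fields_along[OF _ _ l, of V] V U(2) by (auto simp: opens_in_def)
  have fr: "frame n (subshf (tangent n) (fields_along n ?J)) U r ?\<delta>" by (rule fields_along_frame[OF subset_refl l h U l])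
  have "frame n (subshf (tangent n) (vf n)) U r ?\<delta>"
  proof (rule iffD2[OF family_frame_iff[OF tangent_family U(1)]])
    show "?\<delta> i \<in> vf n U" for i unfolding eq[OF opens_in_refl[OF U(1)]] by (rule coord_field_mem[OF U(1) l])
    show "\<forall>V\<in>opens_in n U. \<forall>t\<in>vf n V. \<exists>!a. a \<in> {..<r} \<rightarrow>\<^sub>E carrier (reg n V) \<and>
      (\<forall>W\<in>opens_in n V. \<forall>f\<in>carrier (reg n W). \<forall>p\<in>W. t W f p = (\<Sum>i<r. a i p * ?\<delta> i W f p))"
      by (intro ballI frame_ex1[OF F U(1) fr]) (simp_all only: eq)
  qed
  then show ?thesis unfolding subshf_vf .
qed

text \<open>The family of sections inside \<open>log_tangent\<close>, named so that it can be
  treated as a family of vector fields.\<close>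

definition log_fields :: "nat \<Rightarrow> pt set \<Rightarrow> pt set \<Rightarrow> (pt set \<Rightarrow> fn \<Rightarrow> fn) set"
  where "log_fields n D U = {\<theta> \<in> carrier (sec (tangent n) U).
    \<forall>p \<in> U \<inter> D. \<exists>W\<in>opens_in n U. p \<in> W \<and>
      (\<exists>z \<delta>. local_coordinates n W z \<delta> \<and> D \<inter> W = {q \<in> W. z 0 q = 0} \<and>
        (\<exists>a. (\<forall>i<n. a i \<in> carrier (reg n W)) \<and>
          rst (tangent n) U W \<theta> = (\<Oplus>\<^bsub>sec (tangent n) W\<^esub>i\<in>{..<n}.
            (if i = 0 then a 0 \<otimes>\<^bsub>reg n W\<^esub> z 0 else a i) \<odot>\<^bsub>sec (tangent n) W\<^esub> \<delta> i)))}"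

lemma log_tangent_eq: "log_tangent n D = subshf (tangent n) (log_fields n D)"
  unfolding log_tangent_def log_fields_def ..

definition coord_hyperplane :: "nat \<Rightarrow> nat \<Rightarrow> pt set"
  where "coord_hyperplane n k = {p \<in> PP n. \<forall>x\<in>p. x k = 0}"

lemma mem_coord_hyperplane:
  assumes "x \<in> vecs n"
  shows "hclass x \<in> coord_hyperplane n k \<longleftrightarrow> x k = 0"
  using assms mem_hclass[of x] unfolding coord_hyperplane_def PP_vecs by (auto simp: hclass_def)

text \<open>The definition of the logarithmic fields takes coordinate number 0 as the equation of
  \<open>D\<close>, so an enumeration of the affine coordinates has to begin with
  \<open>k\<close>.\<close>

lemma ex_bij_betw_first:
  assumes "finite A" "k \<in> A"
  shows "\<exists>h. bij_betw h {..<card A} A \<and> h 0 = k"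
proof -
  have c: "card A = Suc (card (A - {k}))" using assms by (metis card.remove)
  obtain g where g: "bij_betw g {..<card (A - {k})} (A - {k})"
    using ex_bij_betw_nat_finite[of "A - {k}"] assms(1) by (auto simp: atLeast0LessThan)
  define h where "h i = (case i of 0 \<Rightarrow> k | Suc i \<Rightarrow> g i)" for i
  have "h ` {..<card A} = insert k (g ` {..<card (A - {k})})"
    unfolding c lessThan_Suc_eq_insert_0 by (simp add: h_def image_image)
  then have im: "h ` {..<card A} = A" using g assms(2) by (auto simp: bij_betw_def)
  then have "inj_on h {..<card A}" by (intro eq_card_imp_inj_on) simp_all
  then show ?thesis using im by (auto simp: bij_betw_def h_def intro!: exI[of _ h])
qed

text \<open>Near a point of the hyperplane some \<open>l\<close> different from \<open>k\<close> has
  \<open>x l\<close> nonzero, and the coordinates \<open>x j / x l\<close> are adapted, with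
  \<open>x k / x l\<close> in position 0. As \<open>k\<close> is left out, the field takes this
  coordinate to \<open>- s l / x l\<close> times itself.\<close>

lemma fields_along_subset_log_fields:
  assumes n: "n \<ge> 1" and k: "k \<le> n" and U: "U \<in> opens n"
  shows "fields_along n ({..n} - {k}) U \<subseteq> log_fields n (coord_hyperplane n k) U"
proof
  let ?I = "{..n} - {k}" and ?D = "coord_hyperplane n k"
  fix \<theta> assume \<theta>: "\<theta> \<in> fields_along n ?I U"
  have I: "?I \<subseteq> {..n}" by blast
  note \<theta>vf = fields_along_vf[OF I \<theta>]
  obtain s where s: "coeffs n ?I U s" "\<theta> = field_along n ?I s U" using \<theta> by (rule fields_alongE)
  have "\<exists>W\<in>opens_in n U. p \<in> W \<and>
      (\<exists>z \<delta>. local_coordinates n W z \<delta> \<and> ?D \<inter> W = {q \<in> W. z 0 q = 0} \<and>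
        (\<exists>a. (\<forall>i<n. a i \<in> carrier (reg n W)) \<and>
          rst (tangent n) U W \<theta> = (\<Oplus>\<^bsub>sec (tangent n) W\<^esub>i\<in>{..<n}.
            (if i = 0 then a 0 \<otimes>\<^bsub>reg n W\<^esub> z 0 else a i) \<odot>\<^bsub>sec (tangent n) W\<^esub> \<delta> i)))"
    if p: "p \<in> U \<inter> ?D" for p
  proof -
    obtain x where x: "x \<in> \<Union>U" "p = hclass x" "x \<in> vecs n" using cone_obtain[OF U, of p] p by blast
    have xk: "x k = 0" using p mem_coord_hyperplane[OF x(3)] x(2) by blast
    obtain l where l: "l \<le> n" "x l \<noteq> 0" using x(3) unfolding vecs_def by blast
    have lk: "l \<noteq> k" using l xk by blast
    let ?W = "U \<inter> chart n l" and ?J = "{..n} - {l}"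
    have J: "?J \<subseteq> {..n}" by blast
    have op: "?W \<in> opens n" by (rule opens_Int[OF U chart_opens[OF l(1)]])
    have W: "?W \<in> opens_in n U" "?W \<subseteq> chart n l" using op by (simp_all add: opens_in_def)
    have WW: "?W \<in> opens_in n ?W" by (rule opens_in_refl[OF op])
    have pW: "p \<in> ?W" using p mem_chart[OF l(1) x(3)] l(2) x(2) by simp
    have "card ?J = n" using l(1) by simp
    then obtain h where h: "bij_betw h {..<n} ?J" "h 0 = k" using ex_bij_betw_first[of ?J k] k lk by auto
    have hJ: "h i \<in> ?J" if "i < n" for i using bij_betwE[OF h(1)] that by simp
    have hn: "h i \<le> n" if "i < n" for i using hJ[OF that] by simp
    define z where "z i = (\<lambda>p\<in>?W. aff l (h i) p)" for i
    define \<delta> where "\<delta> i = coord_field n ?J l (h i) ?W" for i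
    have z: "z i \<in> carrier (reg n ?W)" if "i < n" for i unfolding z_def by (rule aff_reg[OF op W(2) l(1) hn[OF that]])
    have \<delta>_frame: "frame n (tangent n) ?W n \<delta>" unfolding \<delta>_def by (rule tangent_frame[OF h(1) op W(2) l(1)])
    have \<delta>vf: "\<delta> i \<in> vf n ?W" if "i < n" for i using \<delta>_frame that unfolding frame_def by blast
    have \<delta>_apply: "\<delta> i V f (hclass y) = y l * pd (h i) (\<lambda>y. f (hclass y)) y"
      if "i < n" "V \<in> opens_in n ?W" "f \<in> carrier (reg n V)" "y \<in> \<Union>V" for i V f y
      unfolding \<delta>_def by (rule coord_field_apply[OF J op l(1) hJ[OF that(1)] that(2-4)])
    have coords: "local_coordinates n ?W z \<delta>"
      unfolding local_coordinates_def
    proof (intro conjI allI impI)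
      show "frame n (tangent n) ?W n \<delta>" by (rule \<delta>_frame)
      fix i j assume i: "i < n" and j: "j < n"
      show "z i \<in> carrier (reg n ?W)" by (rule z[OF i])
      show "\<delta> i ?W (z j) = (if i = j then \<one>\<^bsub>reg n ?W\<^esub> else \<zero>\<^bsub>reg n ?W\<^esub>)"
      proof (rule reg_eqI[OF vf_closed[OF \<delta>vf[OF i] WW z[OF j]]])
        show "(if i = j then \<one>\<^bsub>reg n ?W\<^esub> else \<zero>\<^bsub>reg n ?W\<^esub>) \<in> carrier (reg n ?W)"
          using reg_const[OF op, of 0] reg_const[OF op, of 1] by (simp add: reg_simps)
        fix q assume q: "q \<in> ?W"
        obtain y where y: "y \<in> \<Union>?W" "q = hclass y" using cone_obtain[OF op q] .
        have yl: "y l \<noteq> 0" by (rule chart_nonzero[OF l(1) op W(2) y(1)])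
        have sub: "{h i} \<subseteq> {..n}" using hn[OF i] by simp
        have "\<delta> i ?W (z j) (hclass y) = deriv_along {h i} (\<lambda>_ y. y l) (z j) y"
          unfolding \<delta>_apply[OF i WW z[OF j] y(1)] by (simp add: deriv_along_def)
        also have "\<dots> = (if h j = h i then 1 else 0)"
          unfolding z_def deriv_along_affine[OF op W(2) l(1) hn[OF j] y(1) sub] using hJ[OF i] yl by auto
        also have "\<dots> = (if i = j then 1 else 0)"
          using bij_betw_imp_inj_on[OF h(1)] i j by (auto simp: inj_on_def)
        finally show "\<delta> i ?W (z j) q = (if i = j then \<one>\<^bsub>reg n ?W\<^esub> else \<zero>\<^bsub>reg n ?W\<^esub>) q"
          using q unfolding y(2) by (simp add: reg_simps)
      qed
    qed
    have zero: "?D \<inter> ?W = {q \<in> ?W. z 0 q = 0}"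
    proof -
      have "q \<in> ?D \<longleftrightarrow> z 0 q = 0" if q: "q \<in> ?W" for q
      proof -
        obtain y where y: "y \<in> \<Union>?W" "q = hclass y" "y \<in> vecs n" using cone_obtain[OF op q] .
        have "y l \<noteq> 0" by (rule chart_nonzero[OF l(1) op W(2) y(1)])
        then show ?thesis using mem_coord_hyperplane[OF y(3), of k] q unfolding z_def h(2) y(2) by (simp add: aff_apply)
      qed
      then show ?thesis by blast
    qed
    let ?\<theta> = "restrict \<theta> (opens_in n ?W)"
    have \<theta>W: "?\<theta> \<in> vf n ?W" by (rule vf_rst_closed[OF \<theta>vf W(1)])
    have lI: "l \<in> ?I" using l(1) lk by simp
    have q0: "lquot n 0 ?W (\<lambda>x. - s l x / x l)"
    proof -
      have m: "lquot n 1 ?W (\<lambda>x. - s l x)" by (rule lquot_minus[OF lquot_restrict[OF coeffsD[OF s(1) lI] W(1)] op])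
      have "lquot n (1 - 1) ?W (\<lambda>x. - s l x / x l)"
        by (rule lquot_divide[OF m lquot_var[OF op l(1)]]) (rule chart_nonzero[OF l(1) op W(2)])
      then show ?thesis by simp
    qed
    \<comment> \<open>At 0 stands the factor by which the field multiplies \<open>z 0\<close>; the
      other coefficients are the derivatives of the coordinates themselves.\<close>
    define a where "a i = (if i = 0 then desc ?W (\<lambda>x. - s l x / x l) else ?\<theta> ?W (z i))" for i
    have a: "a i \<in> carrier (reg n ?W)" if "i < n" for i
      unfolding a_def using desc_reg[OF q0 op] vf_closed[OF \<theta>W WW z[OF that]] by simp
    let ?c = "\<lambda>i. if i = 0 then a 0 \<otimes>\<^bsub>reg n ?W\<^esub> z 0 else a i"
    have c: "?c i \<in> carrier (reg n ?W)" if "i < n" for i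
      using reg_mult[OF op a[of 0] z[of 0]] a[OF that] n by (simp add: reg_simps)
    have c_eq: "?c i q = ?\<theta> ?W (z i) q" if i: "i < n" and q: "q \<in> ?W" for i q
    proof (cases "i = 0")
      case True
      obtain y where y: "y \<in> \<Union>?W" "q = hclass y" using cone_obtain[OF op q] .
      have yl: "y l \<noteq> 0" by (rule chart_nonzero[OF l(1) op W(2) y(1)])
      have z0: "z 0 \<in> carrier (reg n ?W)" using z n by simp
      have "?\<theta> ?W (z 0) (hclass y) = deriv_along ?I s (z 0) y"
        using field_along_apply[OF I s(1) W(1) z0 y(1)] WW unfolding s(2) by simp
      also have "\<dots> = - s l y * y k / (y l)\<^sup>2"
        unfolding z_def h(2) deriv_along_affine[OF op W(2) l(1) k y(1) I] using lI by simp
      also have "\<dots> = desc ?W (\<lambda>x. - s l x / x l) (hclass y) * z 0 (hclass y)"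
        unfolding desc_apply[OF q0 op y(1)] using q y(2) by (simp add: z_def h(2) aff_apply power2_eq_square)
      finally show ?thesis using True q unfolding y(2) by (simp add: reg_simps a_def)
    qed (simp add: a_def)
    have "?\<theta> = (\<Oplus>\<^bsub>sec (tangent n) ?W\<^esub>i\<in>{..<n}. ?c i \<odot>\<^bsub>sec (tangent n) ?W\<^esub> \<delta> i)"
    proof (rule vf_eq_on_cone[OF \<theta>W vf_combination(1)[OF op \<delta>vf c]])
      fix V f y assume V: "V \<in> opens_in n ?W" and f: "f \<in> carrier (reg n V)" and y: "y \<in> \<Union>V"
      have opV: "V \<in> opens n" using V by (simp add: opens_in_def)
      have yV: "hclass y \<in> V" by (rule hclass_mem[OF opV y])
      then have yW: "hclass y \<in> ?W" using V by (auto simp: opens_in_def)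
      let ?s = "\<lambda>j x. x l * ?\<theta> ?W (\<lambda>p\<in>?W. aff l j p) (hclass x)"
      have cs: "coeffs n ?J ?W ?s" by (rule coeffsI[OF vf_expand(1)[OF \<theta>W op W(2) l(1)]]) simp
      have "?\<theta> V f (hclass y) = field_along n ?J ?s ?W V f (hclass y)"
        using vf_expand(2)[OF \<theta>W op W(2) l(1)] by (rule arg_cong)
      also have "\<dots> = deriv_along ?J ?s f y" by (rule field_along_apply[OF J cs V f y])
      also have "\<dots> = (\<Sum>i<n. ?s (h i) y * pd (h i) (\<lambda>y. f (hclass y)) y)"
        unfolding deriv_along_def by (rule sum.reindex_bij_betw[OF h(1), symmetric])
      also have "\<dots> = (\<Sum>i<n. ?c i (hclass y) * \<delta> i V f (hclass y))"
      proof (rule sum.cong[OF refl])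
        fix i assume "i \<in> {..<n}"
        then have i: "i < n" by simp
        have e: "?c i (hclass y) = ?\<theta> ?W (\<lambda>p\<in>?W. aff l (h i) p) (hclass y)"
          by (rule trans[OF c_eq[OF i yW]]) (simp only: z_def)
        show "?s (h i) y * pd (h i) (\<lambda>y. f (hclass y)) y = ?c i (hclass y) * \<delta> i V f (hclass y)"
          unfolding e \<delta>_apply[OF i V f y] by (simp only: mult_ac)
      qed
      also have "\<dots> = (\<Oplus>\<^bsub>sec (tangent n) ?W\<^esub>i\<in>{..<n}. ?c i \<odot>\<^bsub>sec (tangent n) ?W\<^esub> \<delta> i) V f (hclass y)"
        by (rule vf_combination(2)[OF op \<delta>vf c V f yV, symmetric])
      finally show "?\<theta> V f (hclass y) = (\<Oplus>\<^bsub>sec (tangent n) ?W\<^esub>i\<in>{..<n}. ?c i \<odot>\<^bsub>sec (tangent n) ?W\<^esub> \<delta> i) V f (hclass y)" .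
    qed
    then show ?thesis using W(1) pW coords zero a unfolding rst_tangent by blast
  qed
  then show "\<theta> \<in> log_fields n ?D U" unfolding log_fields_def using \<theta>vf by blast
qed

text \<open>The adapted coordinates are arbitrary, so \<open>z 0\<close> has to be compared with
  \<open>x k / x l\<close>. Their quotient is nonzero on the hyperplane because
  \<open>\<delta> 0\<close> takes \<open>z 0\<close> to 1. So the field, which multiplies
  \<open>z 0\<close> by a function, also takes \<open>x k / x l\<close> to a multiple of itself near
  the point, and a multiple of the Euler field removes the direction \<open>k\<close>.\<close>

lemma log_fields_subset_fields_along:
  assumes n: "n \<ge> 1" and k: "k \<le> n" and U: "U \<in> opens n"
  shows "log_fields n (coord_hyperplane n k) U \<subseteq> fields_along n ({..n} - {k}) U"
proof
  let ?I = "{..n} - {k}" and ?D = "coord_hyperplane n k"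
  have I: "?I \<subseteq> {..n}" by blast
  fix \<theta> assume \<theta>: "\<theta> \<in> log_fields n ?D U"
  then have \<theta>vf: "\<theta> \<in> vf n U" unfolding log_fields_def by blast
  show "\<theta> \<in> fields_along n ?I U"
  proof (rule fields_along_glue[OF subset_refl k U \<theta>vf])
    fix p assume p: "p \<in> U"
    obtain x where x: "x \<in> \<Union>U" "p = hclass x" "x \<in> vecs n" using cone_obtain[OF U p] .
    show "\<exists>V\<in>opens_in n U. p \<in> V \<and> restrict \<theta> (opens_in n V) \<in> fields_along n ?I V"
    proof (cases "p \<in> ?D")
      \<comment> \<open>Off the hyperplane \<open>x k\<close> is nonzero, and on the chart of
        \<open>k\<close> every vector field can be written without this direction.\<close>
      case False
      let ?V = "U \<inter> chart n k"
      have op: "?V \<in> opens n" by (rule opens_Int[OF U chart_opens[OF k]])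
      have V: "?V \<in> opens_in n U" "?V \<subseteq> chart n k" using op by (simp_all add: opens_in_def)
      have "p \<in> ?V" using False p mem_coord_hyperplane[OF x(3), of k] mem_chart[OF k x(3)] x(2) by simp
      moreover have "restrict \<theta> (opens_in n ?V) \<in> fields_along n ?I ?V"
        using vf_rst_closed[OF \<theta>vf V(1)] vf_eq_fields_along[OF op V(2) k] by simp
      ultimately show ?thesis using V(1) by blast
    next
      case True
      then obtain W z \<delta> a where W: "W \<in> opens_in n U" "p \<in> W" and lc: "local_coordinates n W z \<delta>"
        and D: "?D \<inter> W = {q \<in> W. z 0 q = 0}" and a: "\<forall>i<n. a i \<in> carrier (reg n W)"
        and comb: "rst (tangent n) U W \<theta> = (\<Oplus>\<^bsub>sec (tangent n) W\<^esub>i\<in>{..<n}.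
            (if i = 0 then a 0 \<otimes>\<^bsub>reg n W\<^esub> z 0 else a i) \<odot>\<^bsub>sec (tangent n) W\<^esub> \<delta> i)"
        using \<theta> p unfolding log_fields_def by blast
      have opW: "W \<in> opens n" using W(1) by (simp add: opens_in_def)
      have WW: "W \<in> opens_in n W" by (rule opens_in_refl[OF opW])
      have n0: "0 < n" using n by simp
      have z0: "z 0 \<in> carrier (reg n W)" using lc n0 unfolding local_coordinates_def by blast
      have \<delta>vf: "\<delta> i \<in> vf n W" if "i < n" for i using lc that unfolding local_coordinates_def frame_def by blast
      have \<delta>z: "\<delta> i W (z 0) q = (if i = 0 then 1 else 0)" if "i < n" "q \<in> W" for i q
      proof -
        have "\<delta> i W (z 0) = (if i = 0 then \<one>\<^bsub>reg n W\<^esub> else \<zero>\<^bsub>reg n W\<^esub>)"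
          using lc that(1) n0 unfolding local_coordinates_def by blast
        then show ?thesis using that(2) by (simp add: reg_simps)
      qed
      let ?c = "\<lambda>i. if i = 0 then a 0 \<otimes>\<^bsub>reg n W\<^esub> z 0 else a i"
      have c: "?c i \<in> carrier (reg n W)" if "i < n" for i
        using reg_mult[OF opW, of "a 0" "z 0"] a z0 n0 that by (simp add: reg_simps)
      \<comment> \<open>Applied to \<open>z 0\<close>, the combination keeps only its first term,
        which contains the factor \<open>z 0\<close>.\<close>
      have \<theta>z: "\<theta> W (z 0) q = a 0 q * z 0 q" if q: "q \<in> W" for q
      proof -
        have "\<theta> W (z 0) q = (\<Oplus>\<^bsub>sec (tangent n) W\<^esub>i\<in>{..<n}. ?c i \<odot>\<^bsub>sec (tangent n) W\<^esub> \<delta> i) W (z 0) q"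
          unfolding comb[symmetric] rst_tangent using WW by simp
        also have "\<dots> = (\<Sum>i<n. ?c i q * \<delta> i W (z 0) q)" by (rule vf_combination(2)[OF opW \<delta>vf c WW z0 q])
        also have "\<dots> = (\<Sum>i<n. if i = 0 then ?c 0 q else 0)" using \<delta>z q by (intro sum.cong) auto
        also have "\<dots> = ?c 0 q" using n0 by simp
        finally show ?thesis using q by (simp add: reg_simps)
      qed
      have xk: "x k = 0" using True mem_coord_hyperplane[OF x(3)] x(2) by blast
      obtain l where l: "l \<le> n" "x l \<noteq> 0" using x(3) unfolding vecs_def by blast
      have lk: "l \<noteq> k" using l xk by blast
      let ?W1 = "W \<inter> chart n l"
      have op1: "?W1 \<in> opens n" by (rule opens_Int[OF opW chart_opens[OF l(1)]])
      have W1: "?W1 \<in> opens_in n W" using op1 by (simp add: opens_in_def)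
      have x1: "x \<in> \<Union>?W1"
        unfolding mem_cone[OF op1] using x(2,3) W(2) mem_chart[OF l(1) x(3)] l(2) by simp
      have zD: "z 0 (hclass y) = 0" if "y \<in> \<Union>W" "y k = 0" for y
      proof -
        have "y \<in> vecs n" "hclass y \<in> W" using mem_cone[OF opW, of y] that(1) by blast+
        then show ?thesis using mem_coord_hyperplane[of y n k] that(2) D by blast
      qed
      have "lquot n 0 ?W1 (\<lambda>y. z 0 (hclass y))" by (rule lquot_restrict[OF reg_lquot[OF z0] W1])
      from lquot_divide_hyperplane[OF this op1 x1 xk k l(1,2)] zD obtain W2 u where
        W2: "W2 \<in> opens_in n ?W1" "x \<in> \<Union>W2" "lquot n 0 W2 u"
          "\<forall>y\<in>\<Union>W2. y l \<noteq> 0 \<and> z 0 (hclass y) = u y * (y k / y l)" by blast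
      have op2: "W2 \<in> opens n" and W2l: "W2 \<subseteq> chart n l" and W2W: "W2 \<in> opens_in n W"
        using W2(1) opens_in_trans[OF W2(1) W1] by (auto simp: opens_in_def)
      have W2U: "W2 \<in> opens_in n U" by (rule opens_in_trans[OF W2W W(1)])
      have W22: "W2 \<in> opens_in n W2" by (rule opens_in_refl[OF op2])
      let ?u = "desc W2 u" and ?w = "\<lambda>p\<in>W2. aff l k p"
      have u: "?u \<in> carrier (reg n W2)" by (rule desc_reg[OF W2(3) op2])
      have w: "?w \<in> carrier (reg n W2)" by (rule aff_reg[OF op2 W2l l(1) k])
      have zuw: "restrict (z 0) W2 = (\<lambda>p\<in>W2. ?u p * ?w p)"
      proof (rule restrict_ext)
        fix q assume q: "q \<in> W2"
        obtain y where y: "y \<in> \<Union>W2" "q = hclass y" using cone_obtain[OF op2 q] .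
        show "z 0 q = ?u q * ?w q"
          unfolding y(2) desc_apply[OF W2(3) op2 y(1)] using bspec[OF W2(4) y(1)] y(2) q by (simp add: aff_apply)
      qed
      \<comment> \<open>Applied to \<open>\<delta> 0\<close>, defined over \<open>W\<close>, and to
        \<open>\<theta>\<close>, defined over \<open>U\<close>; hence the variable
        \<open>Y\<close>.\<close>
      have prod: "\<eta> W (z 0) q = ?u q * \<eta> W2 ?w q + ?w q * \<eta> W2 ?u q"
        if \<eta>: "\<eta> \<in> vf n Y" and Y: "W \<in> opens_in n Y" and q: "q \<in> W2" for \<eta> Y q
        unfolding vf_restrict_apply[OF \<eta> Y W2W z0 q, symmetric] zuw
        by (rule vf_mult_apply[OF \<eta> opens_in_trans[OF W2W Y] u w q])
      have \<theta>w: "\<theta> W2 ?w (hclass y) = 0" if y: "y \<in> \<Union>W2" "y k = 0" for y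
      proof -
        have q: "hclass y \<in> W2" by (rule hclass_mem[OF op2 y(1)])
        then have qW: "hclass y \<in> W" using W2W by (auto simp: opens_in_def)
        have w0: "?w (hclass y) = 0" using q y(2) by (simp add: aff_apply)
        have "y \<in> \<Union>W" using y(1) W2W by (auto simp: opens_in_def)
        note zy = zD[OF this y(2)]
        \<comment> \<open>Where \<open>?w\<close> vanishes, the product rule leaves
          \<open>?u\<close> times the derivative of \<open>?w\<close>. For \<open>\<delta> 0\<close>
          the total is 1, so \<open>?u\<close> has no zero on the hyperplane.\<close>
        have "?u (hclass y) * \<delta> 0 W2 ?w (hclass y) = 1"
          using prod[OF \<delta>vf[OF n0] WW q] trans[OF \<delta>z[OF n0 qW] if_P[OF refl]]
          unfolding w0 mult_zero_left add_0_right by (rule trans[OF sym])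
        then have "?u (hclass y) \<noteq> 0" by (metis mult_zero_left zero_neq_one)
        moreover have "?u (hclass y) * \<theta> W2 ?w (hclass y) = 0"
          using prod[OF \<theta>vf W(1) q] \<theta>z[OF qW] unfolding w0 zy by (simp only: mult_zero_left mult_zero_right add_0_right)
        ultimately show ?thesis by (metis mult_eq_0_iff)
      qed
      \<comment> \<open>The derivative of \<open>x k / x l\<close> vanishes on the hyperplane, so a
        second division writes it as \<open>b\<close> times \<open>x k / x l\<close> near the
        point.\<close>
      from lquot_divide_hyperplane[OF reg_lquot[OF vf_closed[OF \<theta>vf W2U w]] op2 W2(2) xk k l \<theta>w] obtain W3 b where
        W3: "W3 \<in> opens_in n W2" "x \<in> \<Union>W3" "lquot n 0 W3 b"
          "\<forall>y\<in>\<Union>W3. y l \<noteq> 0 \<and> \<theta> W2 ?w (hclass y) = b y * (y k / y l)" by blast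
      have op3: "W3 \<in> opens n" and W3l: "W3 \<subseteq> chart n l" using W3(1) W2l by (auto simp: opens_in_def)
      have W3U: "W3 \<in> opens_in n U" by (rule opens_in_trans[OF W3(1) W2U])
      have W33: "W3 \<in> opens_in n W3" by (rule opens_in_refl[OF op3])
      let ?\<theta> = "restrict \<theta> (opens_in n W3)"
      have \<theta>3: "?\<theta> \<in> vf n W3" by (rule vf_rst_closed[OF \<theta>vf W3U])
      let ?t = "\<lambda>j. ?\<theta> W3 (\<lambda>p\<in>W3. aff l j p)"
      define s where "s j y = y l * ?t j (hclass y) - b y * y j" for j y
      have s: "coeffs n ?I W3 s"
      proof (rule coeffsI)
        fix j assume "j \<in> ?I"
        then have j: "j \<le> n" by simp
        have "lquot n (0 + 1) W3 (\<lambda>y. b y * y j)" by (rule lquot_mult[OF W3(3) lquot_var[OF op3 j]])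
        then have "lquot n 1 W3 (\<lambda>y. b y * y j)" by simp
        from lquot_diff[OF vf_expand(1)[OF \<theta>3 op3 W3l l(1) j] this op3] show "lquot n 1 W3 (s j)" unfolding s_def .
      qed
      have "?\<theta> = field_along n ?I s W3"
      proof (rule vf_eq_affine[OF \<theta>3 field_along_vf[OF I s] op3 W3l l(1)])
        fix j q assume j: "j \<le> n" and q: "q \<in> W3"
        obtain y where y: "y \<in> \<Union>W3" "q = hclass y" using cone_obtain[OF op3 q] .
        have yl: "y l \<noteq> 0" by (rule chart_nonzero[OF l(1) op3 W3l y(1)])
        have tl: "?t l (hclass y) = 0" using vf_aff_self[OF \<theta>3 op3 W3l l(1) q] unfolding y(2) .
        have tk: "?t k (hclass y) = b y * (y k / y l)"
        proof -
          have "(\<lambda>p\<in>W3. aff l k p) = restrict ?w W3" using W3(1) by (auto simp: opens_in_def fun_eq_iff)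
          then have "?t k (hclass y) = \<theta> W3 (restrict ?w W3) (hclass y)" using W33 by simp
          also have "\<dots> = \<theta> W2 ?w (hclass y)"
            by (rule vf_restrict_apply[OF \<theta>vf W2U W3(1) w]) (use q y(2) in simp)
          also have "\<dots> = b y * (y k / y l)" using W3(4) y(1) by blast
          finally show ?thesis .
        qed
        have sl: "s l y = - b y * y l" unfolding s_def tl by simp
        have lI: "l \<in> ?I" using l(1) lk by simp
        have "field_along n ?I s W3 W3 (\<lambda>p\<in>W3. aff l j p) (hclass y) = deriv_along ?I s (\<lambda>p\<in>W3. aff l j p) y"
          by (rule field_along_apply[OF I s W33 aff_reg[OF op3 W3l l(1) j] y(1)])
        also have "\<dots> = (if j \<in> ?I then s j y / y l else 0) + b y * y j / y l"
          unfolding deriv_along_affine[OF op3 W3l l(1) j y(1) I] using lI yl by (simp add: sl power2_eq_square)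
        also have "\<dots> = ?t j (hclass y)"
        proof (cases "j = k")
          case True
          then show ?thesis unfolding True tk by simp
        next
          case False
          then have "j \<in> ?I" using j by simp
          moreover have "s j y / y l = ?t j (hclass y) - b y * y j / y l"
            unfolding s_def diff_divide_distrib nonzero_mult_div_cancel_left[OF yl] ..
          ultimately show ?thesis by (simp only: if_True diff_add_cancel)
        qed
        finally show "?t j q = field_along n ?I s W3 W3 (\<lambda>p\<in>W3. aff l j p) q" unfolding y(2) ..
      qed
      then have "?\<theta> \<in> fields_along n ?I W3" using fields_alongI[OF s] by simp
      moreover have "p \<in> W3" unfolding x(2) by (rule hclass_mem[OF op3 W3(2)])
      ultimately show ?thesis using W3U by blast
    qed
  qed
qed


section \<open>Transfer between families that agree on open sets\<close>

lemma vf_family_cong: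
  assumes "vf_family n F" "\<And>U. U \<in> opens n \<Longrightarrow> G U = F U"
  shows "vf_family n G"
  using assms unfolding vf_family_def opens_in_def by simp

lemma generates_cong:
  assumes G: "generates n E V m s" and V: "V \<in> opens n"
    and sec: "\<And>U. U \<in> opens n \<Longrightarrow> sec E' U = sec E U" and rst: "rst E' = rst E"
  shows "generates n E' V m s"
  unfolding generates_def
proof (intro conjI ballI)
  show "\<forall>i<m. s i \<in> carrier (sec E' V)" using G unfolding generates_def sec[OF V] by (rule conjunct1)
  fix W t p assume W: "W \<in> opens_in n V" and t: "t \<in> carrier (sec E' W)" and p: "p \<in> W"
  have "W \<in> opens n" using W by (simp add: opens_in_def)
  then have t': "t \<in> carrier (sec E W)" using t sec by simp
  have "\<exists>X\<in>opens_in n W. p \<in> X \<and> (\<exists>a. (\<forall>i<m. a i \<in> carrier (reg n X)) \<and>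
      rst E W X t = (\<Oplus>\<^bsub>sec E X\<^esub>i\<in>{..<m}. a i \<odot>\<^bsub>sec E X\<^esub> rst E V X (s i)))"
    by (rule bspec[OF bspec[OF bspec[OF conjunct2[OF G[unfolded generates_def]] W] t'] p])
  then obtain X where X: "X \<in> opens_in n W" and pX: "p \<in> X \<and> (\<exists>a. (\<forall>i<m. a i \<in> carrier (reg n X)) \<and>
      rst E W X t = (\<Oplus>\<^bsub>sec E X\<^esub>i\<in>{..<m}. a i \<odot>\<^bsub>sec E X\<^esub> rst E V X (s i)))" ..
  have "sec E' X = sec E X" by (rule sec) (use X in \<open>simp add: opens_in_def\<close>)
  then show "\<exists>X\<in>opens_in n W. p \<in> X \<and> (\<exists>a. (\<forall>i<m. a i \<in> carrier (reg n X)) \<and>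
      rst E' W X t = (\<Oplus>\<^bsub>sec E' X\<^esub>i\<in>{..<m}. a i \<odot>\<^bsub>sec E' X\<^esub> rst E' V X (s i)))"
    using X pX rst by (intro bexI[of _ X]) (simp_all only:)
qed

text \<open>The logarithmic family and the fields along coordinates are known to agree on open sets,
  not as functions of arbitrary sets, so finite type is transferred through the open sets that it
  mentions.\<close>

lemma finite_type_cong:
  assumes "finite_type n U E" "\<And>V. V \<in> opens n \<Longrightarrow> sec E' V = sec E V" "rst E' = rst E"
  shows "finite_type n U E'"
  unfolding finite_type_def
proof
  fix p assume "p \<in> U"
  then obtain V m s where V: "V \<in> opens_in n U" "p \<in> V" "generates n E V m s"
    using assms(1) unfolding finite_type_def by blast
  have "V \<in> opens n" using V(1) by (simp add: opens_in_def)
  from generates_cong[OF V(3) this assms(2,3)] show "\<exists>V\<in>opens_in n U. p \<in> V \<and> (\<exists>m s. generates n E' V m s)"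
    using V(1,2) by blast
qed

lemma subshf_subshf: "subshf (subshf E G) F = subshf E F"
  by (simp add: subshf_def)

lemma family_subsheaf:
  assumes F: "vf_family n F" and G: "vf_family n G" and sub: "\<And>U. U \<in> opens n \<Longrightarrow> F U \<subseteq> G U"
  shows "subsheaf n F (subshf (tangent n) G)"
  unfolding subsheaf_def subshf_subshf
proof (intro conjI ballI family_sheaf[OF F])
  fix U assume U: "U \<in> opens n"
  show "submodule (F U) (reg n U) (sec (subshf (tangent n) G) U)"
  proof (rule module.module_incl_imp_submodule[OF family_module[OF G U]])
    show "F U \<subseteq> carrier (sec (subshf (tangent n) G) U)" using sub[OF U] by (simp add: sec_subshf)
    show "module (reg n U) (sec (subshf (tangent n) G) U\<lparr>carrier := F U\<rparr>)"
      using family_module[OF F U] by (simp add: sec_subshf)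
  qed
qed

text \<open>With two nonzero coefficients \<open>a i\<close> and \<open>a k\<close>, the vector with
  entry \<open>a k\<close> at \<open>i\<close> and \<open>- a i\<close> at \<open>k\<close> lies on
  the hyperplane. Doubling its entry at \<open>i\<close>, an action of the torus, changes the value
  of the equation from 0 to \<open>a i * a k\<close>.\<close>

lemma torus_invariant_hyperplane:
  assumes "hyperplane n D" "torus_invariant n D"
  shows "\<exists>k\<le>n. D = coord_hyperplane n k"
proof -
  obtain a k where k: "k \<le> n" "a k \<noteq> 0" and D: "D = {p \<in> PP n. \<forall>x\<in>p. (\<Sum>j\<le>n. a j * x j) = 0}"
    using assms(1) unfolding hyperplane_def by blast
  have mem: "hclass x \<in> D \<longleftrightarrow> (\<Sum>j\<le>n. a j * x j) = 0" if "x \<in> vecs n" for x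
  proof -
    have "(\<Sum>j\<le>n. a j * (c * x j)) = c * (\<Sum>j\<le>n. a j * x j)" for c by (simp add: sum_distrib_left mult_ac)
    then show ?thesis unfolding D PP_vecs using that mem_hclass[of x] by (auto simp: hclass_def)
  qed
  have only: "a i = 0" if i: "i \<le> n" "i \<noteq> k" for i
  proof (rule ccontr)
    assume ai: "a i \<noteq> 0"
    define x where "x j = (if j = i then a k else if j = k then - a i else 0)" for j
    define t where "t j = (if j = i then 2 else 1 :: complex)" for j
    have two: "(\<Sum>j\<le>n. a j * y j) = a i * y i + a k * y k" if "\<And>j. j \<noteq> i \<Longrightarrow> j \<noteq> k \<Longrightarrow> y j = 0" for y
    proof -
      have "(\<Sum>j\<le>n. a j * y j) = (\<Sum>j\<in>{i, k}. a j * y j)"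
        by (rule sum.mono_neutral_right) (use i k that in auto)
      then show ?thesis using i by simp
    qed
    have x: "x \<in> vecs n" using i k by (auto simp: vecs_def x_def)
    have "(\<Sum>j\<le>n. a j * x j) = 0" using i by (subst two) (auto simp: x_def)
    then have "hclass x \<in> D" using mem[OF x] by blast
    moreover have "\<forall>j\<le>n. t j \<noteq> 0" by (simp add: t_def)
    ultimately have "(\<lambda>x j. t j * x j) ` hclass x \<in> D" using assms(2) unfolding torus_invariant_def by blast
    then have "\<forall>y\<in>(\<lambda>x j. t j * x j) ` hclass x. (\<Sum>j\<le>n. a j * y j) = 0"
      unfolding D mem_Collect_eq by (rule conjunct2)
    from bspec[OF this imageI[OF mem_hclass]] have "(\<Sum>j\<le>n. a j * (t j * x j)) = 0" .
    moreover have "(\<Sum>j\<le>n. a j * (t j * x j)) = a i * a k" using i by (subst two) (auto simp: x_def t_def)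
    ultimately show False using ai k by simp
  qed
  have "(\<Sum>j\<le>n. a j * x j) = a k * x k" for x
  proof -
    have "(\<Sum>j\<le>n. a j * x j) = (\<Sum>j\<in>{k}. a j * x j)"
      by (rule sum.mono_neutral_right) (use k only in auto)
    then show ?thesis by simp
  qed
  then have "D = coord_hyperplane n k" unfolding D coord_hyperplane_def using k(2) by simp
  then show ?thesis using k(1) by blast
qed

text \<open>The components come from splitting a coefficient family into its entries, and they are
  unique because coefficients are. The ambient family \<open>L\<close> is pinned down on open sets
  only, as that is how the logarithmic fields are known.\<close>

lemma direct_sum_coordinates:
  assumes k: "k \<le> n" and h: "bij_betw h {..<r} ({..n} - {k})"
    and L: "\<And>U. U \<in> opens n \<Longrightarrow> L U = fields_along n ({..n} - {k}) U"
  shows "direct_sum n (subshf (tangent n) L) r (\<lambda>i. fields_along n {h i})"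
proof -
  let ?I = "{..n} - {k}"
  have I: "?I \<subseteq> {..n}" by blast
  have FL: "vf_family n L" by (rule vf_family_cong[OF fields_along_family[OF subset_refl k] L])
  have hI: "h i \<in> ?I" if "i < r" for i using bij_betwE[OF h] that by simp
  have single: "{h i} \<subseteq> {..n} - {k}" "{h i} \<subseteq> {..n}" "h i \<le> n" if "i < r" for i using hI[OF that] by auto
  have sum: "(\<Sum>i<r. field_along n {h i} (\<lambda>_. s (h i)) U V f (hclass x)) = deriv_along ?I s f x"
    if s: "\<And>i. i < r \<Longrightarrow> lquot n 1 U (s (h i))" and V: "V \<in> opens_in n U" "f \<in> carrier (reg n V)" "x \<in> \<Union>V"
    for s U V f x
  proof -
    have "(\<Sum>i<r. field_along n {h i} (\<lambda>_. s (h i)) U V f (hclass x)) =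
        (\<Sum>i<r. s (h i) x * pd (h i) (\<lambda>y. f (hclass y)) x)"
    proof (rule sum.cong[OF refl])
      fix i assume "i \<in> {..<r}"
      then have i: "i < r" by simp
      show "field_along n {h i} (\<lambda>_. s (h i)) U V f (hclass x) = s (h i) x * pd (h i) (\<lambda>y. f (hclass y)) x"
        unfolding field_along_apply[OF single(2)[OF i] coeffs_single[OF s[OF i]] V] by (simp add: deriv_along_def)
    qed
    also have "\<dots> = deriv_along ?I s f x" unfolding deriv_along_def by (rule sum.reindex_bij_betw[OF h])
    finally show ?thesis .
  qed
  have sub: "fields_along n {h i} U \<subseteq> L U" if i: "i < r" and U: "U \<in> opens n" for i U
  proof
    fix \<theta> assume "\<theta> \<in> fields_along n {h i} U"
    then obtain s where s: "lquot n 1 U s" "\<theta> = field_along n {h i} (\<lambda>_. s) U"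
      using single(3)[OF i] U by (rule fields_along_singleE)
    let ?s = "\<lambda>j. if j = h i then s else (\<lambda>x. 0)"
    have c: "coeffs n ?I U ?s"
    proof (rule coeffsI)
      fix j assume "j \<in> ?I"
      then show "lquot n 1 U (?s j)" using s(1) coeffsD[OF coeffs_zero[OF I U]] by simp
    qed
    have "\<theta> = field_along n ?I ?s U"
    proof (rule field_along_eqI[OF I c])
      show "\<theta> \<in> vf n U" unfolding s(2) by (rule field_along_vf[OF single(2)[OF i] coeffs_single[OF s(1)]])
      fix V f x assume V: "V \<in> opens_in n U" "f \<in> carrier (reg n V)" "x \<in> \<Union>V"
      have "deriv_along ?I ?s f x = (\<Sum>j\<in>?I. if j = h i then s x * pd j (\<lambda>y. f (hclass y)) x else 0)"
        unfolding deriv_along_def by (intro sum.cong) auto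
      also have "\<dots> = s x * pd (h i) (\<lambda>y. f (hclass y)) x" using hI[OF i] by simp
      finally show "\<theta> V f (hclass x) = deriv_along ?I ?s f x"
        unfolding s(2) field_along_apply[OF single(2)[OF i] coeffs_single[OF s(1)] V] by (simp add: deriv_along_def)
    qed
    then show "\<theta> \<in> L U" unfolding L[OF U] using fields_alongI[OF c] by simp
  qed
  have finsum: "(\<Oplus>\<^bsub>sec (subshf (tangent n) L) U\<^esub>i\<in>{..<r}. t i) = field_along n ?I s U"
    if U: "U \<in> opens n" and s: "\<And>i. i < r \<Longrightarrow> lquot n 1 U (s (h i))"
      and t: "\<And>i. i < r \<Longrightarrow> t i = field_along n {h i} (\<lambda>_. s (h i)) U" for U s t
  proof -
    have c: "coeffs n ?I U s"
    proof (rule coeffsI)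
      fix j assume "j \<in> ?I"
      then obtain i where "i < r" "j = h i" using h by (auto simp: bij_betw_def)
      then show "lquot n 1 U (s j)" using s by simp
    qed
    have tL: "t i \<in> L U" if "i \<in> {..<r}" for i
    proof -
      have i: "i < r" using that by simp
      show ?thesis unfolding t[OF i] by (rule subsetD[OF sub[OF i U] fields_alongI[OF coeffs_single[OF s[OF i]]]])
    qed
    show ?thesis
    proof (rule field_along_eqI[OF I c])
      show "(\<Oplus>\<^bsub>sec (subshf (tangent n) L) U\<^esub>i\<in>{..<r}. t i) \<in> vf n U"
        by (rule family_vf[OF FL U family_finsum_closed[OF FL U finite_lessThan tL]])
      fix V f x assume V: "V \<in> opens_in n U" "f \<in> carrier (reg n V)" "x \<in> \<Union>V"
      have xV: "hclass x \<in> V" using hclass_mem[OF _ V(3)] V(1) by (auto simp: opens_in_def)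
      have "(\<Oplus>\<^bsub>sec (subshf (tangent n) L) U\<^esub>i\<in>{..<r}. t i) V f (hclass x) = (\<Sum>i<r. t i V f (hclass x))"
        by (rule family_finsum_apply[OF FL U finite_lessThan tL V(1,2) xV])
      also have "\<dots> = (\<Sum>i<r. field_along n {h i} (\<lambda>_. s (h i)) U V f (hclass x))" by (rule sum.cong[OF refl]) (simp add: t)
      also have "\<dots> = deriv_along ?I s f x" by (rule sum[where s = s, OF s V])
      finally show "(\<Oplus>\<^bsub>sec (subshf (tangent n) L) U\<^esub>i\<in>{..<r}. t i) V f (hclass x) = deriv_along ?I s f x" .
    qed
  qed
  show ?thesis
    unfolding direct_sum_def
  proof (intro conjI allI impI ballI)
    show "subsheaf n (fields_along n {h i}) (subshf (tangent n) L)" if i: "i < r" for i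
      by (rule family_subsheaf[OF fields_along_family[OF single(1)[OF i] k] FL sub[OF i]])
    fix U \<theta> assume U: "U \<in> opens n" and "\<theta> \<in> carrier (sec (subshf (tangent n) L) U)"
    then have "\<theta> \<in> fields_along n ?I U" using L[OF U] by (simp add: sec_subshf)
    then obtain s where s: "coeffs n ?I U s" "\<theta> = field_along n ?I s U" by (rule fields_alongE)
    have sh: "lquot n 1 U (s (h i))" if "i < r" for i by (rule coeffsD[OF s(1) hI[OF that]])
    let ?t = "\<lambda>i\<in>{..<r}. field_along n {h i} (\<lambda>_. s (h i)) U"
    show "\<exists>!t. t \<in> (\<Pi>\<^sub>E j\<in>{..<r}. fields_along n {h j} U) \<and> \<theta> = (\<Oplus>\<^bsub>sec (subshf (tangent n) L) U\<^esub>j\<in>{..<r}. t j)"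
    proof (rule ex1I[of _ ?t], intro conjI)
      show "?t \<in> (\<Pi>\<^sub>E j\<in>{..<r}. fields_along n {h j} U)"
        unfolding restrict_PiE_iff using fields_alongI[OF coeffs_single[OF sh]] by simp
      show "\<theta> = (\<Oplus>\<^bsub>sec (subshf (tangent n) L) U\<^esub>j\<in>{..<r}. ?t j)"
        unfolding s(2) by (rule sym, rule finsum[where s = s, OF U sh]) simp_all
      fix t assume "t \<in> (\<Pi>\<^sub>E j\<in>{..<r}. fields_along n {h j} U) \<and> \<theta> = (\<Oplus>\<^bsub>sec (subshf (tangent n) L) U\<^esub>j\<in>{..<r}. t j)"
      then have t: "t \<in> (\<Pi>\<^sub>E j\<in>{..<r}. fields_along n {h j} U)" and eq: "\<theta> = (\<Oplus>\<^bsub>sec (subshf (tangent n) L) U\<^esub>j\<in>{..<r}. t j)"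
        by blast+
      have "\<exists>u. lquot n 1 U u \<and> t i = field_along n {h i} (\<lambda>_. u) U" if i: "i < r" for i
      proof -
        have "t i \<in> fields_along n {h i} U" using PiE_mem[OF t] i by simp
        then show ?thesis using single(3)[OF i] U by (rule fields_along_singleE) blast
      qed
      then obtain u where u: "\<And>i. i < r \<Longrightarrow> lquot n 1 U (u i)" "\<And>i. i < r \<Longrightarrow> t i = field_along n {h i} (\<lambda>_. u i) U" by metis
      \<comment> \<open>The coefficients of the given components, indexed by coordinates instead of
        positions, form one coefficient family that can be compared with \<open>s\<close>.\<close>
      define u' where "u' j = u (inv_into {..<r} h j)" for j
      have u'h: "u' (h i) = u i" if "i < r" for i unfolding u'_def using bij_betw_inv_into_left[OF h] that by simp
      have u'q: "lquot n 1 U (u' (h i))" if "i < r" for i using u(1)[OF that] u'h[OF that] by simp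
      have "\<theta> = field_along n ?I u' U" unfolding eq by (rule finsum[where s = u', OF U u'q]) (simp_all add: u(2) u'h)
      then have eq': "field_along n ?I s U = field_along n ?I u' U" using s(2) by simp
      have cu: "coeffs n ?I U u'"
      proof (rule coeffsI)
        fix j assume "j \<in> ?I"
        then obtain i where "i < r" "j = h i" using h by (auto simp: bij_betw_def)
        then show "lquot n 1 U (u' j)" using u'q by simp
      qed
      show "t = ?t"
      proof (rule PiE_ext[OF t])
        show "?t \<in> (\<Pi>\<^sub>E j\<in>{..<r}. fields_along n {h j} U)"
          unfolding restrict_PiE_iff using fields_alongI[OF coeffs_single[OF sh]] by simp
        fix i assume "i \<in> {..<r}"
        then have i: "i < r" by simp
        have "u i x = s (h i) x" if "x \<in> \<Union>U" for x
          using field_along_inject[OF subset_refl k U s(1) cu eq' hI[OF i] that] u'h[OF i] by simp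
        then have "field_along n {h i} (\<lambda>_. u i) U = field_along n {h i} (\<lambda>_. s (h i)) U"
          by (intro field_along_cong[OF single(2)[OF i] U coeffs_single[OF u(1)[OF i]]])
        then show "t i = ?t i" using u(2)[OF i] i by simp
      qed
    qed
  qed
qed

theorem proposition1p4:
  fixes n :: nat and D :: "pt set"
  assumes "n \<ge> 1"
    and "hyperplane n D" and "torus_invariant n D"
  shows "polystable n (log_tangent n D)"
proof -
  obtain k where k: "k \<le> n" and D: "D = coord_hyperplane n k"
    using torus_invariant_hyperplane[OF assms(2,3)] by blast
  let ?I = "{..n} - {k}" and ?L = "log_fields n D"
  have L: "?L U = fields_along n ?I U" if "U \<in> opens n" for U
    unfolding D using fields_along_subset_log_fields[OF assms(1) k that] log_fields_subset_fields_along[OF assms(1) k that] by blast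
  have F: "vf_family n ?L" by (rule vf_family_cong[OF fields_along_family[OF subset_refl k] L])
  \<comment> \<open>\<open>direct_sum\<close> numbers its summands from 0, so the coordinates other
    than \<open>k\<close> have to be enumerated.\<close>
  obtain h where h: "bij_betw h {..<card ?I} ?I" using ex_bij_betw_nat_finite[of ?I] by (auto simp: atLeast0LessThan)
  have hI: "h i \<in> ?I" if "i < card ?I" for i using bij_betwE[OF h] that by simp
  have "finite_type n (PP n) (subshf (tangent n) ?L)"
    by (rule finite_type_cong[OF fields_along_finite_type[OF subset_refl k]])
      (simp_all add: sec_subshf rst_subshf L opens_PP)
  from family_coherent[OF F this] have coh: "coherent n (log_tangent n D)" unfolding log_tangent_eq .
  have tf: "torsion_free n (log_tangent n D)" unfolding log_tangent_eq by (rule family_torsion_free[OF F])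
  show ?thesis
    unfolding polystable_def
  proof (intro conjI coh tf exI)
    show "direct_sum n (log_tangent n D) (card ?I) (\<lambda>i. fields_along n {h i})"
      unfolding log_tangent_eq by (rule direct_sum_coordinates[OF k h L])
    show "\<forall>j<card ?I. stable n (subshf (log_tangent n D) (fields_along n {h j}))"
      unfolding log_tangent_eq subshf_subshf using fields_along_stable[OF hI k] by blast
    show "\<forall>i<card ?I. \<forall>j<card ?I. slope n (subshf (log_tangent n D) (fields_along n {h i})) = slope n (subshf (log_tangent n D) (fields_along n {h j}))"
      unfolding log_tangent_eq subshf_subshf using fields_along_slope[OF hI hI k] by blast
  qed
qed

end
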